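(* Let $\Gamma$ be a transitive Lie pseudogroup on a manifold $\mathbf{X}$ and let $G=(J^1\Gamma)_{x_0}$ be its isotropy group at an arbitrary point $x_0\in\mathbf{X}$, with Lie algebra $\mathfrak{g}$. If $K$ is a Lie group, with Lie algebra $\mathfrak{k}$, acting freely and transitively on $\mathbf{X}$, then the Pfaffian group $(G,\mathfrak{g},\mathfrak{k})$ admits a reductive Cartan-type extension $\mathfrak{z}=\mathfrak{g}\ltimes\mathfrak{k}$.
   Context: A pseudogroup $\Gamma$ on $\mathbf{X}$ is a set of smooth embeddings of open subsets of $\mathbf{X}$ into $\mathbf{X}$ containing $\mathrm{id}_{\mathbf{X}}$ and closed under composition (where defined), inversion, restriction to open subsets and gluing. It is transitive if for all $x,y$ there is $\varphi\in\Gamma$ with $\varphi(x)=y$. $J^k\Gamma$ is the set of $k$-jets $j^k_x\varphi$, $\varphi\in\Gamma$; $\Gamma$ is a Lie pseudogroup if each $J^k\Gamma\subset J^k(\mathbf{X},\mathbf{X})$ is an embedded submanifold and the projections $J^k\Gamma\to J^{k-1}\Gamma$ are surjective submersions. $J^k\Gamma\rightrightarrows\mathbf{X}$ is a Lie groupoid with $s(j^k_x\varphi)=x$, $t(j^k_x\varphi)=\varphi(x)$ and multiplication induced by composition; its isotropy group at $x_0$ is $(J^1\Gamma)_{x_0}=\{j^1_{x_0}\varphi:\varphi\in\Gamma,\varphi(x_0)=x_0\}$. A Pfaffian group $(G,\mathfrak{h},V)$ is a Lie group $G$, a representation $V$ of $G$, and a $G$-equivariant linear map $\mathfrak{g}\to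 V$ (adjoint representation on $\mathfrak g$) with kernel $\mathfrak{h}$. For $(G,\mathfrak{g},\mathfrak{k})$ this map is zero, and $G$ acts linearly on the vector space $\mathfrak{k}=T_eK$ by $j^1_{x_0}\varphi\cdot\xi=(d_e\Phi_{x_0})^{-1}\circ d_{x_0}\varphi\circ d_e\Phi_{x_0}(\xi)$, where $\Phi_{x_0}:K\to\mathbf{X}$, $k\mapsto k\cdot x_0$, is the orbit map (a diffeomorphism). An almost Lie bracket is a bilinear skew-symmetric bracket (Jacobi not required). $\mathfrak{g}\ltimes\mathfrak{k}$ is $\mathfrak{g}\times\mathfrak{k}$ with the product $G$-representation and the almost Lie bracket $[(\alpha,v),(\beta,w)]=([\alpha,\beta]_{\mathfrak{g}},[v,w]_{\mathfrak{k}}+\alpha(w)-\beta(v))$, where $\alpha(w)$ is the differentiated $G$-representation (not necessarily by derivations of $\mathfrak{k}$). A Cartan-type extension of $(G,\mathfrak{h},V)$ is a $G$-representation $\mathfrak{z}$ in a short exact sequence of $G$-representations $0\to\mathfrak{h}\xrightarrow{i}\mathfrak{z}\xrightarrow{p}V\to0$, with an almost Lie bracket on $\mathfrak{z}$ such that $i$ preserves brackets. It is reductive if there is a $G$-equivariant left splitting $l:\mathfrak{z}\to\mathfrak{h}$ preserving brackets and such that $\alpha(v)=p([i(\alpha),r(v)]_{\mathfrak{z}})$ for all $\alpha\in\mathfrak{h}$, $v\in V$, where $r:V\to\mathfrak{z}$ is the right splitting with $l\circ r=0$. For $\mathfrak{g}\ltimes\mathfrak{k}$ the maps are $i(\alpha)=(\alpha,0)$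 and $p(\alpha,v)=v$. *)

theory Defs
  imports
    "HOL-Analysis.Analysis"
    "HOL-Analysis.Finite_Function_Topology"
    "HOL-Algebra.Group_Action"
begin

section \<open>Smooth maps on open subsets of a finite-dimensional subspace\<close>

text \<open>
  The model space of a manifold is a finite-dimensional subspace \<open>V\<close> of some real normed space,
  not the whole type. In this way the dimension is not tied to a type (the jet spaces
  \<open>J\<^sup>k(X,X)\<close> for all \<open>k\<close> live in one type), and dimension 0 is included.
\<close>

definition fin_dim_subspace :: "'a::real_vector set \<Rightarrow> bool" where
  "fin_dim_subspace V \<longleftrightarrow> (\<exists>B. finite B \<and> span B = V)"

text \<open>
  In the two definitions below, \<open>U\<close> is meant to be open in \<open>V\<close>. Then the Frechet derivative within
  \<open>U\<close> is determined by \<open>f\<close> on the directions \<open>v \<in> V\<close>, the only ones that are used.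
\<close>

primrec C_on :: "nat \<Rightarrow> 'a::real_normed_vector set \<Rightarrow> 'a set \<Rightarrow> ('a \<Rightarrow> 'b::real_normed_vector) \<Rightarrow> bool"
where
  "C_on 0 V U f \<longleftrightarrow> continuous_on U f"
| "C_on (Suc k) V U f \<longleftrightarrow>
     (\<exists>D. (\<forall>x\<in>U. (f has_derivative D x) (at x within U)) \<and> (\<forall>v\<in>V. C_on k V U (\<lambda>x. D x v)))"

definition smooth_on :: "'a::real_normed_vector set \<Rightarrow> 'a set \<Rightarrow> ('a \<Rightarrow> 'b::real_normed_vector) \<Rightarrow> bool"
where
  "smooth_on V U f \<longleftrightarrow> (\<forall>k. C_on k V U f)"

definition dir_deriv :: "('a::real_normed_vector \<Rightarrow> 'b::real_normed_vector) \<Rightarrow> 'a \<Rightarrow> 'a \<Rightarrow> 'b" where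
  "dir_deriv f x v = vector_derivative (\<lambda>t::real. f (x + t *\<^sub>R v)) (at 0)"

primrec iter_deriv :: "'a::real_normed_vector list \<Rightarrow> ('a \<Rightarrow> 'b::real_normed_vector) \<Rightarrow> 'a \<Rightarrow> 'b" where
  "iter_deriv [] f = f"
| "iter_deriv (v # vs) f = (\<lambda>x. dir_deriv (iter_deriv vs f) x v)"


section \<open>Smooth manifolds\<close>

type_synonym ('p, 'm) chart = "'p set \<times> ('p \<Rightarrow> 'm)"

text \<open>
  A chart is a pair of a domain and a coordinate map; the values of the coordinate map outside
  the domain are irrelevant.
\<close>

record ('p, 'm) mfd =
  pts :: "'p set"
  model :: "'m set"
  atlas :: "('p, 'm) chart set"

definition chart_inv :: "('p, 'm) chart \<Rightarrow> 'm \<Rightarrow> 'p" where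
  "chart_inv c = inv_into (fst c) (snd c)"

definition is_chart :: "'p set \<Rightarrow> 'm::real_normed_vector set \<Rightarrow> ('p, 'm) chart \<Rightarrow> bool" where
  "is_chart P V c \<longleftrightarrow>
     fst c \<subseteq> P \<and> inj_on (snd c) (fst c) \<and> openin (top_of_set V) (snd c ` fst c)"

definition smooth_transition ::
  "'m::real_normed_vector set \<Rightarrow> ('p, 'm) chart \<Rightarrow> ('p, 'm) chart \<Rightarrow> bool" where
  "smooth_transition V c d \<longleftrightarrow>
     openin (top_of_set V) (snd c ` (fst c \<inter> fst d)) \<and>
     smooth_on V (snd c ` (fst c \<inter> fst d)) (snd d \<circ> chart_inv c)"

definition compatible :: "'m::real_normed_vector set \<Rightarrow> ('p, 'm) chart \<Rightarrow> ('p, 'm) chart \<Rightarrow> bool" where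
  "compatible V c d \<longleftrightarrow> smooth_transition V c d \<and> smooth_transition V d c"

text \<open>The topology determined by the atlas: the one for which all charts are homeomorphisms.\<close>

definition mtop :: "('p, 'm::real_normed_vector) mfd \<Rightarrow> 'p topology" where
  "mtop M = topology (\<lambda>W. W \<subseteq> pts M \<and>
     (\<forall>c\<in>atlas M. openin (top_of_set (model M)) (snd c ` (W \<inter> fst c))))"

definition smooth_manifold :: "('p, 'm::real_normed_vector) mfd \<Rightarrow> bool" where
  "smooth_manifold M \<longleftrightarrow>
     fin_dim_subspace (model M) \<and>
     (\<forall>c\<in>atlas M. is_chart (pts M) (model M) c) \<and>
     (\<Union>c\<in>atlas M. fst c) = pts M \<and>
     (\<forall>c\<in>atlas M. \<forall>d\<in>atlas M. compatible (model M) c d) \<and>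
     Hausdorff_space (mtop M) \<and> second_countable (mtop M)"

definition max_atlas :: "('p, 'm::real_normed_vector) mfd \<Rightarrow> ('p, 'm) chart set" where
  "max_atlas M = {c. is_chart (pts M) (model M) c \<and> (\<forall>d\<in>atlas M. compatible (model M) c d)}"

text \<open>Smooth maps from a subset \<open>W\<close> of \<open>M\<close>, which is forced to be open, to \<open>N\<close>.\<close>

definition smooth_map_on ::
  "('p, 'm::real_normed_vector) mfd \<Rightarrow> ('q, 'n::real_normed_vector) mfd \<Rightarrow> 'p set \<Rightarrow> ('p \<Rightarrow> 'q) \<Rightarrow> bool"
where
  "smooth_map_on M N W f \<longleftrightarrow>
     W \<subseteq> pts M \<and> f ` W \<subseteq> pts N \<and>
     (\<forall>c\<in>atlas M. \<forall>d\<in>atlas N.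
        (let U = snd c ` {x \<in> fst c \<inter> W. f x \<in> fst d}
         in openin (top_of_set (model M)) U \<and> smooth_on (model M) U (snd d \<circ> f \<circ> chart_inv c)))"

abbreviation smooth_map ::
  "('p, 'm::real_normed_vector) mfd \<Rightarrow> ('q, 'n::real_normed_vector) mfd \<Rightarrow> ('p \<Rightarrow> 'q) \<Rightarrow> bool"
where
  "smooth_map M N f \<equiv> smooth_map_on M N (pts M) f"

definition prod_mfd ::
  "('p, 'm::real_normed_vector) mfd \<Rightarrow> ('q, 'n::real_normed_vector) mfd \<Rightarrow> ('p \<times> 'q, 'm \<times> 'n) mfd"
where
  "prod_mfd M N =
     \<lparr>pts = pts M \<times> pts N, model = model M \<times> model N,
      atlas = {(fst c \<times> fst d, map_prod (snd c) (snd d)) |c d. c \<in> atlas M \<and> d \<in> atlas N}\<rparr>"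

definition vec_mfd :: "'m::real_normed_vector set \<Rightarrow> ('m, 'm) mfd" where
  "vec_mfd W = \<lparr>pts = W, model = W, atlas = {(W, \<lambda>x. x)}\<rparr>"

text \<open>
  The tangent space of \<open>M\<close> at \<open>x\<close> is \<open>model M\<close>, identified with it by the chosen chart
  \<open>chart_at M x\<close>; \<open>mdiff M N f x\<close> is the differential of \<open>f\<close> at \<open>x\<close> under the identifications at
  \<open>x\<close> and \<open>f x\<close>.
\<close>

definition chart_at :: "('p, 'm) mfd \<Rightarrow> 'p \<Rightarrow> ('p, 'm) chart" where
  "chart_at M x = (SOME c. c \<in> atlas M \<and> x \<in> fst c)"

definition mdiff ::
  "('p, 'm::real_normed_vector) mfd \<Rightarrow> ('q, 'n::real_normed_vector) mfd \<Rightarrow> ('p \<Rightarrow> 'q) \<Rightarrow> 'p \<Rightarrow> 'm \<Rightarrow> 'n"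
where
  "mdiff M N f x v =
     dir_deriv (snd (chart_at N (f x)) \<circ> f \<circ> chart_inv (chart_at M x)) (snd (chart_at M x) x) v"

text \<open>
  Embedded submanifolds are given by slice charts: \<open>L\<close> is the model space of the submanifold,
  a linear subspace of the model space of \<open>M\<close> that is the same for all points.
\<close>

definition slice_chart :: "('p, 'm::real_normed_vector) mfd \<Rightarrow> 'p set \<Rightarrow> 'm set \<Rightarrow> ('p, 'm) chart \<Rightarrow> bool"
where
  "slice_chart M S L c \<longleftrightarrow> c \<in> max_atlas M \<and> snd c ` (S \<inter> fst c) = snd c ` fst c \<inter> L"

definition slice_model :: "('p, 'm::real_normed_vector) mfd \<Rightarrow> 'p set \<Rightarrow> 'm set \<Rightarrow> bool" where
  "slice_model M S L \<longleftrightarrow>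
     subspace L \<and> L \<subseteq> model M \<and> (\<forall>x\<in>S. \<exists>c. x \<in> fst c \<and> slice_chart M S L c)"

definition embedded_submanifold :: "('p, 'm::real_normed_vector) mfd \<Rightarrow> 'p set \<Rightarrow> bool" where
  "embedded_submanifold M S \<longleftrightarrow> S \<subseteq> pts M \<and> (\<exists>L. slice_model M S L)"

definition submfd :: "('p, 'm::real_normed_vector) mfd \<Rightarrow> 'p set \<Rightarrow> ('p, 'm) mfd" where
  "submfd M S =
     (let L = (SOME L. slice_model M S L)
      in \<lparr>pts = S, model = L, atlas = {(S \<inter> fst c, snd c) |c. slice_chart M S L c}\<rparr>)"

definition surjective_submersion ::
  "('p, 'm::real_normed_vector) mfd \<Rightarrow> ('q, 'n::real_normed_vector) mfd \<Rightarrow> ('p \<Rightarrow> 'q) \<Rightarrow> bool"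
where
  "surjective_submersion M N f \<longleftrightarrow>
     smooth_map M N f \<and> f ` pts M = pts N \<and>
     (\<forall>x\<in>pts M. mdiff M N f x ` model M = model N)"


section \<open>Pseudogroups\<close>

text \<open>
  Locally defined maps are partial functions, so that two of them are equal iff they have the
  same domain and the same values on it.
\<close>

definition local_smooth_map :: "('x, 'a::real_normed_vector) mfd \<Rightarrow> ('x \<rightharpoonup> 'x) \<Rightarrow> bool" where
  "local_smooth_map X \<phi> \<longleftrightarrow> smooth_map_on X X (dom \<phi>) (the \<circ> \<phi>)"

definition smooth_embedding :: "('x, 'a::real_normed_vector) mfd \<Rightarrow> ('x \<rightharpoonup> 'x) \<Rightarrow> bool" where
  "smooth_embedding X \<phi> \<longleftrightarrow>
     local_smooth_map X \<phi> \<and>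
     (\<forall>x\<in>dom \<phi>. inj_on (mdiff X X (the \<circ> \<phi>) x) (model X)) \<and>
     homeomorphic_map (subtopology (mtop X) (dom \<phi>)) (subtopology (mtop X) (ran \<phi>)) (the \<circ> \<phi>)"

definition id_pmap :: "('x, 'a) mfd \<Rightarrow> ('x \<rightharpoonup> 'x)" where
  "id_pmap X = Some |` pts X"

definition inverse_pmap :: "('x \<rightharpoonup> 'x) \<Rightarrow> ('x \<rightharpoonup> 'x)" where
  "inverse_pmap \<phi> y = (if y \<in> ran \<phi> then Some (THE x. \<phi> x = Some y) else None)"

definition pseudogroup :: "('x, 'a::real_normed_vector) mfd \<Rightarrow> ('x \<rightharpoonup> 'x) set \<Rightarrow> bool" where
  "pseudogroup X \<Gamma> \<longleftrightarrow>
     (\<forall>\<phi>\<in>\<Gamma>. smooth_embedding X \<phi>) \<and>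
     id_pmap X \<in> \<Gamma> \<and>
     (\<forall>\<phi>\<in>\<Gamma>. \<forall>\<psi>\<in>\<Gamma>. \<psi> \<circ>\<^sub>m \<phi> \<in> \<Gamma>) \<and>
     (\<forall>\<phi>\<in>\<Gamma>. inverse_pmap \<phi> \<in> \<Gamma>) \<and>
     (\<forall>\<phi>\<in>\<Gamma>. \<forall>U. openin (mtop X) U \<longrightarrow> \<phi> |` U \<in> \<Gamma>) \<and>
     (\<forall>\<phi>. smooth_embedding X \<phi> \<and>
          (\<forall>x\<in>dom \<phi>. \<exists>U. openin (mtop X) U \<and> x \<in> U \<and> \<phi> |` U \<in> \<Gamma>) \<longrightarrow> \<phi> \<in> \<Gamma>)"

definition transitive_pseudogroup :: "('x, 'a) mfd \<Rightarrow> ('x \<rightharpoonup> 'x) set \<Rightarrow> bool" where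
  "transitive_pseudogroup X \<Gamma> \<longleftrightarrow> (\<forall>x\<in>pts X. \<forall>y\<in>pts X. \<exists>\<phi>\<in>\<Gamma>. \<phi> x = Some y)"


section \<open>Jets and Lie pseudogroups\<close>

definition model_basis :: "'a::real_vector set \<Rightarrow> 'a set" where
  "model_basis V = (SOME B. B \<subseteq> V \<and> independent B \<and> span B = V)"

text \<open>
  The \<open>k\<close>-jet of \<open>\<phi>\<close> at \<open>x\<close> in charts \<open>c\<close> around \<open>x\<close> and \<open>d\<close> around \<open>\<phi> x\<close>: the source \<open>x\<close>, and all
  partial derivatives up to order \<open>k\<close> of the coordinate expression of \<open>\<phi>\<close>, indexed by lists of
  basis vectors (the empty list gives the target \<open>\<phi> x\<close>).
\<close>

type_synonym 'a jet_coord = "'a \<times> ('a list \<Rightarrow>\<^sub>0 'a)"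

definition jet_index :: "nat \<Rightarrow> 'a::real_vector set \<Rightarrow> 'a list set" where
  "jet_index k V = {vs. set vs \<subseteq> model_basis V \<and> length vs \<le> k}"

definition jet_coords ::
  "('x, 'a::real_normed_vector) mfd \<Rightarrow> nat \<Rightarrow> ('x, 'a) chart \<Rightarrow> ('x, 'a) chart \<Rightarrow> 'x \<Rightarrow> ('x \<rightharpoonup> 'x) \<Rightarrow> 'a jet_coord"
where
  "jet_coords X k c d x \<phi> =
     (snd c x,
      Abs_poly_mapping (\<lambda>vs. if vs \<in> jet_index k (model X)
        then iter_deriv vs (snd d \<circ> the \<circ> \<phi> \<circ> chart_inv c) (snd c x) else 0))"

text \<open>A jet is its source together with the class of all local smooth maps that have this jet.\<close>

type_synonym 'x jet = "'x \<times> ('x \<rightharpoonup> 'x) set"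

definition jet :: "('x, 'a::real_normed_vector) mfd \<Rightarrow> nat \<Rightarrow> 'x \<Rightarrow> ('x \<rightharpoonup> 'x) \<Rightarrow> 'x jet" where
  "jet X k x \<phi> =
     (x, {\<psi>. local_smooth_map X \<psi> \<and> x \<in> dom \<psi> \<and> \<psi> x = \<phi> x \<and>
            (\<forall>c\<in>atlas X. \<forall>d\<in>atlas X. x \<in> fst c \<and> the (\<phi> x) \<in> fst d \<longrightarrow>
               jet_coords X k c d x \<psi> = jet_coords X k c d x \<phi>)})"

definition jet_rep :: "'x jet \<Rightarrow> ('x \<rightharpoonup> 'x)" where
  "jet_rep j = (SOME \<phi>. \<phi> \<in> snd j)"

definition jet_source :: "'x jet \<Rightarrow> 'x" where
  "jet_source j = fst j"

definition jet_target :: "'x jet \<Rightarrow> 'x" where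
  "jet_target j = the (jet_rep j (jet_source j))"

definition jets_of :: "('x, 'a::real_normed_vector) mfd \<Rightarrow> nat \<Rightarrow> ('x \<rightharpoonup> 'x) set \<Rightarrow> 'x jet set" where
  "jets_of X k F = {jet X k x \<phi> |x \<phi>. \<phi> \<in> F \<and> x \<in> dom \<phi>}"

text \<open>
  The manifold \<open>J\<^sup>k(X,X)\<close>. The condition on \<open>mset\<close> in the model space expresses the symmetry of
  partial derivatives.
\<close>

definition jet_mfd :: "('x, 'a::real_normed_vector) mfd \<Rightarrow> nat \<Rightarrow> ('x jet, 'a jet_coord) mfd" where
  "jet_mfd X k =
     (let J = jets_of X k {\<phi>. local_smooth_map X \<phi>}
      in \<lparr>pts = J,
          model = {(y, p). y \<in> model X \<and> (\<forall>vs. Poly_Mapping.lookup p vs \<in> model X) \<and>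
            Poly_Mapping.keys p \<subseteq> jet_index k (model X) \<and>
            (\<forall>vs ws. mset vs = mset ws \<longrightarrow> Poly_Mapping.lookup p vs = Poly_Mapping.lookup p ws)},
          atlas = {({j \<in> J. jet_source j \<in> fst c \<and> jet_target j \<in> fst d},
                    \<lambda>j. jet_coords X k c d (jet_source j) (jet_rep j)) |c d.
                   c \<in> atlas X \<and> d \<in> atlas X}\<rparr>)"

definition jet_pseudogroup_mfd ::
  "('x, 'a::real_normed_vector) mfd \<Rightarrow> ('x \<rightharpoonup> 'x) set \<Rightarrow> nat \<Rightarrow> ('x jet, 'a jet_coord) mfd" where
  "jet_pseudogroup_mfd X \<Gamma> k = submfd (jet_mfd X k) (jets_of X k \<Gamma>)"

definition jet_proj :: "('x, 'a::real_normed_vector) mfd \<Rightarrow> nat \<Rightarrow> 'x jet \<Rightarrow> 'x jet" where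
  "jet_proj X k j = jet X k (jet_source j) (jet_rep j)"

definition lie_pseudogroup :: "('x, 'a::real_normed_vector) mfd \<Rightarrow> ('x \<rightharpoonup> 'x) set \<Rightarrow> bool" where
  "lie_pseudogroup X \<Gamma> \<longleftrightarrow>
     pseudogroup X \<Gamma> \<and>
     (\<forall>k. embedded_submanifold (jet_mfd X k) (jets_of X k \<Gamma>)) \<and>
     (\<forall>k. surjective_submersion (jet_pseudogroup_mfd X \<Gamma> (Suc k)) (jet_pseudogroup_mfd X \<Gamma> k)
            (jet_proj X k))"


section \<open>Lie groups, their Lie algebras and representations\<close>

text \<open>A Lie group is a group \<open>G\<close> together with a manifold \<open>M\<close> on its carrier.\<close>

definition lie_group :: "('g, 'e) monoid_scheme \<Rightarrow> ('g, 'm::real_normed_vector) mfd \<Rightarrow> bool" where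
  "lie_group G M \<longleftrightarrow>
     group G \<and> smooth_manifold M \<and> pts M = carrier G \<and>
     smooth_map (prod_mfd M M) M (\<lambda>(g, h). g \<otimes>\<^bsub>G\<^esub> h) \<and>
     smooth_map M M (\<lambda>g. inv\<^bsub>G\<^esub> g)"

text \<open>
  Vector fields assign to each point an element of the tangent space at this point (in the above
  identification). Their bracket is \<open>[\<xi>,\<eta>] = D\<eta>(\<xi>) - D\<xi>(\<eta>)\<close> in coordinates.
\<close>

definition vf_in_chart ::
  "('p, 'm::real_normed_vector) mfd \<Rightarrow> ('p, 'm) chart \<Rightarrow> ('p \<Rightarrow> 'm) \<Rightarrow> 'm \<Rightarrow> 'm" where
  "vf_in_chart M c \<xi> y =
     (let x = chart_inv c y; d = chart_at M x
      in dir_deriv (snd c \<circ> chart_inv d) (snd d x) (\<xi> x))"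

definition vf_bracket ::
  "('p, 'm::real_normed_vector) mfd \<Rightarrow> ('p \<Rightarrow> 'm) \<Rightarrow> ('p \<Rightarrow> 'm) \<Rightarrow> 'p \<Rightarrow> 'm" where
  "vf_bracket M \<xi> \<eta> x =
     (let c = chart_at M x; y = snd c x;
          \<xi>c = vf_in_chart M c \<xi>; \<eta>c = vf_in_chart M c \<eta>
      in dir_deriv \<eta>c y (\<xi>c y) - dir_deriv \<xi>c y (\<eta>c y))"

definition left_invariant_vf ::
  "('g, 'e) monoid_scheme \<Rightarrow> ('g, 'm::real_normed_vector) mfd \<Rightarrow> 'm \<Rightarrow> 'g \<Rightarrow> 'm" where
  "left_invariant_vf G M \<alpha> g = mdiff M M (\<lambda>h. g \<otimes>\<^bsub>G\<^esub> h) \<one>\<^bsub>G\<^esub> \<alpha>"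

text \<open>The Lie algebra is the tangent space at the identity, i.e. \<open>model M\<close>, with this bracket.\<close>

definition lie_bracket ::
  "('g, 'e) monoid_scheme \<Rightarrow> ('g, 'm::real_normed_vector) mfd \<Rightarrow> 'm \<Rightarrow> 'm \<Rightarrow> 'm" where
  "lie_bracket G M \<alpha> \<beta> = vf_bracket M (left_invariant_vf G M \<alpha>) (left_invariant_vf G M \<beta>) \<one>\<^bsub>G\<^esub>"

definition Ad :: "('g, 'e) monoid_scheme \<Rightarrow> ('g, 'm::real_normed_vector) mfd \<Rightarrow> 'g \<Rightarrow> 'm \<Rightarrow> 'm" where
  "Ad G M g \<alpha> = mdiff M M (\<lambda>h. g \<otimes>\<^bsub>G\<^esub> h \<otimes>\<^bsub>G\<^esub> inv\<^bsub>G\<^esub> g) \<one>\<^bsub>G\<^esub> \<alpha>"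

definition linear_betw :: "'v::real_vector set \<Rightarrow> 'w::real_vector set \<Rightarrow> ('v \<Rightarrow> 'w) \<Rightarrow> bool" where
  "linear_betw V W f \<longleftrightarrow>
     f ` V \<subseteq> W \<and> (\<forall>v\<in>V. \<forall>w\<in>V. f (v + w) = f v + f w) \<and> (\<forall>a. \<forall>v\<in>V. f (a *\<^sub>R v) = a *\<^sub>R f v)"

definition lie_rep ::
  "('g, 'e) monoid_scheme \<Rightarrow> ('g, 'm::real_normed_vector) mfd \<Rightarrow>
   'v::real_normed_vector set \<Rightarrow> ('g \<Rightarrow> 'v \<Rightarrow> 'v) \<Rightarrow> bool" where
  "lie_rep G M V \<rho> \<longleftrightarrow>
     fin_dim_subspace V \<and>
     (\<forall>g\<in>carrier G. linear_betw V V (\<rho> g)) \<and>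
     (\<forall>v\<in>V. \<rho> \<one>\<^bsub>G\<^esub> v = v) \<and>
     (\<forall>g\<in>carrier G. \<forall>h\<in>carrier G. \<forall>v\<in>V. \<rho> (g \<otimes>\<^bsub>G\<^esub> h) v = \<rho> g (\<rho> h v)) \<and>
     smooth_map (prod_mfd M (vec_mfd V)) (vec_mfd V) (\<lambda>(g, v). \<rho> g v)"

definition equivariant ::
  "('g, 'e) monoid_scheme \<Rightarrow> 'v set \<Rightarrow> ('g \<Rightarrow> 'v \<Rightarrow> 'v) \<Rightarrow> ('g \<Rightarrow> 'w \<Rightarrow> 'w) \<Rightarrow> ('v \<Rightarrow> 'w) \<Rightarrow> bool" where
  "equivariant G V \<rho> \<sigma> f \<longleftrightarrow> (\<forall>g\<in>carrier G. \<forall>v\<in>V. f (\<rho> g v) = \<sigma> g (f v))"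

text \<open>The differentiated representation \<open>\<alpha>(v)\<close> of the Lie algebra on \<open>V\<close>.\<close>

definition diff_rep ::
  "('g, 'e) monoid_scheme \<Rightarrow> ('g, 'm::real_normed_vector) mfd \<Rightarrow>
   'v::real_normed_vector set \<Rightarrow> ('g \<Rightarrow> 'v \<Rightarrow> 'v) \<Rightarrow> 'm \<Rightarrow> 'v \<Rightarrow> 'v" where
  "diff_rep G M V \<rho> \<alpha> v = mdiff M (vec_mfd V) (\<lambda>g. \<rho> g v) \<one>\<^bsub>G\<^esub> \<alpha>"

definition lie_group_action ::
  "('k, 'e) monoid_scheme \<Rightarrow> ('k, 'b::real_normed_vector) mfd \<Rightarrow>
   ('x, 'a::real_normed_vector) mfd \<Rightarrow> ('k \<Rightarrow> 'x \<Rightarrow> 'x) \<Rightarrow> bool" where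
  "lie_group_action K KM X A \<longleftrightarrow>
     group_action K (pts X) A \<and> smooth_map (prod_mfd KM X) X (\<lambda>(k, x). A k x)"

definition free_action :: "('k, 'e) monoid_scheme \<Rightarrow> 'x set \<Rightarrow> ('k \<Rightarrow> 'x \<Rightarrow> 'x) \<Rightarrow> bool" where
  "free_action K E A \<longleftrightarrow> (\<forall>x\<in>E. stabilizer K A x = {\<one>\<^bsub>K\<^esub>})"


section \<open>Pfaffian groups and Cartan-type extensions\<close>

text \<open>
  In \<open>(G, \<hh>, V)\<close>, the equivariant map from the Lie algebra to \<open>V\<close> is \<open>\<theta>\<close>, with kernel \<open>H\<close>.
\<close>

definition pfaffian_group ::
  "('g, 'e) monoid_scheme \<Rightarrow> ('g, 'm::real_normed_vector) mfd \<Rightarrow> 'm set \<Rightarrow>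
   'v::real_normed_vector set \<Rightarrow> ('g \<Rightarrow> 'v \<Rightarrow> 'v) \<Rightarrow> ('m \<Rightarrow> 'v) \<Rightarrow> bool" where
  "pfaffian_group G M H V \<rho> \<theta> \<longleftrightarrow>
     lie_group G M \<and> lie_rep G M V \<rho> \<and>
     linear_betw (model M) V \<theta> \<and> equivariant G (model M) (Ad G M) \<rho> \<theta> \<and>
     H = {\<alpha> \<in> model M. \<theta> \<alpha> = 0}"

definition almost_lie_bracket :: "'z::real_vector set \<Rightarrow> ('z \<Rightarrow> 'z \<Rightarrow> 'z) \<Rightarrow> bool" where
  "almost_lie_bracket Z br \<longleftrightarrow>
     (\<forall>x\<in>Z. linear_betw Z Z (br x)) \<and> (\<forall>y\<in>Z. linear_betw Z Z (\<lambda>x. br x y)) \<and>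
     (\<forall>x\<in>Z. \<forall>y\<in>Z. br x y = - br y x)"

definition cartan_type_extension ::
  "('g, 'e) monoid_scheme \<Rightarrow> ('g, 'm::real_normed_vector) mfd \<Rightarrow> 'm set \<Rightarrow>
   'v::real_normed_vector set \<Rightarrow> ('g \<Rightarrow> 'v \<Rightarrow> 'v) \<Rightarrow>
   'z::real_normed_vector set \<Rightarrow> ('g \<Rightarrow> 'z \<Rightarrow> 'z) \<Rightarrow> ('z \<Rightarrow> 'z \<Rightarrow> 'z) \<Rightarrow>
   ('m \<Rightarrow> 'z) \<Rightarrow> ('z \<Rightarrow> 'v) \<Rightarrow> bool" where
  "cartan_type_extension G M H V \<rho> Z \<sigma> br i p \<longleftrightarrow>
     lie_rep G M H (Ad G M) \<and> lie_rep G M V \<rho> \<and> lie_rep G M Z \<sigma> \<and>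
     linear_betw H Z i \<and> equivariant G H (Ad G M) \<sigma> i \<and>
     linear_betw Z V p \<and> equivariant G Z \<sigma> \<rho> p \<and>
     inj_on i H \<and> i ` H = {z \<in> Z. p z = 0} \<and> p ` Z = V \<and>
     almost_lie_bracket Z br \<and>
     (\<forall>\<alpha>\<in>H. \<forall>\<beta>\<in>H. i (lie_bracket G M \<alpha> \<beta>) = br (i \<alpha>) (i \<beta>))"

definition reductive_extension ::
  "('g, 'e) monoid_scheme \<Rightarrow> ('g, 'm::real_normed_vector) mfd \<Rightarrow> 'm set \<Rightarrow>
   'v::real_normed_vector set \<Rightarrow> ('g \<Rightarrow> 'v \<Rightarrow> 'v) \<Rightarrow>
   'z::real_normed_vector set \<Rightarrow> ('g \<Rightarrow> 'z \<Rightarrow> 'z) \<Rightarrow> ('z \<Rightarrow> 'z \<Rightarrow> 'z) \<Rightarrow>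
   ('m \<Rightarrow> 'z) \<Rightarrow> ('z \<Rightarrow> 'v) \<Rightarrow> bool" where
  "reductive_extension G M H V \<rho> Z \<sigma> br i p \<longleftrightarrow>
     (\<exists>l r. linear_betw Z H l \<and> equivariant G Z \<sigma> (Ad G M) l \<and> (\<forall>\<alpha>\<in>H. l (i \<alpha>) = \<alpha>) \<and>
            (\<forall>x\<in>Z. \<forall>y\<in>Z. l (br x y) = lie_bracket G M (l x) (l y)) \<and>
            linear_betw V Z r \<and> (\<forall>v\<in>V. p (r v) = v \<and> l (r v) = 0) \<and>
            (\<forall>\<alpha>\<in>H. \<forall>v\<in>V. diff_rep G M V \<rho> \<alpha> v = p (br (i \<alpha>) (r v))))"

definition semidirect_bracket ::
  "('m \<Rightarrow> 'm \<Rightarrow> 'm) \<Rightarrow> ('v::real_vector \<Rightarrow> 'v \<Rightarrow> 'v) \<Rightarrow> ('m \<Rightarrow> 'v \<Rightarrow> 'v) \<Rightarrow>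
   'm \<times> 'v \<Rightarrow> 'm \<times> 'v \<Rightarrow> 'm \<times> 'v" where
  "semidirect_bracket br\<^sub>\<gg> br\<^sub>\<kk> act =
     (\<lambda>(\<alpha>, v) (\<beta>, w). (br\<^sub>\<gg> \<alpha> \<beta>, br\<^sub>\<kk> v w + act \<alpha> w - act \<beta> v))"


section \<open>The isotropy group of a pseudogroup and its action on the Lie algebra of \<open>K\<close>\<close>

definition isotropy_group ::
  "('x, 'a::real_normed_vector) mfd \<Rightarrow> ('x \<rightharpoonup> 'x) set \<Rightarrow> 'x \<Rightarrow> 'x jet monoid" where
  "isotropy_group X \<Gamma> x\<^sub>0 =
     \<lparr>carrier = {jet X 1 x\<^sub>0 \<phi> |\<phi>. \<phi> \<in> \<Gamma> \<and> \<phi> x\<^sub>0 = Some x\<^sub>0},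
      mult = \<lambda>j j'. jet X 1 x\<^sub>0 (jet_rep j \<circ>\<^sub>m jet_rep j'),
      one = jet X 1 x\<^sub>0 (id_pmap X)\<rparr>"

text \<open>Its smooth structure is that of a submanifold of the Lie groupoid \<open>J\<^sup>1\<Gamma>\<close>.\<close>

definition isotropy_mfd ::
  "('x, 'a::real_normed_vector) mfd \<Rightarrow> ('x \<rightharpoonup> 'x) set \<Rightarrow> 'x \<Rightarrow> ('x jet, 'a jet_coord) mfd" where
  "isotropy_mfd X \<Gamma> x\<^sub>0 = submfd (jet_pseudogroup_mfd X \<Gamma> 1) (carrier (isotropy_group X \<Gamma> x\<^sub>0))"

text \<open>The differential at the identity of the orbit map of \<open>x\<^sub>0\<close>.\<close>

definition orbit_map_diff ::
  "('k, 'e) monoid_scheme \<Rightarrow> ('k, 'b::real_normed_vector) mfd \<Rightarrow>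
   ('x, 'a::real_normed_vector) mfd \<Rightarrow> ('k \<Rightarrow> 'x \<Rightarrow> 'x) \<Rightarrow> 'x \<Rightarrow> 'b \<Rightarrow> 'a" where
  "orbit_map_diff K KM X A x\<^sub>0 = mdiff KM X (\<lambda>k. A k x\<^sub>0) \<one>\<^bsub>K\<^esub>"

definition isotropy_rep ::
  "('k, 'e) monoid_scheme \<Rightarrow> ('k, 'b::real_normed_vector) mfd \<Rightarrow>
   ('x, 'a::real_normed_vector) mfd \<Rightarrow> ('k \<Rightarrow> 'x \<Rightarrow> 'x) \<Rightarrow> 'x \<Rightarrow> 'x jet \<Rightarrow> 'b \<Rightarrow> 'b" where
  "isotropy_rep K KM X A x\<^sub>0 j \<xi> =
     inv_into (model KM) (orbit_map_diff K KM X A x\<^sub>0)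
       (mdiff X X (the \<circ> jet_rep j) x\<^sub>0 (orbit_map_diff K KM X A x\<^sub>0 \<xi>))"

end

theory Submission
  imports Defs
begin

text \<open>
  The extension itself is formal: once \<open>G\<close> is known to be a Lie group that acts smoothly on \<open>\<kk>\<close>, the
  projection \<open>\<gg> \<times> \<kk> \<rightarrow> \<gg>\<close> and the inclusion of \<open>\<kk>\<close> are equivariant splittings with the required
  compatibility with the brackets. The work lies in two facts.

  First, \<open>G\<close> is the fibre of the submersion \<open>J\<^sup>1\<Gamma> \<rightarrow> J\<^sup>0\<Gamma>\<close> over the 0-jet of the identity at
  \<open>x\<^sub>0\<close>, hence an embedded submanifold by the inverse function theorem. In the coordinates of a jet
  chart around \<open>x\<^sub>0\<close> a 1-jet is a matrix, so multiplication and inversion are smooth.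

  Second, the differential at the identity of the orbit map \<open>k \<mapsto> k \<cdot> x\<^sub>0\<close> is an isomorphism. By
  equivariance the orbit map has constant rank, and it is injective, so its differential is
  injective. If \<open>K\<close> had smaller dimension than \<open>X\<close>, then \<open>X\<close>, a countable union of smooth images of
  charts of \<open>K\<close>, would have measure zero.
\<close>

text \<open>The obstacle is that \<open>G\<close> gets its smooth structure through two successive
  choices of slice charts, starting from a jet manifold for which only weak chart axioms are
  established: openness of chart images and smoothness of transitions are not shown there.
  Compatibility is instead built into the maximal atlas, and what survives each restriction is
  \<open>vec_embedding\<close>: near every point some chart is a smooth function of fixed linear
  coordinates \<open>E\<close>, and these are smooth in the chart. Smoothness of maps into
  \<open>G\<close>, the Hausdorff property and second countability are then read off in one vector
  space. A jet is a class of local maps with an arbitrary representative, possibly outside \<Gamma>.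
  The group laws are therefore checked on the faithful linear representation \<open>lin\<close>.
  Model spaces are subspaces of normed spaces without an inner product. Linear maps on them are
  extended to the whole type along a bounded projection \<open>proj V\<close>, and bounded
  functionals are what produces it. For the orbit map, constant rank replaces integral curves of
  vector fields: no differential equation is solved.\<close>

text \<open>
  By the Hahn-Banach theorem every real normed space has this property. The model spaces of jet
  manifolds are built from Euclidean spaces by products and finitely supported functions, where
  the functionals can be written down.
\<close>

class dual_separating = real_normed_vector +
  assumes dual_separating: "x \<noteq> 0 \<Longrightarrow> \<exists>f::'a \<Rightarrow> real. (\<forall>u v. f (u + v) = f u + f v) \<and>
    (\<forall>r u. f (r *\<^sub>R u) = r *\<^sub>R f u) \<and> (\<exists>K. \<forall>u. norm (f u) \<le> norm u * K) \<and> f x \<noteq> 0"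

lemma ex_bounded_functional:
  assumes "(x::'a::dual_separating) \<noteq> 0"
  shows "\<exists>f::'a \<Rightarrow> real. bounded_linear f \<and> f x \<noteq> 0"
  using dual_separating[OF assms] by (metis bounded_linear_intro)

lemma bounded_linearE:
  assumes "bounded_linear f"
  shows "(\<forall>u v. f (u + v) = f u + f v) \<and> (\<forall>r u. f (r *\<^sub>R u) = r *\<^sub>R f u) \<and> (\<exists>K. \<forall>u. norm (f u) \<le> norm u * K)"
proof -
  interpret bounded_linear f
    by fact
  show ?thesis
    using bounded by (auto simp: add scale)
qed

instance real_inner \<subseteq> dual_separating
proof
  fix x :: 'a
  assume "x \<noteq> 0"
  then have "x \<bullet> x \<noteq> 0"
    by simp
  then show "\<exists>f::'a \<Rightarrow> real. (\<forall>u v. f (u + v) = f u + f v) \<and> (\<forall>r u. f (r *\<^sub>R u) = r *\<^sub>R f u) \<and>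
      (\<exists>K. \<forall>u. norm (f u) \<le> norm u * K) \<and> f x \<noteq> 0"
    using bounded_linearE[OF bounded_linear_inner_right[of x]] by blast
qed

instance prod :: (dual_separating, dual_separating) dual_separating
proof
  fix x :: "'a \<times> 'b"
  assume "x \<noteq> 0"
  then consider "fst x \<noteq> 0" | "snd x \<noteq> 0"
    by (metis prod.collapse zero_prod_def)
  then have "\<exists>f::'a \<times> 'b \<Rightarrow> real. bounded_linear f \<and> f x \<noteq> 0"
  proof cases
    case 1
    then obtain f :: "'a \<Rightarrow> real" where "bounded_linear f" "f (fst x) \<noteq> 0"
      using ex_bounded_functional by blast
    then show ?thesis
      by (intro exI[of _ "\<lambda>y. f (fst y)"]) (auto intro: bounded_linear_compose bounded_linear_fst)
  next
    case 2
    then obtain f :: "'b \<Rightarrow> real" where "bounded_linear f" "f (snd x) \<noteq> 0"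
      using ex_bounded_functional by blast
    then show ?thesis
      by (intro exI[of _ "\<lambda>y. f (snd y)"]) (auto intro: bounded_linear_compose bounded_linear_snd)
  qed
  then show "\<exists>f::'a \<times> 'b \<Rightarrow> real. (\<forall>u v. f (u + v) = f u + f v) \<and> (\<forall>r u. f (r *\<^sub>R u) = r *\<^sub>R f u) \<and>
      (\<exists>K. \<forall>u. norm (f u) \<le> norm u * K) \<and> f x \<noteq> 0"
    using bounded_linearE by blast
qed

lemma lookup_scaleR: "Poly_Mapping.lookup (r *\<^sub>R p) k = r *\<^sub>R Poly_Mapping.lookup p k"
proof -
  have "finite {i. r *\<^sub>R Poly_Mapping.lookup p i \<noteq> 0}"
    by (rule finite_subset[OF _ finite_lookup[of p]]) auto
  then show ?thesis
    by (simp add: scaleR_poly_mapping_def)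
qed

text \<open>The norm on finitely supported functions is the sum of the norms of the coefficients, so
  each coefficient is bounded with constant 1.\<close>

lemma bounded_linear_lookup:
  "bounded_linear (\<lambda>p::'i \<Rightarrow>\<^sub>0 'b::real_normed_vector. Poly_Mapping.lookup p k)"
proof (rule bounded_linear_intro[of _ 1])
  fix p :: "'i \<Rightarrow>\<^sub>0 'b"
  have "norm p = (\<Sum>n \<in> Poly_Mapping.keys p. norm (Poly_Mapping.lookup p n))"
    by (simp add: norm_poly_mapping_def dist_poly_mapping_def)
  moreover have "norm (Poly_Mapping.lookup p k) \<le> (\<Sum>n \<in> Poly_Mapping.keys p. norm (Poly_Mapping.lookup p n))"
  proof (cases "k \<in> Poly_Mapping.keys p")
    case True
    then show ?thesis
      by (intro member_le_sum) auto
  qed (simp add: in_keys_iff sum_nonneg)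
  ultimately show "norm (Poly_Mapping.lookup p k) \<le> norm p * 1"
    by simp
qed (simp_all add: lookup_add lookup_scaleR)

lemma bounded_linear_single:
  "bounded_linear (Poly_Mapping.single k :: 'b::real_normed_vector \<Rightarrow> ('i \<Rightarrow>\<^sub>0 'b))"
proof (rule bounded_linear_intro[of _ 1])
  show "norm (Poly_Mapping.single k x) \<le> norm x * 1" for x :: 'b
    by (cases "x = 0") (auto simp: norm_poly_mapping_def dist_poly_mapping_def)
next
  show "Poly_Mapping.single k (r *\<^sub>R x) = r *\<^sub>R Poly_Mapping.single k x" for r and x :: 'b
    by (rule poly_mapping_eqI) (simp add: lookup_scaleR lookup_single when_def)
qed (simp add: single_add)

instance poly_mapping :: (type, dual_separating) dual_separating
proof
  fix p :: "'a \<Rightarrow>\<^sub>0 'b"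
  assume "p \<noteq> 0"
  then obtain k where "Poly_Mapping.lookup p k \<noteq> 0"
    by (metis lookup_zero poly_mapping_eqI)
  then obtain f :: "'b \<Rightarrow> real" where "bounded_linear f" "f (Poly_Mapping.lookup p k) \<noteq> 0"
    using ex_bounded_functional by blast
  then have "bounded_linear (\<lambda>q::'a \<Rightarrow>\<^sub>0 'b. f (Poly_Mapping.lookup q k))"
    by (auto intro: bounded_linear_compose bounded_linear_lookup)
  from bounded_linearE[OF this] \<open>f (Poly_Mapping.lookup p k) \<noteq> 0\<close>
  show "\<exists>f::('a \<Rightarrow>\<^sub>0 'b) \<Rightarrow> real. (\<forall>u v. f (u + v) = f u + f v) \<and> (\<forall>r u. f (r *\<^sub>R u) = r *\<^sub>R f u) \<and>
      (\<exists>K. \<forall>u. norm (f u) \<le> norm u * K) \<and> f p \<noteq> 0"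
    by (intro exI[of _ "\<lambda>q. f (Poly_Mapping.lookup q k)"]) simp
qed

section \<open>Finite-dimensional subspaces\<close>

text \<open>An induction in the manner of Gram-Schmidt, with functionals in place of an inner
  product. The residual \<open>r\<close> kills \<open>B\<close> but not the new vector
  \<open>b\<close>, so a functional that is non-zero at \<open>r b\<close>, composed with
  \<open>r\<close> and normalised, is dual to \<open>b\<close>. Setting \<open>c b\<close> to zero
  outside \<open>B\<close> keeps every \<open>c b\<close> bounded without a side condition on the
  index.\<close>

lemma dual_basis_exists:
  fixes B :: "'a::dual_separating set"
  assumes "finite B" "independent B"
  shows "\<exists>c. (\<forall>b. bounded_linear (c b)) \<and> (\<forall>b. b \<notin> B \<longrightarrow> c b = (\<lambda>_. 0)) \<and>
    (\<forall>b\<in>B. \<forall>b'\<in>B. c b b' = (if b = b' then 1 else (0::real)))"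
  using assms
proof (induction B rule: finite_induct)
  case empty
  show ?case
    by (intro exI[of _ "\<lambda>_ _. 0"]) auto
next
  case (insert b B)
  then obtain c where c: "\<And>b. bounded_linear (c b)" "\<And>b. b \<notin> B \<Longrightarrow> c b = (\<lambda>_. 0)"
    "\<And>b b'. b \<in> B \<Longrightarrow> b' \<in> B \<Longrightarrow> c b b' = (if b = b' then 1 else (0::real))"
    by (metis independent_insert)
  define r where "r = (\<lambda>x. x - (\<Sum>b\<in>B. c b x *\<^sub>R b))"
  have r: "bounded_linear r"
    unfolding r_def by (intro bounded_linear_sub bounded_linear_ident bounded_linear_sum
      bounded_linear_scaleR_left[THEN bounded_linear_compose] c)
  have "(\<Sum>b\<in>B. c b b' *\<^sub>R b) = b'" if "b' \<in> B" for b'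
  proof -
    have "(\<Sum>b\<in>B. c b b' *\<^sub>R b) = (\<Sum>b\<in>B. if b = b' then b else 0)"
      using c(3) that by (intro sum.cong) auto
    then show ?thesis
      using that insert by simp
  qed
  then have rB: "r b' = 0" if "b' \<in> B" for b'
    using that by (simp add: r_def)
  have "b \<notin> span B"
    using insert by (simp add: independent_insert)
  moreover have "(\<Sum>b'\<in>B. c b' b *\<^sub>R b') \<in> span B"
    by (intro span_sum span_scale span_base)
  ultimately have "r b \<noteq> 0"
    unfolding r_def by auto
  then obtain f :: "'a \<Rightarrow> real" where f: "bounded_linear f" "f (r b) \<noteq> 0"
    using ex_bounded_functional by blast
  define cb where "cb = (\<lambda>x. f (r x) / f (r b))"
  have cb: "bounded_linear cb"
    unfolding cb_def using f(1) r
    by (simp add: bounded_linear_compose bounded_linear_divide[THEN bounded_linear_compose])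
  have cbB: "cb b' = 0" if "b' \<in> B" for b'
    using rB[OF that] linear_0[OF bounded_linear.linear[OF f(1)]] by (simp add: cb_def)
  have "cb b = 1"
    using f by (simp add: cb_def)
  \<comment> \<open>The correction makes the old functionals vanish at the new vector; on
    \<open>B\<close> it changes nothing, because \<open>cb\<close> is zero there.\<close>
  define c' where "c' = (\<lambda>b'. if b' = b then cb else (\<lambda>x. c b' x - cb x * c b' b))"
  show ?case
  proof (intro exI[of _ c'] conjI allI ballI impI)
    show "bounded_linear (c' b')" for b'
      unfolding c'_def using c(1) cb
      by (auto intro!: bounded_linear_sub bounded_linear_mult_left[THEN bounded_linear_compose])
    show "c' b' = (\<lambda>_. 0)" if "b' \<notin> insert b B" for b'
      using that c(2) by (auto simp: c'_def)
    show "c' b1 b2 = (if b1 = b2 then 1 else 0)" if "b1 \<in> insert b B" "b2 \<in> insert b B" for b1 b2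
      using that c(3) cbB \<open>cb b = 1\<close> insert.hyps by (auto simp: c'_def)
  qed
qed

lemma fin_dim_subspaceD:
  assumes "fin_dim_subspace V"
  shows "subspace V" "finite (model_basis V)" "independent (model_basis V)"
    "model_basis V \<subseteq> V" "span (model_basis V) = V"
proof -
  obtain B where B: "finite B" "span B = V"
    using assms by (auto simp: fin_dim_subspace_def)
  show "subspace V"
    using B by auto
  have "\<exists>C. C \<subseteq> V \<and> independent C \<and> span C = V"
    by (metis B(2) maximal_independent_subset span_minimal span_subspace subspace_span)
  then have *: "model_basis V \<subseteq> V \<and> independent (model_basis V) \<and> span (model_basis V) = V"
    unfolding model_basis_def by (rule someI_ex)
  then show "independent (model_basis V)" "model_basis V \<subseteq> V" "span (model_basis V) = V"
    by auto
  show "finite (model_basis V)"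
    using independent_span_bound[OF B(1), of "model_basis V"] * B by auto
qed

text \<open>Coordinates with respect to \<open>model_basis V\<close>, extended to bounded
  functionals on the whole type; the extension off \<open>V\<close> is an arbitrary choice.\<close>

definition coord :: "'a::dual_separating set \<Rightarrow> 'a \<Rightarrow> 'a \<Rightarrow> real" where
  "coord V = (SOME c. (\<forall>b. bounded_linear (c b)) \<and> (\<forall>b. b \<notin> model_basis V \<longrightarrow> c b = (\<lambda>_. 0)) \<and>
    (\<forall>b\<in>model_basis V. \<forall>b'\<in>model_basis V. c b b' = (if b = b' then 1 else 0)))"

text \<open>A bounded projection of the whole type onto \<open>V\<close>. A map \<open>f\<close>
  that is linear only on \<open>V\<close> becomes the bounded linear map
  \<open>f (proj V x)\<close>, a form that \<open>has_derivative\<close> accepts.\<close>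

definition proj :: "'a::dual_separating set \<Rightarrow> 'a \<Rightarrow> 'a" where
  "proj V x = (\<Sum>b\<in>model_basis V. coord V b x *\<^sub>R b)"

lemma
  assumes "fin_dim_subspace V"
  shows bounded_linear_coord: "bounded_linear (coord V b)"
    and coord_basis: "b \<in> model_basis V \<Longrightarrow> b' \<in> model_basis V \<Longrightarrow> coord V b b' = (if b = b' then 1 else 0)"
  using someI_ex[OF dual_basis_exists[OF fin_dim_subspaceD(2,3)[OF assms]]]
  unfolding coord_def[symmetric] by auto

lemma bounded_linear_proj:
  assumes "fin_dim_subspace V"
  shows "bounded_linear (proj V)"
  unfolding proj_def
  by (intro bounded_linear_sum bounded_linear_scaleR_left[THEN bounded_linear_compose]
      bounded_linear_coord assms)

lemma proj_in: "fin_dim_subspace V \<Longrightarrow> proj V x \<in> V"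
  unfolding proj_def using fin_dim_subspaceD(1,4)[of V]
  by (auto intro!: subspace_sum subspace_scale)

lemma proj_id:
  assumes "fin_dim_subspace V" "v \<in> V"
  shows "proj V v = v"
proof -
  interpret bounded_linear "proj V"
    by (rule bounded_linear_proj[OF assms(1)])
  have "proj V b = b" if b: "b \<in> model_basis V" for b
  proof -
    have "proj V b = (\<Sum>b'\<in>model_basis V. if b' = b then b' else 0)"
      unfolding proj_def using coord_basis[OF assms(1)] b by (intro sum.cong) auto
    then show ?thesis
      using b fin_dim_subspaceD(2)[OF assms(1)] by simp
  qed
  moreover have "v \<in> span (model_basis V)"
    using assms(2) by (simp add: fin_dim_subspaceD(5)[OF assms(1)])
  ultimately show ?thesis
    using linear_eq_on[OF linear_axioms linear_id] by (metis id_apply)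
qed

lemma proj_ident_iff: "fin_dim_subspace V \<Longrightarrow> proj V v = v \<longleftrightarrow> v \<in> V"
  by (metis proj_id proj_in)

lemma fin_dim_subspace_closed:
  fixes V :: "'a::dual_separating set"
  assumes "fin_dim_subspace V"
  shows "closed V"
proof -
  have "V = {x. proj V x = x}"
    using proj_ident_iff[OF assms] by auto
  moreover have "closed {x. proj V x = x}"
    by (intro closed_Collect_eq continuous_intros linear_continuous_on bounded_linear_proj assms)
  ultimately show ?thesis
    by simp
qed

text \<open>Completeness is inherited from the finitely many coordinates. It feeds the contraction
  principle in the inverse function theorem, where the ambient type need not be complete.\<close>

lemma fin_dim_subspace_complete:
  fixes V :: "'a::dual_separating set"
  assumes "fin_dim_subspace V"
  shows "complete V"
proof (rule completeI)
  fix s :: "nat \<Rightarrow> 'a"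
  assume s: "\<forall>n. s n \<in> V" "Cauchy s"
  have "\<exists>l. (\<lambda>n. coord V b (s n)) \<longlonglongrightarrow> l" for b
    using bounded_linear.Cauchy[OF bounded_linear_coord[OF assms] s(2)]
    by (simp add: Cauchy_convergent_iff convergent_def)
  then obtain l where "(\<lambda>n. coord V b (s n)) \<longlonglongrightarrow> l b" for b
    by metis
  then have "(\<lambda>n. proj V (s n)) \<longlonglongrightarrow> (\<Sum>b\<in>model_basis V. l b *\<^sub>R b)"
    unfolding proj_def by (intro tendsto_intros)
  moreover have "(\<Sum>b\<in>model_basis V. l b *\<^sub>R b) \<in> V"
    using fin_dim_subspaceD(1,4)[OF assms] by (auto intro!: subspace_sum subspace_scale)
  ultimately show "\<exists>l\<in>V. s \<longlonglongrightarrow> l"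
    using s(1) by (auto simp: proj_id[OF assms])
qed

lemma fin_dim_subspace_subset:
  assumes "fin_dim_subspace V" "subspace W" "W \<subseteq> V"
  shows "fin_dim_subspace W"
proof -
  obtain B where B: "B \<subseteq> W" "independent B" "span B = W"
    by (metis assms(2) maximal_independent_subset span_minimal span_subspace subspace_span)
  moreover have "finite B"
    using independent_span_bound[OF fin_dim_subspaceD(2)[OF assms(1)], of B] B assms
      fin_dim_subspaceD(5) by auto
  ultimately show ?thesis
    by (auto simp: fin_dim_subspace_def)
qed

lemma fin_dim_subspace_Times:
  assumes "fin_dim_subspace V" "fin_dim_subspace W"
  shows "fin_dim_subspace (V \<times> W)"
proof -
  obtain B C where BC: "finite B" "span B = V" "finite C" "span C = W"
    using assms by (auto simp: fin_dim_subspace_def)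
  have "span ((\<lambda>b. (b, 0)) ` B \<union> (\<lambda>c. (0, c)) ` C) = V \<times> W"
  proof -
    have lin: "linear (\<lambda>b::'a. (b, 0::'b))" "linear (\<lambda>c::'b. (0::'a, c))"
      by (auto intro!: linearI)
    have "span ((\<lambda>b. (b, 0::'b)) ` B) = (\<lambda>b. (b, 0)) ` V"
      unfolding linear_span_image[OF lin(1)] BC(2) ..
    moreover have "span ((\<lambda>c. (0::'a, c)) ` C) = (\<lambda>c. (0, c)) ` W"
      unfolding linear_span_image[OF lin(2)] BC(4) ..
    ultimately have "span ((\<lambda>b. (b, 0)) ` B \<union> (\<lambda>c. (0, c)) ` C) = {x + y |x y. x \<in> (\<lambda>b. (b, 0::'b)) ` V \<and> y \<in> (\<lambda>c. (0::'a, c)) ` W}"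
      by (simp only: span_Un)
    also have "\<dots> = V \<times> W"
    proof (intro equalityI subsetI)
      fix z :: "'a \<times> 'b" assume "z \<in> V \<times> W"
      then have "z = (fst z, 0) + (0, snd z)" "fst z \<in> V" "snd z \<in> W"
        by auto
      then show "z \<in> {x + y |x y. x \<in> (\<lambda>b. (b, 0::'b)) ` V \<and> y \<in> (\<lambda>c. (0::'a, c)) ` W}"
        by blast
    qed auto
    finally show ?thesis .
  qed
  moreover have "finite ((\<lambda>b. (b, 0::'b)) ` B \<union> (\<lambda>c. (0::'a, c)) ` C)"
    using BC by simp
  ultimately show ?thesis
    unfolding fin_dim_subspace_def by (intro exI conjI)
qed

lemma fin_dim_subspace_euclidean:
  fixes V :: "'a::euclidean_space set"
  assumes "subspace V"
  shows "fin_dim_subspace V"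
proof -
  obtain B where "B \<subseteq> V" "independent B" "V \<subseteq> span B"
    using basis_exists[of V] by metis
  then show ?thesis
    using assms finiteI_independent[of B] span_subspace[of B V] by (auto simp: fin_dim_subspace_def)
qed

section \<open>Linear maps between subspaces\<close>

lemma linear_betw_add: "linear_betw V W f \<Longrightarrow> u \<in> V \<Longrightarrow> v \<in> V \<Longrightarrow> f (u + v) = f u + f v"
  and linear_betw_scale: "linear_betw V W f \<Longrightarrow> v \<in> V \<Longrightarrow> f (a *\<^sub>R v) = a *\<^sub>R f v"
  and linear_betw_in: "linear_betw V W f \<Longrightarrow> v \<in> V \<Longrightarrow> f v \<in> W"
  by (auto simp: linear_betw_def)

lemma linear_betw_sum:
  assumes "linear_betw V W f" "subspace V" "finite B" "\<And>b. b \<in> B \<Longrightarrow> g b \<in> V"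
  shows "f (\<Sum>b\<in>B. g b) = (\<Sum>b\<in>B. f (g b))"
  using assms(3,4)
proof (induction B rule: finite_induct)
  case empty
  have "f (0 *\<^sub>R 0) = 0 *\<^sub>R f 0"
    using assms subspace_0 unfolding linear_betw_def by blast
  then show ?case
    by simp
next
  case (insert b B)
  then have "(\<Sum>b\<in>B. g b) \<in> V" "g b \<in> V"
    using assms(2) by (auto intro: subspace_sum)
  then show ?case
    using insert assms(1) by (simp add: linear_betw_def)
qed

lemma linear_betw_0: "linear_betw V W f \<Longrightarrow> subspace V \<Longrightarrow> f 0 = 0"
  using linear_betw_sum[of V W f "{}" id] by simp

lemma linear_betw_diff:
  assumes "linear_betw V W f" "subspace V" "u \<in> V" "v \<in> V"
  shows "f (u - v) = f u - f v"
proof -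
  have "f (u + (-1) *\<^sub>R v) = f u + (-1) *\<^sub>R f v"
    using assms subspace_scale[of V v "-1"] unfolding linear_betw_def by metis
  then show ?thesis
    by simp
qed

lemma linear_betw_proj_sum:
  assumes "linear_betw V W f" "fin_dim_subspace V"
  shows "f (proj V v) = (\<Sum>b\<in>model_basis V. coord V b v *\<^sub>R f b)"
proof -
  note V = fin_dim_subspaceD[OF assms(2)]
  have "f (proj V v) = (\<Sum>b\<in>model_basis V. f (coord V b v *\<^sub>R b))"
    unfolding proj_def using V by (intro linear_betw_sum[OF assms(1)]) (auto intro: subspace_scale)
  also have "\<dots> = (\<Sum>b\<in>model_basis V. coord V b v *\<^sub>R f b)"
    using V(4) by (intro sum.cong refl linear_betw_scale[OF assms(1)]) auto
  finally show ?thesis .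
qed

lemma linear_betw_coord_sum:
  assumes "linear_betw V W f" "fin_dim_subspace V" "v \<in> V"
  shows "f v = (\<Sum>b\<in>model_basis V. coord V b v *\<^sub>R f b)"
  using linear_betw_proj_sum[OF assms(1,2), of v] by (simp only: proj_id[OF assms(2,3)])

text \<open>Linear maps out of a finite-dimensional space are bounded: the extension is a finite sum
  of bounded coordinates times fixed vectors.\<close>

lemma bounded_linear_proj_comp:
  assumes "linear_betw V W f" "fin_dim_subspace V"
  shows "bounded_linear (\<lambda>x. f (proj V x))"
proof -
  have "(\<lambda>x. f (proj V x)) = (\<lambda>x. \<Sum>b\<in>model_basis V. coord V b x *\<^sub>R f b)"
    by (rule ext) (rule linear_betw_proj_sum[OF assms])
  moreover have "bounded_linear \<dots>"
    by (intro bounded_linear_sum bounded_linear_scaleR_left[THEN bounded_linear_compose]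
      bounded_linear_coord assms)
  ultimately show ?thesis
    by simp
qed

lemma linear_betw_bounded_linear:
  "bounded_linear f \<Longrightarrow> f ` V \<subseteq> W \<Longrightarrow> linear_betw V W f"
  using bounded_linearE[of f] by (auto simp: linear_betw_def)

lemma linear_betw_comp:
  "linear_betw U V f \<Longrightarrow> linear_betw V W g \<Longrightarrow> linear_betw U W (\<lambda>x. g (f x))"
  unfolding linear_betw_def by (auto simp: image_subset_iff)

lemma linear_betw_cong:
  assumes "subspace V" "\<And>v. v \<in> V \<Longrightarrow> f v = g v"
  shows "linear_betw V W f \<longleftrightarrow> linear_betw V W g"
  using assms by (auto simp: linear_betw_def image_subset_iff subspace_add subspace_scale)

lemma linear_betw_image_subspace:
  assumes "linear_betw V W f" "subspace V"
  shows "subspace (f ` V)"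
proof (rule subspaceI)
  show "0 \<in> f ` V"
    using linear_betw_0[OF assms] subspace_0[OF assms(2)] by (intro image_eqI[of _ _ 0]) auto
  show "x + y \<in> f ` V" if "x \<in> f ` V" "y \<in> f ` V" for x y
  proof -
    from that obtain u v where "u \<in> V" "v \<in> V" "x = f u" "y = f v"
      by blast
    then show ?thesis
      using linear_betw_add[OF assms(1), of u v] subspace_add[OF assms(2), of u v]
      by (intro image_eqI[of _ _ "u + v"]) auto
  qed
  show "a *\<^sub>R x \<in> f ` V" if "x \<in> f ` V" for a x
  proof -
    from that obtain u where "u \<in> V" "x = f u"
      by blast
    then show ?thesis
      using linear_betw_scale[OF assms(1), of u] subspace_scale[OF assms(2), of u]
      by (intro image_eqI[of _ _ "a *\<^sub>R u"]) auto
  qed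
qed

lemma linear_betw_inv_into:
  assumes "linear_betw V W f" "subspace V" "inj_on f V" "f ` V = W"
  shows "linear_betw W V (inv_into V f)"
  unfolding linear_betw_def
proof (intro conjI ballI allI)
  show "inv_into V f ` W \<subseteq> V"
    using assms(4) by (auto simp: inv_into_into)
next
  fix v w assume "v \<in> W" "w \<in> W"
  then show "inv_into V f (v + w) = inv_into V f v + inv_into V f w"
    using assms by (intro inv_into_f_eq) (auto simp: linear_betw_def inv_into_into f_inv_into_f subspace_add)
next
  fix a v assume "v \<in> W"
  then show "inv_into V f (a *\<^sub>R v) = a *\<^sub>R inv_into V f v"
    using assms by (intro inv_into_f_eq) (auto simp: linear_betw_def inv_into_into f_inv_into_f subspace_scale)
qed

lemma linear_betw_inj_on:
  assumes "linear_betw V W f" "subspace V" "\<And>v. v \<in> V \<Longrightarrow> f v = 0 \<Longrightarrow> v = 0"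
  shows "inj_on f V"
proof (rule inj_onI)
  fix u v assume "u \<in> V" "v \<in> V" "f u = f v"
  then have "u - v = 0"
    using linear_betw_diff[OF assms(1,2), of u v] by (intro assms(3) subspace_diff assms(2)) auto
  then show "u = v"
    by simp
qed

text \<open>Counting: the images of the basis span \<open>V\<close>, so there are at least as many
  of them as basis vectors. Hence they are distinct and independent, and a kernel vector has zero
  coordinates.\<close>

lemma linear_betw_surj_inj:
  fixes f :: "'a::dual_separating \<Rightarrow> 'a"
  assumes f: "linear_betw V V f" and V: "fin_dim_subspace V" and "f ` V = V"
  shows "inj_on f V"
proof -
  note D = fin_dim_subspaceD[OF V]
  have "linear (\<lambda>x. f (proj V x))"
    using bounded_linear_proj_comp[OF f V] bounded_linear.linear by blast
  moreover have "(\<lambda>x. f (proj V x)) ` model_basis V = f ` model_basis V"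
    using proj_id[OF V] D by (intro image_cong) auto
  moreover have "(\<lambda>x. f (proj V x)) ` V = f ` V"
    using proj_id[OF V] by (intro image_cong) auto
  ultimately have sp: "span (f ` model_basis V) = V"
    using linear_span_image[of "\<lambda>x. f (proj V x)" "model_basis V"] D(5) assms(3) by auto
  have card: "card (model_basis V) \<le> card (f ` model_basis V)"
    using independent_span_bound[of "f ` model_basis V" "model_basis V"] D sp by auto
  have inj: "inj_on f (model_basis V)"
    by (rule eq_card_imp_inj_on) (use D card card_image_le[OF D(2), of f] in auto)
  \<comment> \<open>A maximal independent set of images still spans \<open>V\<close>, so it has full
    size and is the whole set of images.\<close>
  have ind: "independent (f ` model_basis V)"
  proof -
    obtain C where C: "C \<subseteq> f ` model_basis V" "independent C" "f ` model_basis V \<subseteq> span C"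
      using maximal_independent_subset[of "f ` model_basis V"] by metis
    have "model_basis V \<subseteq> span C"
      using C(3) sp D(4) by (metis span_minimal subspace_span subset_trans)
    then have "card (model_basis V) \<le> card C"
      using independent_span_bound[of C "model_basis V"] D C finite_subset[OF C(1)] by auto
    then have "C = f ` model_basis V"
      using C(1) D(2) card_image_le[OF D(2), of f] by (intro card_seteq) auto
    then show ?thesis
      using C by simp
  qed
  show ?thesis
  proof (rule linear_betw_inj_on[OF f D(1)])
    fix v assume v: "v \<in> V" "f v = 0"
    then have "(\<Sum>b\<in>model_basis V. coord V b v *\<^sub>R f b) = 0"
      using linear_betw_coord_sum[OF f V] by simp
    then have "(\<Sum>w\<in>f ` model_basis V. coord V (inv_into (model_basis V) f w) v *\<^sub>R w) = 0"
      by (subst sum.reindex[OF inj]) (simp add: inv_into_f_f[OF inj])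
    then have "coord V (inv_into (model_basis V) f w) v = 0" if "w \<in> f ` model_basis V" for w
      by (rule independentD[OF ind finite_imageI[OF D(2)] subset_refl]) (fact that)
    then have "coord V b v = 0" if "b \<in> model_basis V" for b
      using that inv_into_f_f[OF inj] by (metis imageI)
    then show "v = 0"
      using proj_id[OF V v(1)] by (simp add: proj_def)
  qed
qed


section \<open>Calculus of smooth maps\<close>

abbreviation open_in :: "'a::topological_space set \<Rightarrow> 'a set \<Rightarrow> bool" where
  "open_in V U \<equiv> openin (top_of_set V) U"

lemma at_within_open_in:
  assumes "open_in V N" "N \<subseteq> U" "U \<subseteq> V" "x \<in> N"
  shows "at x within N = at x within U"
proof -
  obtain S where "open S" "N = V \<inter> S"
    using assms(1) by (auto simp: openin_open)
  then show ?thesis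
    using assms by (intro at_within_nhd[of x S]) auto
qed

text \<open>A line through \<open>x\<close> in a direction of \<open>V\<close> stays in
  \<open>U\<close> for small parameters, so a derivative within \<open>U\<close> yields a genuine
  two-sided derivative of a curve. This makes \<open>dir_deriv\<close> agree with any derivative
  within \<open>U\<close> on directions in \<open>V\<close>.\<close>

lemma has_vector_derivative_line:
  assumes "subspace V" "open_in V U" "x \<in> U" "v \<in> V" "(f has_derivative D) (at x within U)"
  shows "((\<lambda>t. f (x + t *\<^sub>R v)) has_vector_derivative D v) (at 0)"
proof -
  obtain S where S: "open S" "U = V \<inter> S"
    using assms(2) by (auto simp: openin_open)
  define T where "T = (\<lambda>t::real. x + t *\<^sub>R v) -` S"
  have "open T"
    unfolding T_def by (intro open_vimage S continuous_intros)
  have "0 \<in> T"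
    using assms(3) S by (simp add: T_def)
  have TU: "(\<lambda>t. x + t *\<^sub>R v) ` T \<subseteq> U"
    using assms S by (auto simp: T_def intro!: subspace_add subspace_scale)
  have "((\<lambda>t. x + t *\<^sub>R v) has_derivative (\<lambda>t. t *\<^sub>R v)) (at 0 within T)"
    by (auto intro!: derivative_eq_intros)
  moreover have "(f has_derivative D) (at (x + 0 *\<^sub>R v) within (\<lambda>t. x + t *\<^sub>R v) ` T)"
    using has_derivative_subset[OF assms(5) TU] by simp
  ultimately have "((\<lambda>t. f (x + t *\<^sub>R v)) has_derivative (\<lambda>t. D (t *\<^sub>R v))) (at 0 within T)"
    by (rule has_derivative_in_compose)
  then have "((\<lambda>t. f (x + t *\<^sub>R v)) has_derivative (\<lambda>t. D (t *\<^sub>R v))) (at 0)"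
    using at_within_open[OF \<open>0 \<in> T\<close> \<open>open T\<close>] by simp
  moreover have "D (t *\<^sub>R v) = t *\<^sub>R D v" for t
    using has_derivative_linear[OF assms(5)] by (rule linear_cmul)
  ultimately show ?thesis
    by (simp add: has_vector_derivative_def)
qed

lemma dir_deriv_eq:
  assumes "subspace V" "open_in V U" "x \<in> U" "v \<in> V" "(f has_derivative D) (at x within U)"
  shows "dir_deriv f x v = D v"
  unfolding dir_deriv_def by (rule vector_derivative_at[OF has_vector_derivative_line[OF assms]])

lemma dir_deriv_cong:
  assumes "subspace V" "open_in V U" "x \<in> U" "v \<in> V" "\<And>y. y \<in> U \<Longrightarrow> f y = g y"
  shows "dir_deriv f x v = dir_deriv g x v"
proof -
  obtain S where S: "open S" "U = V \<inter> S"
    using assms(2) by (auto simp: openin_open)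
  have "open ((\<lambda>t::real. x + t *\<^sub>R v) -` S)"
    by (intro open_vimage S continuous_intros)
  then have "\<forall>\<^sub>F t in nhds (0::real). t \<in> (\<lambda>t. x + t *\<^sub>R v) -` S"
    using assms(3) S by (intro eventually_nhds_in_open) auto
  then have "\<forall>\<^sub>F t in nhds (0::real). f (x + t *\<^sub>R v) = g (x + t *\<^sub>R v)"
  proof eventually_elim
    case (elim t)
    then show ?case
      using assms S by (auto intro!: subspace_add subspace_scale)
  qed
  moreover have "f (x + 0 *\<^sub>R v) = g (x + 0 *\<^sub>R v)"
    using assms by simp
  ultimately show ?thesis
    unfolding dir_deriv_def by (intro vector_derivative_cong_eq) auto
qed

text \<open>A derivative within a subset of \<open>V\<close> tests only differences that lie in
  \<open>V\<close>; off \<open>V\<close> its values are not determined. Precomposing with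
  \<open>proj V\<close> fixes one normal form.\<close>

lemma has_derivative_proj:
  assumes "fin_dim_subspace V" "U \<subseteq> V" "x \<in> U" "(f has_derivative D) (at x within U)"
  shows "(f has_derivative (\<lambda>v. D (proj V v))) (at x within U)"
proof -
  have "proj V (y - x) = y - x" if "y \<in> U" for y
    using that assms by (intro proj_id subspace_diff fin_dim_subspaceD) auto
  then have "\<forall>\<^sub>F y in at x within U. (1 / norm (y - x)) *\<^sub>R (f y - (f x + D (y - x))) =
      (1 / norm (y - x)) *\<^sub>R (f y - (f x + D (proj V (y - x))))"
    by (auto simp: eventually_at_filter)
  note ev = this
  show ?thesis
    unfolding has_derivative_within
  proof
    show "bounded_linear (\<lambda>v. D (proj V v))"
      by (rule bounded_linear_compose[OF has_derivative_bounded_linear[OF assms(4)] bounded_linear_proj[OF assms(1)]])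
    show "((\<lambda>y. (1 / norm (y - x)) *\<^sub>R (f y - (f x + D (proj V (y - x))))) \<longlongrightarrow> 0) (at x within U)"
      using assms(4) tendsto_cong[OF ev] unfolding has_derivative_within by blast
  qed
qed

lemma has_derivative_dir_deriv:
  assumes "fin_dim_subspace V" "open_in V U" "x \<in> U" "(f has_derivative D) (at x within U)"
  shows "(f has_derivative (\<lambda>v. dir_deriv f x (proj V v))) (at x within U)"
proof -
  have "dir_deriv f x (proj V v) = D (proj V v)" for v
    by (rule dir_deriv_eq[OF fin_dim_subspaceD(1)[OF assms(1)] assms(2,3) proj_in[OF assms(1)] assms(4)])
  then show ?thesis
    using has_derivative_proj[OF assms(1) openin_imp_subset[OF assms(2)] assms(3,4)] by simp
qed

text \<open>On \<open>U\<close> the map equals its projection to \<open>W\<close>, so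
  \<open>D\<close> and \<open>proj W\<close> after \<open>D\<close> are both derivatives of it; on
  directions in \<open>V\<close> both equal \<open>dir_deriv\<close>.\<close>

lemma has_derivative_in_subspace:
  fixes f :: "'a::real_normed_vector \<Rightarrow> 'b::dual_separating"
  assumes "subspace V" "open_in V U" "x \<in> U" "v \<in> V" "(f has_derivative D) (at x within U)"
    "fin_dim_subspace W" "f ` U \<subseteq> W"
  shows "D v \<in> W"
proof -
  have "((\<lambda>x. proj W (f x)) has_derivative (\<lambda>h. proj W (D h))) (at x within U)"
    by (rule bounded_linear.has_derivative[OF bounded_linear_proj[OF assms(6)] assms(5)])
  then have "(f has_derivative (\<lambda>h. proj W (D h))) (at x within U)"
    by (rule has_derivative_transform[OF assms(3), rotated]) (use assms(7) proj_id[OF assms(6)] in auto)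
  then have "D v = proj W (D v)"
    using dir_deriv_eq[OF assms(1-5)] dir_deriv_eq[OF assms(1-4)] by metis
  then show ?thesis
    using proj_in[OF assms(6)] by metis
qed

section \<open>Classes of differentiability\<close>

lemma C_on_SucI:
  "(\<And>x. x \<in> U \<Longrightarrow> (f has_derivative D x) (at x within U)) \<Longrightarrow>
   (\<And>v. v \<in> V \<Longrightarrow> C_on k V U (\<lambda>x. D x v)) \<Longrightarrow> C_on (Suc k) V U f"
  by auto

lemma C_on_SucE:
  assumes "C_on (Suc k) V U f"
  obtains D where "\<And>x. x \<in> U \<Longrightarrow> (f has_derivative D x) (at x within U)"
    "\<And>v. v \<in> V \<Longrightarrow> C_on k V U (\<lambda>x. D x v)"
  using assms by auto

lemma C_on_cong:
  assumes "C_on k V U f" "\<And>x. x \<in> U \<Longrightarrow> f x = g x"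
  shows "C_on k V U g"
proof (cases k)
  case 0
  then show ?thesis
    using assms continuous_on_cong[of U U f g] by simp
next
  case (Suc m)
  from assms(1)[unfolded Suc] obtain D where D: "\<And>x. x \<in> U \<Longrightarrow> (f has_derivative D x) (at x within U)"
    "\<And>v. v \<in> V \<Longrightarrow> C_on m V U (\<lambda>x. D x v)"
    by (rule C_on_SucE) blast
  have "(g has_derivative D x) (at x within U)" if "x \<in> U" for x
    by (rule has_derivative_transform[OF that _ D(1)[OF that]]) (use assms(2) in simp)
  then show ?thesis
    unfolding Suc using D(2) by (rule C_on_SucI)
qed

lemma C_on_subset: "C_on k V U f \<Longrightarrow> U' \<subseteq> U \<Longrightarrow> V' \<subseteq> V \<Longrightarrow> C_on k V' U' f"
proof (induction k arbitrary: f)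
  case 0
  then show ?case
    by (auto intro: continuous_on_subset)
next
  case (Suc k)
  from Suc.prems(1) obtain D where D: "\<And>x. x \<in> U \<Longrightarrow> (f has_derivative D x) (at x within U)"
    "\<And>v. v \<in> V \<Longrightarrow> C_on k V U (\<lambda>x. D x v)"
    by (rule C_on_SucE) blast
  show ?case
  proof (rule C_on_SucI)
    show "(f has_derivative D x) (at x within U')" if "x \<in> U'" for x
      using that Suc.prems D(1) has_derivative_subset by blast
    show "C_on k V' U' (\<lambda>x. D x v)" if "v \<in> V'" for v
      using that Suc.prems D(2) Suc.IH by blast
  qed
qed

lemma C_on_Suc_imp: "C_on (Suc k) V U f \<Longrightarrow> C_on k V U f"
proof (induction k arbitrary: f)
  case 0
  then obtain D where "\<And>x. x \<in> U \<Longrightarrow> (f has_derivative D x) (at x within U)"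
    by (rule C_on_SucE) blast
  then show ?case
    by (auto intro: has_derivative_continuous_on)
next
  case (Suc k)
  from Suc.prems obtain D where D: "\<And>x. x \<in> U \<Longrightarrow> (f has_derivative D x) (at x within U)"
    "\<And>v. v \<in> V \<Longrightarrow> C_on (Suc k) V U (\<lambda>x. D x v)"
    by (rule C_on_SucE) blast
  show ?case
    by (rule C_on_SucI[where D = D]) (use D Suc.IH in auto)
qed

lemma C_on_dir_deriv:
  assumes "C_on (Suc k) V U f" "subspace V" "open_in V U" "v \<in> V"
  shows "C_on k V U (\<lambda>x. dir_deriv f x v)"
proof -
  from assms(1) obtain D where D: "\<And>x. x \<in> U \<Longrightarrow> (f has_derivative D x) (at x within U)"
    "\<And>v. v \<in> V \<Longrightarrow> C_on k V U (\<lambda>x. D x v)"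
    by (rule C_on_SucE) blast
  show ?thesis
    using D(2)[OF assms(4)] by (rule C_on_cong) (use dir_deriv_eq[OF assms(2,3) _ assms(4)] D(1) in metis)
qed

text \<open>The definition of \<open>C_on\<close> admits any derivative as a witness, and local
  witnesses need not fit together off \<open>V\<close>. The canonical witness built from
  \<open>dir_deriv\<close> and \<open>proj V\<close> depends on \<open>f\<close> alone, so it serves
  on all of \<open>U\<close>.\<close>

lemma C_on_local:
  fixes V :: "'a::dual_separating set"
  assumes "fin_dim_subspace V" "open_in V U"
    "\<And>x. x \<in> U \<Longrightarrow> \<exists>N. open_in V N \<and> x \<in> N \<and> N \<subseteq> U \<and> C_on k V N f"
  shows "C_on k V U f"
  using assms(3)
proof (induction k arbitrary: f)
  case 0
  have "continuous (at x within U) f" if x: "x \<in> U" for x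
  proof -
    obtain N where N: "open_in V N" "x \<in> N" "N \<subseteq> U" "continuous_on N f"
      using 0[OF x] by auto
    then show ?thesis
      using at_within_open_in[OF N(1,3) openin_imp_subset[OF assms(2)] N(2)]
      by (metis continuous_on_eq_continuous_within)
  qed
  then show ?case
    by (simp add: continuous_on_eq_continuous_within)
next
  case (Suc k)
  note V = fin_dim_subspaceD(1)[OF assms(1)]
  show ?case
  proof (rule C_on_SucI[where D = "\<lambda>x v. dir_deriv f x (proj V v)"])
    fix x assume x: "x \<in> U"
    obtain N where N: "open_in V N" "x \<in> N" "N \<subseteq> U" "C_on (Suc k) V N f"
      using Suc.prems[OF x] by auto
    then obtain D where "(f has_derivative D x) (at x within N)"
      by (metis C_on_SucE)
    then have "(f has_derivative D x) (at x within U)"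
      by (simp add: at_within_open_in[OF N(1,3) openin_imp_subset[OF assms(2)] N(2)])
    then show "(f has_derivative (\<lambda>v. dir_deriv f x (proj V v))) (at x within U)"
      by (rule has_derivative_dir_deriv[OF assms(1,2) x])
  next
    fix v assume v: "v \<in> V"
    have "C_on k V U (\<lambda>x. dir_deriv f x v)"
    proof (rule Suc.IH)
      fix x assume x: "x \<in> U"
      obtain N where N: "open_in V N" "x \<in> N" "N \<subseteq> U" "C_on (Suc k) V N f"
        using Suc.prems[OF x] by auto
      then show "\<exists>N. open_in V N \<and> x \<in> N \<and> N \<subseteq> U \<and> C_on k V N (\<lambda>x. dir_deriv f x v)"
        using C_on_dir_deriv[OF N(4) V N(1) v] by blast
    qed
    then show "C_on k V U (\<lambda>x. dir_deriv f x (proj V v))"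
      by (simp add: proj_id[OF assms(1) v])
  qed
qed

lemma C_on_const: "C_on k V U (\<lambda>_. c)"
proof (induction k arbitrary: c)
  case (Suc k)
  show ?case
    by (rule C_on_SucI[where D = "\<lambda>_ _. 0"]) (auto intro: Suc)
qed auto

lemma C_on_linear: "bounded_linear L \<Longrightarrow> C_on k V U L"
proof (cases k)
  case (Suc m)
  assume "bounded_linear L"
  then show ?thesis
    unfolding Suc
    by (intro C_on_SucI[where D = "\<lambda>_. L"] C_on_const bounded_linear_imp_has_derivative)
qed (auto intro: linear_continuous_on)

lemma C_on_bounded_linear:
  "bounded_linear L \<Longrightarrow> C_on k V U f \<Longrightarrow> C_on k V U (\<lambda>x. L (f x))"
proof (induction k arbitrary: f)
  case 0
  then show ?case
    by (auto intro: bounded_linear.continuous_on)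
next
  case (Suc k)
  from Suc.prems(2) obtain D where D: "\<And>x. x \<in> U \<Longrightarrow> (f has_derivative D x) (at x within U)"
    "\<And>v. v \<in> V \<Longrightarrow> C_on k V U (\<lambda>x. D x v)"
    by (rule C_on_SucE) blast
  show ?case
    by (rule C_on_SucI[where D = "\<lambda>x v. L (D x v)", OF bounded_linear.has_derivative[OF Suc.prems(1) D(1)]
          Suc.IH[OF Suc.prems(1) D(2)]])
qed

lemma C_on_add: "C_on k V U f \<Longrightarrow> C_on k V U g \<Longrightarrow> C_on k V U (\<lambda>x. f x + g x)"
proof (induction k arbitrary: f g)
  case 0
  then show ?case
    by (auto intro: continuous_on_add)
next
  case (Suc k)
  from Suc.prems(1) obtain D where D: "\<And>x. x \<in> U \<Longrightarrow> (f has_derivative D x) (at x within U)"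
    "\<And>v. v \<in> V \<Longrightarrow> C_on k V U (\<lambda>x. D x v)"
    by (rule C_on_SucE) blast
  from Suc.prems(2) obtain E where E: "\<And>x. x \<in> U \<Longrightarrow> (g has_derivative E x) (at x within U)"
    "\<And>v. v \<in> V \<Longrightarrow> C_on k V U (\<lambda>x. E x v)"
    by (rule C_on_SucE) blast
  show ?case
    by (rule C_on_SucI[where D = "\<lambda>x v. D x v + E x v", OF has_derivative_add[OF D(1) E(1)]
          Suc.IH[OF D(2) E(2)]])
qed

lemma C_on_bilinear:
  assumes "bounded_bilinear p"
  shows "C_on k V U f \<Longrightarrow> C_on k V U g \<Longrightarrow> C_on k V U (\<lambda>x. p (f x) (g x))"
proof (induction k arbitrary: f g)
  case 0
  then show ?case
    using bounded_bilinear.continuous_on[OF assms] by auto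
next
  case (Suc k)
  from Suc.prems(1) obtain D where D: "\<And>x. x \<in> U \<Longrightarrow> (f has_derivative D x) (at x within U)"
    "\<And>v. v \<in> V \<Longrightarrow> C_on k V U (\<lambda>x. D x v)"
    by (rule C_on_SucE) blast
  from Suc.prems(2) obtain E where E: "\<And>x. x \<in> U \<Longrightarrow> (g has_derivative E x) (at x within U)"
    "\<And>v. v \<in> V \<Longrightarrow> C_on k V U (\<lambda>x. E x v)"
    by (rule C_on_SucE) blast
  show ?case
  proof (rule C_on_SucI[where D = "\<lambda>x v. p (f x) (E x v) + p (D x v) (g x)"])
    show "((\<lambda>x. p (f x) (g x)) has_derivative (\<lambda>v. p (f x) (E x v) + p (D x v) (g x))) (at x within U)"
      if "x \<in> U" for x
      by (rule bounded_bilinear.FDERIV[OF assms D(1)[OF that] E(1)[OF that]])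
    show "C_on k V U (\<lambda>x. p (f x) (E x v) + p (D x v) (g x))" if "v \<in> V" for v
      using D(2)[OF that] E(2)[OF that] Suc.prems[THEN C_on_Suc_imp]
      by (intro C_on_add Suc.IH)
  qed
qed

lemma C_on_sum:
  "finite B \<Longrightarrow> (\<And>b. b \<in> B \<Longrightarrow> C_on k V U (f b)) \<Longrightarrow> C_on k V U (\<lambda>x. \<Sum>b\<in>B. f b x)"
  by (induction B rule: finite_induct) (auto intro: C_on_add C_on_const)

text \<open>\<open>C_on\<close> controls derivatives only in fixed directions, but the chain rule
  evaluates the derivative of \<open>g\<close> in the moving direction \<open>D x v\<close>. This
  direction lies in \<open>V'\<close>, and expanding it in coordinates there leaves a sum of
  products of functions of class \<open>k\<close>.\<close>

lemma C_on_comp: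
  fixes f :: "'a::real_normed_vector \<Rightarrow> 'b::dual_separating"
  assumes V: "subspace V" "open_in V U" and V': "fin_dim_subspace V'" "U' \<subseteq> V'" "f ` U \<subseteq> U'"
  shows "C_on k V U f \<Longrightarrow> C_on k V' U' g \<Longrightarrow> C_on k V U (\<lambda>x. g (f x))"
proof (induction k arbitrary: g)
  case 0
  then show ?case
    using continuous_on_compose2[of U' g U f] V' by auto
next
  case (Suc k)
  from Suc.prems(1) obtain D where D: "\<And>x. x \<in> U \<Longrightarrow> (f has_derivative D x) (at x within U)"
    "\<And>v. v \<in> V \<Longrightarrow> C_on k V U (\<lambda>x. D x v)"
    by (rule C_on_SucE) blast
  from Suc.prems(2) obtain E where E: "\<And>x. x \<in> U' \<Longrightarrow> (g has_derivative E x) (at x within U')"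
    "\<And>v. v \<in> V' \<Longrightarrow> C_on k V' U' (\<lambda>x. E x v)"
    by (rule C_on_SucE) blast
  show ?case
  proof (rule C_on_SucI[where D = "\<lambda>x v. E (f x) (D x v)"])
    show "((\<lambda>x. g (f x)) has_derivative (\<lambda>v. E (f x) (D x v))) (at x within U)" if x: "x \<in> U" for x
    proof -
      have "f x \<in> U'"
        using x V' by auto
      then show ?thesis
        using has_derivative_in_compose[OF D(1)[OF x] has_derivative_subset[OF E(1) V'(3)]] by simp
    qed
  next
    fix v assume v: "v \<in> V"
    have eq: "(\<Sum>b\<in>model_basis V'. coord V' b (D x v) *\<^sub>R E (f x) b) = E (f x) (D x v)" if x: "x \<in> U" for x
    proof -
      have "D x v \<in> V'"
        using V' by (intro has_derivative_in_subspace[OF V x v D(1)[OF x]]) auto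
      moreover have "linear_betw V' UNIV (E (f x))"
        using x V' by (intro linear_betw_bounded_linear has_derivative_bounded_linear[OF E(1)]) auto
      ultimately show ?thesis
        using linear_betw_coord_sum[OF _ V'(1)] by metis
    qed
    have "C_on k V U (\<lambda>x. coord V' b (D x v) *\<^sub>R E (f x) b)" if b: "b \<in> model_basis V'" for b
    proof -
      have "b \<in> V'"
        using b fin_dim_subspaceD(4)[OF V'(1)] by auto
      then show ?thesis
        using C_on_Suc_imp[OF Suc.prems(1)] E(2) D(2)[OF v]
        by (intro C_on_bilinear[OF bounded_bilinear_scaleR]
            C_on_bounded_linear[OF bounded_linear_coord[OF V'(1)]] Suc.IH)
    qed
    then have "C_on k V U (\<lambda>x. \<Sum>b\<in>model_basis V'. coord V' b (D x v) *\<^sub>R E (f x) b)"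
      by (intro C_on_sum fin_dim_subspaceD V')
    then show "C_on k V U (\<lambda>x. E (f x) (D x v))"
      by (rule C_on_cong) (fact eq)
  qed
qed

lemma smooth_on_cong: "smooth_on V U f \<Longrightarrow> (\<And>x. x \<in> U \<Longrightarrow> f x = g x) \<Longrightarrow> smooth_on V U g"
  unfolding smooth_on_def using C_on_cong by blast

lemma smooth_on_subset: "smooth_on V U f \<Longrightarrow> U' \<subseteq> U \<Longrightarrow> V' \<subseteq> V \<Longrightarrow> smooth_on V' U' f"
  unfolding smooth_on_def using C_on_subset by blast

lemma smooth_on_local:
  fixes V :: "'a::dual_separating set"
  assumes "fin_dim_subspace V" "open_in V U"
    "\<And>x. x \<in> U \<Longrightarrow> \<exists>N. open_in V N \<and> x \<in> N \<and> N \<subseteq> U \<and> smooth_on V N f"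
  shows "smooth_on V U f"
  unfolding smooth_on_def
proof (intro allI C_on_local[OF assms(1,2)])
  fix k x assume "x \<in> U"
  then show "\<exists>N. open_in V N \<and> x \<in> N \<and> N \<subseteq> U \<and> C_on k V N f"
    using assms(3)[of x] unfolding smooth_on_def by blast
qed

lemma smooth_on_imp_continuous_on: "smooth_on V U f \<Longrightarrow> continuous_on U f"
  unfolding smooth_on_def by (metis C_on.simps(1))

lemma smooth_on_const: "smooth_on V U (\<lambda>_. c)"
  by (simp add: smooth_on_def C_on_const)

lemma smooth_on_linear: "bounded_linear L \<Longrightarrow> smooth_on V U L"
  by (simp add: smooth_on_def C_on_linear)

lemma smooth_on_ident: "smooth_on V U (\<lambda>x. x)"
  by (intro smooth_on_linear bounded_linear_ident)

lemma smooth_on_bounded_linear: "bounded_linear L \<Longrightarrow> smooth_on V U f \<Longrightarrow> smooth_on V U (\<lambda>x. L (f x))"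
  by (simp add: smooth_on_def C_on_bounded_linear)

lemma smooth_on_add: "smooth_on V U f \<Longrightarrow> smooth_on V U g \<Longrightarrow> smooth_on V U (\<lambda>x. f x + g x)"
  by (simp add: smooth_on_def C_on_add)

lemma smooth_on_minus: "smooth_on V U f \<Longrightarrow> smooth_on V U (\<lambda>x. - f x)"
  by (rule smooth_on_bounded_linear[OF bounded_linear_minus[OF bounded_linear_ident]])

lemma smooth_on_diff: "smooth_on V U f \<Longrightarrow> smooth_on V U g \<Longrightarrow> smooth_on V U (\<lambda>x. f x - g x)"
  using smooth_on_add[OF _ smooth_on_minus, of V U f g] by simp

lemma smooth_on_scaleR: "smooth_on V U f \<Longrightarrow> smooth_on V U g \<Longrightarrow> smooth_on V U (\<lambda>x. f x *\<^sub>R g x)"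
  by (simp add: smooth_on_def C_on_bilinear[OF bounded_bilinear_scaleR])

lemma smooth_on_sum:
  "finite B \<Longrightarrow> (\<And>b. b \<in> B \<Longrightarrow> smooth_on V U (f b)) \<Longrightarrow> smooth_on V U (\<lambda>x. \<Sum>b\<in>B. f b x)"
  by (simp add: smooth_on_def C_on_sum)

lemma smooth_on_comp:
  fixes f :: "'a::real_normed_vector \<Rightarrow> 'b::dual_separating"
  assumes "subspace V" "open_in V U" "fin_dim_subspace V'" "U' \<subseteq> V'" "\<And>x. x \<in> U \<Longrightarrow> f x \<in> U'"
    "smooth_on V U f" "smooth_on V' U' g"
  shows "smooth_on V U (\<lambda>x. g (f x))"
  using C_on_comp[OF assms(1-4), of f _ g] assms(5-7) unfolding smooth_on_def by (metis image_subsetI)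

lemma smooth_on_Pair:
  assumes "smooth_on V U f" "smooth_on V U g"
  shows "smooth_on V U (\<lambda>x. (f x, g x))"
proof -
  have "bounded_linear (\<lambda>x. (x, 0))" "bounded_linear (\<lambda>x. (0, x))"
    by (auto intro!: bounded_linear_Pair bounded_linear_ident bounded_linear_zero)
  then have "smooth_on V U (\<lambda>x. (f x, 0) + (0, g x))"
    by (intro smooth_on_add smooth_on_bounded_linear[OF _ assms(1)] smooth_on_bounded_linear[OF _ assms(2)])
  then show ?thesis
    by simp
qed

lemma smooth_on_dir_deriv:
  assumes "smooth_on V U f" "subspace V" "open_in V U" "v \<in> V"
  shows "smooth_on V U (\<lambda>x. dir_deriv f x v)"
  using assms C_on_dir_deriv unfolding smooth_on_def by blast

lemma smooth_on_has_derivative: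
  fixes V :: "'a::dual_separating set"
  assumes "smooth_on V U f" "fin_dim_subspace V" "open_in V U" "x \<in> U"
  shows "(f has_derivative (\<lambda>v. dir_deriv f x (proj V v))) (at x within U)"
proof -
  have "C_on (Suc 0) V U f"
    using assms(1) by (simp only: smooth_on_def)
  then obtain D where "\<And>x. x \<in> U \<Longrightarrow> (f has_derivative D x) (at x within U)"
    by (rule C_on_SucE) blast
  then show ?thesis
    using has_derivative_dir_deriv[OF assms(2-4)] assms(4) by blast
qed

lemma linear_betw_dir_deriv:
  fixes f :: "'a::dual_separating \<Rightarrow> 'b::dual_separating"
  assumes "smooth_on V U f" "fin_dim_subspace V" "open_in V U" "x \<in> U" "fin_dim_subspace W" "f ` U \<subseteq> W"
  shows "linear_betw V W (dir_deriv f x)"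
proof -
  note V = fin_dim_subspaceD(1)[OF assms(2)]
  note D = smooth_on_has_derivative[OF assms(1-4)]
  have "linear_betw V W (\<lambda>v. dir_deriv f x (proj V v))"
    using has_derivative_in_subspace[OF V assms(3,4) _ D assms(5,6)]
    by (intro linear_betw_bounded_linear has_derivative_bounded_linear[OF D]) auto
  then show ?thesis
    by (rule linear_betw_cong[OF V, THEN iffD1, rotated]) (simp add: proj_id[OF assms(2)])
qed

lemma linear_betw_dir_deriv_UNIV:
  fixes f :: "'a::dual_separating \<Rightarrow> 'b::real_normed_vector"
  assumes "smooth_on V U f" "fin_dim_subspace V" "open_in V U" "x \<in> U"
  shows "linear_betw V UNIV (dir_deriv f x)"
proof -
  note D = smooth_on_has_derivative[OF assms(1-4)]
  have "linear_betw V UNIV (\<lambda>v. dir_deriv f x (proj V v))"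
    by (intro linear_betw_bounded_linear has_derivative_bounded_linear[OF D]) auto
  then show ?thesis
    by (rule linear_betw_cong[OF fin_dim_subspaceD(1)[OF assms(2)], THEN iffD1, rotated]) (simp add: proj_id[OF assms(2)])
qed

lemma dir_deriv_comp:
  fixes f :: "'a::dual_separating \<Rightarrow> 'b::dual_separating"
  assumes "smooth_on V U f" "fin_dim_subspace V" "open_in V U" "x \<in> U"
    "smooth_on W U' g" "fin_dim_subspace W" "open_in W U'" "\<And>y. y \<in> U \<Longrightarrow> f y \<in> U'" "v \<in> V"
  shows "dir_deriv (\<lambda>y. g (f y)) x v = dir_deriv g (f x) (dir_deriv f x v)"
proof -
  have fU: "f ` U \<subseteq> U'"
    using assms(8) by auto
  note D = smooth_on_has_derivative[OF assms(1-4)]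
  have "(g has_derivative (\<lambda>v. dir_deriv g (f x) (proj W v))) (at (f x) within f ` U)"
    by (rule has_derivative_subset[OF smooth_on_has_derivative[OF assms(5-7)] fU]) (use assms in auto)
  from has_derivative_in_compose[OF D this]
  have "dir_deriv (\<lambda>y. g (f y)) x v = dir_deriv g (f x) (proj W (dir_deriv f x (proj V v)))"
    by (rule dir_deriv_eq[OF fin_dim_subspaceD(1)[OF assms(2)] assms(3,4,9)])
  moreover have "dir_deriv f x v \<in> W"
    using linear_betw_in[OF linear_betw_dir_deriv[OF assms(1-4,6)] assms(9)] fU openin_imp_subset[OF assms(7)]
    by auto
  ultimately show ?thesis
    using assms(9) by (simp add: proj_id[OF assms(2)] proj_id[OF assms(6)])
qed

lemma dir_deriv_bounded_linear:
  assumes "bounded_linear L"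
  shows "dir_deriv L x v = L v"
proof -
  interpret bounded_linear L
    by fact
  show ?thesis
    using dir_deriv_eq[of UNIV UNIV x v L L] has_derivative[OF has_derivative_ident] by simp
qed

text \<open>Both the base point and the direction move; the expansion of \<open>w x\<close> in the
  basis of \<open>W\<close> reduces the claim to fixed directions.\<close>

lemma smooth_on_dir_deriv_comp:
  fixes a w :: "'a::dual_separating \<Rightarrow> 'b::dual_separating"
  assumes V: "fin_dim_subspace V" "open_in V U" and W: "fin_dim_subspace W" "open_in W U'"
    and f: "smooth_on W U' f" and a: "smooth_on V U a" "\<And>x. x \<in> U \<Longrightarrow> a x \<in> U'"
    and w: "smooth_on V U w" "\<And>x. x \<in> U \<Longrightarrow> w x \<in> W"
  shows "smooth_on V U (\<lambda>x. dir_deriv f (a x) (w x))"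
proof -
  note W' = fin_dim_subspaceD[OF W(1)]
  have "smooth_on V U (\<lambda>x. \<Sum>b\<in>model_basis W. coord W b (w x) *\<^sub>R dir_deriv f (a x) b)"
  proof (intro smooth_on_sum smooth_on_scaleR W')
    fix b assume "b \<in> model_basis W"
    then show "smooth_on V U (\<lambda>x. dir_deriv f (a x) b)"
      by (intro smooth_on_comp[OF fin_dim_subspaceD(1)[OF V(1)] V(2) W(1) openin_imp_subset[OF W(2)] a(2) a(1)]
          smooth_on_dir_deriv[OF f W'(1) W(2)]) (use W'(4) in auto)
    show "smooth_on V U (\<lambda>x. coord W b (w x))"
      by (rule smooth_on_bounded_linear[OF bounded_linear_coord[OF W(1)] w(1)])
  qed
  then show ?thesis
  proof (rule smooth_on_cong)
    fix x assume x: "x \<in> U"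
    show "(\<Sum>b\<in>model_basis W. coord W b (w x) *\<^sub>R dir_deriv f (a x) b) = dir_deriv f (a x) (w x)"
      using linear_betw_coord_sum[OF linear_betw_dir_deriv_UNIV[OF f W a(2)[OF x]] W(1) w(2)[OF x]] by simp
  qed
qed

section \<open>Relatively open sets and operator bounds\<close>

lemma open_in_Times: "open_in V U \<Longrightarrow> open_in W U' \<Longrightarrow> open_in (V \<times> W) (U \<times> U')"
proof -
  assume "open_in V U" "open_in W U'"
  then obtain S T where "open S" "U = V \<inter> S" "open T" "U' = W \<inter> T"
    by (auto simp: openin_open)
  then show ?thesis
    using open_Times[of S T] by (auto simp: openin_open intro!: exI[of _ "S \<times> T"])
qed

lemma open_in_preimage:
  assumes "continuous_on U f" "open_in V U" "\<And>x. x \<in> U \<Longrightarrow> f x \<in> W" "open_in W T"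
  shows "open_in V {x \<in> U. f x \<in> T}"
proof -
  have "{x \<in> U. f x \<in> T} = U \<inter> f -` T"
    by auto
  moreover have "open_in U (U \<inter> f -` T)"
    using assms by (intro continuous_openin_preimage[of U f W T]) auto
  ultimately show ?thesis
    using assms(2) openin_trans by metis
qed

lemma open_in_ball:
  assumes "open_in V U" "x \<in> U"
  obtains r where "r > 0" "cball x r \<inter> V \<subseteq> U"
proof -
  obtain S where S: "open S" "U = V \<inter> S"
    using assms(1) by (auto simp: openin_open)
  then obtain r where "r > 0" "cball x r \<subseteq> S"
    using assms(2) open_contains_cball[of S] by auto
  then show ?thesis
    using that S by auto
qed

text \<open>The constant is explicit in the values of \<open>f\<close> on the basis. For a family of
  linear maps it is therefore a continuous function of the parameter as soon as these values
  are.\<close>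

lemma norm_linear_betw_proj_le:
  fixes V :: "'a::dual_separating set"
  assumes "linear_betw V W f" "fin_dim_subspace V"
  shows "norm (f (proj V v)) \<le> (\<Sum>b\<in>model_basis V. onorm (coord V b) * norm (f b)) * norm v"
proof -
  have "norm (f (proj V v)) \<le> (\<Sum>b\<in>model_basis V. norm (coord V b v *\<^sub>R f b))"
    unfolding linear_betw_proj_sum[OF assms] by (rule norm_sum)
  also have "\<dots> \<le> (\<Sum>b\<in>model_basis V. onorm (coord V b) * norm (f b) * norm v)"
  proof (rule sum_mono)
    fix b
    have "\<bar>coord V b v\<bar> \<le> onorm (coord V b) * norm v"
      using onorm[OF bounded_linear_coord[OF assms(2)], of b v] by simp
    then have "\<bar>coord V b v\<bar> * norm (f b) \<le> onorm (coord V b) * norm v * norm (f b)"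
      by (intro mult_right_mono) auto
    then show "norm (coord V b v *\<^sub>R f b) \<le> onorm (coord V b) * norm (f b) * norm v"
      by (simp add: mult_ac)
  qed
  finally show ?thesis
    by (simp add: sum_distrib_right)
qed

lemma norm_linear_betw_le:
  fixes V :: "'a::dual_separating set"
  assumes "linear_betw V W f" "fin_dim_subspace V" "v \<in> V"
  shows "norm (f v) \<le> (\<Sum>b\<in>model_basis V. onorm (coord V b) * norm (f b)) * norm v"
  using norm_linear_betw_proj_le[OF assms(1,2), of v] by (simp only: proj_id[OF assms(2,3)])

section \<open>Smooth families of invertible linear maps\<close>

text \<open>A lower bound \<open>norm z \<le> K * norm (M y0 z)\<close> survives with
  \<open>2 * K\<close> under a small perturbation of the operator. It is applied to the difference
  of \<open>N y w\<close> and \<open>N y0 w\<close>, whose image under \<open>M y\<close> is small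
  by continuity of \<open>M\<close>.\<close>

lemma tendsto_inverse_family:
  fixes W :: "'b::dual_separating set"
  assumes W: "fin_dim_subspace W" and y0: "y0 \<in> U"
    and M: "\<And>y. y \<in> U \<Longrightarrow> linear_betw W W (M y)"
    and N: "\<And>y. y \<in> U \<Longrightarrow> linear_betw W W (N y)"
    and NM: "\<And>y w. y \<in> U \<Longrightarrow> w \<in> W \<Longrightarrow> N y (M y w) = w"
    and MN: "\<And>y w. y \<in> U \<Longrightarrow> w \<in> W \<Longrightarrow> M y (N y w) = w"
    and cont: "\<And>w. w \<in> W \<Longrightarrow> ((\<lambda>y. M y w) \<longlongrightarrow> M y0 w) (at y0 within U)"
    and w: "w \<in> W"
  shows "((\<lambda>y. N y w) \<longlongrightarrow> N y0 w) (at y0 within U)"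
proof -
  note W' = fin_dim_subspaceD[OF W]
  \<comment> \<open>The summand 1 makes \<open>K\<close> positive even if the sum is zero.\<close>
  define K where "K = (\<Sum>b\<in>model_basis W. onorm (coord W b) * norm (N y0 b)) + 1"
  have "0 \<le> onorm (coord W b)" for b
    by (rule onorm_pos_le[OF bounded_linear_coord[OF W]])
  then have "K > 0"
    unfolding K_def by (intro add_nonneg_pos sum_nonneg) auto
  have K: "norm z \<le> K * norm (M y0 z)" if "z \<in> W" for z
  proof -
    have "M y0 z \<in> W"
      using that M[OF y0] by (rule linear_betw_in[rotated])
    then have "norm (N y0 (M y0 z)) \<le> (K - 1) * norm (M y0 z)"
      unfolding K_def using norm_linear_betw_le[OF N[OF y0] W] by simp
    moreover have "(K - 1) * norm (M y0 z) \<le> K * norm (M y0 z)"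
      by (intro mult_right_mono) auto
    ultimately show ?thesis
      using NM[OF y0 that] by simp
  qed
  \<comment> \<open>This bounds the operator norm on \<open>W\<close> of the difference of
    \<open>M y\<close> and \<open>M y0\<close>.\<close>
  define \<epsilon> where "\<epsilon> y = (\<Sum>b\<in>model_basis W. onorm (coord W b) * norm (M y b - M y0 b))" for y
  have "((\<lambda>y. M y b - M y0 b) \<longlongrightarrow> 0) (at y0 within U)" if "b \<in> model_basis W" for b
    using cont[of b] that W'(4) LIM_zero by blast
  then have "(\<epsilon> \<longlongrightarrow> (\<Sum>b\<in>model_basis W. onorm (coord W b) * 0)) (at y0 within U)"
    unfolding \<epsilon>_def by (intro tendsto_sum tendsto_mult tendsto_const tendsto_norm_zero)
  then have "(\<epsilon> \<longlongrightarrow> 0) (at y0 within U)"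
    by simp
  \<comment> \<open>With this threshold the perturbation costs at most half of the lower bound at
    \<open>y0\<close>.\<close>
  then have "\<forall>\<^sub>F y in at y0 within U. \<epsilon> y < 1 / (2 * K)"
    using \<open>K > 0\<close> by (intro order_tendstoD(2)) auto
  moreover have "\<forall>\<^sub>F y in at y0 within U. y \<in> U"
    by (simp add: eventually_at_filter)
  ultimately have ev: "\<forall>\<^sub>F y in at y0 within U. norm (N y w - N y0 w) \<le> 2 * K * norm (M y (N y0 w) - M y0 (N y0 w))"
  proof eventually_elim
    case (elim y)
    have le: "norm z \<le> 2 * K * norm (M y z)" if z: "z \<in> W" for z
    proof -
      have "linear_betw W W (\<lambda>z. M y z - M y0 z)"
        using M[OF elim(2)] M[OF y0] W'(1)
        by (auto simp: linear_betw_def subspace_diff image_subset_iff algebra_simps)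
      then have "norm (M y z - M y0 z) \<le> \<epsilon> y * norm z"
        unfolding \<epsilon>_def by (rule norm_linear_betw_le[OF _ W z])
      also have "\<dots> \<le> 1 / (2 * K) * norm z"
        using elim by (intro mult_right_mono) auto
      finally have "K * norm (M y z - M y0 z) \<le> norm z / 2"
        using \<open>K > 0\<close> by (simp add: field_simps)
      moreover have "norm (M y0 z) \<le> norm (M y z) + norm (M y z - M y0 z)"
        using norm_triangle_ineq4[of "M y z" "M y z - M y0 z"] by simp
      then have "K * norm (M y0 z) \<le> K * norm (M y z) + K * norm (M y z - M y0 z)"
        using \<open>K > 0\<close> by (metis distrib_left less_imp_le mult_left_mono)
      ultimately show ?thesis
        using K[OF z] by simp
    qed
    have N0: "N y0 w \<in> W" "N y w \<in> W"
      using N[OF y0] N[OF elim(2)] w by (auto intro: linear_betw_in)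
    have "M y (N y w - N y0 w) = M y0 (N y0 w) - M y (N y0 w)"
      using linear_betw_diff[OF M[OF elim(2)] W'(1) N0(2,1)] MN[OF elim(2) w] MN[OF y0 w] by simp
    then show ?case
      using le[OF subspace_diff[OF W'(1) N0(2,1)]] by (simp add: norm_minus_commute)
  qed
  have "((\<lambda>y. M y (N y0 w)) \<longlongrightarrow> M y0 (N y0 w)) (at y0 within U)"
    by (rule cont[OF linear_betw_in[OF N[OF y0] w]])
  then have "((\<lambda>y. 2 * K * norm (M y (N y0 w) - M y0 (N y0 w))) \<longlongrightarrow> 2 * K * 0) (at y0 within U)"
    by (rule tendsto_mult[OF tendsto_const tendsto_norm_zero[OF LIM_zero]])
  then have "((\<lambda>y. 2 * K * norm (M y (N y0 w) - M y0 (N y0 w))) \<longlongrightarrow> 0) (at y0 within U)"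
    by (simp only: mult_zero_right)
  then have "((\<lambda>y. N y w - N y0 w) \<longlongrightarrow> 0) (at y0 within U)"
    by (rule Lim_null_comparison[OF ev])
  then show ?thesis
    by (rule LIM_zero_cancel)
qed

text \<open>Product rule with a merely continuous second factor: because \<open>f\<close> vanishes
  at \<open>x\<close>, a derivative of \<open>g\<close> would be multiplied by zero. This breaks the
  circle in differentiating an inverse family, where \<open>g\<close> is the inverse itself.\<close>

lemma has_derivative_scaleR_vanishing:
  fixes f :: "'a::real_normed_vector \<Rightarrow> real"
  assumes "(f has_derivative f') (at x within U)" "f x = 0" "(g \<longlongrightarrow> g x) (at x within U)"
  shows "((\<lambda>y. f y *\<^sub>R g y) has_derivative (\<lambda>v. f' v *\<^sub>R g x)) (at x within U)"
proof -
  have bl: "bounded_linear f'"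
    by (rule has_derivative_bounded_linear[OF assms(1)])
  define e where "e y = (f y - f x - f' (y - x)) /\<^sub>R norm (y - x)" for y
  have e: "(e \<longlongrightarrow> 0) (at x within U)"
    using assms(1) unfolding has_derivative_at_within e_def by simp
  obtain B where B: "\<And>v. norm (f' v) \<le> norm v * B" "B > 0"
    using bounded_linear.pos_bounded[OF bl] by blast
  have "((\<lambda>y. e y *\<^sub>R g y) \<longlongrightarrow> 0 *\<^sub>R g x) (at x within U)"
    by (intro tendsto_scaleR e assms)
  moreover have "((\<lambda>y. (f' (y - x) / norm (y - x)) *\<^sub>R (g y - g x)) \<longlongrightarrow> 0) (at x within U)"
  proof (rule Lim_null_comparison)
    have le: "\<bar>f' v\<bar> / norm v \<le> B" for v
      using B(1)[of v] B(2) by (cases "v = 0") (auto simp: field_simps)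
    have "norm ((f' (y - x) / norm (y - x)) *\<^sub>R (g y - g x)) \<le> B * norm (g y - g x)" for y
      using mult_right_mono[OF le[of "y - x"], of "norm (g y - g x)"] by simp
    then show "\<forall>\<^sub>F y in at x within U. norm ((f' (y - x) / norm (y - x)) *\<^sub>R (g y - g x)) \<le> B * norm (g y - g x)"
      by simp
    have "((\<lambda>y. B * norm (g y - g x)) \<longlongrightarrow> B * 0) (at x within U)"
      by (intro tendsto_mult tendsto_const tendsto_norm_zero LIM_zero assms)
    then show "((\<lambda>y. B * norm (g y - g x)) \<longlongrightarrow> 0) (at x within U)"
      by simp
  qed
  ultimately have "((\<lambda>y. e y *\<^sub>R g y + (f' (y - x) / norm (y - x)) *\<^sub>R (g y - g x)) \<longlongrightarrow> 0 *\<^sub>R g x + 0) (at x within U)"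
    by (rule tendsto_add)
  moreover have "e y *\<^sub>R g y + (f' (y - x) / norm (y - x)) *\<^sub>R (g y - g x) =
      (f y *\<^sub>R g y - f x *\<^sub>R g x - f' (y - x) *\<^sub>R g x) /\<^sub>R norm (y - x)" for y
    using assms(2) by (simp add: e_def divide_inverse algebra_simps)
  ultimately show ?thesis
    unfolding has_derivative_at_within using bounded_linear_scaleR_left[THEN bounded_linear_compose, OF bl] by simp
qed

text \<open>The derivative of an inverse is minus the product of \<open>N\<close>, the derivative of
  \<open>M\<close>, and \<open>N\<close>. As it involves only \<open>N\<close> and derivatives of
  \<open>M\<close>, each order of smoothness of \<open>N\<close> yields the next.\<close>

lemma smooth_on_inverse_family:
  fixes V :: "'a::dual_separating set" and W :: "'b::dual_separating set"
  assumes V: "fin_dim_subspace V" "open_in V U" and W: "fin_dim_subspace W"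
    and M: "\<And>y. y \<in> U \<Longrightarrow> linear_betw W W (M y)"
    and N: "\<And>y. y \<in> U \<Longrightarrow> linear_betw W W (N y)"
    and NM: "\<And>y w. y \<in> U \<Longrightarrow> w \<in> W \<Longrightarrow> N y (M y w) = w"
    and MN: "\<And>y w. y \<in> U \<Longrightarrow> w \<in> W \<Longrightarrow> M y (N y w) = w"
    and smooth: "\<And>w. w \<in> W \<Longrightarrow> smooth_on V U (\<lambda>y. M y w)"
    and w: "w \<in> W"
  shows "smooth_on V U (\<lambda>y. N y w)"
proof -
  note V' = fin_dim_subspaceD[OF V(1)]
  note W' = fin_dim_subspaceD[OF W]
  have Nlim: "((\<lambda>y. N y w) \<longlongrightarrow> N y0 w) (at y0 within U)" if "w \<in> W" "y0 \<in> U" for w y0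
    using smooth_on_imp_continuous_on[OF smooth] that
    by (intro tendsto_inverse_family[OF W that(2) M N NM MN _ that(1)]) (auto simp: continuous_on_def)
  \<comment> \<open>The formula for the derivative in coordinates: the inner sum differentiates
    \<open>M\<close> at the fixed vector \<open>N y w\<close>, the outer sum applies
    \<open>N y\<close> to the result.\<close>
  define D where "D y w v = - (\<Sum>b\<in>model_basis W. coord W b
      (\<Sum>b'\<in>model_basis W. coord W b' (N y w) *\<^sub>R dir_deriv (\<lambda>y. M y b') y (proj V v)) *\<^sub>R N y b)" for y w v
  have deriv: "((\<lambda>y. N y w) has_derivative D y0 w) (at y0 within U)" if w: "w \<in> W" and y0: "y0 \<in> U" for w y0
  proof -
    txt \<open>Here \<open>N y w - N y0 w = - N y (q y - q y0)\<close>, where \<open>q y = M y (N y0 w)\<close>.\<close>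
    let ?z = "N y0 w"
    define q where "q y = M y ?z" for y
    define Dq where "Dq v = (\<Sum>b'\<in>model_basis W. coord W b' ?z *\<^sub>R dir_deriv (\<lambda>y. M y b') y0 (proj V v))" for v
    have zW: "?z \<in> W"
      by (rule linear_betw_in[OF N[OF y0] w])
    have "((\<lambda>y. \<Sum>b'\<in>model_basis W. coord W b' ?z *\<^sub>R M y b') has_derivative Dq) (at y0 within U)"
      unfolding Dq_def
    proof (intro has_derivative_sum has_derivative_scaleR_right smooth_on_has_derivative V y0 smooth)
      show "b' \<in> W" if "b' \<in> model_basis W" for b'
        using that W'(4) by auto
    qed
    then have q: "(q has_derivative Dq) (at y0 within U)"
      by (rule has_derivative_transform[OF y0, rotated]) (simp add: q_def linear_betw_coord_sum[OF M W zW])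
    have "q y0 = w"
      using MN[OF y0 w] by (simp add: q_def)
    have "((\<lambda>y. N y0 w - (\<Sum>b\<in>model_basis W. coord W b (q y - w) *\<^sub>R N y b)) has_derivative
        (\<lambda>v. 0 - (\<Sum>b\<in>model_basis W. coord W b (Dq v - 0) *\<^sub>R N y0 b))) (at y0 within U)"
    proof (intro has_derivative_diff has_derivative_sum has_derivative_const has_derivative_scaleR_vanishing)
      fix b assume "b \<in> model_basis W"
      then have "b \<in> W"
        using W'(4) by auto
      show "((\<lambda>y. coord W b (q y - w)) has_derivative (\<lambda>v. coord W b (Dq v - 0))) (at y0 within U)"
        by (intro bounded_linear.has_derivative[OF bounded_linear_coord[OF W]] has_derivative_diff q has_derivative_const)
      show "coord W b (q y0 - w) = 0"
        using \<open>q y0 = w\<close> bounded_linear.linear[OF bounded_linear_coord[OF W]] by (simp add: linear_0)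
      show "((\<lambda>y. N y b) \<longlongrightarrow> N y0 b) (at y0 within U)"
        by (rule Nlim[OF \<open>b \<in> W\<close> y0])
    qed
    then have "((\<lambda>y. N y0 w - (\<Sum>b\<in>model_basis W. coord W b (q y - w) *\<^sub>R N y b)) has_derivative D y0 w) (at y0 within U)"
      by (simp add: D_def[abs_def] Dq_def)
    then show ?thesis
    proof (rule has_derivative_transform[OF y0, rotated])
      fix y assume y: "y \<in> U"
      have qW: "q y \<in> W"
        unfolding q_def by (rule linear_betw_in[OF M[OF y] zW])
      have "(\<Sum>b\<in>model_basis W. coord W b (q y - w) *\<^sub>R N y b) = N y (q y - w)"
        by (rule linear_betw_coord_sum[OF N[OF y] W subspace_diff[OF W'(1) qW w], symmetric])
      also have "\<dots> = N y0 w - N y w"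
        using linear_betw_diff[OF N[OF y] W'(1) qW w] NM[OF y zW] by (simp add: q_def)
      finally show "N y w = N y0 w - (\<Sum>b\<in>model_basis W. coord W b (q y - w) *\<^sub>R N y b)"
        by simp
    qed
  qed
  have "C_on k V U (\<lambda>y. N y w)" if "w \<in> W" for k w
    using that
  proof (induction k arbitrary: w)
    case 0
    then show ?case
      by (simp add: continuous_on_def Nlim)
  next
    case (Suc k)
    show ?case
    proof (rule C_on_SucI[where D = "\<lambda>y. D y w", OF deriv[OF Suc.prems]])
      fix v assume v: "v \<in> V"
      have sm: "C_on k V U (\<lambda>y. dir_deriv (\<lambda>y. M y b') y (proj V v))" if "b' \<in> model_basis W" for b'
        using smooth_on_dir_deriv[OF smooth V'(1) V(2) proj_in[OF V(1)]] that W'(4) by (auto simp: smooth_on_def)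
      have "C_on k V U (\<lambda>y. - (\<Sum>b\<in>model_basis W. coord W b
        (\<Sum>b'\<in>model_basis W. coord W b' (N y w) *\<^sub>R dir_deriv (\<lambda>y. M y b') y (proj V v)) *\<^sub>R N y b))"
        by (rule C_on_bounded_linear[OF bounded_linear_minus[OF bounded_linear_ident]],
          intro C_on_sum W' C_on_bilinear[OF bounded_bilinear_scaleR] sm
              C_on_bounded_linear[OF bounded_linear_coord[OF W]] Suc.IH Suc.prems)
           (use W'(4) in auto)
      then show "C_on k V U (\<lambda>y. D y w v)"
        by (simp add: D_def)
    qed
  qed
  then show ?thesis
    using w by (simp add: smooth_on_def)
qed

text \<open>A vector outside the image could be adjoined to the images of the basis, which would
  give more independent vectors than the basis of \<open>V\<close> allows.\<close>

lemma linear_betw_inj_surj: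
  fixes f :: "'a::dual_separating \<Rightarrow> 'a"
  assumes f: "linear_betw V V f" and V: "fin_dim_subspace V" and inj: "inj_on f V"
  shows "f ` V = V"
proof (rule ccontr)
  assume ne: "f ` V \<noteq> V"
  note D = fin_dim_subspaceD[OF V]
  have lin: "linear (\<lambda>x. f (proj V x))"
    by (rule bounded_linear.linear[OF bounded_linear_proj_comp[OF f V]])
  have im: "(\<lambda>x. f (proj V x)) ` S = f ` S" if "S \<subseteq> V" for S
    using that proj_id[OF V] by (intro image_cong) auto
  have "inj_on (\<lambda>x. f (proj V x)) (span (model_basis V))"
    using inj proj_id[OF V] D(5) by (auto simp: inj_on_def)
  then have ind: "independent (f ` model_basis V)"
    using linear_independent_injective_image[OF lin D(3)] im[OF D(4)] by simp
  have sp: "span (f ` model_basis V) = f ` V"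
    using linear_span_image[OF lin, of "model_basis V"] im[OF D(4)] im[of V] D(5) by simp
  obtain v where v: "v \<in> V" "v \<notin> f ` V"
    using ne f by (auto simp: linear_betw_def)
  then have "independent (insert v (f ` model_basis V))"
    using ind sp independent_insertI by metis
  moreover have "insert v (f ` model_basis V) \<subseteq> span (model_basis V)"
    using v linear_betw_in[OF f] D(4,5) by auto
  ultimately have "card (insert v (f ` model_basis V)) \<le> card (model_basis V)"
    using independent_span_bound[OF D(2)] by blast
  moreover have "v \<notin> f ` model_basis V"
    using v D(4) by auto
  moreover have "card (f ` model_basis V) = card (model_basis V)"
    by (rule card_image) (rule inj_on_subset[OF inj D(4)])
  ultimately show False
    using D(2) by simp
qed

section \<open>The inverse function theorem\<close>

text \<open>Normalised by the inverse of its derivative at \<open>x0\<close>, the map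
  \<open>f\<close> is the identity up to \<open>h\<close>, a contraction with factor 1/2 near
  \<open>x0\<close>. This gives a Lipschitz inverse at once and an open image by fixed points. The
  inverse is smooth because its derivative is the inverse family of the derivatives of
  \<open>f\<close>, evaluated along the inverse itself.\<close>

lemma smooth_inverse_function:
  fixes f :: "'a::dual_separating \<Rightarrow> 'a"
  assumes V: "fin_dim_subspace V" and U: "open_in V U" and x0: "x0 \<in> U"
    and f: "smooth_on V U f" "f ` U \<subseteq> V" and surj: "dir_deriv f x0 ` V = V"
  obtains U0 g where "open_in V U0" "x0 \<in> U0" "U0 \<subseteq> U" "inj_on f U0" "open_in V (f ` U0)"
    "smooth_on V (f ` U0) g" "\<And>x. x \<in> U0 \<Longrightarrow> g (f x) = x" "\<And>x. x \<in> U0 \<Longrightarrow> dir_deriv f x ` V = V"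
proof -
  note V' = fin_dim_subspaceD[OF V]
  note UV = openin_imp_subset[OF U]
  note linD = linear_betw_dir_deriv[OF f(1) V U _ V f(2)]
  have A: "inj_on (dir_deriv f x0) V"
    by (rule linear_betw_surj_inj[OF linD[OF x0] V surj])
  define T where "T = inv_into V (dir_deriv f x0)"
  have T: "linear_betw V V T"
    unfolding T_def by (rule linear_betw_inv_into[OF linD[OF x0] V'(1) A surj])
  have TA: "T (dir_deriv f x0 v) = v" if "v \<in> V" for v
    unfolding T_def by (rule inv_into_f_f[OF A that])
  have AT: "dir_deriv f x0 (T v) = v" if "v \<in> V" for v
    unfolding T_def by (rule f_inv_into_f) (use surj that in simp)
  define T' where "T' = (\<lambda>x. T (proj V x))"
  have T': "bounded_linear T'"
    unfolding T'_def by (rule bounded_linear_proj_comp[OF T V])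
  have T'V: "T' v = T v" if "v \<in> V" for v
    by (simp add: T'_def proj_id[OF V that])
  have T'in: "T' v \<in> V" for v
    unfolding T'_def by (rule linear_betw_in[OF T proj_in[OF V]])
  have T'inj: "u = v" if "u \<in> V" "v \<in> V" "T' u = T' v" for u v
    using that by (metis AT T'V)
  \<comment> \<open>A fixed point of the map that sends \<open>x\<close> to \<open>y + h x\<close>
    is a solution of \<open>T' (f x) = y\<close>.\<close>
  define h where "h x = x - T' (f x)" for x
  have h: "smooth_on V U h"
    unfolding h_def by (intro smooth_on_diff smooth_on_ident smooth_on_bounded_linear[OF T' f(1)])
  have hV: "h ` U \<subseteq> V"
    using UV T'in V'(1) by (auto simp: h_def intro!: subspace_diff)
  note linh = linear_betw_dir_deriv[OF h V U _ V hV]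
  have Dh: "dir_deriv h x v = v - T' (dir_deriv f x v)" if "x \<in> U" "v \<in> V" for x v
  proof -
    have "(h has_derivative (\<lambda>v. v - T' (dir_deriv f x (proj V v)))) (at x within U)"
      unfolding h_def
      by (intro has_derivative_diff has_derivative_ident bounded_linear.has_derivative[OF T']
          smooth_on_has_derivative f V U that)
    from dir_deriv_eq[OF V'(1) U that this] show ?thesis
      by (simp add: proj_id[OF V that(2)])
  qed
  \<comment> \<open>A continuous bound for the operator norm of the derivative of \<open>h\<close>,
    zero at \<open>x0\<close>.\<close>
  define \<delta> where "\<delta> x = (\<Sum>b\<in>model_basis V. onorm (coord V b) * norm (dir_deriv h x b))" for x
  have "continuous_on U \<delta>"
    unfolding \<delta>_def
    by (intro continuous_intros smooth_on_imp_continuous_on[OF smooth_on_dir_deriv[OF h V'(1) U]])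
       (use V'(4) in auto)
  then have "open_in V {x \<in> U. \<delta> x \<in> {..<1/2}}"
    by (rule open_in_preimage[where W = UNIV]) (use U in auto)
  moreover have "\<delta> x0 = 0"
    unfolding \<delta>_def
  proof (intro sum.neutral ballI)
    fix b assume "b \<in> model_basis V"
    then have "b \<in> V"
      using V'(4) by auto
    then have "dir_deriv f x0 b \<in> V" "T (dir_deriv f x0 b) = b"
      using linear_betw_in[OF linD[OF x0]] TA by auto
    then show "onorm (coord V b) * norm (dir_deriv h x0 b) = 0"
      by (simp add: Dh[OF x0 \<open>b \<in> V\<close>] T'V)
  qed
  ultimately obtain r where r: "r > 0" "cball x0 r \<inter> V \<subseteq> {x \<in> U. \<delta> x \<in> {..<1/2}}"
    using x0 open_in_ball[of V "{x \<in> U. \<delta> x \<in> {..<1/2}}" x0] by auto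
  define S where "S = cball x0 r \<inter> V"
  have SU: "S \<subseteq> U"
    using r(2) by (auto simp: S_def)
  have Dh_le: "norm (dir_deriv h x (proj V v)) \<le> 1/2 * norm v" if "x \<in> S" for x v
  proof -
    have "norm (dir_deriv h x (proj V v)) \<le> \<delta> x * norm v"
      unfolding \<delta>_def by (rule norm_linear_betw_proj_le[OF linh V]) (use that SU in auto)
    also have "\<dots> \<le> 1/2 * norm v"
      using that r(2) by (intro mult_right_mono) (auto simp: S_def)
    finally show ?thesis .
  qed
  have lip: "norm (h x - h y) \<le> 1/2 * norm (x - y)" if "x \<in> S" "y \<in> S" for x y
  proof (rule differentiable_bound[of S h "\<lambda>x v. dir_deriv h x (proj V v)"])
    show "convex S"
      unfolding S_def by (intro convex_Int convex_cball subspace_imp_convex V')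
    show "(h has_derivative (\<lambda>v. dir_deriv h x (proj V v))) (at x within S)" if "x \<in> S" for x
      by (rule has_derivative_subset[OF smooth_on_has_derivative[OF h V U] SU]) (use that SU in auto)
    show "onorm (\<lambda>v. dir_deriv h x (proj V v)) \<le> 1/2" if "x \<in> S" for x
      using Dh_le[OF that] by (intro onorm_bound) auto
  qed (use that in auto)
  \<comment> \<open>This yields injectivity of \<open>f\<close> and, later, the Lipschitz bound for
    its inverse.\<close>
  have lower: "norm (x - y) \<le> 2 * norm (T' (f x) - T' (f y))" if "x \<in> S" "y \<in> S" for x y
  proof -
    have "norm (x - y) \<le> norm (h x - h y) + norm (T' (f x) - T' (f y))"
      using norm_triangle_ineq[of "h x - h y" "T' (f x) - T' (f y)"] by (simp add: h_def algebra_simps)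
    then show ?thesis
      using lip[OF that] by simp
  qed
  define U0 where "U0 = ball x0 r \<inter> V"
  have U0S: "U0 \<subseteq> S"
    by (auto simp: U0_def S_def)
  have U0U: "U0 \<subseteq> U"
    using U0S SU by auto
  have U0: "open_in V U0"
    unfolding U0_def by (metis inf_commute open_ball openin_open_Int)
  have surj_T': "\<exists>s>0. \<forall>y\<in>V. dist y (T' (f x1)) < s \<longrightarrow> y \<in> (\<lambda>x. T' (f x)) ` U0" if x1: "x1 \<in> U0" for x1
  proof -
    obtain s where s: "s > 0" "cball x1 s \<subseteq> ball x0 r"
      using x1 open_contains_cball_eq[OF open_ball] unfolding U0_def by blast
    define C where "C = cball x1 s \<inter> V"
    have CU0: "C \<subseteq> U0"
      using s by (auto simp: C_def U0_def)
    \<comment> \<open>The target may move by \<open>s / 2\<close>, and the contraction adds at most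
      \<open>s / 2\<close>, so the closed ball of radius \<open>s\<close> around \<open>x1\<close>
      is mapped to itself.\<close>
    have "y \<in> (\<lambda>x. T' (f x)) ` U0" if y: "y \<in> V" "dist y (T' (f x1)) < s / 2" for y
    proof -
      have "\<exists>!x\<in>C. y + h x = x"
      proof (rule Banach_fix[where c = "1/2"])
        have "closed C"
          unfolding C_def by (intro closed_Int closed_cball fin_dim_subspace_closed V)
        then show "complete C"
          unfolding C_def by (metis closed_cball complete_Int_closed fin_dim_subspace_complete[OF V] inf_commute)
        have "x1 \<in> C"
          using s x1 by (auto simp: C_def U0_def)
        then show "C \<noteq> {}"
          by blast
        show "(\<lambda>x. y + h x) ` C \<subseteq> C"
        proof (rule image_subsetI)
          fix x assume x: "x \<in> C"
          have "norm (y + h x - x1) \<le> norm (y - T' (f x1)) + norm (h x - h x1)"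
            using norm_triangle_ineq[of "y - T' (f x1)" "h x - h x1"] by (simp add: h_def algebra_simps)
          also have "norm (h x - h x1) \<le> 1/2 * norm (x - x1)"
            using x x1 CU0 U0S by (intro lip) auto
          also have "norm (x - x1) \<le> s"
            using x by (simp add: C_def dist_norm norm_minus_commute)
          finally have "norm (y + h x - x1) \<le> s"
            using y(2) by (simp add: dist_norm)
          moreover have "y + h x \<in> V"
            using y(1) hV x CU0 U0U V'(1) by (auto intro!: subspace_add)
          ultimately show "y + h x \<in> C"
            by (simp add: C_def dist_norm norm_minus_commute)
        qed
        show "dist (y + h x) (y + h z) \<le> 1/2 * dist x z" if "x \<in> C" "z \<in> C" for x z
          using lip[of x z] that CU0 U0S by (auto simp: dist_norm)
      qed auto
      then obtain x where "x \<in> C" "y + h x = x"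
        by auto
      then have "y = T' (f x)"
        unfolding h_def by (simp add: algebra_simps)
      then show ?thesis
        using \<open>x \<in> C\<close> CU0 by blast
    qed
    then show ?thesis
      using s by (intro exI[of _ "s / 2"]) auto
  qed
  \<comment> \<open>Openness is first obtained for the image of \<open>T'\<close> after
    \<open>f\<close>. Since \<open>T'\<close> is continuous, and injective on \<open>V\<close>, the
    preimage of this set in \<open>V\<close> is open and equals the image of
    \<open>f\<close>.\<close>
  have "open_in V ((\<lambda>x. T' (f x)) ` U0)"
    unfolding openin_euclidean_subtopology_iff using surj_T' T'in by auto
  then have "open_in V {z \<in> V. T' z \<in> (\<lambda>x. T' (f x)) ` U0}"
    by (intro open_in_preimage[where W = V] linear_continuous_on T' T'in) auto
  moreover have "{z \<in> V. T' z \<in> (\<lambda>x. T' (f x)) ` U0} = f ` U0"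
    using T'inj f(2) U0U by blast
  ultimately have fU0: "open_in V (f ` U0)"
    by simp
  have inj: "inj_on f U0"
  proof (rule inj_onI)
    fix x y assume "x \<in> U0" "y \<in> U0" "f x = f y"
    then show "x = y"
      using lower[of x y] U0S by auto
  qed
  define g where "g = inv_into U0 f"
  have gf: "g (f x) = x" if "x \<in> U0" for x
    unfolding g_def by (rule inv_into_f_f[OF inj that])
  have gU0: "g z \<in> U0" "f (g z) = z" if "z \<in> f ` U0" for z
    using that gf by auto
  \<comment> \<open>A vector killed by \<open>T\<close> after the derivative of \<open>f\<close> is
    fixed by the derivative of \<open>h\<close>, which at least halves norms. So this composite is
    injective, hence onto, and \<open>T\<close> can be cancelled.\<close>
  have surjD: "dir_deriv f x ` V = V" if x: "x \<in> U0" for x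
  proof -
    have xU: "x \<in> U" "x \<in> S"
      using x U0U U0S by auto
    have lin: "linear_betw V V (\<lambda>v. T (dir_deriv f x v))"
      by (rule linear_betw_comp[OF linD[OF xU(1)] T])
    have "(\<lambda>v. T (dir_deriv f x v)) ` V = V"
    proof (rule linear_betw_inj_surj[OF lin V])
      show "inj_on (\<lambda>v. T (dir_deriv f x v)) V"
      proof (rule linear_betw_inj_on[OF lin V'(1)])
        fix v assume v: "v \<in> V" "T (dir_deriv f x v) = 0"
        have "dir_deriv f x v \<in> V"
          by (rule linear_betw_in[OF linD[OF xU(1)] v(1)])
        then have "dir_deriv h x v = v"
          using Dh[OF xU(1) v(1)] v by (simp add: T'V)
        then have "norm v \<le> 1/2 * norm v"
          using Dh_le[OF xU(2), of v] by (simp add: proj_id[OF V v(1)])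
        then show "v = 0"
          by simp
      qed
    qed
    then show ?thesis
    proof (intro equalityI subsetI)
      fix w assume *: "(\<lambda>v. T (dir_deriv f x v)) ` V = V" and w: "w \<in> V"
      have "T w \<in> (\<lambda>v. T (dir_deriv f x v)) ` V"
        unfolding * by (rule linear_betw_in[OF T w])
      then obtain v where v: "v \<in> V" "T w = T (dir_deriv f x v)"
        by auto
      moreover have "dir_deriv f x v \<in> V"
        by (rule linear_betw_in[OF linD[OF xU(1)] v(1)])
      ultimately have "w = dir_deriv f x v"
        using T'inj[OF w] w by (simp add: T'V)
      then show "w \<in> dir_deriv f x ` V"
        using v by blast
    qed (use linear_betw_in[OF linD[OF xU(1)]] in auto)
  qed
  define N where "N x = inv_into V (dir_deriv f x)" for x
  have injD: "inj_on (dir_deriv f x) V" if "x \<in> U0" for x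
    using linear_betw_surj_inj[OF linD V surjD] that U0U by auto
  have N: "linear_betw V V (N x)" if "x \<in> U0" for x
    unfolding N_def using linear_betw_inv_into[OF linD V'(1) injD surjD] that U0U by auto
  have ND: "N x (dir_deriv f x v) = v" if "x \<in> U0" "v \<in> V" for x v
    unfolding N_def by (rule inv_into_f_f[OF injD[OF that(1)] that(2)])
  have DN: "dir_deriv f x (N x v) = v" if "x \<in> U0" "v \<in> V" for x v
    unfolding N_def by (rule f_inv_into_f) (use surjD[OF that(1)] that(2) in simp)
  have Nsmooth: "smooth_on V U0 (\<lambda>x. N x v)" if "v \<in> V" for v
  proof (rule smooth_on_inverse_family[OF V U0 V _ N ND DN _ that])
    show "linear_betw V V (dir_deriv f x)" if "x \<in> U0" for x
      using linD that U0U by auto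
    show "smooth_on V U0 (\<lambda>y. dir_deriv f y w)" if "w \<in> V" for w
      by (rule smooth_on_subset[OF smooth_on_dir_deriv[OF f(1) V'(1) U that] U0U subset_refl])
  qed auto
  obtain K where K: "\<And>v. norm (T' v) \<le> norm v * K" "K > 0"
    using bounded_linear.pos_bounded[OF T'] by blast
  have g_lip: "norm (g z - g z') \<le> 2 * K * norm (z - z')" if "z \<in> f ` U0" "z' \<in> f ` U0" for z z'
  proof -
    have "norm (g z - g z') \<le> 2 * norm (T' (z - z'))"
      using lower[of "g z" "g z'"] gU0[OF that(1)] gU0[OF that(2)] U0S
      by (auto simp: linear_diff[OF bounded_linear.linear[OF T']])
    then show ?thesis
      using K(1)[of "z - z'"] by (simp add: mult_ac)
  qed
  have g_deriv: "(g has_derivative (\<lambda>v. N (g z) (proj V v))) (at z within f ` U0)" if z: "z \<in> f ` U0" for z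
    unfolding has_derivative_within_alt
  proof (intro conjI allI impI)
    let ?x = "g z"
    note x = gU0[OF z]
    have xU: "?x \<in> U"
      using x U0U by auto
    show bl: "bounded_linear (\<lambda>v. N ?x (proj V v))"
      by (rule bounded_linear_proj_comp[OF N[OF x(1)] V])
    then obtain L where L: "\<And>v. norm (N ?x (proj V v)) \<le> norm v * L" "L > 0"
      using bounded_linear.pos_bounded by blast
    fix e :: real assume "e > 0"
    \<comment> \<open>The factor absorbs the bound \<open>L\<close> of the inverse derivative and
      the Lipschitz constant \<open>2 * K\<close> of \<open>g\<close>.\<close>
    define e' where "e' = e / (L * (2 * K))"
    have "e' > 0"
      using \<open>e > 0\<close> L K by (simp add: e'_def)
    then obtain d where d: "d > 0"
      "\<And>y. y \<in> U \<Longrightarrow> norm (y - ?x) < d \<Longrightarrow> norm (f y - f ?x - dir_deriv f ?x (proj V (y - ?x))) \<le> e' * norm (y - ?x)"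
      using smooth_on_has_derivative[OF f(1) V U xU] unfolding has_derivative_within_alt by meson
    show "\<exists>d>0. \<forall>z'\<in>f ` U0. norm (z' - z) < d \<longrightarrow>
        norm (g z' - g z - N ?x (proj V (z' - z))) \<le> e * norm (z' - z)"
    proof (intro exI[of _ "d / (2 * K)"] conjI ballI impI)
      show "d / (2 * K) > 0"
        using d K by simp
      fix z' assume z': "z' \<in> f ` U0" "norm (z' - z) < d / (2 * K)"
      let ?y = "g z'"
      note y = gU0[OF z'(1)]
      have yU: "?y \<in> U"
        using y U0U by auto
      have le: "norm (?y - ?x) \<le> 2 * K * norm (z' - z)"
        by (rule g_lip[OF z'(1) z])
      also have "\<dots> < d"
        using z' K by (simp add: field_simps)
      finally have fd: "norm (z' - z - dir_deriv f ?x (proj V (?y - ?x))) \<le> e' * norm (?y - ?x)"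
        using d(2)[OF yU] x y by simp
      have inV: "?y - ?x \<in> V" "z' - z \<in> V"
        using x y xU yU UV f(2) z z'(1) U0U by (auto intro!: subspace_diff V')
      have DV: "dir_deriv f ?x (?y - ?x) \<in> V"
        by (rule linear_betw_in[OF linD[OF xU] inV(1)])
      have "N ?x (z' - z - dir_deriv f ?x (?y - ?x)) = N ?x (z' - z) - (?y - ?x)"
        using linear_betw_diff[OF N[OF x(1)] V'(1) inV(2) DV] ND[OF x(1) inV(1)] by simp
      then have "norm (?y - ?x - N ?x (z' - z)) = norm (N ?x (proj V (z' - z - dir_deriv f ?x (?y - ?x))))"
        using proj_id[OF V subspace_diff[OF V'(1) inV(2) DV]] by (simp add: norm_minus_commute)
      also have "\<dots> \<le> norm (z' - z - dir_deriv f ?x (?y - ?x)) * L"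
        by (rule L(1))
      also have "\<dots> \<le> e' * norm (?y - ?x) * L"
        using fd L(2) by (intro mult_right_mono) (auto simp: proj_id[OF V inV(1)])
      also have "\<dots> \<le> e' * (2 * K * norm (z' - z)) * L"
        using le L(2) \<open>e' > 0\<close> by (intro mult_right_mono mult_left_mono) auto
      also have "\<dots> = e * norm (z' - z)"
        using L(2) K(2) by (simp add: e'_def field_simps)
      finally show "norm (g z' - g z - N ?x (proj V (z' - z))) \<le> e * norm (z' - z)"
        by (simp add: proj_id[OF V inV(2)])
    qed
  qed
  have gim: "g ` f ` U0 \<subseteq> U0"
    using gU0(1) by (rule image_subsetI)
  \<comment> \<open>The derivative of \<open>g\<close> is \<open>N\<close> composed with
    \<open>g\<close>, so class \<open>k\<close> of \<open>g\<close> passes to its derivative and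
    yields the next class.\<close>
  have "C_on k V (f ` U0) g" for k
  proof (induction k)
    case 0
    show ?case
      using has_derivative_continuous_on[OF g_deriv] by simp
  next
    case (Suc k)
    show ?case
    proof (rule C_on_SucI[OF g_deriv])
      fix v assume v: "v \<in> V"
      have "C_on k V U0 (\<lambda>x. N x (proj V v))"
        using Nsmooth[OF proj_in[OF V]] by (simp add: smooth_on_def)
      then show "C_on k V (f ` U0) (\<lambda>z. N (g z) (proj V v))"
        by (rule C_on_comp[OF V'(1) fU0 V openin_imp_subset[OF U0] gim Suc.IH])
    qed
  qed
  then have "smooth_on V (f ` U0) g"
    by (simp add: smooth_on_def)
  moreover have "x0 \<in> U0"
    using x0 UV r by (auto simp: U0_def)
  ultimately show ?thesis
    using that[OF U0 _ U0U inj fU0 _ gf surjD] by blast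
qed

section \<open>Rank and dimension\<close>

lemma linear_betw_subset:
  "linear_betw V W f \<Longrightarrow> V' \<subseteq> V \<Longrightarrow> f ` V' \<subseteq> W' \<Longrightarrow> linear_betw V' W' f"
  unfolding linear_betw_def by (meson subsetD)

text \<open>\<open>R\<close> lifts a basis of the range of \<open>T\<close> and is defined on the
  whole type. As \<open>T\<close> need not be onto, it inverts \<open>T\<close> only up to the
  projection to the range.\<close>

lemma linear_right_inverse:
  fixes T :: "'a::dual_separating \<Rightarrow> 'b::dual_separating"
  assumes T: "linear_betw V W T" and V: "fin_dim_subspace V" and W: "fin_dim_subspace W"
  obtains R where "bounded_linear R" "\<And>w. R w \<in> V" "\<And>w. T (R w) = proj (T ` V) w"
proof -
  note V' = fin_dim_subspaceD[OF V]
  have TV: "fin_dim_subspace (T ` V)"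
    using T by (intro fin_dim_subspace_subset[OF W] linear_betw_image_subspace[OF T V'(1)]) (auto simp: linear_betw_def)
  have "\<exists>p. \<forall>c\<in>model_basis (T ` V). p c \<in> V \<and> T (p c) = c"
    using fin_dim_subspaceD(4)[OF TV] by (intro bchoice) auto
  then obtain p where p: "\<And>c. c \<in> model_basis (T ` V) \<Longrightarrow> p c \<in> V" "\<And>c. c \<in> model_basis (T ` V) \<Longrightarrow> T (p c) = c"
    by blast
  define R where "R w = (\<Sum>c\<in>model_basis (T ` V). coord (T ` V) c w *\<^sub>R p c)" for w
  show ?thesis
  proof
    show "bounded_linear R"
      unfolding R_def by (intro bounded_linear_sum bounded_linear_scaleR_left[THEN bounded_linear_compose]
          bounded_linear_coord TV)
    show "R w \<in> V" for w
      unfolding R_def using p V'(1) by (auto intro!: subspace_sum subspace_scale)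
    show "T (R w) = proj (T ` V) w" for w
    proof -
      have "T (R w) = (\<Sum>c\<in>model_basis (T ` V). T (coord (T ` V) c w *\<^sub>R p c))"
        unfolding R_def using p by (intro linear_betw_sum[OF T V'(1)] fin_dim_subspaceD TV subspace_scale V')
      also have "\<dots> = (\<Sum>c\<in>model_basis (T ` V). coord (T ` V) c w *\<^sub>R c)"
        using p by (intro sum.cong refl) (simp add: linear_betw_scale[OF T])
      finally show ?thesis
        by (simp add: proj_def)
    qed
  qed
qed

lemma independent_dual_basis:
  fixes B :: "'a::real_vector set"
  assumes "finite B" "\<And>b. b \<in> B \<Longrightarrow> linear (c b)"
    "\<And>b b'. b \<in> B \<Longrightarrow> b' \<in> B \<Longrightarrow> c b b' = (if b = b' then 1 else (0::real))"
  shows "independent B"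
proof (rule independent_if_scalars_zero[OF assms(1)])
  fix u b assume "(\<Sum>x\<in>B. u x *\<^sub>R x) = 0" and b: "b \<in> B"
  then have "0 = (\<Sum>x\<in>B. u x * c b x)"
    using linear_sum[OF assms(2)[OF b], of "\<lambda>x. u x *\<^sub>R x" B] linear_0[OF assms(2)[OF b]]
    by (simp add: linear_cmul[OF assms(2)[OF b]])
  also have "\<dots> = (\<Sum>x\<in>B. if x = b then u x else 0)"
    using assms(3)[OF b] by (intro sum.cong) auto
  also have "\<dots> = u b"
    using b assms(1) by simp
  finally show "u b = 0"
    by simp
qed

lemma card_basis_eq:
  assumes "fin_dim_subspace V" "finite B" "independent B" "span B = V"
  shows "card B = card (model_basis V)"
proof -
  note V = fin_dim_subspaceD[OF assms(1)]
  show ?thesis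
    using independent_span_bound[OF assms(2) V(3)] independent_span_bound[OF V(2) assms(3)] V assms(4)
      span_superset[of B] by auto
qed

lemma subspace_kernel_betw:
  assumes "linear_betw V W D" "subspace V"
  shows "subspace {v \<in> V. D v = 0}"
  using assms linear_betw_0[OF assms] by (auto simp: linear_betw_def subspace_def)

text \<open>A basis of the kernel and lifts of a basis of \<open>W\<close> form a basis of
  \<open>V\<close>. Independence is seen from explicit dual functionals, since
  \<open>v - R (D v)\<close> is the kernel part of \<open>v\<close>.\<close>

lemma rank_nullity:
  fixes D :: "'a::dual_separating \<Rightarrow> 'b::dual_separating"
  assumes D: "linear_betw V W D" and V: "fin_dim_subspace V" and W: "fin_dim_subspace W" and surj: "D ` V = W"
  shows "card (model_basis V) = card (model_basis {v \<in> V. D v = 0}) + card (model_basis W)"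
proof -
  note V' = fin_dim_subspaceD[OF V] and W' = fin_dim_subspaceD[OF W]
  define L where "L = {v \<in> V. D v = 0}"
  have L: "fin_dim_subspace L"
    unfolding L_def by (rule fin_dim_subspace_subset[OF V subspace_kernel_betw[OF D V'(1)]]) auto
  note L' = fin_dim_subspaceD[OF L]
  obtain R where R: "bounded_linear R" "\<And>w. R w \<in> V" "\<And>w. D (R w) = proj (D ` V) w"
    using linear_right_inverse[OF D V W] by blast
  have DR: "D (R w) = w" if "w \<in> W" for w
    using R(3) proj_id[OF W that] surj by simp
  define D' where "D' v = D (proj V v)" for v
  have D': "bounded_linear D'"
    unfolding D'_def by (rule bounded_linear_proj_comp[OF D V])
  have D'V: "D' v = D v" if "v \<in> V" for v
    by (simp add: D'_def proj_id[OF V that])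
  have W0: "w \<noteq> 0" if "w \<in> model_basis W" for w
    using W'(3) that dependent_zero by blast
  have Lb: "b \<in> V" "D b = 0" if "b \<in> model_basis L" for b
    using that L'(4) by (auto simp: L_def)
  have Wb: "w \<in> W" if "w \<in> model_basis W" for w
    using that W'(4) by auto
  have disj: "model_basis L \<inter> R ` model_basis W = {}"
    using Lb(2) DR W0 Wb by force
  have inj: "inj_on R (model_basis W)"
    by (rule inj_on_inverseI[where g = D]) (use DR Wb in auto)
  define B where "B = model_basis L \<union> R ` model_basis W"
  have BV: "B \<subseteq> V"
    using Lb R(2) by (auto simp: B_def)
  \<comment> \<open>For a lift \<open>b = R w\<close> the index is recovered as \<open>D b\<close>,
    which equals \<open>w\<close>.\<close>
  define c where "c b v = (if b \<in> model_basis L then coord L b (v - R (D' v)) else coord W (D b) (D' v))" for b v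
  have "independent B"
  proof (rule independent_dual_basis)
    show "finite B"
      using L'(2) W'(2) by (simp add: B_def)
    show "linear (c b)" for b
    proof (cases "b \<in> model_basis L")
      case True
      have "bounded_linear (\<lambda>v. coord L b (v - R (D' v)))"
        by (intro bounded_linear_compose[OF bounded_linear_coord[OF L]] bounded_linear_sub
            bounded_linear_ident bounded_linear_compose[OF R(1) D'])
      with True show ?thesis
        by (simp add: c_def[abs_def] bounded_linear.linear)
    next
      case False
      have "bounded_linear (\<lambda>v. coord W (D b) (D' v))"
        by (rule bounded_linear_compose[OF bounded_linear_coord[OF W] D'])
      with False show ?thesis
        by (simp add: c_def[abs_def] bounded_linear.linear)
    qed
    have R0: "R 0 = 0" and cL0: "coord L b 0 = 0" and cW0: "coord W b' 0 = 0" for b b'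
      using R(1) bounded_linear_coord[OF L] bounded_linear_coord[OF W]
      by (auto intro: linear_0 bounded_linear.linear)
    show "c b b' = (if b = b' then 1 else 0)" if b: "b \<in> B" "b' \<in> B" for b b'
    proof -
      consider "b \<in> model_basis L" "b' \<in> model_basis L"
        | w' where "b \<in> model_basis L" "b' = R w'" "w' \<in> model_basis W"
        | w where "b = R w" "w \<in> model_basis W" "b' \<in> model_basis L"
        | w w' where "b = R w" "w \<in> model_basis W" "b' = R w'" "w' \<in> model_basis W"
        using b unfolding B_def by blast
      then show ?thesis
      proof cases
        case 1
        then show ?thesis
          by (simp add: c_def D'V Lb R0 coord_basis[OF L])
      next
        case 2
        then have "b \<noteq> b'"
          using disj by auto
        with 2 show ?thesis
          by (simp add: c_def D'V R(2) DR Wb cL0)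
      next
        case 3
        then have "b \<notin> model_basis L" "b \<noteq> b'"
          using disj by auto
        with 3 show ?thesis
          by (simp add: c_def D'V Lb cW0)
      next
        case 4
        then have "b \<notin> model_basis L"
          using disj by auto
        with 4 show ?thesis
          using inj by (simp add: c_def D'V R(2) DR Wb coord_basis[OF W] inj_on_eq_iff)
      qed
    qed
  qed
  moreover have "V \<subseteq> span B"
  proof
    fix v assume v: "v \<in> V"
    have DvW: "D v \<in> W"
      by (rule linear_betw_in[OF D v])
    have "D (v - R (D v)) = 0"
      using linear_betw_diff[OF D V'(1) v R(2)] DR[OF DvW] by simp
    then have "v - R (D v) \<in> L"
      using v R(2) V'(1) by (auto simp: L_def intro: subspace_diff)
    then have "v - R (D v) \<in> span B"
      using span_mono[of "model_basis L" B] L'(5) by (auto simp: B_def)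
    moreover have "D v \<in> span (model_basis W)"
      using DvW W'(5) by simp
    then have "R (D v) \<in> span (R ` model_basis W)"
      unfolding linear_span_image[OF bounded_linear.linear[OF R(1)]] by blast
    then have "R (D v) \<in> span B"
      using span_mono[of "R ` model_basis W" B] by (auto simp: B_def)
    ultimately have "v - R (D v) + R (D v) \<in> span B"
      by (rule span_add)
    then show "v \<in> span B"
      by simp
  qed
  ultimately have "card B = card (model_basis V)"
    using BV L'(2) W'(2) span_minimal[OF BV V'(1)] by (intro card_basis_eq V) (auto simp: B_def)
  then show ?thesis
    using disj L'(2) W'(2) card_image[OF inj] by (simp add: B_def card_Un_disjoint L_def)
qed

text \<open>\<open>S\<close> reads the coordinates that an injection of bases assigns to
  \<open>L\<close> and forgets the others. It relates spaces between which there is no natural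
  map.\<close>

lemma linear_onto:
  fixes L :: "'a::dual_separating set" and L' :: "'b::dual_separating set"
  assumes L: "fin_dim_subspace L" and L': "fin_dim_subspace L'" and card: "card (model_basis L) \<le> card (model_basis L')"
  obtains S where "bounded_linear S" "\<And>v. S v \<in> L" "S ` L' = L"
proof -
  note D = fin_dim_subspaceD[OF L] and D' = fin_dim_subspaceD[OF L']
  obtain \<beta> where \<beta>: "\<beta> ` model_basis L \<subseteq> model_basis L'" "inj_on \<beta> (model_basis L)"
    using card_le_inj[OF D(2) D'(2) card] by blast
  define S where "S v = (\<Sum>b\<in>model_basis L. coord L' (\<beta> b) v *\<^sub>R b)" for v
  have S: "bounded_linear S"
    unfolding S_def by (intro bounded_linear_sum bounded_linear_scaleR_left[THEN bounded_linear_compose]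
        bounded_linear_coord L')
  have SL: "S v \<in> L" for v
    unfolding S_def using D(1,4) by (auto intro!: subspace_sum subspace_scale)
  have S\<beta>: "S (\<beta> b) = b" if b: "b \<in> model_basis L" for b
  proof -
    have "S (\<beta> b) = (\<Sum>b'\<in>model_basis L. if b' = b then b' else 0)"
      unfolding S_def
    proof (intro sum.cong refl)
      fix b' assume b': "b' \<in> model_basis L"
      have "coord L' (\<beta> b') (\<beta> b) = (if \<beta> b' = \<beta> b then 1 else 0)"
        using b b' \<beta>(1) by (intro coord_basis[OF L']) auto
      then show "coord L' (\<beta> b') (\<beta> b) *\<^sub>R b' = (if b' = b then b' else 0)"
        using inj_on_eq_iff[OF \<beta>(2) b' b] by auto
    qed
    then show ?thesis
      using b D(2) by simp
  qed
  have "L \<subseteq> S ` L'"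
  proof
    fix l assume l: "l \<in> L"
    define v where "v = (\<Sum>b\<in>model_basis L. coord L b l *\<^sub>R \<beta> b)"
    have "v \<in> L'"
      unfolding v_def using \<beta>(1) D'(1,4) by (intro subspace_sum subspace_scale) auto
    moreover have "S v = proj L l"
      unfolding v_def linear_sum[OF bounded_linear.linear[OF S]] proj_def
      by (intro sum.cong refl) (simp add: linear_cmul[OF bounded_linear.linear[OF S]] S\<beta>)
    ultimately show "l \<in> S ` L'"
      using proj_id[OF L l] by (intro image_eqI[of _ _ v]) auto
  qed
  then show ?thesis
    using that S SL by blast
qed

text \<open>
  A smooth map of constant rank is constant along the curves on which a suitable projection of it
  is constant. If it is injective, then its differential must be injective.
\<close>

lemma constant_rank_injective:
  fixes f :: "'a::dual_separating \<Rightarrow> 'b::dual_separating"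
  assumes V: "fin_dim_subspace V" and W: "fin_dim_subspace W" and U: "open_in V U" and y0: "y0 \<in> U"
    and f: "smooth_on V U f" "f ` U \<subseteq> W" and inj: "inj_on f U"
    and rank: "\<And>y. y \<in> U \<Longrightarrow> \<exists>\<alpha> \<beta>. linear_betw V V \<alpha> \<and> linear_betw W W \<beta> \<and>
      (\<forall>v\<in>V. dir_deriv f y v = \<beta> (dir_deriv f y0 (\<alpha> v)))"
    and v: "v \<in> V" "dir_deriv f y0 v = 0"
  shows "v = 0"
proof -
  note V' = fin_dim_subspaceD[OF V]
  note UV = openin_imp_subset[OF U]
  note linD = linear_betw_dir_deriv[OF f(1) V U _ W f(2)]
  define T where "T = dir_deriv f y0"
  have T: "linear_betw V W T"
    unfolding T_def by (rule linD[OF y0])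
  obtain R where R: "bounded_linear R" "\<And>w. R w \<in> V" "\<And>w. T (R w) = proj (T ` V) w"
    using linear_right_inverse[OF T V W] by blast
  have TV: "fin_dim_subspace (T ` V)"
    using T by (intro fin_dim_subspace_subset[OF W] linear_betw_image_subspace[OF T V'(1)]) (auto simp: linear_betw_def)
  have TRT: "T (R (T v)) = T v" if "v \<in> V" for v
    unfolding R(3) by (rule proj_id[OF TV imageI[OF that]])
  \<comment> \<open>New coordinates. Since \<open>R\<close> inverts \<open>T\<close> on its range,
    the derivative of \<open>F\<close> at \<open>y0\<close> is the identity and
    \<open>T (F y) = T (R (f y))\<close>. Moving in these coordinates along the kernel vector
    \<open>v\<close> of \<open>T\<close> thus leaves \<open>T (R (f y))\<close> unchanged.\<close>
  define F where "F y = R (f y) + (y - R (T (proj V y)))" for y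
  have Tproj: "bounded_linear (\<lambda>y. R (T (proj V y)))"
    by (rule bounded_linear_compose[OF R(1) bounded_linear_proj_comp[OF T V]])
  have F: "smooth_on V U F"
    unfolding F_def by (intro smooth_on_add smooth_on_diff smooth_on_ident
        smooth_on_bounded_linear[OF R(1) f(1)] smooth_on_linear[OF Tproj])
  have FV: "F ` U \<subseteq> V"
    using R(2) UV by (auto simp: F_def intro!: subspace_add[OF V'(1)] subspace_diff[OF V'(1)])
  have DF: "dir_deriv F y w = R (dir_deriv f y w) + (w - R (T w))" if "y \<in> U" "w \<in> V" for y w
  proof -
    have "(F has_derivative (\<lambda>w. R (dir_deriv f y (proj V w)) + (w - R (T (proj V w))))) (at y within U)"
      unfolding F_def
      by (intro has_derivative_add has_derivative_diff has_derivative_ident bounded_linear.has_derivative[OF R(1)]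
          bounded_linear_imp_has_derivative[OF Tproj] smooth_on_has_derivative f V U that)
    from dir_deriv_eq[OF V'(1) U that this] show ?thesis
      by (simp add: proj_id[OF V that(2)])
  qed
  have "dir_deriv F y0 w = w" if "w \<in> V" for w
    using DF[OF y0 that] by (simp add: T_def)
  then have "dir_deriv F y0 ` V = V"
    by simp
  then obtain U0 g where U0: "open_in V U0" "y0 \<in> U0" "U0 \<subseteq> U" "inj_on F U0" and FU0: "open_in V (F ` U0)"
    and g: "smooth_on V (F ` U0) g" "\<And>x. x \<in> U0 \<Longrightarrow> g (F x) = x"
    and surjDF: "\<And>x. x \<in> U0 \<Longrightarrow> dir_deriv F x ` V = V"
    by (rule smooth_inverse_function[OF V U y0 F FV]) (rule that)
  have gU0: "g z \<in> U0" "F (g z) = z" if "z \<in> F ` U0" for z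
    using that g(2) by auto
  have gV: "g ` F ` U0 \<subseteq> V"
    using gU0(1) openin_imp_subset[OF U0(1)] by blast
  have fg: "smooth_on V (F ` U0) (\<lambda>z. f (g z))"
    by (rule smooth_on_comp[OF V'(1) FU0 V openin_imp_subset[OF U0(1)] gU0(1) g(1) smooth_on_subset[OF f(1) U0(3) subset_refl]])
  \<comment> \<open>In the direction \<open>w\<close> that corresponds to \<open>v\<close>, applying
    \<open>T\<close> after \<open>R\<close> kills the derivative of \<open>f\<close>. The rank
    hypothesis shows that nothing is lost under this projection, so the derivative itself
    vanishes.\<close>
  have zero: "dir_deriv (\<lambda>z. f (g z)) z v = 0" if z: "z \<in> F ` U0" for z
  proof -
    let ?y = "g z"
    have yU: "?y \<in> U"
      using gU0(1)[OF z] U0(3) by auto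
    define w where "w = dir_deriv g z v"
    have w: "w \<in> V"
      unfolding w_def by (rule linear_betw_in[OF linear_betw_dir_deriv[OF g(1) V FU0 z V gV] v(1)])
    have "dir_deriv F ?y w = dir_deriv (\<lambda>z. F (g z)) z v"
      unfolding w_def
      by (rule dir_deriv_comp[OF g(1) V FU0 z smooth_on_subset[OF F U0(3) subset_refl] V U0(1) gU0(1) v(1), symmetric])
    also have "\<dots> = dir_deriv (\<lambda>z. z) z v"
      by (rule dir_deriv_cong[OF V'(1) FU0 z v(1) gU0(2)])
    also have "\<dots> = v"
      by (rule dir_deriv_bounded_linear[OF bounded_linear_ident])
    finally have Fw: "R (dir_deriv f ?y w) + (w - R (T w)) = v"
      by (simp add: DF[OF yU w])
    have "T v = T (R (dir_deriv f ?y w)) + (T w - T (R (T w)))"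
      unfolding Fw[symmetric] using w R(2) V'(1)
      by (simp add: linear_betw_add[OF T] linear_betw_diff[OF T V'(1)] subspace_diff)
    then have TR0: "T (R (dir_deriv f ?y w)) = 0"
      using v(2) TRT[OF w] by (simp add: T_def)
    obtain \<alpha> \<beta> where \<alpha>: "linear_betw V V \<alpha>" and \<beta>: "linear_betw W W \<beta>"
      and eq: "\<And>u. u \<in> V \<Longrightarrow> dir_deriv f ?y u = \<beta> (T (\<alpha> u))"
      using rank[OF yU] unfolding T_def by blast
    \<comment> \<open>Since the derivative of \<open>F\<close> is onto, the projected derivative of
      \<open>f\<close> at \<open>?y\<close> still covers the range of \<open>T\<close>. It factors
      through \<open>\<Theta>\<close>, which is thus onto and hence injective on that range.\<close>
    define \<Theta> where "\<Theta> t = T (R (\<beta> t))" for t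
    have TVW: "T ` V \<subseteq> W"
      using linear_betw_in[OF T] by auto
    have \<Theta>: "linear_betw (T ` V) (T ` V) \<Theta>"
    proof -
      have "linear_betw (T ` V) W \<beta>"
        using linear_betw_in[OF \<beta>] TVW by (intro linear_betw_subset[OF \<beta> TVW]) auto
      moreover have "linear_betw W V R"
        using R by (intro linear_betw_bounded_linear) auto
      moreover have "linear_betw V (T ` V) T"
        by (rule linear_betw_subset[OF T subset_refl subset_refl])
      ultimately show ?thesis
        unfolding \<Theta>_def by (intro linear_betw_comp[of "T ` V" V _ "T ` V" T] linear_betw_comp[of "T ` V" W _ V R])
    qed
    have "T ` V \<subseteq> \<Theta> ` T ` V"
    proof (rule image_subsetI)
      fix u assume "u \<in> V"
      then obtain u' where u': "u' \<in> V" "u = dir_deriv F ?y u'"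
        using surjDF[OF gU0(1)[OF z]] by (metis imageE)
      have "T u = T (R (dir_deriv f ?y u'))"
        unfolding u'(2) DF[OF yU u'(1)] using u' R(2) V'(1)
        by (simp add: linear_betw_add[OF T] linear_betw_diff[OF T V'(1)] subspace_diff TRT)
      also have "\<dots> = \<Theta> (T (\<alpha> u'))"
        by (simp add: \<Theta>_def eq u')
      finally show "T u \<in> \<Theta> ` T ` V"
        using linear_betw_in[OF \<alpha> u'(1)] by blast
    qed
    then have "\<Theta> ` T ` V = T ` V"
      using \<Theta> by (auto simp: linear_betw_def)
    then have inj\<Theta>: "inj_on \<Theta> (T ` V)"
      by (rule linear_betw_surj_inj[OF \<Theta> TV])
    have "\<Theta> (T (\<alpha> w)) = \<Theta> 0"
      using TR0 eq[OF w] linear_betw_0[OF \<Theta> fin_dim_subspaceD(1)[OF TV]] by (simp add: \<Theta>_def)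
    then have "T (\<alpha> w) = 0"
      using inj\<Theta> linear_betw_in[OF \<alpha> w] subspace_0[OF fin_dim_subspaceD(1)[OF TV]] by (auto dest: inj_onD)
    then have "dir_deriv f ?y w = 0"
      using eq[OF w] linear_betw_0[OF \<beta> fin_dim_subspaceD(1)[OF W]] by simp
    moreover have "dir_deriv (\<lambda>z. f (g z)) z v = dir_deriv f ?y w"
      unfolding w_def
      by (rule dir_deriv_comp[OF g(1) V FU0 z smooth_on_subset[OF f(1) U0(3) subset_refl] V U0(1) gU0(1) v(1)])
    ultimately show ?thesis
      by simp
  qed
  obtain r where r: "r > 0" "cball (F y0) r \<inter> V \<subseteq> F ` U0"
    using open_in_ball[OF FU0 imageI[OF U0(2)]] by blast
  \<comment> \<open>Adding 1 keeps the quotient meaningful when \<open>v\<close> is zero; the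
    segment up to \<open>t\<close> stays in the ball.\<close>
  define t where "t = r / (norm v + 1)"
  have nv: "norm v + 1 > 0"
    by (rule add_nonneg_pos) auto
  then have "t > 0"
    using r by (simp add: t_def)
  have line: "F y0 + s *\<^sub>R v \<in> F ` U0" if "s \<in> {0..t}" for s
  proof -
    have "norm (s *\<^sub>R v) \<le> t * (norm v + 1)"
      using that by (auto intro!: mult_mono)
    then have "F y0 + s *\<^sub>R v \<in> cball (F y0) r"
      using nv by (simp add: t_def dist_norm)
    moreover have "F y0 + s *\<^sub>R v \<in> V"
      using FV y0 v by (auto intro!: subspace_add[OF V'(1)] subspace_scale[OF V'(1)])
    ultimately show ?thesis
      using r by blast
  qed
  \<comment> \<open>The curve has zero derivative, so \<open>f\<close> takes the same value at both
    ends; injectivity of \<open>f\<close> then forces the displacement \<open>t *\<^sub>R v\<close>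
    to vanish.\<close>
  define \<gamma> where "\<gamma> s = f (g (F y0 + s *\<^sub>R v))" for s
  have "(\<gamma> has_derivative (\<lambda>h. 0)) (at s within {0..t})" if s: "s \<in> {0..t}" for s
  proof -
    have "((\<lambda>h. f (g (F y0 + s *\<^sub>R v + h *\<^sub>R v))) has_vector_derivative
        dir_deriv (\<lambda>z. f (g z)) (F y0 + s *\<^sub>R v) (proj V v)) (at 0)"
      by (rule has_vector_derivative_line[OF V'(1) FU0 line[OF s] v(1) smooth_on_has_derivative[OF fg V FU0 line[OF s]]])
    then have "((\<lambda>h. \<gamma> (s + h)) has_vector_derivative 0) (at 0)"
      using zero[OF line[OF s]] proj_id[OF V v(1)] by (simp add: \<gamma>_def scaleR_left_distrib add.assoc)
    then have "((\<lambda>h. \<gamma> (s + h)) has_derivative (\<lambda>h. 0)) (at (s - s))"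
      by (simp add: has_vector_derivative_def)
    moreover have "((\<lambda>x. x - s) has_derivative (\<lambda>x. x)) (at s within {0..t})"
      by (auto intro!: derivative_eq_intros)
    ultimately have "((\<lambda>x. \<gamma> (s + (x - s))) has_derivative (\<lambda>x. 0)) (at s within {0..t})"
      by (rule has_derivative_compose[rotated])
    then show ?thesis
      by simp
  qed
  then have "\<exists>c. \<forall>s\<in>{0..t}. \<gamma> s = c"
    by (intro has_derivative_zero_constant) auto
  then have "\<gamma> t = \<gamma> 0"
    using \<open>t > 0\<close> by auto
  moreover have "\<gamma> 0 = f y0"
    using g(2)[OF U0(2)] by (simp add: \<gamma>_def)
  ultimately have "f (g (F y0 + t *\<^sub>R v)) = f y0"
    by (simp add: \<gamma>_def)
  moreover have tl: "F y0 + t *\<^sub>R v \<in> F ` U0"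
    using \<open>t > 0\<close> by (intro line) auto
  ultimately have "g (F y0 + t *\<^sub>R v) = y0"
    using inj gU0(1)[OF tl] U0(3) y0 by (auto dest: inj_onD)
  then have "F y0 + t *\<^sub>R v = F y0"
    using gU0(2)[OF tl] by simp
  then show ?thesis
    using \<open>t > 0\<close> by simp
qed

section \<open>Images of spaces of lower dimension\<close>

text \<open>\<open>W\<close> may itself be a null set of its Euclidean space, so the claim is
  thickened: the full preimage of \<open>Q\<close> under \<open>proj W\<close> is open there, and it
  is covered by countably many differentiable images of pieces of a proper subspace
  \<open>M\<close>.\<close>

lemma lowdim_images_empty_interior:
  fixes V :: "'b::euclidean_space set" and W :: "'a::euclidean_space set"
  assumes V: "fin_dim_subspace V" and W: "fin_dim_subspace W"
    and card: "card (model_basis V) < card (model_basis W)"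
    and I: "countable I" and f: "\<And>i. i \<in> I \<Longrightarrow> f i differentiable_on U i" "\<And>i. i \<in> I \<Longrightarrow> U i \<subseteq> V"
    and Q: "open_in W Q" "Q \<subseteq> (\<Union>i\<in>I. f i ` U i)"
  shows "Q = {}"
proof (rule ccontr)
  assume "Q \<noteq> {}"
  note V' = fin_dim_subspaceD[OF V] and W' = fin_dim_subspaceD[OF W]
  note P = bounded_linear_proj[OF W]
  \<comment> \<open>\<open>S\<close> and its section \<open>R\<close> copy \<open>V\<close> into
    \<open>W\<close>, so that the maps \<open>f i\<close> can be pulled back to the type in which
    measure is taken.\<close>
  obtain S where S: "bounded_linear S" "\<And>v. S v \<in> V" "S ` W = V"
    using linear_onto[OF V W] card by (metis less_imp_le)
  have "linear_betw W V S"
    using S by (intro linear_betw_bounded_linear) auto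
  then obtain R where R: "bounded_linear R" "\<And>w. R w \<in> W" "\<And>w. S (R w) = proj (S ` W) w"
    using linear_right_inverse[OF _ W V] by blast
  have SR: "S (R u) = u" if "u \<in> V" for u
    using R(3) S(3) proj_id[OF V that] by simp
  \<comment> \<open>The directions complementary to \<open>W\<close> are all kept, so
    \<open>M\<close> is proper because the copy of \<open>V\<close> does not fill
    \<open>W\<close>.\<close>
  define M where "M = {x. proj W x \<in> R ` V}"
  have "subspace (R ` V)"
    by (intro linear_subspace_image bounded_linear.linear R V')
  then have subM: "subspace M"
    unfolding M_def using linear_subspace_linear_preimage[OF bounded_linear.linear[OF P]] by (simp add: vimage_def)
  have "M \<noteq> UNIV"
  proof
    assume "M = UNIV"
    then have "W \<subseteq> R ` V"
      using proj_id[OF W] unfolding M_def by (metis UNIV_I mem_Collect_eq subsetI)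
    then have "model_basis W \<subseteq> span (R ` model_basis V)"
      unfolding linear_span_image[OF bounded_linear.linear[OF R(1)]] V'(5) using W'(4) by blast
    then have "card (model_basis W) \<le> card (R ` model_basis V)"
      using independent_span_bound[OF finite_imageI[OF V'(2)] W'(3)] by blast
    then show False
      using card card_image_le[OF V'(2), of R] by simp
  qed
  then have "dim M < DIM('a)"
    using dim_subset_UNIV[of M] dim_eq_full[of M] subM by (metis le_neq_implies_less span_eq_iff)
  then have negM: "negligible M"
    by (rule negligible_lowdim)
  \<comment> \<open>\<open>g i\<close> acts through \<open>f i\<close> on the component in
    \<open>W\<close> and as the identity on the complementary component.\<close>
  define g where "g i x = f i (S (proj W x)) + (x - proj W x)" for i x
  define N where "N i = {x \<in> M. S (proj W x) \<in> U i}" for i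
  have "negligible (g i ` N i)" if i: "i \<in> I" for i
  proof (rule negligible_differentiable_image_negligible)
    show "negligible (N i)"
      by (rule negligible_subset[OF negM]) (auto simp: N_def)
    have SP: "bounded_linear (\<lambda>x. S (proj W x))"
      by (rule bounded_linear_compose[OF S(1) P])
    have "f i differentiable_on (\<lambda>x. S (proj W x)) ` N i"
      by (rule differentiable_on_subset[OF f(1)[OF i]]) (auto simp: N_def)
    then have "(\<lambda>x. f i (S (proj W x))) differentiable_on N i"
      by (rule differentiable_on_compose[OF bounded_linear_imp_differentiable_on[OF SP]])
    moreover have "(\<lambda>x. x - proj W x) differentiable_on N i"
      by (intro bounded_linear_imp_differentiable_on bounded_linear_sub bounded_linear_ident P)
    ultimately show "g i differentiable_on N i"
      unfolding g_def by (rule differentiable_on_add)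
  qed auto
  then have "negligible (\<Union>i\<in>I. g i ` N i)"
    using I by (intro negligible_countable_Union) auto
  moreover have "{x. proj W x \<in> Q} \<subseteq> (\<Union>i\<in>I. g i ` N i)"
  proof
    fix x assume "x \<in> {x. proj W x \<in> Q}"
    then obtain i u where i: "i \<in> I" "u \<in> U i" "proj W x = f i u"
      using Q(2) by auto
    then have u: "u \<in> V"
      using f(2) by auto
    define y where "y = R u + (x - proj W x)"
    have "proj W y = R u + (proj W x - proj W (proj W x))"
      unfolding y_def using P R(2)
      by (simp add: bounded_linear.linear linear_add linear_diff proj_id[OF W])
    then have Py: "proj W y = R u"
      using proj_id[OF W proj_in[OF W]] by simp
    then have "y \<in> N i"
      using i u SR by (auto simp: N_def M_def)
    moreover have "g i y = x"
      unfolding g_def Py SR[OF u] i(3)[symmetric] by (simp add: y_def)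
    ultimately show "x \<in> (\<Union>i\<in>I. g i ` N i)"
      using i by blast
  qed
  ultimately have "negligible {x. proj W x \<in> Q}"
    by (rule negligible_subset)
  moreover have "open {x. proj W x \<in> Q}"
  proof -
    obtain T where T: "open T" "Q = W \<inter> T"
      using Q(1) by (auto simp: openin_open)
    then have "{x. proj W x \<in> Q} = proj W -` T"
      using proj_in[OF W] by auto
    then show ?thesis
      using T(1) by (simp add: open_vimage linear_continuous_on P)
  qed
  moreover have "{x. proj W x \<in> Q} \<noteq> {}"
    using \<open>Q \<noteq> {}\<close> proj_id[OF W] openin_imp_subset[OF Q(1)] by (metis (mono_tags) empty_Collect_eq ex_in_conv subsetD)
  ultimately show False
    using open_not_negligible by blast
qed

section \<open>Manifolds and smooth maps\<close>

text \<open>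
  The manifold axioms without the separation and countability conditions, and the part of them
  that is needed to define the maximal atlas. The jet manifolds enter only through the latter.
\<close>

definition charted :: "('p, 'm::real_normed_vector) mfd \<Rightarrow> bool" where
  "charted M \<longleftrightarrow> fin_dim_subspace (model M) \<and> (\<forall>c\<in>atlas M. is_chart (pts M) (model M) c) \<and>
     (\<Union>c\<in>atlas M. fst c) = pts M \<and> (\<forall>c\<in>atlas M. \<forall>d\<in>atlas M. compatible (model M) c d)"

definition weakly_charted :: "('p, 'm::real_normed_vector) mfd \<Rightarrow> bool" where
  "weakly_charted M \<longleftrightarrow> fin_dim_subspace (model M) \<and> (\<forall>c\<in>atlas M. inj_on (snd c) (fst c)) \<and>
     (\<Union>c\<in>atlas M. fst c) = pts M"

lemma smooth_manifold_charted: "smooth_manifold M \<Longrightarrow> charted M"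
  by (auto simp: smooth_manifold_def charted_def)

lemma charted_weakly_charted: "charted M \<Longrightarrow> weakly_charted M"
  by (auto simp: charted_def weakly_charted_def is_chart_def)

lemma charted_fin_dim: "charted M \<Longrightarrow> fin_dim_subspace (model M)"
  by (simp add: charted_def)

lemma charted_atlas_subset: "charted M \<Longrightarrow> atlas M \<subseteq> max_atlas M"
  by (auto simp: charted_def max_atlas_def)

lemma max_atlasD:
  assumes "c \<in> max_atlas M"
  shows "is_chart (pts M) (model M) c" "inj_on (snd c) (fst c)" "fst c \<subseteq> pts M"
    "open_in (model M) (snd c ` fst c)"
  using assms by (auto simp: max_atlas_def is_chart_def)

lemma charted_atlasD:
  assumes "charted M" "c \<in> atlas M"
  shows "inj_on (snd c) (fst c)" "fst c \<subseteq> pts M" "open_in (model M) (snd c ` fst c)"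
  using max_atlasD[of c M] charted_atlas_subset[OF assms(1)] assms(2) by auto

lemma chart_at_atlas:
  assumes "charted M" "x \<in> pts M"
  shows "chart_at M x \<in> atlas M" "x \<in> fst (chart_at M x)"
proof -
  have "x \<in> (\<Union>c\<in>atlas M. fst c)"
    using assms by (simp add: charted_def)
  then have "\<exists>c. c \<in> atlas M \<and> x \<in> fst c"
    by blast
  from someI_ex[OF this] show "chart_at M x \<in> atlas M" "x \<in> fst (chart_at M x)"
    by (auto simp: chart_at_def)
qed

lemma chart_at_max_atlas:
  assumes "charted M" "x \<in> pts M"
  shows "chart_at M x \<in> max_atlas M" "x \<in> fst (chart_at M x)"
  using chart_at_atlas[OF assms] charted_atlas_subset[OF assms(1)] by auto

lemma chart_inv_left: "inj_on (snd c) (fst c) \<Longrightarrow> x \<in> fst c \<Longrightarrow> chart_inv c (snd c x) = x"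
  by (simp add: chart_inv_def)

lemma chart_inv_right: "y \<in> snd c ` fst c \<Longrightarrow> snd c (chart_inv c y) = y"
  by (simp add: chart_inv_def f_inv_into_f)

lemma chart_inv_in: "y \<in> snd c ` fst c \<Longrightarrow> chart_inv c y \<in> fst c"
  by (simp add: chart_inv_def inv_into_into)

section \<open>Coordinate representations of maps\<close>

text \<open>Smoothness at a point with an explicit neighbourhood in coordinates, a form that can be
  moved between charts and then glued.\<close>

definition local_rep where
  "local_rep V W c d f x U \<longleftrightarrow> x \<in> fst c \<and> open_in V U \<and> snd c x \<in> U \<and> U \<subseteq> snd c ` fst c \<and>
     (\<forall>y\<in>U. chart_inv c y \<in> W \<and> f (chart_inv c y) \<in> fst d) \<and> smooth_on V U (\<lambda>y. snd d (f (chart_inv c y)))"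

text \<open>One transition is composed on each side, with the neighbourhood shrunk once for each.
  Only the transitions from \<open>c1\<close> to \<open>c\<close> and from \<open>d\<close> to
  \<open>d1\<close> enter, so charts of the atlas and of the maximal atlas can be mixed.\<close>

lemma local_rep_change:
  fixes V :: "'m::dual_separating set" and V' :: "'n::dual_separating set"
  assumes V: "fin_dim_subspace V" "fin_dim_subspace V'"
    and c: "smooth_transition V c1 c" "inj_on (snd c1) (fst c1)" "inj_on (snd c) (fst c)" "snd c ` fst c \<subseteq> V"
    and d: "smooth_transition V' d d1" "inj_on (snd d) (fst d)" "snd d ` fst d \<subseteq> V'"
    and x: "x \<in> fst c1" "f x \<in> fst d1" and rep: "local_rep V W c d f x U"
  shows "\<exists>N. local_rep V W c1 d1 f x N"
proof -
  have xc: "x \<in> fst c" and U: "open_in V U" "snd c x \<in> U" "U \<subseteq> snd c ` fst c"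
    "\<And>y. y \<in> U \<Longrightarrow> chart_inv c y \<in> W \<and> f (chart_inv c y) \<in> fst d" "smooth_on V U (\<lambda>y. snd d (f (chart_inv c y)))"
    using rep by (auto simp: local_rep_def)
  define A where "A = snd c1 ` (fst c1 \<inter> fst c)"
  define A' where "A' = snd d ` (fst d \<inter> fst d1)"
  have A: "open_in V A" "smooth_on V A (\<lambda>z. snd c (chart_inv c1 z))"
    and A': "open_in V' A'" "smooth_on V' A' (\<lambda>z. snd d1 (chart_inv d z))"
    using c(1) d(1) by (auto simp: smooth_transition_def A_def A'_def o_def)
  have A_in: "chart_inv c1 z \<in> fst c1" "chart_inv c1 z \<in> fst c" "z \<in> snd c1 ` fst c1" if "z \<in> A" for z
    using that chart_inv_left[OF c(2)] by (auto simp: A_def)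
  define N where "N = {z \<in> A. snd c (chart_inv c1 z) \<in> U}"
  have N: "open_in V N"
    unfolding N_def
    by (rule open_in_preimage[OF smooth_on_imp_continuous_on[OF A(2)] A(1) _ U(1)]) (use A_in(2) c(4) in auto)
  have cN: "chart_inv c (snd c (chart_inv c1 z)) = chart_inv c1 z" if "z \<in> A" for z
    by (rule chart_inv_left[OF c(3) A_in(2)[OF that]])
  have N_in: "chart_inv c1 z \<in> W" "f (chart_inv c1 z) \<in> fst d" if "z \<in> N" for z
    using U(4)[of "snd c (chart_inv c1 z)"] that cN[of z] by (auto simp: N_def)
  have sm: "smooth_on V N (\<lambda>z. snd d (f (chart_inv c1 z)))"
  proof (rule smooth_on_cong)
    show "smooth_on V N (\<lambda>z. snd d (f (chart_inv c (snd c (chart_inv c1 z)))))"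
      by (rule smooth_on_comp[OF fin_dim_subspaceD(1)[OF V(1)] N V(1) openin_imp_subset[OF U(1)] _ smooth_on_subset[OF A(2) _ subset_refl] U(5)])
         (auto simp: N_def)
    show "snd d (f (chart_inv c (snd c (chart_inv c1 z)))) = snd d (f (chart_inv c1 z))" if "z \<in> N" for z
      using cN[of z] that by (auto simp: N_def)
  qed
  define N' where "N' = {z \<in> N. snd d (f (chart_inv c1 z)) \<in> A'}"
  have N': "open_in V N'"
    unfolding N'_def
    by (rule open_in_preimage[OF smooth_on_imp_continuous_on[OF sm] N _ A'(1)]) (use N_in(2) d(3) in auto)
  have N'_in: "f (chart_inv c1 z) \<in> fst d1" if "z \<in> N'" for z
  proof -
    have "snd d (f (chart_inv c1 z)) \<in> A'" "f (chart_inv c1 z) \<in> fst d"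
      using that N_in by (auto simp: N'_def)
    then show ?thesis
      using d(2) by (auto simp: A'_def dest: inj_onD)
  qed
  have dN': "chart_inv d (snd d (f (chart_inv c1 z))) = f (chart_inv c1 z)" if "z \<in> N'" for z
    by (rule chart_inv_left[OF d(2) N_in(2)]) (use that in \<open>simp add: N'_def\<close>)
  have sm': "smooth_on V N' (\<lambda>z. snd d1 (f (chart_inv c1 z)))"
  proof (rule smooth_on_cong)
    show "smooth_on V N' (\<lambda>z. snd d1 (chart_inv d (snd d (f (chart_inv c1 z)))))"
      by (rule smooth_on_comp[OF fin_dim_subspaceD(1)[OF V(1)] N' V(2) openin_imp_subset[OF A'(1)] _ smooth_on_subset[OF sm _ subset_refl] A'(2)])
         (auto simp: N'_def)
    show "snd d1 (chart_inv d (snd d (f (chart_inv c1 z)))) = snd d1 (f (chart_inv c1 z))" if "z \<in> N'" for z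
      by (simp add: dN'[OF that])
  qed
  have "snd c1 x \<in> A" "chart_inv c1 (snd c1 x) = x" "chart_inv c (snd c x) = x"
    using x xc chart_inv_left[OF c(2)] chart_inv_left[OF c(3)] by (auto simp: A_def)
  moreover from this have "f x \<in> fst d"
    using U(4)[OF U(2)] by simp
  ultimately have "snd c1 x \<in> N'"
    using U(2) x(2) by (auto simp: N'_def N_def A'_def)
  moreover have "N' \<subseteq> snd c1 ` fst c1"
    using A_in(3) by (auto simp: N'_def N_def)
  ultimately have "local_rep V W c1 d1 f x N'"
    unfolding local_rep_def using x N' sm' N'_in N_in(1) by (auto simp: N'_def)
  then show ?thesis
    by blast
qed

text \<open>Near a common point the two charts are compared through an atlas chart \<open>e\<close>,
  by changing charts in the representation of the identity map. Since compatibility with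
  \<open>e\<close> is built into the maximal atlas, a weakly charted space provides enough for
  this.\<close>

lemma max_atlas_compatible:
  fixes M :: "('p, 'm::dual_separating) mfd"
  assumes M: "weakly_charted M" and c: "c \<in> max_atlas M" and d: "d \<in> max_atlas M"
  shows "smooth_transition (model M) c d"
proof -
  let ?V = "model M"
  have V: "fin_dim_subspace ?V"
    using M by (simp add: weakly_charted_def)
  have rep: "\<exists>N. open_in ?V N \<and> snd c x \<in> N \<and> N \<subseteq> snd c ` (fst c \<inter> fst d) \<and> smooth_on ?V N (\<lambda>z. snd d (chart_inv c z))"
    if x: "x \<in> fst c \<inter> fst d" for x
  proof -
    have "x \<in> pts M"
      using x max_atlasD(3)[OF c] by auto
    then have "x \<in> (\<Union>c\<in>atlas M. fst c)"
      using M by (simp add: weakly_charted_def)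
    then obtain e where e: "e \<in> atlas M" "x \<in> fst e"
      by blast
    have inj: "inj_on (snd e) (fst e)"
      using e M by (auto simp: weakly_charted_def)
    have ce: "smooth_transition ?V c e" "smooth_transition ?V e c" and ed: "smooth_transition ?V e d"
      using c d e by (auto simp: max_atlas_def compatible_def)
    \<comment> \<open>The image of \<open>e\<close> is known to lie in the model space only over its
      overlap with \<open>c\<close>, hence the restriction.\<close>
    define e' where "e' = (fst c \<inter> fst e, snd e)"
    have inv_e': "chart_inv e' (snd e y) = y" if "y \<in> fst c \<inter> fst e" for y
      using chart_inv_left[of e' y] inj that by (auto simp: e'_def inj_on_def)
    have inv_e: "chart_inv e (snd e y) = y" if "y \<in> fst e" for y
      by (rule chart_inv_left[OF inj that])
    define T where "T = snd e ` (fst e \<inter> fst c \<inter> fst d)"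
    have T: "T = snd e ` (fst e \<inter> fst c) \<inter> snd e ` (fst e \<inter> fst d)"
      using inj unfolding T_def by (auto simp: inj_on_def)
    have "local_rep ?V (fst c) e' d (\<lambda>y. y) x T"
      unfolding local_rep_def
    proof (intro conjI ballI)
      show "open_in ?V T"
        using ce ed by (auto simp: smooth_transition_def T)
      show "smooth_on ?V T (\<lambda>y. snd d (chart_inv e' y))"
      proof (rule smooth_on_cong)
        show "smooth_on ?V T (\<lambda>y. snd d (chart_inv e y))"
          by (rule smooth_on_subset[of ?V "snd e ` (fst e \<inter> fst d)"])
             (use ed in \<open>auto simp: smooth_transition_def o_def T\<close>)
      qed (auto simp: inv_e inv_e' T_def)
    qed (use x e inv_e' in \<open>auto simp: e'_def T_def\<close>)
    moreover have "smooth_transition ?V c e'"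
      using ce(1) by (simp add: smooth_transition_def e'_def)
    moreover have "smooth_transition ?V d d"
      using max_atlasD[OF d] unfolding smooth_transition_def
      by (auto simp: o_def chart_inv_left intro!: smooth_on_cong[OF smooth_on_ident])
    moreover have "snd e' ` fst e' \<subseteq> ?V"
      using ce(2) openin_imp_subset by (fastforce simp: smooth_transition_def e'_def)
    ultimately have "\<exists>N. local_rep ?V (fst c) c d (\<lambda>y. y) x N"
      using max_atlasD(2)[OF c] max_atlasD(2)[OF d] x inj openin_imp_subset[OF max_atlasD(4)[OF d]]
      by (intro local_rep_change[OF V V, of c e' d d x "\<lambda>y. y" "fst c" T]) (auto simp: e'_def inj_on_Int)
    then obtain N where "local_rep ?V (fst c) c d (\<lambda>y. y) x N"
      by blast
    then have N: "open_in ?V N" "snd c x \<in> N" "N \<subseteq> snd c ` fst c"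
      "\<And>y. y \<in> N \<Longrightarrow> chart_inv c y \<in> fst c \<and> chart_inv c y \<in> fst d" "smooth_on ?V N (\<lambda>z. snd d (chart_inv c z))"
      by (auto simp: local_rep_def)
    have "N \<subseteq> snd c ` (fst c \<inter> fst d)"
    proof
      fix y assume y: "y \<in> N"
      then have "snd c (chart_inv c y) = y"
        using N(3) by (intro chart_inv_right) auto
      then show "y \<in> snd c ` (fst c \<inter> fst d)"
        using N(4)[OF y] by (metis IntI imageI)
    qed
    then show ?thesis
      using N by blast
  qed
  have op: "open_in ?V (snd c ` (fst c \<inter> fst d))"
    by (subst openin_subopen) (use rep in blast)
  moreover have "smooth_on ?V (snd c ` (fst c \<inter> fst d)) (\<lambda>z. snd d (chart_inv c z))"
    by (rule smooth_on_local[OF V op]) (use rep in blast)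
  ultimately show ?thesis
    by (simp add: smooth_transition_def o_def)
qed

text \<open>One pair of charts at each point suffices, and it may come from the maximal atlases;
  \<open>local_rep_change\<close> carries it to every pair of atlas charts.\<close>

lemma smooth_map_onI:
  fixes M :: "('p, 'm::dual_separating) mfd" and N :: "('q, 'n::dual_separating) mfd"
  assumes M: "charted M" and N: "charted N" and W: "W \<subseteq> pts M" "f ` W \<subseteq> pts N"
    and rep: "\<And>x. x \<in> W \<Longrightarrow> \<exists>c\<in>max_atlas M. \<exists>d\<in>max_atlas N. \<exists>U. local_rep (model M) W c d f x U"
  shows "smooth_map_on M N W f"
proof -
  have "open_in (model M) (snd c' ` {x \<in> fst c' \<inter> W. f x \<in> fst d'}) \<and>
      smooth_on (model M) (snd c' ` {x \<in> fst c' \<inter> W. f x \<in> fst d'}) (snd d' \<circ> f \<circ> chart_inv c')"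
    if c': "c' \<in> atlas M" and d': "d' \<in> atlas N" for c' d'
  proof -
    let ?U = "snd c' ` {x \<in> fst c' \<inter> W. f x \<in> fst d'}"
    have *: "\<exists>T. open_in (model M) T \<and> y \<in> T \<and> T \<subseteq> ?U \<and> smooth_on (model M) T (\<lambda>z. snd d' (f (chart_inv c' z)))"
      if "y \<in> ?U" for y
    proof -
      from that obtain x where x: "x \<in> fst c'" "x \<in> W" "f x \<in> fst d'" "y = snd c' x"
        by auto
      obtain c d U where cd: "c \<in> max_atlas M" "d \<in> max_atlas N" and U: "local_rep (model M) W c d f x U"
        using rep[OF x(2)] by blast
      have "smooth_transition (model M) c' c" "smooth_transition (model N) d d'"
        using cd c' d' by (auto simp: max_atlas_def compatible_def)
      then obtain T where T: "local_rep (model M) W c' d' f x T"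
        using local_rep_change[OF charted_fin_dim[OF M] charted_fin_dim[OF N] _ _ _ _ _ _ _ x(1) _ U, of d']
          charted_atlasD[OF M c'] max_atlasD[OF cd(1)] max_atlasD[OF cd(2)] x openin_imp_subset by meson
      have "z \<in> ?U" if "z \<in> T" for z
        using T that chart_inv_right[of z c'] chart_inv_in[of z c']
        by (intro image_eqI[of _ _ "chart_inv c' z"]) (auto simp: local_rep_def)
      then show ?thesis
        using T x(4) unfolding local_rep_def by blast
    qed
    have op: "open_in (model M) ?U"
      by (subst openin_subopen) (use * in blast)
    moreover have "smooth_on (model M) ?U (\<lambda>z. snd d' (f (chart_inv c' z)))"
      by (rule smooth_on_local[OF charted_fin_dim[OF M] op]) (use * in blast)
    ultimately show ?thesis
      by (simp add: o_def)
  qed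
  then show ?thesis
    using W by (simp add: smooth_map_on_def Let_def)
qed

text \<open>The reverse passage: smoothness is defined by atlas charts, and
  \<open>local_rep_change\<close> extends it to the maximal atlases.\<close>

lemma smooth_map_onD:
  fixes M :: "('p, 'm::dual_separating) mfd" and N :: "('q, 'n::dual_separating) mfd"
  assumes M: "charted M" and N: "charted N" and f: "smooth_map_on M N W f"
    and c': "c' \<in> max_atlas M" and d': "d' \<in> max_atlas N"
  shows "open_in (model M) (snd c' ` {x \<in> fst c' \<inter> W. f x \<in> fst d'})"
    "smooth_on (model M) (snd c' ` {x \<in> fst c' \<inter> W. f x \<in> fst d'}) (\<lambda>z. snd d' (f (chart_inv c' z)))"
proof -
  let ?U = "snd c' ` {x \<in> fst c' \<inter> W. f x \<in> fst d'}"
  have *: "\<exists>T. open_in (model M) T \<and> y \<in> T \<and> T \<subseteq> ?U \<and> smooth_on (model M) T (\<lambda>z. snd d' (f (chart_inv c' z)))"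
    if "y \<in> ?U" for y
  proof -
    from that obtain x where x: "x \<in> fst c'" "x \<in> W" "f x \<in> fst d'" "y = snd c' x"
      by auto
    have "x \<in> pts M" "f x \<in> pts N"
      using x max_atlasD(3)[OF c'] max_atlasD(3)[OF d'] by auto
    then have cd: "chart_at M x \<in> atlas M" "x \<in> fst (chart_at M x)" "chart_at N (f x) \<in> atlas N" "f x \<in> fst (chart_at N (f x))"
      using chart_at_atlas[OF M] chart_at_atlas[OF N] by auto
    define c d where "c = chart_at M x" and "d = chart_at N (f x)"
    note cd = cd[folded c_def d_def]
    define U where "U = snd c ` {x \<in> fst c \<inter> W. f x \<in> fst d}"
    have "local_rep (model M) W c d f x U"
      unfolding local_rep_def
    proof (intro conjI ballI)
      show "open_in (model M) U" "smooth_on (model M) U (\<lambda>y. snd d (f (chart_inv c y)))"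
        using f cd by (auto simp: smooth_map_on_def Let_def U_def o_def)
    qed (use cd x chart_inv_left[OF charted_atlasD(1)[OF M cd(1)]] in \<open>auto simp: U_def\<close>)
    moreover have "smooth_transition (model M) c' c" "smooth_transition (model N) d d'"
      using cd c' d' by (auto simp: max_atlas_def compatible_def)
    ultimately obtain T where T: "local_rep (model M) W c' d' f x T"
      using local_rep_change[OF charted_fin_dim[OF M] charted_fin_dim[OF N] _ _ _ _ _ _ _ x(1), of c d d' f W U]
        charted_atlasD[OF M cd(1)] charted_atlasD[OF N cd(3)] max_atlasD[OF c'] x openin_imp_subset by meson
    have "z \<in> ?U" if "z \<in> T" for z
      using T that chart_inv_right[of z c'] chart_inv_in[of z c']
      by (intro image_eqI[of _ _ "chart_inv c' z"]) (auto simp: local_rep_def)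
    then show ?thesis
      using T x(4) unfolding local_rep_def by blast
  qed
  show op: "open_in (model M) ?U"
    by (subst openin_subopen) (use * in blast)
  show "smooth_on (model M) ?U (\<lambda>z. snd d' (f (chart_inv c' z)))"
    by (rule smooth_on_local[OF charted_fin_dim[OF M] op]) (use * in blast)
qed

lemma smooth_map_on_image: "smooth_map_on M N W f \<Longrightarrow> x \<in> W \<Longrightarrow> f x \<in> pts N"
  and smooth_map_on_subset: "smooth_map_on M N W f \<Longrightarrow> W \<subseteq> pts M"
  by (auto simp: smooth_map_on_def)

lemma smooth_map_on_rep:
  fixes M :: "('p, 'm::dual_separating) mfd" and N :: "('q, 'n::dual_separating) mfd"
  assumes M: "charted M" and N: "charted N" and f: "smooth_map_on M N W f"
    and c: "c \<in> max_atlas M" "x \<in> fst c" and d: "d \<in> max_atlas N" "f x \<in> fst d" and x: "x \<in> W"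
  shows "local_rep (model M) W c d f x (snd c ` {x \<in> fst c \<inter> W. f x \<in> fst d})"
  unfolding local_rep_def
  using smooth_map_onD[OF M N f c(1) d(1)] c d x chart_inv_left[OF max_atlasD(2)[OF c(1)]] by auto

lemma smooth_map_on_comp:
  fixes M :: "('p, 'm::dual_separating) mfd" and N :: "('q, 'n::dual_separating) mfd" and P :: "('r, 'l::dual_separating) mfd"
  assumes M: "charted M" and N: "charted N" and P: "charted P"
    and f: "smooth_map_on M N W f" and g: "smooth_map_on N P W' g"
  shows "smooth_map_on M P {x \<in> W. f x \<in> W'} (\<lambda>x. g (f x))"
proof (rule smooth_map_onI[OF M P])
  show "{x \<in> W. f x \<in> W'} \<subseteq> pts M" "(\<lambda>x. g (f x)) ` {x \<in> W. f x \<in> W'} \<subseteq> pts P"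
    using smooth_map_on_subset[OF f] smooth_map_on_image[OF g] by auto
next
  fix x assume x: "x \<in> {x \<in> W. f x \<in> W'}"
  have "x \<in> pts M" "f x \<in> pts N" "g (f x) \<in> pts P"
    using x smooth_map_on_subset[OF f] smooth_map_on_image[OF f] smooth_map_on_image[OF g] by auto
  then obtain c d e where cde: "c \<in> max_atlas M" "x \<in> fst c" "d \<in> max_atlas N" "f x \<in> fst d" "e \<in> max_atlas P" "g (f x) \<in> fst e"
    using chart_at_max_atlas M N P by metis
  note rf = smooth_map_on_rep[OF M N f cde(1-4)]
  note rg = smooth_map_on_rep[OF N P g cde(3-6)]
  define U where "U = snd c ` {x \<in> fst c \<inter> W. f x \<in> fst d}"
  define U' where "U' = snd d ` {y \<in> fst d \<inter> W'. g y \<in> fst e}"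
  define T where "T = {y \<in> U. snd d (f (chart_inv c y)) \<in> U'}"
  note ic = chart_inv_left[OF max_atlasD(2)[OF cde(1)]] and id = chart_inv_left[OF max_atlasD(2)[OF cde(3)]]
  have dV: "snd d y \<in> model N" if "y \<in> fst d" for y
    using openin_imp_subset[OF max_atlasD(4)[OF cde(3)]] that by auto
  have U: "open_in (model M) U" "smooth_on (model M) U (\<lambda>y. snd d (f (chart_inv c y)))"
    and U': "open_in (model N) U'" "smooth_on (model N) U' (\<lambda>y. snd e (g (chart_inv d y)))"
    using rf rg x by (auto simp: local_rep_def U_def U'_def)
  have U_in: "chart_inv c y \<in> fst c" "chart_inv c y \<in> W" "f (chart_inv c y) \<in> fst d" if "y \<in> U" for y
    using that ic by (auto simp: U_def)
  have T: "open_in (model M) T"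
    unfolding T_def by (rule open_in_preimage[OF smooth_on_imp_continuous_on[OF U(2)] U(1) _ U'(1)]) (use U_in dV in auto)
  have T_in: "f (chart_inv c y) \<in> W'" "g (f (chart_inv c y)) \<in> fst e" if "y \<in> T" for y
  proof -
    have "snd d (f (chart_inv c y)) \<in> U'" "f (chart_inv c y) \<in> fst d"
      using that U_in by (auto simp: T_def)
    then show "f (chart_inv c y) \<in> W'" "g (f (chart_inv c y)) \<in> fst e"
      using id by (auto simp: U'_def dest: inj_onD[OF max_atlasD(2)[OF cde(3)]])
  qed
  have sm: "smooth_on (model M) T (\<lambda>y. snd e (g (chart_inv d (snd d (f (chart_inv c y))))))"
    by (rule smooth_on_comp[OF fin_dim_subspaceD(1)[OF charted_fin_dim[OF M]] T charted_fin_dim[OF N]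
          openin_imp_subset[OF U'(1)] _ smooth_on_subset[OF U(2) _ subset_refl] U'(2)]) (auto simp: T_def)
  have "smooth_on (model M) T (\<lambda>y. snd e (g (f (chart_inv c y))))"
    using sm by (rule smooth_on_cong) (use U_in id in \<open>auto simp: T_def\<close>)
  moreover have "snd c x \<in> T"
    using x cde ic unfolding T_def U_def U'_def by (auto intro!: imageI)
  moreover have "T \<subseteq> snd c ` fst c"
    unfolding T_def U_def by auto
  moreover have "chart_inv c y \<in> {x \<in> W. f x \<in> W'} \<and> g (f (chart_inv c y)) \<in> fst e" if "y \<in> T" for y
    using T_in[OF that] U_in(2)[of y] that by (simp add: T_def)
  ultimately have "local_rep (model M) {x \<in> W. f x \<in> W'} c e (\<lambda>x. g (f x)) x T"
    unfolding local_rep_def using T cde(2) by blast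
  then show "\<exists>c\<in>max_atlas M. \<exists>d\<in>max_atlas P. \<exists>U. local_rep (model M) {x \<in> W. f x \<in> W'} c d (\<lambda>x. g (f x)) x U"
    using cde by blast
qed

lemma smooth_map_comp:
  fixes M :: "('p, 'm::dual_separating) mfd" and N :: "('q, 'n::dual_separating) mfd" and P :: "('r, 'l::dual_separating) mfd"
  assumes "charted M" "charted N" "charted P" "smooth_map_on M N W f" "smooth_map N P g"
  shows "smooth_map_on M P W (\<lambda>x. g (f x))"
proof -
  have "{x \<in> W. f x \<in> pts N} = W"
    using smooth_map_on_image[OF assms(4)] by auto
  then show ?thesis
    using smooth_map_on_comp[OF assms] by simp
qed

lemma smooth_map_on_cong:
  assumes "smooth_map_on M N W f" "\<And>x. x \<in> W \<Longrightarrow> f x = g x" "charted M"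
  shows "smooth_map_on M N W g"
proof -
  have im: "g ` W \<subseteq> pts N"
    using assms(1,2) by (force simp: smooth_map_on_def)
  have "open_in (model M) (snd c ` {x \<in> fst c \<inter> W. g x \<in> fst d}) \<and>
      smooth_on (model M) (snd c ` {x \<in> fst c \<inter> W. g x \<in> fst d}) (snd d \<circ> g \<circ> chart_inv c)"
    if "c \<in> atlas M" "d \<in> atlas N" for c d
  proof -
    have eq: "{x \<in> fst c \<inter> W. g x \<in> fst d} = {x \<in> fst c \<inter> W. f x \<in> fst d}"
      using assms(2) by auto
    have "open_in (model M) (snd c ` {x \<in> fst c \<inter> W. f x \<in> fst d})"
      "smooth_on (model M) (snd c ` {x \<in> fst c \<inter> W. f x \<in> fst d}) (snd d \<circ> f \<circ> chart_inv c)"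
      using assms(1) that by (auto simp: smooth_map_on_def Let_def)
    then show ?thesis
      unfolding eq using chart_inv_left[OF charted_atlasD(1)[OF assms(3) that(1)]] assms(2)
      by (auto elim!: smooth_on_cong)
  qed
  then show ?thesis
    using assms(1) im by (simp add: smooth_map_on_def Let_def)
qed

lemma smooth_map_ident:
  fixes M :: "('p, 'm::dual_separating) mfd"
  assumes M: "charted M"
  shows "smooth_map M M (\<lambda>x. x)"
proof (rule smooth_map_onI[OF M M])
  fix x assume "x \<in> pts M"
  then have c: "chart_at M x \<in> max_atlas M" "x \<in> fst (chart_at M x)"
    by (rule chart_at_max_atlas[OF M])+
  define c where "c = chart_at M x"
  note c = c[folded c_def]
  have "local_rep (model M) (pts M) c c (\<lambda>x. x) x (snd c ` fst c)"
    unfolding local_rep_def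
    using max_atlasD[OF c(1)] c chart_inv_in[of _ c]
    by (auto simp: chart_inv_left intro!: smooth_on_cong[OF smooth_on_ident])
  then show "\<exists>c\<in>max_atlas M. \<exists>d\<in>max_atlas M. \<exists>U. local_rep (model M) (pts M) c d (\<lambda>x. x) x U"
    using c by blast
qed auto

lemma smooth_map_const:
  fixes M :: "('p, 'm::dual_separating) mfd" and N :: "('q, 'n::dual_separating) mfd"
  assumes M: "charted M" and N: "charted N" and q: "q \<in> pts N"
  shows "smooth_map M N (\<lambda>_. q)"
proof (rule smooth_map_onI[OF M N])
  fix x assume "x \<in> pts M"
  then have c: "chart_at M x \<in> max_atlas M" "x \<in> fst (chart_at M x)"
    by (rule chart_at_max_atlas[OF M])+
  define c where "c = chart_at M x"
  note c = c[folded c_def]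
  have "local_rep (model M) (pts M) c (chart_at N q) (\<lambda>_. q) x (snd c ` fst c)"
    unfolding local_rep_def
    using max_atlasD[OF c(1)] c chart_inv_in[of _ c] chart_at_max_atlas[OF N q]
    by (auto simp: chart_inv_left intro!: smooth_on_const)
  then show "\<exists>c\<in>max_atlas M. \<exists>d\<in>max_atlas N. \<exists>U. local_rep (model M) (pts M) c d (\<lambda>_. q) x U"
    using c chart_at_max_atlas[OF N q] by blast
qed (use q in auto)

section \<open>Differentials, products and vector spaces\<close>

text \<open>\<open>mdiff\<close> uses the chosen chart at each point, which varies arbitrarily with
  the point. Arguments that follow a derivative over a neighbourhood need the chain rule in fixed
  charts instead.\<close>

lemma dir_deriv_chart_comp:
  fixes M :: "('p, 'm::dual_separating) mfd" and N :: "('q, 'n::dual_separating) mfd" and P :: "('r, 'l::dual_separating) mfd"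
  assumes M: "charted M" and N: "charted N" and P: "charted P"
    and f: "smooth_map_on M N W f" and g: "smooth_map_on N P W' g" and x: "x \<in> W" "f x \<in> W'"
    and c: "c \<in> max_atlas M" "x \<in> fst c" and d: "d \<in> max_atlas N" "f x \<in> fst d"
    and e: "e \<in> max_atlas P" "g (f x) \<in> fst e" and v: "v \<in> model M"
  shows "dir_deriv (\<lambda>y. snd e (g (f (chart_inv c y)))) (snd c x) v =
    dir_deriv (\<lambda>z. snd e (g (chart_inv d z))) (snd d (f x)) (dir_deriv (\<lambda>y. snd d (f (chart_inv c y))) (snd c x) v)"
proof -
  note rf = smooth_map_on_rep[OF M N f c d x(1)]
  note rg = smooth_map_on_rep[OF N P g d e x(2)]
  define U where "U = snd c ` {x \<in> fst c \<inter> W. f x \<in> fst d}"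
  define U' where "U' = snd d ` {y \<in> fst d \<inter> W'. g y \<in> fst e}"
  define T where "T = {y \<in> U. snd d (f (chart_inv c y)) \<in> U'}"
  note ic = chart_inv_left[OF max_atlasD(2)[OF c(1)]] and id = chart_inv_left[OF max_atlasD(2)[OF d(1)]]
  have U: "open_in (model M) U" "smooth_on (model M) U (\<lambda>y. snd d (f (chart_inv c y)))"
    and U': "open_in (model N) U'" "smooth_on (model N) U' (\<lambda>y. snd e (g (chart_inv d y)))"
    using rf rg by (auto simp: local_rep_def U_def U'_def)
  have U_in: "f (chart_inv c y) \<in> fst d" if "y \<in> U" for y
    using that ic by (auto simp: U_def)
  have dN: "snd d y \<in> model N" if "y \<in> fst d" for y
    using openin_imp_subset[OF max_atlasD(4)[OF d(1)]] that by auto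
  have T: "open_in (model M) T"
    unfolding T_def by (rule open_in_preimage[OF smooth_on_imp_continuous_on[OF U(2)] U(1) _ U'(1)]) (use U_in dN in auto)
  have "snd c x \<in> U"
    using x(1) c(2) d(2) by (auto simp: U_def)
  moreover have "snd d (f x) \<in> U'"
    using x(2) d(2) e(2) by (auto simp: U'_def)
  ultimately have xT: "snd c x \<in> T"
    using ic[OF c(2)] by (simp add: T_def)
  have "dir_deriv (\<lambda>y. snd e (g (f (chart_inv c y)))) (snd c x) v =
      dir_deriv (\<lambda>y. snd e (g (chart_inv d (snd d (f (chart_inv c y)))))) (snd c x) v"
    by (rule dir_deriv_cong[OF fin_dim_subspaceD(1)[OF charted_fin_dim[OF M]] T xT v])
       (use id U_in in \<open>auto simp: T_def\<close>)
  also have "\<dots> = dir_deriv (\<lambda>z. snd e (g (chart_inv d z))) (snd d (f (chart_inv c (snd c x))))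
      (dir_deriv (\<lambda>y. snd d (f (chart_inv c y))) (snd c x) v)"
    by (rule dir_deriv_comp[OF smooth_on_subset[OF U(2) _ subset_refl] charted_fin_dim[OF M] T xT U'(2) charted_fin_dim[OF N] U'(1) _ v])
       (auto simp: T_def)
  finally show ?thesis
    by (simp only: ic[OF c(2)])
qed

lemma linear_betw_chart:
  fixes M :: "('p, 'm::dual_separating) mfd" and N :: "('q, 'n::dual_separating) mfd"
  assumes M: "charted M" and N: "charted N" and f: "smooth_map_on M N W f" and x: "x \<in> W"
    and c: "c \<in> max_atlas M" "x \<in> fst c" and d: "d \<in> max_atlas N" "f x \<in> fst d"
  shows "linear_betw (model M) (model N) (dir_deriv (\<lambda>y. snd d (f (chart_inv c y))) (snd c x))"
proof -
  note rf = smooth_map_on_rep[OF M N f c d x, unfolded local_rep_def]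
  show ?thesis
    by (rule linear_betw_dir_deriv[OF _ charted_fin_dim[OF M] _ _ charted_fin_dim[OF N]])
       (use rf openin_imp_subset[OF max_atlasD(4)[OF d(1)]] in auto)
qed

lemma mdiff_eq: "mdiff M N f x v =
    dir_deriv (\<lambda>y. snd (chart_at N (f x)) (f (chart_inv (chart_at M x) y))) (snd (chart_at M x) x) v"
  by (simp add: mdiff_def o_def)

lemma mdiff_linear:
  fixes M :: "('p, 'm::dual_separating) mfd" and N :: "('q, 'n::dual_separating) mfd"
  assumes M: "charted M" and N: "charted N" and f: "smooth_map_on M N W f" and x: "x \<in> W"
  shows "linear_betw (model M) (model N) (mdiff M N f x)"
proof -
  have "x \<in> pts M" "f x \<in> pts N"
    using smooth_map_on_subset[OF f] smooth_map_on_image[OF f] x by auto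
  then have "linear_betw (model M) (model N) (\<lambda>v. mdiff M N f x v)"
    unfolding mdiff_eq by (intro linear_betw_chart[OF M N f x] chart_at_max_atlas M N)
  then show ?thesis
    by simp
qed

lemma mdiff_comp:
  fixes M :: "('p, 'm::dual_separating) mfd" and N :: "('q, 'n::dual_separating) mfd" and P :: "('r, 'l::dual_separating) mfd"
  assumes M: "charted M" and N: "charted N" and P: "charted P"
    and f: "smooth_map_on M N W f" and g: "smooth_map_on N P W' g" and x: "x \<in> W" "f x \<in> W'" and v: "v \<in> model M"
  shows "mdiff M P (\<lambda>x. g (f x)) x v = mdiff N P g (f x) (mdiff M N f x v)"
proof -
  have "x \<in> pts M" "f x \<in> pts N" "g (f x) \<in> pts P"
    using smooth_map_on_subset[OF f] smooth_map_on_image[OF f] smooth_map_on_image[OF g] x by auto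
  then show ?thesis
    unfolding mdiff_eq by (intro dir_deriv_chart_comp[OF M N P f g x] chart_at_max_atlas M N P v)
qed

lemma mdiff_cong:
  fixes M :: "('p, 'm::dual_separating) mfd" and N :: "('q, 'n::dual_separating) mfd"
  assumes M: "charted M" and N: "charted N" and f: "smooth_map_on M N W f" and x: "x \<in> W" and v: "v \<in> model M"
    and eq: "\<And>y. y \<in> W \<Longrightarrow> f y = g y"
  shows "mdiff M N f x v = mdiff M N g x v"
proof -
  have xp: "x \<in> pts M" "f x \<in> pts N"
    using smooth_map_on_subset[OF f] smooth_map_on_image[OF f] x by auto
  define c where "c = chart_at M x"
  have c: "c \<in> max_atlas M" "x \<in> fst c"
    unfolding c_def by (rule chart_at_max_atlas[OF M xp(1)])+
  from smooth_map_on_rep[OF M N f c chart_at_max_atlas[OF N xp(2)] x] have U: "open_in (model M) (snd c ` {y \<in> fst c \<inter> W. f y \<in> fst (chart_at N (f x))})"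
    "snd c x \<in> snd c ` {y \<in> fst c \<inter> W. f y \<in> fst (chart_at N (f x))}"
    by (auto simp: local_rep_def)
  have "f (chart_inv c y) = g (chart_inv c y)"
    if "y \<in> snd c ` {y \<in> fst c \<inter> W. f y \<in> fst (chart_at N (f x))}" for y
    using that chart_inv_left[OF max_atlasD(2)[OF c(1)]] by (auto intro: eq)
  then show ?thesis
    unfolding mdiff_eq eq[OF x, symmetric] c_def[symmetric]
    by (intro dir_deriv_cong[OF fin_dim_subspaceD(1)[OF charted_fin_dim[OF M]] U v]) auto
qed

lemma dir_deriv_chart_ident:
  fixes M :: "('p, 'm::dual_separating) mfd"
  assumes M: "charted M" and c: "c \<in> max_atlas M" "x \<in> fst c" and v: "v \<in> model M"
  shows "dir_deriv (\<lambda>y. snd c (chart_inv c y)) (snd c x) v = v"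
proof -
  have "dir_deriv (\<lambda>y. snd c (chart_inv c y)) (snd c x) v = dir_deriv (\<lambda>y. y) (snd c x) v"
    by (rule dir_deriv_cong[OF fin_dim_subspaceD(1)[OF charted_fin_dim[OF M]] max_atlasD(4)[OF c(1)] _ v])
       (use c chart_inv_right[of _ c] in auto)
  then show ?thesis
    by (simp add: dir_deriv_bounded_linear[OF bounded_linear_ident])
qed

lemma mdiff_ident:
  fixes M :: "('p, 'm::dual_separating) mfd"
  assumes M: "charted M" and x: "x \<in> pts M" and v: "v \<in> model M"
  shows "mdiff M M (\<lambda>x. x) x v = v"
  unfolding mdiff_eq by (rule dir_deriv_chart_ident[OF M chart_at_max_atlas[OF M x] v])

section \<open>Products of manifolds\<close>

abbreviation prod_chart :: "('p, 'm) chart \<Rightarrow> ('q, 'n) chart \<Rightarrow> ('p \<times> 'q, 'm \<times> 'n) chart" where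
  "prod_chart c d \<equiv> (fst c \<times> fst d, map_prod (snd c) (snd d))"

lemma prod_mfd_simps [simp]:
  "pts (prod_mfd M N) = pts M \<times> pts N" "model (prod_mfd M N) = model M \<times> model N"
  by (simp_all add: prod_mfd_def)

lemma prod_mfd_atlas: "p \<in> atlas (prod_mfd M N) \<longleftrightarrow> (\<exists>c\<in>atlas M. \<exists>d\<in>atlas N. p = prod_chart c d)"
  by (simp add: prod_mfd_def del: split_paired_Ex) blast

lemma prod_chart_image: "map_prod f g ` (A \<times> B) = f ` A \<times> g ` B"
  by force

lemma chart_inv_prod:
  assumes "inj_on (snd c) (fst c)" "inj_on (snd d) (fst d)" "y \<in> snd c ` fst c" "z \<in> snd d ` fst d"
  shows "chart_inv (prod_chart c d) (y, z) = (chart_inv c y, chart_inv d z)"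
proof -
  have "inj_on (snd (prod_chart c d)) (fst (prod_chart c d))"
    using assms by (auto intro!: map_prod_inj_on)
  then have "chart_inv (prod_chart c d) (snd (prod_chart c d) (chart_inv c y, chart_inv d z)) = (chart_inv c y, chart_inv d z)"
    by (rule chart_inv_left) (use chart_inv_in[OF assms(3)] chart_inv_in[OF assms(4)] in simp)
  then show ?thesis
    by (simp add: chart_inv_right[OF assms(3)] chart_inv_right[OF assms(4)])
qed

lemma smooth_on_fst: "smooth_on V U fst" and smooth_on_snd: "smooth_on V U snd"
  by (auto intro: smooth_on_linear bounded_linear_fst bounded_linear_snd)

lemma smooth_transition_prod:
  fixes V :: "'m::dual_separating set" and V' :: "'n::dual_separating set"
  assumes V: "fin_dim_subspace V" "fin_dim_subspace V'"
    and c: "smooth_transition V c c'" "inj_on (snd c) (fst c)" and d: "smooth_transition V' d d'" "inj_on (snd d) (fst d)"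
  shows "smooth_transition (V \<times> V') (prod_chart c d) (prod_chart c' d')"
proof -
  define A where "A = snd c ` (fst c \<inter> fst c')"
  define B where "B = snd d ` (fst d \<inter> fst d')"
  have A: "open_in V A" "smooth_on V A (\<lambda>y. snd c' (chart_inv c y))" and B: "open_in V' B" "smooth_on V' B (\<lambda>y. snd d' (chart_inv d y))"
    using c d by (auto simp: smooth_transition_def A_def B_def o_def)
  have AB: "snd (prod_chart c d) ` (fst (prod_chart c d) \<inter> fst (prod_chart c' d')) = A \<times> B"
    by (simp add: A_def B_def Times_Int_Times prod_chart_image)
  note AB_open = open_in_Times[OF A(1) B(1)]
  note VV = fin_dim_subspaceD(1)[OF fin_dim_subspace_Times[OF V]]
  have "smooth_on (V \<times> V') (A \<times> B) (\<lambda>p. (snd c' (chart_inv c (fst p)), snd d' (chart_inv d (snd p))))"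
    by (intro smooth_on_Pair smooth_on_comp[OF VV AB_open V(1) openin_imp_subset[OF A(1)] _ smooth_on_fst A(2)]
          smooth_on_comp[OF VV AB_open V(2) openin_imp_subset[OF B(1)] _ smooth_on_snd B(2)]) auto
  then have "smooth_on (V \<times> V') (A \<times> B) (snd (prod_chart c' d') \<circ> chart_inv (prod_chart c d))"
  proof (rule smooth_on_cong)
    fix p assume "p \<in> A \<times> B"
    then obtain y z where p: "p = (y, z)" "y \<in> snd c ` fst c" "z \<in> snd d ` fst d"
      by (auto simp: A_def B_def)
    show "(snd c' (chart_inv c (fst p)), snd d' (chart_inv d (snd p))) = (snd (prod_chart c' d') \<circ> chart_inv (prod_chart c d)) p"
      unfolding p(1) o_def chart_inv_prod[OF c(2) d(2) p(2,3)] by simp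
  qed
  then show ?thesis
    unfolding smooth_transition_def AB using AB_open by blast
qed

lemma charted_prod:
  fixes M :: "('p, 'm::dual_separating) mfd" and N :: "('q, 'n::dual_separating) mfd"
  assumes M: "charted M" and N: "charted N"
  shows "charted (prod_mfd M N)"
  unfolding charted_def
proof (intro conjI ballI)
  show "fin_dim_subspace (model (prod_mfd M N))"
    using fin_dim_subspace_Times[OF charted_fin_dim[OF M] charted_fin_dim[OF N]] by simp
  show "is_chart (pts (prod_mfd M N)) (model (prod_mfd M N)) p" if "p \<in> atlas (prod_mfd M N)" for p
  proof -
    from that obtain c d where cd: "c \<in> atlas M" "d \<in> atlas N" "p = prod_chart c d"
      unfolding prod_mfd_atlas by blast
    then show ?thesis
      using charted_atlasD[OF M cd(1)] charted_atlasD[OF N cd(2)]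
      by (auto simp: is_chart_def prod_chart_image intro!: map_prod_inj_on open_in_Times)
  qed
  show "(\<Union>p\<in>atlas (prod_mfd M N). fst p) = pts (prod_mfd M N)"
  proof (intro equalityI subsetI)
    fix x assume "x \<in> pts (prod_mfd M N)"
    then have "fst x \<in> pts M" "snd x \<in> pts N"
      by auto
    from chart_at_atlas[OF M this(1)] chart_at_atlas[OF N this(2)]
    have "prod_chart (chart_at M (fst x)) (chart_at N (snd x)) \<in> atlas (prod_mfd M N)"
      "x \<in> fst (prod_chart (chart_at M (fst x)) (chart_at N (snd x)))"
      by (auto simp: prod_mfd_atlas mem_Times_iff)
    then show "x \<in> (\<Union>p\<in>atlas (prod_mfd M N). fst p)"
      by blast
  next
    fix x assume "x \<in> (\<Union>p\<in>atlas (prod_mfd M N). fst p)"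
    then obtain p where "p \<in> atlas (prod_mfd M N)" "x \<in> fst p"
      by blast
    then obtain c d where cd: "c \<in> atlas M" "d \<in> atlas N" "x \<in> fst c \<times> fst d"
      unfolding prod_mfd_atlas by auto
    then show "x \<in> pts (prod_mfd M N)"
      using charted_atlasD(2)[OF M cd(1)] charted_atlasD(2)[OF N cd(2)] by auto
  qed
  show "compatible (model (prod_mfd M N)) p q" if p: "p \<in> atlas (prod_mfd M N)" and q: "q \<in> atlas (prod_mfd M N)" for p q
  proof -
    from p q obtain c d c' d' where cd: "c \<in> atlas M" "d \<in> atlas N" "p = prod_chart c d"
      "c' \<in> atlas M" "d' \<in> atlas N" "q = prod_chart c' d'"
      unfolding prod_mfd_atlas by blast
    have "compatible (model M) c c'" "compatible (model N) d d'"
      using M N cd by (auto simp: charted_def)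
    then show ?thesis
      unfolding cd compatible_def prod_mfd_simps
      using charted_atlasD(1)[OF M] charted_atlasD(1)[OF N] cd
      by (intro conjI smooth_transition_prod charted_fin_dim M N) auto
  qed
qed

lemma prod_chart_max_atlas:
  fixes M :: "('p, 'm::dual_separating) mfd" and N :: "('q, 'n::dual_separating) mfd"
  assumes "charted M" "charted N" "c \<in> atlas M" "d \<in> atlas N"
  shows "prod_chart c d \<in> max_atlas (prod_mfd M N)"
proof (rule subsetD[OF charted_atlas_subset[OF charted_prod[OF assms(1,2)]]])
  show "prod_chart c d \<in> atlas (prod_mfd M N)"
    unfolding prod_mfd_atlas using assms(3,4) by blast
qed

lemma smooth_map_fst_snd:
  fixes M :: "('p, 'm::dual_separating) mfd" and N :: "('q, 'n::dual_separating) mfd"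
  assumes M: "charted M" and N: "charted N"
  shows "smooth_map (prod_mfd M N) M fst" "smooth_map (prod_mfd M N) N snd"
proof -
  note MN = charted_prod[OF M N]
  have rep: "local_rep (model (prod_mfd M N)) (pts (prod_mfd M N)) (prod_chart c d) c fst x (snd c ` fst c \<times> snd d ` fst d)"
    "local_rep (model (prod_mfd M N)) (pts (prod_mfd M N)) (prod_chart c d) d snd x (snd c ` fst c \<times> snd d ` fst d)"
    if cd: "c \<in> atlas M" "d \<in> atlas N" "x \<in> fst c \<times> fst d" for c d x
  proof -
    note c = charted_atlasD[OF M cd(1)] and d = charted_atlasD[OF N cd(2)]
    have inv: "chart_inv (prod_chart c d) y = (chart_inv c (fst y), chart_inv d (snd y))" if "y \<in> snd c ` fst c \<times> snd d ` fst d" for y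
      using chart_inv_prod[OF c(1) d(1), of "fst y" "snd y"] that by auto
    have pt: "chart_inv (prod_chart c d) y \<in> pts (prod_mfd M N)" "fst (chart_inv (prod_chart c d) y) \<in> fst c"
      "snd (chart_inv (prod_chart c d) y) \<in> fst d" if "y \<in> snd c ` fst c \<times> snd d ` fst d" for y
      using inv[OF that] that c(2) d(2) chart_inv_in[of "fst y" c] chart_inv_in[of "snd y" d] by auto
    have cr: "snd c (fst (chart_inv (prod_chart c d) y)) = fst y" "snd d (snd (chart_inv (prod_chart c d) y)) = snd y"
      if "y \<in> snd c ` fst c \<times> snd d ` fst d" for y
      using inv[OF that] chart_inv_right[of "fst y" c] chart_inv_right[of "snd y" d] that by (auto simp: mem_Times_iff)
    have sm: "smooth_on (model (prod_mfd M N)) (snd c ` fst c \<times> snd d ` fst d) (\<lambda>y. snd c (fst (chart_inv (prod_chart c d) y)))"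
      by (rule smooth_on_cong[OF smooth_on_fst]) (rule cr(1)[symmetric])
    have sm': "smooth_on (model (prod_mfd M N)) (snd c ` fst c \<times> snd d ` fst d) (\<lambda>y. snd d (snd (chart_inv (prod_chart c d) y)))"
      by (rule smooth_on_cong[OF smooth_on_snd]) (rule cr(2)[symmetric])
    have op: "open_in (model (prod_mfd M N)) (snd c ` fst c \<times> snd d ` fst d)"
      using open_in_Times[OF c(3) d(3)] by simp
    have im: "snd (prod_chart c d) x \<in> snd c ` fst c \<times> snd d ` fst d" "snd c ` fst c \<times> snd d ` fst d \<subseteq> snd (prod_chart c d) ` fst (prod_chart c d)"
      using cd(3) by (auto simp: prod_chart_image)
    show "local_rep (model (prod_mfd M N)) (pts (prod_mfd M N)) (prod_chart c d) c fst x (snd c ` fst c \<times> snd d ` fst d)"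
      unfolding local_rep_def using cd(3) op im pt sm by simp
    show "local_rep (model (prod_mfd M N)) (pts (prod_mfd M N)) (prod_chart c d) d snd x (snd c ` fst c \<times> snd d ` fst d)"
      unfolding local_rep_def using cd(3) op im pt sm' by simp
  qed
  have ex: "\<exists>c\<in>atlas M. \<exists>d\<in>atlas N. x \<in> fst c \<times> fst d" if "x \<in> pts (prod_mfd M N)" for x
    using chart_at_atlas[OF M, of "fst x"] chart_at_atlas[OF N, of "snd x"] that by (auto simp: mem_Times_iff)
  show "smooth_map (prod_mfd M N) M fst"
  proof (rule smooth_map_onI[OF MN M])
    fix x assume "x \<in> pts (prod_mfd M N)"
    from ex[OF this] obtain c d where cd: "c \<in> atlas M" "d \<in> atlas N" "x \<in> fst c \<times> fst d"
      by blast
    show "\<exists>c\<in>max_atlas (prod_mfd M N). \<exists>d\<in>max_atlas M. \<exists>U. local_rep (model (prod_mfd M N)) (pts (prod_mfd M N)) c d fst x U"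
      using rep(1)[OF cd] prod_chart_max_atlas[OF M N cd(1,2)] charted_atlas_subset[OF M] cd(1) by blast
  qed auto
  show "smooth_map (prod_mfd M N) N snd"
  proof (rule smooth_map_onI[OF MN N])
    fix x assume "x \<in> pts (prod_mfd M N)"
    from ex[OF this] obtain c d where cd: "c \<in> atlas M" "d \<in> atlas N" "x \<in> fst c \<times> fst d"
      by blast
    show "\<exists>c\<in>max_atlas (prod_mfd M N). \<exists>d\<in>max_atlas N. \<exists>U. local_rep (model (prod_mfd M N)) (pts (prod_mfd M N)) c d snd x U"
      using rep(2)[OF cd] prod_chart_max_atlas[OF M N cd(1,2)] charted_atlas_subset[OF N] cd(2) by blast
  qed auto
qed

lemma smooth_map_on_Pair:
  fixes M :: "('p, 'm::dual_separating) mfd" and N :: "('q, 'n::dual_separating) mfd" and P :: "('r, 'l::dual_separating) mfd"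
  assumes M: "charted M" and N: "charted N" and P: "charted P"
    and f: "smooth_map_on M N W f" and g: "smooth_map_on M P W g"
  shows "smooth_map_on M (prod_mfd N P) W (\<lambda>x. (f x, g x))"
proof (rule smooth_map_onI[OF M charted_prod[OF N P]])
  show "W \<subseteq> pts M" "(\<lambda>x. (f x, g x)) ` W \<subseteq> pts (prod_mfd N P)"
    using smooth_map_on_subset[OF f] smooth_map_on_image[OF f] smooth_map_on_image[OF g] by auto
  fix x assume x: "x \<in> W"
  then have xp: "x \<in> pts M" "f x \<in> pts N" "g x \<in> pts P"
    using smooth_map_on_subset[OF f] smooth_map_on_image[OF f] smooth_map_on_image[OF g] by auto
  define c d e where "c = chart_at M x" and "d = chart_at N (f x)" and "e = chart_at P (g x)"
  have c: "c \<in> max_atlas M" "x \<in> fst c" and d: "d \<in> atlas N" "d \<in> max_atlas N" "f x \<in> fst d"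
    and e: "e \<in> atlas P" "e \<in> max_atlas P" "g x \<in> fst e"
    unfolding c_def d_def e_def
    using chart_at_max_atlas[OF M xp(1)] chart_at_max_atlas[OF N xp(2)] chart_at_max_atlas[OF P xp(3)]
      chart_at_atlas[OF N xp(2)] chart_at_atlas[OF P xp(3)] by auto
  define A where "A = snd c ` {x \<in> fst c \<inter> W. f x \<in> fst d}"
  define B where "B = snd c ` {x \<in> fst c \<inter> W. g x \<in> fst e}"
  note rf = smooth_map_on_rep[OF M N f c d(2,3) x, folded A_def]
  note rg = smooth_map_on_rep[OF M P g c e(2,3) x, folded B_def]
  have "local_rep (model M) W c (prod_chart d e) (\<lambda>x. (f x, g x)) x (A \<inter> B)"
    unfolding local_rep_def
  proof (intro conjI)
    show "smooth_on (model M) (A \<inter> B) (\<lambda>y. snd (prod_chart d e) (f (chart_inv c y), g (chart_inv c y)))"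
      using rf rg unfolding local_rep_def snd_conv map_prod_simp
      by (intro smooth_on_Pair) (auto intro: smooth_on_subset)
  qed (use rf rg in \<open>auto simp: local_rep_def\<close>)
  then show "\<exists>c\<in>max_atlas M. \<exists>d\<in>max_atlas (prod_mfd N P). \<exists>U. local_rep (model M) W c d (\<lambda>x. (f x, g x)) x U"
    using c(1) prod_chart_max_atlas[OF N P d(1) e(1)] by blast
qed

section \<open>Vector spaces as manifolds\<close>

lemma vec_mfd_simps [simp]: "pts (vec_mfd W) = W" "model (vec_mfd W) = W" "atlas (vec_mfd W) = {(W, \<lambda>x. x)}"
  by (simp_all add: vec_mfd_def)

lemma chart_inv_vec: "y \<in> W \<Longrightarrow> chart_inv (W, \<lambda>x. x) y = y"
  using chart_inv_left[of "(W, \<lambda>x. x)" y] by simp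

lemma charted_vec_mfd:
  fixes W :: "'m::dual_separating set"
  assumes "fin_dim_subspace W"
  shows "charted (vec_mfd W)"
proof -
  have "smooth_on W W ((\<lambda>x. x) \<circ> chart_inv (W, \<lambda>x. x))"
    by (rule smooth_on_cong[OF smooth_on_ident]) (simp add: chart_inv_vec)
  then show ?thesis
    using assms by (simp add: charted_def is_chart_def compatible_def smooth_transition_def)
qed

lemma vec_chart: "fin_dim_subspace (W :: 'm::dual_separating set) \<Longrightarrow> (W, \<lambda>x. x) \<in> max_atlas (vec_mfd W)"
  using charted_atlas_subset[OF charted_vec_mfd] by auto

lemma chart_at_vec: "x \<in> W \<Longrightarrow> chart_at (vec_mfd W) x = (W, \<lambda>x. x)"
  unfolding chart_at_def by (rule some_equality) auto

lemma smooth_map_on_vecD: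
  fixes M :: "('p, 'm::dual_separating) mfd" and W :: "'n::dual_separating set"
  assumes M: "charted M" and W: "fin_dim_subspace W" and f: "smooth_map_on M (vec_mfd W) Q f" and c: "c \<in> max_atlas M"
  shows "open_in (model M) (snd c ` (fst c \<inter> Q))" "smooth_on (model M) (snd c ` (fst c \<inter> Q)) (\<lambda>y. f (chart_inv c y))"
proof -
  have "{x \<in> fst c \<inter> Q. f x \<in> fst (W, \<lambda>x. x)} = fst c \<inter> Q"
    using smooth_map_on_image[OF f] by auto
  then show "open_in (model M) (snd c ` (fst c \<inter> Q))" "smooth_on (model M) (snd c ` (fst c \<inter> Q)) (\<lambda>y. f (chart_inv c y))"
    using smooth_map_onD[OF M charted_vec_mfd[OF W] f c vec_chart[OF W]] by simp_all
qed

lemma smooth_map_vecI: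
  fixes M :: "('p, 'm::dual_separating) mfd" and W :: "'n::dual_separating set"
  assumes M: "charted M" and W: "fin_dim_subspace W" and im: "\<And>x. x \<in> pts M \<Longrightarrow> f x \<in> W"
    and sm: "\<And>c. c \<in> atlas M \<Longrightarrow> smooth_on (model M) (snd c ` fst c) (\<lambda>y. f (chart_inv c y))"
  shows "smooth_map M (vec_mfd W) f"
proof (rule smooth_map_onI[OF M charted_vec_mfd[OF W]])
  fix x assume x: "x \<in> pts M"
  note c = chart_at_atlas[OF M x]
  note cD = charted_atlasD[OF M c(1)]
  have "local_rep (model M) (pts M) (chart_at M x) (W, \<lambda>x. x) f x (snd (chart_at M x) ` fst (chart_at M x))"
    unfolding local_rep_def using c(2) cD sm[OF c(1)] im chart_inv_in[of _ "chart_at M x"] by auto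
  then show "\<exists>c\<in>max_atlas M. \<exists>d\<in>max_atlas (vec_mfd W). \<exists>U. local_rep (model M) (pts M) c d f x U"
    using vec_chart[OF W] chart_at_max_atlas[OF M x] by blast
qed (use im in auto)

text \<open>The second factor has the identity as its only chart, so only the charts of
  \<open>M\<close> remain to be tested, with the vector as a free variable.\<close>

lemma smooth_map_prod_vecI:
  fixes M :: "('p, 'm::dual_separating) mfd" and V :: "'l::dual_separating set" and W :: "'n::dual_separating set"
  assumes M: "charted M" and V: "fin_dim_subspace V" and W: "fin_dim_subspace W"
    and im: "\<And>x v. x \<in> pts M \<Longrightarrow> v \<in> V \<Longrightarrow> f (x, v) \<in> W"
    and sm: "\<And>c. c \<in> atlas M \<Longrightarrow> smooth_on (model M \<times> V) (snd c ` fst c \<times> V) (\<lambda>p. f (chart_inv c (fst p), snd p))"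
  shows "smooth_map (prod_mfd M (vec_mfd V)) (vec_mfd W) f"
proof (rule smooth_map_vecI[OF charted_prod[OF M charted_vec_mfd[OF V]] W])
  fix p assume "p \<in> atlas (prod_mfd M (vec_mfd V))"
  then obtain c where c: "c \<in> atlas M" "p = prod_chart c (V, \<lambda>x. x)"
    unfolding prod_mfd_atlas by auto
  have "smooth_on (model M \<times> V) (snd c ` fst c \<times> V) (\<lambda>y. f (chart_inv p y))"
  proof (rule smooth_on_cong[OF sm[OF c(1)]])
    fix q assume "q \<in> snd c ` fst c \<times> V"
    then show "f (chart_inv c (fst q), snd q) = f (chart_inv p q)"
      using chart_inv_prod[of c "(V, \<lambda>x. x)" "fst q" "snd q"] charted_atlasD(1)[OF M c(1)] chart_inv_vec[of "snd q" V]
      by (auto simp: c(2))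
  qed
  moreover have "snd p ` fst p = snd c ` fst c \<times> V"
    by (simp add: c(2) prod_chart_image)
  ultimately show "smooth_on (model (prod_mfd M (vec_mfd V))) (snd p ` fst p) (\<lambda>y. f (chart_inv p y))"
    by simp
qed (use im in auto)

lemma smooth_map_prod_vecD:
  fixes M :: "('p, 'm::dual_separating) mfd" and V :: "'l::dual_separating set" and W :: "'n::dual_separating set"
  assumes M: "charted M" and V: "fin_dim_subspace V" and W: "fin_dim_subspace W"
    and f: "smooth_map (prod_mfd M (vec_mfd V)) (vec_mfd W) f" and c: "c \<in> atlas M"
  shows "smooth_on (model M \<times> V) (snd c ` fst c \<times> V) (\<lambda>p. f (chart_inv c (fst p), snd p))"
proof -
  let ?p = "prod_chart c (V, \<lambda>x. x)"
  have p: "?p \<in> max_atlas (prod_mfd M (vec_mfd V))"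
    by (rule prod_chart_max_atlas[OF M charted_vec_mfd[OF V] c]) simp
  have "fst ?p \<inter> pts (prod_mfd M (vec_mfd V)) = fst ?p"
    using charted_atlasD(2)[OF M c] by auto
  then have "smooth_on (model M \<times> V) (snd c ` fst c \<times> V) (\<lambda>y. f (chart_inv ?p y))"
    using smooth_map_on_vecD(2)[OF charted_prod[OF M charted_vec_mfd[OF V]] W f p] by (simp add: prod_chart_image)
  then show ?thesis
  proof (rule smooth_on_cong)
    fix q assume "q \<in> snd c ` fst c \<times> V"
    then show "f (chart_inv ?p q) = f (chart_inv c (fst q), snd q)"
      using chart_inv_prod[of c "(V, \<lambda>x. x)" "fst q" "snd q"] charted_atlasD(1)[OF M c] chart_inv_vec[of "snd q" V]
      by auto
  qed
qed

section \<open>Submanifolds\<close>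

lemma weakly_chartedD:
  assumes "weakly_charted M"
  shows "fin_dim_subspace (model M)" "c \<in> atlas M \<Longrightarrow> inj_on (snd c) (fst c)"
    "x \<in> pts M \<Longrightarrow> \<exists>c\<in>atlas M. x \<in> fst c"
  using assms unfolding weakly_charted_def by blast+

text \<open>This is how the inverse function theorem produces charts: \<open>F\<close> with local
  inverse \<open>g\<close> changes the coordinates of \<open>c\<close>. Compatibility has to be
  verified against atlas charts only, as these define the maximal atlas.\<close>

lemma max_atlas_diffeo:
  fixes M :: "('p, 'm::dual_separating) mfd"
  assumes M: "weakly_charted M" and c: "c \<in> max_atlas M"
    and U: "open_in (model M) U" "U \<subseteq> snd c ` fst c"
    and F: "smooth_on (model M) U F" "open_in (model M) (F ` U)" "smooth_on (model M) (F ` U) g"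
      "\<And>y. y \<in> U \<Longrightarrow> g (F y) = y"
  shows "(chart_inv c ` U, \<lambda>x. F (snd c x)) \<in> max_atlas M"
proof -
  let ?V = "model M" and ?c' = "(chart_inv c ` U, \<lambda>x. F (snd c x))"
  note V = weakly_chartedD(1)[OF M]
  note V' = fin_dim_subspaceD(1)[OF V]
  note cD = max_atlasD[OF c]
  have cinv: "snd c (chart_inv c y) = y" "chart_inv c y \<in> fst c" if "y \<in> U" for y
    using chart_inv_right[of y c] chart_inv_in[of y c] that U(2) by auto
  have c'c: "chart_inv c ` U \<subseteq> fst c" "\<And>x. x \<in> chart_inv c ` U \<Longrightarrow> snd c x \<in> U"
    using cinv by auto
  have im: "snd ?c' ` fst ?c' = F ` U"
    using cinv by (force simp: image_iff)
  have inj: "inj_on (snd ?c') (fst ?c')"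
    unfolding snd_conv fst_conv
  proof (rule inj_onI)
    fix x y assume xy: "x \<in> chart_inv c ` U" "y \<in> chart_inv c ` U" "F (snd c x) = F (snd c y)"
    then have "snd c x = snd c y"
      using F(4) c'c(2) by metis
    then show "x = y"
      using cD(2) c'c(1) xy by (auto dest: inj_onD)
  qed
  have c'inv: "chart_inv ?c' z = chart_inv c (g z)" "g z \<in> U" "chart_inv c (g z) \<in> fst ?c'" if "z \<in> F ` U" for z
  proof -
    from that obtain y where y: "y \<in> U" "z = F y"
      by blast
    show "g z \<in> U"
      using y F(4) by simp
    show "chart_inv c (g z) \<in> fst ?c'"
      using y F(4) by simp
    have "chart_inv ?c' (snd ?c' (chart_inv c y)) = chart_inv c y"
      using y by (intro chart_inv_left[OF inj]) auto
    then show "chart_inv ?c' z = chart_inv c (g z)"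
      using y cinv F(4) by simp
  qed
  have "compatible ?V ?c' d" if d: "d \<in> atlas M" for d
  proof -
    note injd = weakly_chartedD(2)[OF M d]
    define A where "A = snd c ` (fst c \<inter> fst d)"
    define B where "B = snd d ` (fst d \<inter> fst c)"
    have A: "open_in ?V A" "smooth_on ?V A (\<lambda>z. snd d (chart_inv c z))"
      and B: "open_in ?V B" "smooth_on ?V B (\<lambda>z. snd c (chart_inv d z))"
      using c d by (auto simp: max_atlas_def compatible_def smooth_transition_def A_def B_def o_def)
    have A_in: "chart_inv c z \<in> fst d" if "z \<in> A" for z
      using that chart_inv_left[OF cD(2)] by (auto simp: A_def)
    have B_in: "chart_inv d z \<in> fst d" "chart_inv d z \<in> fst c" "snd d (chart_inv d z) = z" if "z \<in> B" for z
      using that chart_inv_left[OF injd] by (auto simp: B_def)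
    have im1: "snd ?c' ` (fst ?c' \<inter> fst d) = {z \<in> F ` U. g z \<in> A}"
    proof (intro equalityI subsetI)
      fix z assume "z \<in> snd ?c' ` (fst ?c' \<inter> fst d)"
      then obtain y where y: "y \<in> U" "chart_inv c y \<in> fst d" "z = F (snd c (chart_inv c y))"
        by auto
      then have "z = F y"
        using cinv by auto
      moreover have "y \<in> A"
        unfolding A_def using y(2) cinv[OF y(1)] by (intro image_eqI[of y _ "chart_inv c y"]) auto
      ultimately show "z \<in> {z \<in> F ` U. g z \<in> A}"
        using y(1) F(4)[OF y(1)] by simp
    next
      fix z assume "z \<in> {z \<in> F ` U. g z \<in> A}"
      then obtain y where y: "y \<in> U" "z = F y" "y \<in> A"
        using F(4) by auto
      then have "chart_inv c y \<in> fst ?c' \<inter> fst d" "z = snd ?c' (chart_inv c y)"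
        using A_in cinv by auto
      then show "z \<in> snd ?c' ` (fst ?c' \<inter> fst d)"
        by blast
    qed
    have op1: "open_in ?V {z \<in> F ` U. g z \<in> A}"
      by (rule open_in_preimage[OF smooth_on_imp_continuous_on[OF F(3)] F(2) _ A(1)])
         (use c'inv(2) openin_imp_subset[OF U(1)] in auto)
    have "smooth_on ?V {z \<in> F ` U. g z \<in> A} (\<lambda>z. snd d (chart_inv c (g z)))"
      by (rule smooth_on_comp[OF V' op1 V openin_imp_subset[OF A(1)] _ smooth_on_subset[OF F(3) _ subset_refl] A(2)]) auto
    then have "smooth_on ?V {z \<in> F ` U. g z \<in> A} (snd d \<circ> chart_inv ?c')"
      by (rule smooth_on_cong) (use c'inv(1) in auto)
    then have t1: "smooth_transition ?V ?c' d"
      unfolding smooth_transition_def im1 using op1 by blast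
    have im2: "snd d ` (fst d \<inter> fst ?c') = {z \<in> B. snd c (chart_inv d z) \<in> U}"
    proof (intro equalityI subsetI)
      fix z assume "z \<in> snd d ` (fst d \<inter> fst ?c')"
      then obtain x where x: "x \<in> fst d" "x \<in> chart_inv c ` U" "z = snd d x"
        by auto
      then show "z \<in> {z \<in> B. snd c (chart_inv d z) \<in> U}"
        using c'c chart_inv_left[OF injd x(1)] by (auto simp: B_def)
    next
      fix z assume z: "z \<in> {z \<in> B. snd c (chart_inv d z) \<in> U}"
      then have zB: "z \<in> B" "snd c (chart_inv d z) \<in> U"
        by auto
      have "chart_inv c (snd c (chart_inv d z)) = chart_inv d z"
        by (rule chart_inv_left[OF cD(2) B_in(2)[OF zB(1)]])
      then have "chart_inv d z \<in> fst d \<inter> fst ?c'"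
        using zB B_in by (metis IntI fst_conv imageI)
      then show "z \<in> snd d ` (fst d \<inter> fst ?c')"
        using B_in(3)[OF zB(1)] by (metis imageI)
    qed
    have op2: "open_in ?V {z \<in> B. snd c (chart_inv d z) \<in> U}"
      by (rule open_in_preimage[OF smooth_on_imp_continuous_on[OF B(2)] B(1) _ U(1)])
         (use B_in(2) openin_imp_subset[OF cD(4)] in auto)
    have "smooth_on ?V {z \<in> B. snd c (chart_inv d z) \<in> U} (\<lambda>z. F (snd c (chart_inv d z)))"
      by (rule smooth_on_comp[OF V' op2 V openin_imp_subset[OF U(1)] _ smooth_on_subset[OF B(2) _ subset_refl] F(1)]) auto
    then have t2: "smooth_transition ?V d ?c'"
      unfolding smooth_transition_def im2 using op2 by (simp add: o_def)
    show ?thesis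
      using t1 t2 by (simp add: compatible_def)
  qed
  moreover have "is_chart (pts M) ?V ?c'"
    unfolding is_chart_def im using inj F(2) c'c(1) cD(3) by auto
  ultimately show ?thesis
    by (simp add: max_atlas_def)
qed

lemma max_atlas_restrict:
  fixes M :: "('p, 'm::dual_separating) mfd"
  assumes M: "weakly_charted M" and c: "c \<in> max_atlas M" and U: "open_in (model M) U" "U \<subseteq> snd c ` fst c"
  shows "(chart_inv c ` U, snd c) \<in> max_atlas M"
proof -
  have "(chart_inv c ` U, \<lambda>x. snd c x) \<in> max_atlas M"
    using U by (intro max_atlas_diffeo[OF M c, where F = "\<lambda>x. x" and g = "\<lambda>x. x"] smooth_on_ident) auto
  then show ?thesis
    by simp
qed

definition submfd_model :: "('p, 'm::real_normed_vector) mfd \<Rightarrow> 'p set \<Rightarrow> 'm set" where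
  "submfd_model M S = (SOME L. slice_model M S L)"

lemma submfd_simps [simp]:
  "pts (submfd M S) = S" "model (submfd M S) = submfd_model M S"
  by (simp_all add: submfd_def submfd_model_def Let_def)

lemma submfd_atlas: "k \<in> atlas (submfd M S) \<longleftrightarrow> (\<exists>c. slice_chart M S (submfd_model M S) c \<and> k = (S \<inter> fst c, snd c))"
  by (simp add: submfd_def submfd_model_def Let_def del: split_paired_Ex) blast

lemma slice_model_submfd_model:
  assumes "\<exists>L. slice_model M S L"
  shows "slice_model M S (submfd_model M S)"
  unfolding submfd_model_def using assms by (rule someI_ex)

text \<open>Injectivity of the chart localises the slice condition to smaller domains, so that slice
  charts can be restricted.\<close>

lemma slice_chart_image:
  assumes "slice_chart M S L c"
  shows "snd c ` (S \<inter> fst c) = snd c ` fst c \<inter> L"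
    "A \<subseteq> fst c \<Longrightarrow> snd c ` (S \<inter> A) = snd c ` A \<inter> L"
proof -
  show *: "snd c ` (S \<inter> fst c) = snd c ` fst c \<inter> L"
    using assms by (simp add: slice_chart_def)
  have inj: "inj_on (snd c) (fst c)"
    using assms by (auto simp: slice_chart_def dest: max_atlasD)
  assume A: "A \<subseteq> fst c"
  show "snd c ` (S \<inter> A) = snd c ` A \<inter> L"
  proof (intro equalityI subsetI)
    fix y assume "y \<in> snd c ` (S \<inter> A)"
    then show "y \<in> snd c ` A \<inter> L"
      using * A by blast
  next
    fix y assume "y \<in> snd c ` A \<inter> L"
    then obtain x where x: "x \<in> A" "y = snd c x" "y \<in> L"
      by blast
    then have "snd c x \<in> snd c ` (S \<inter> fst c)"
      using * A by blast
    then have "x \<in> S"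
      using inj x A by (auto dest: inj_onD)
    then show "y \<in> snd c ` (S \<inter> A)"
      using x by blast
  qed
qed

lemma open_in_Int_subspace:
  assumes "open_in V U" "L \<subseteq> V"
  shows "open_in L (U \<inter> L)"
  using assms unfolding openin_open by blast

text \<open>Transitions of the submanifold are restrictions to the slice space of transitions in the
  maximal atlas of \<open>M\<close>, and these are smooth already for a weakly charted
  \<open>M\<close>. This is why submanifolds of jet manifolds are charted.\<close>

lemma charted_submfd:
  fixes M :: "('p, 'm::dual_separating) mfd"
  assumes M: "weakly_charted M" and S: "\<exists>L. slice_model M S L"
  shows "charted (submfd M S)"
proof -
  let ?L = "submfd_model M S"
  have L: "subspace ?L" "?L \<subseteq> model M" "\<And>x. x \<in> S \<Longrightarrow> \<exists>c. x \<in> fst c \<and> slice_chart M S ?L c"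
    using slice_model_submfd_model[OF S] by (auto simp: slice_model_def)
  show ?thesis
    unfolding charted_def
  proof (intro conjI ballI)
    show "fin_dim_subspace (model (submfd M S))"
      using fin_dim_subspace_subset[OF weakly_chartedD(1)[OF M] L(1,2)] by simp
    show "is_chart (pts (submfd M S)) (model (submfd M S)) k" if "k \<in> atlas (submfd M S)" for k
    proof -
      from that obtain c where c: "slice_chart M S ?L c" "k = (S \<inter> fst c, snd c)"
        unfolding submfd_atlas by blast
      have "c \<in> max_atlas M"
        using c(1) by (simp add: slice_chart_def)
      from max_atlasD[OF this] show ?thesis
        unfolding is_chart_def c(2) fst_conv snd_conv slice_chart_image(1)[OF c(1)]
        using open_in_Int_subspace[OF _ L(2)] by (auto simp: inj_on_Int)
    qed
    show "(\<Union>k\<in>atlas (submfd M S). fst k) = pts (submfd M S)"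
    proof (intro equalityI subsetI)
      fix x assume "x \<in> (\<Union>k\<in>atlas (submfd M S). fst k)"
      then obtain k where k: "k \<in> atlas (submfd M S)" "x \<in> fst k"
        by blast
      then show "x \<in> pts (submfd M S)"
        unfolding submfd_atlas by auto
    next
      fix x assume "x \<in> pts (submfd M S)"
      then have x: "x \<in> S"
        by simp
      then obtain c where "x \<in> fst c" "slice_chart M S ?L c"
        using L(3) by blast
      then have "(S \<inter> fst c, snd c) \<in> atlas (submfd M S)" "x \<in> fst (S \<inter> fst c, snd c)"
        unfolding submfd_atlas using x by (blast, simp)
      then show "x \<in> (\<Union>k\<in>atlas (submfd M S). fst k)"
        by blast
    qed
    have trans: "smooth_transition ?L k k'" if k: "k \<in> atlas (submfd M S)" and k': "k' \<in> atlas (submfd M S)" for k k'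
    proof -
      from k k' obtain c d where c: "slice_chart M S ?L c" "k = (S \<inter> fst c, snd c)"
        and d: "slice_chart M S ?L d" "k' = (S \<inter> fst d, snd d)"
        unfolding submfd_atlas by blast
      have cd: "c \<in> max_atlas M" "d \<in> max_atlas M"
        using c d by (auto simp: slice_chart_def)
      note t = max_atlas_compatible[OF M cd]
      have eq: "snd k ` (fst k \<inter> fst k') = snd c ` (fst c \<inter> fst d) \<inter> ?L"
        using slice_chart_image(2)[OF c(1), of "fst c \<inter> fst d"] by (simp add: c(2) d(2) Int_ac)
      have inv: "chart_inv k y = chart_inv c y" if "y \<in> snd c ` (fst c \<inter> fst d) \<inter> ?L" for y
      proof -
        from that obtain x where x: "x \<in> fst k \<inter> fst k'" "y = snd k x"
          unfolding eq[symmetric] by blast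
        have "inj_on (snd k) (fst k)"
          using max_atlasD(2)[OF cd(1)] by (auto simp: c(2) inj_on_def)
        from chart_inv_left[OF this] have "chart_inv k (snd k x) = x"
          using x by blast
        moreover have "chart_inv c (snd c x) = x"
          using x by (intro chart_inv_left[OF max_atlasD(2)[OF cd(1)]]) (simp add: c(2))
        ultimately show ?thesis
          using x by (simp add: c(2))
      qed
      have "smooth_on ?L (snd c ` (fst c \<inter> fst d) \<inter> ?L) (snd d \<circ> chart_inv c)"
        by (rule smooth_on_subset[of "model M" "snd c ` (fst c \<inter> fst d)"])
           (use t L(2) in \<open>auto simp: smooth_transition_def\<close>)
      then have "smooth_on ?L (snd c ` (fst c \<inter> fst d) \<inter> ?L) (snd k' \<circ> chart_inv k)"
        by (rule smooth_on_cong) (simp add: inv d(2))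
      then show ?thesis
        unfolding smooth_transition_def eq
        using t open_in_Int_subspace[OF _ L(2)] by (auto simp: smooth_transition_def)
    qed
    show "compatible (model (submfd M S)) k k'" if "k \<in> atlas (submfd M S)" "k' \<in> atlas (submfd M S)" for k k'
      using trans[OF that] trans[OF that(2,1)] by (simp add: compatible_def)
  qed
qed

text \<open>The kernels of the differentials vary with the point, but one model space has to serve
  all points; the kernel \<open>L\<close> at \<open>x0\<close> is taken. A map \<open>F\<close> that
  takes values in \<open>L\<close> exactly on the fibre, with derivative onto, becomes a slice chart
  by the inverse function theorem.\<close>

lemma fibre_slice_model:
  fixes M :: "('p, 'm::dual_separating) mfd" and N :: "('q, 'n::dual_separating) mfd"
  assumes M: "charted M" and N: "charted N" and f: "smooth_map M N f"
    and surj: "\<And>x. x \<in> pts M \<Longrightarrow> mdiff M N f x ` model M = model N"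
    and x0: "x0 \<in> pts M" "f x0 = q"
  shows "\<exists>L. slice_model M {x \<in> pts M. f x = q} L"
proof -
  let ?V = "model M" and ?W = "model N" and ?S = "{x \<in> pts M. f x = q}"
  note V = charted_fin_dim[OF M] and W = charted_fin_dim[OF N]
  note V' = fin_dim_subspaceD(1)[OF V]
  define D where "D = mdiff M N f x0"
  have D: "linear_betw ?V ?W D" "D ` ?V = ?W"
    unfolding D_def using mdiff_linear[OF M N f x0(1)] surj[OF x0(1)] by auto
  define L where "L = {v \<in> ?V. D v = 0}"
  have LV: "L \<subseteq> ?V" and Lsub: "subspace L"
    unfolding L_def using subspace_kernel_betw[OF D(1) V'] by auto
  note L = fin_dim_subspace_subset[OF V Lsub LV]
  obtain R where R: "bounded_linear R" "\<And>w. R w \<in> ?V" "\<And>w. D (R w) = proj (D ` ?V) w"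
    using linear_right_inverse[OF D(1) V W] by blast
  have DR: "D (R w) = w" if "w \<in> ?W" for w
    using R(3) proj_id[OF W that] D(2) by simp
  have "\<exists>c. x \<in> fst c \<and> slice_chart M ?S L c" if x: "x \<in> ?S" for x
  proof -
    have xM: "x \<in> pts M" "f x = q" and qN: "q \<in> pts N"
      using x smooth_map_on_image[OF f] by auto
    define c d where "c = chart_at M x" and "d = chart_at N q"
    have c: "c \<in> max_atlas M" "x \<in> fst c" and d: "d \<in> max_atlas N" "q \<in> fst d"
      unfolding c_def d_def using chart_at_max_atlas[OF M xM(1)] chart_at_max_atlas[OF N qN] by auto
    note ic = chart_inv_left[OF max_atlasD(2)[OF c(1)]]
    define U where "U = snd c ` {x \<in> fst c \<inter> pts M. f x \<in> fst d}"
    define h where "h y = snd d (f (chart_inv c y))" for y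
    have U: "open_in ?V U" "smooth_on ?V U h"
      unfolding U_def h_def using smooth_map_onD[OF M N f c(1) d(1)] by auto
    have U_in: "chart_inv c y \<in> fst c" "f (chart_inv c y) \<in> fst d" "snd c (chart_inv c y) = y" if "y \<in> U" for y
      using that ic by (auto simp: U_def)
    have hW: "h ` U \<subseteq> ?W"
      using U_in(2) openin_imp_subset[OF max_atlasD(4)[OF d(1)]] by (auto simp: h_def)
    have xU: "snd c x \<in> U"
      using c(2) d(2) xM by (auto simp: U_def)
    define D' where "D' = dir_deriv h (snd c x)"
    have D': "linear_betw ?V ?W D'" "D' ` ?V = ?W"
    proof -
      show "linear_betw ?V ?W D'"
        unfolding D'_def by (rule linear_betw_dir_deriv[OF U(2) V U(1) xU W hW])
      have "D' v = mdiff M N f x v" for v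
        by (simp add: D'_def mdiff_eq h_def[abs_def] c_def d_def xM(2))
      then show "D' ` ?V = ?W"
        using surj[OF xM(1)] by simp
    qed
    define L' where "L' = {v \<in> ?V. D' v = 0}"
    have L'V: "L' \<subseteq> ?V" and L'sub: "subspace L'"
      unfolding L'_def using subspace_kernel_betw[OF D'(1) V'] by auto
    note L' = fin_dim_subspace_subset[OF V L'sub L'V]
    have "card (model_basis L) \<le> card (model_basis L')"
      using rank_nullity[OF D(1) V W D(2)] rank_nullity[OF D'(1) V W D'(2)] by (simp add: L_def L'_def)
    \<comment> \<open>By rank and nullity all kernels have the same dimension, so the kernel at
      \<open>x\<close> can be mapped onto \<open>L\<close>; \<open>s\<close> is defined everywhere,
      with values in \<open>L\<close>.\<close>
    then obtain s where s: "bounded_linear s" "\<And>v. s v \<in> L" "s ` L' = L"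
      using linear_onto[OF L L'] by blast
    define q0 where "q0 = snd d q"
    have q0: "q0 \<in> ?W"
      using d(2) openin_imp_subset[OF max_atlasD(4)[OF d(1)]] by (auto simp: q0_def)
    \<comment> \<open>\<open>R\<close> lifts the value of \<open>f\<close> to a complement of
      \<open>L\<close>, and \<open>s\<close> fills in \<open>L\<close>. As \<open>D\<close> undoes
      \<open>R\<close> and kills \<open>L\<close>, \<open>D (F y)\<close> is
      \<open>h y - q0\<close>, which vanishes exactly on the fibre.\<close>
    define F where "F y = R (h y - q0) + s y" for y
    have F: "smooth_on ?V U F"
      unfolding F_def
      by (intro smooth_on_add smooth_on_linear[OF s(1)] smooth_on_bounded_linear[OF R(1)] smooth_on_diff smooth_on_const U(2))
    have sV: "s v \<in> ?V" for v
      using s(2) LV by auto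
    have FV: "F ` U \<subseteq> ?V"
      using R(2) sV V' by (auto simp: F_def intro!: subspace_add)
    have DF: "dir_deriv F (snd c x) v = R (D' v) + s v" if v: "v \<in> ?V" for v
    proof -
      have "(F has_derivative (\<lambda>v. R (dir_deriv h (snd c x) (proj ?V v) - 0) + s v)) (at (snd c x) within U)"
        unfolding F_def
        by (intro has_derivative_add has_derivative_diff has_derivative_const bounded_linear.has_derivative[OF R(1)]
            bounded_linear_imp_has_derivative[OF s(1)] smooth_on_has_derivative[OF U(2) V U(1) xU])
      from dir_deriv_eq[OF V' U(1) xU v this] show ?thesis
        by (simp add: proj_id[OF V v] D'_def)
    qed
    have "dir_deriv F (snd c x) ` ?V = ?V"
    proof (intro equalityI subsetI)
      fix w assume "w \<in> dir_deriv F (snd c x) ` ?V"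
      then show "w \<in> ?V"
        using linear_betw_in[OF linear_betw_dir_deriv[OF F V U(1) xU V FV]] by auto
    next
      \<comment> \<open>A vector \<open>v\<close> first matches the component of \<open>u\<close>
        lifted by \<open>R\<close>; a kernel vector \<open>k\<close> at \<open>x\<close> then
        corrects the remainder, which lies in \<open>L\<close>.\<close>
      fix u assume u: "u \<in> ?V"
      have DuW: "D u \<in> ?W"
        by (rule linear_betw_in[OF D(1) u])
      then obtain v where v: "v \<in> ?V" "D' v = D u"
        using D'(2) by (metis imageE)
      have "D (u - R (D u)) = 0"
        using linear_betw_diff[OF D(1) V' u R(2)] DR[OF DuW] by simp
      then have "u - R (D u) \<in> L"
        using u R(2) V' by (auto simp: L_def intro: subspace_diff)
      then have "u - R (D u) - s v \<in> L"
        using s(2) Lsub by (auto intro: subspace_diff)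
      then obtain k where k: "k \<in> L'" "u - R (D u) - s v = s k"
        using s(3) by (metis imageE)
      have kV: "k \<in> ?V" "D' k = 0"
        using k by (auto simp: L'_def)
      have "dir_deriv F (snd c x) (v + k) = R (D' (v + k)) + s (v + k)"
        using v kV V' by (intro DF subspace_add)
      also have "\<dots> = u"
        using linear_betw_add[OF D'(1) v(1) kV(1)] v kV k(2) linear_add[OF bounded_linear.linear[OF s(1)]]
        by (simp add: algebra_simps)
      finally show "u \<in> dir_deriv F (snd c x) ` ?V"
        using v kV V' by (metis imageI subspace_add)
    qed
    then obtain U0 g where U0: "open_in ?V U0" "snd c x \<in> U0" "U0 \<subseteq> U" "inj_on F U0" "open_in ?V (F ` U0)"
      "smooth_on ?V (F ` U0) g" "\<And>y. y \<in> U0 \<Longrightarrow> g (F y) = y"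
      and "\<And>x. x \<in> U0 \<Longrightarrow> dir_deriv F x ` ?V = ?V"
      by (rule smooth_inverse_function[OF V U(1) xU F FV]) (rule that)
    have U0c: "U0 \<subseteq> snd c ` fst c"
      using U0(3) by (auto simp: U_def)
    define c' where "c' = (chart_inv c ` U0, \<lambda>x. F (snd c x))"
    have c': "c' \<in> max_atlas M"
      unfolding c'_def
      by (rule max_atlas_diffeo[OF charted_weakly_charted[OF M] c(1) U0(1) U0c smooth_on_subset[OF F U0(3) subset_refl] U0(5-7)])
    have F_iff: "F y \<in> L \<longleftrightarrow> f (chart_inv c y) = q" if y: "y \<in> U0" for y
    proof -
      have yU: "y \<in> U"
        using y U0(3) by auto
      have hy: "h y - q0 \<in> ?W"
        using hW yU q0 fin_dim_subspaceD(1)[OF W] by (auto intro: subspace_diff)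
      have "D (F y) = h y - q0"
        using linear_betw_add[OF D(1) R(2) sV] DR[OF hy] s(2)[of y] by (simp add: F_def L_def)
      then have "F y \<in> L \<longleftrightarrow> h y = q0"
        using FV yU by (auto simp: L_def)
      also have "\<dots> \<longleftrightarrow> f (chart_inv c y) = q"
        using inj_on_eq_iff[OF max_atlasD(2)[OF d(1)] U_in(2)[OF yU] d(2)] by (simp add: h_def q0_def)
      finally show ?thesis .
    qed
    have c'_in: "p \<in> pts M" "snd c p \<in> U0" "chart_inv c (snd c p) = p" if "p \<in> fst c'" for p
    proof -
      from that obtain y where y: "y \<in> U0" "p = chart_inv c y"
        by (auto simp: c'_def)
      then have "snd c p = y"
        using U_in(3) U0(3) by auto
      then show "snd c p \<in> U0" "chart_inv c (snd c p) = p"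
        using y by auto
      show "p \<in> pts M"
        using y U_in(1) U0(3) max_atlasD(3)[OF c(1)] by auto
    qed
    have "snd c' ` (?S \<inter> fst c') = snd c' ` fst c' \<inter> L"
    proof (intro equalityI subsetI)
      fix z assume "z \<in> snd c' ` (?S \<inter> fst c')"
      then obtain p where p: "p \<in> fst c'" "f p = q" "z = snd c' p"
        by auto
      then have "z \<in> L"
        using F_iff[OF c'_in(2)[OF p(1)]] c'_in(3)[OF p(1)] by (simp add: c'_def)
      then show "z \<in> snd c' ` fst c' \<inter> L"
        using p by blast
    next
      fix z assume "z \<in> snd c' ` fst c' \<inter> L"
      then obtain p where p: "p \<in> fst c'" "z = snd c' p" "z \<in> L"
        by auto
      then have "f p = q"
        using F_iff[OF c'_in(2)[OF p(1)]] c'_in(3)[OF p(1)] by (simp add: c'_def)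
      then show "z \<in> snd c' ` (?S \<inter> fst c')"
        using p c'_in(1) by blast
    qed
    moreover have "x \<in> fst c'"
      using U0(2) ic[OF c(2)] by (auto simp: c'_def intro!: image_eqI[of x _ "snd c x"])
    ultimately show ?thesis
      using c' unfolding slice_chart_def by blast
  qed
  then have "slice_model M ?S L"
    using Lsub LV by (simp add: slice_model_def del: split_paired_Ex)
  then show ?thesis
    by blast
qed

section \<open>Manifolds embedded in a vector space\<close>

text \<open>
  Some chart near each point of \<open>Q\<close> is the restriction, along \<open>E\<close>, of a smooth map \<open>\<psi>\<close> on an open
  subset of \<open>V\<close>. Hence smoothness of a map into \<open>M\<close> can be tested after composing it with \<open>E\<close>.
\<close>

definition vec_embedding ::
  "('p, 'm::real_normed_vector) mfd \<Rightarrow> 'p set \<Rightarrow> 'v::real_normed_vector set \<Rightarrow> ('p \<Rightarrow> 'v) \<Rightarrow> bool" where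
  "vec_embedding M Q V E \<longleftrightarrow> fin_dim_subspace V \<and> E ` Q \<subseteq> V \<and>
     (\<forall>x\<in>Q. \<exists>c\<in>atlas M. x \<in> fst c \<and> fst c \<subseteq> Q \<and> smooth_on (model M) (snd c ` fst c) (\<lambda>y. E (chart_inv c y)) \<and>
       (\<exists>T \<psi>. open_in V T \<and> E x \<in> T \<and> smooth_on V T \<psi> \<and> \<psi> ` T \<subseteq> model M \<and>
         (\<forall>y\<in>Q. E y \<in> T \<longrightarrow> y \<in> fst c \<and> snd c y = \<psi> (E y))))"

lemma vec_embeddingE:
  assumes "vec_embedding M Q V E" "x \<in> Q"
  obtains c T \<psi> where "c \<in> atlas M" "x \<in> fst c" "fst c \<subseteq> Q" "smooth_on (model M) (snd c ` fst c) (\<lambda>y. E (chart_inv c y))"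
    "open_in V T" "E x \<in> T" "smooth_on V T \<psi>" "\<psi> ` T \<subseteq> model M"
    "\<And>y. y \<in> Q \<Longrightarrow> E y \<in> T \<Longrightarrow> y \<in> fst c" "\<And>y. y \<in> Q \<Longrightarrow> E y \<in> T \<Longrightarrow> snd c y = \<psi> (E y)"
proof -
  from assms obtain c where "c \<in> atlas M" "x \<in> fst c" "fst c \<subseteq> Q" "smooth_on (model M) (snd c ` fst c) (\<lambda>y. E (chart_inv c y))"
    and "\<exists>T \<psi>. open_in V T \<and> E x \<in> T \<and> smooth_on V T \<psi> \<and> \<psi> ` T \<subseteq> model M \<and>
         (\<forall>y\<in>Q. E y \<in> T \<longrightarrow> y \<in> fst c \<and> snd c y = \<psi> (E y))"
    unfolding vec_embedding_def by blast
  then show thesis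
    using that by blast
qed

text \<open>On their overlap a slice chart \<open>b\<close> and the given chart \<open>c\<close>
  differ by a smooth transition in either direction, so recovery of \<open>c\<close> from
  \<open>E\<close> gives recovery of \<open>b\<close>. The property thus descends to submanifolds
  whose charts are only known to exist.\<close>

lemma vec_embedding_submfd:
  fixes M :: "('p, 'm::dual_separating) mfd" and V :: "'v::dual_separating set"
  assumes M: "weakly_charted M" and S: "\<exists>L. slice_model M S L" and E: "vec_embedding M Q V E"
  shows "vec_embedding (submfd M S) (Q \<inter> S) V E"
  unfolding vec_embedding_def submfd_simps
proof (intro conjI ballI)
  have V: "fin_dim_subspace V" and EQ: "E ` Q \<subseteq> V"
    using E by (auto simp: vec_embedding_def)
  show "fin_dim_subspace V" "E ` (Q \<inter> S) \<subseteq> V"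
    using V EQ by auto
  let ?L = "submfd_model M S" and ?W = "model M"
  note W = weakly_chartedD(1)[OF M]
  note W' = fin_dim_subspaceD(1)[OF W]
  have L: "subspace ?L" "?L \<subseteq> ?W" and slices: "\<And>x. x \<in> S \<Longrightarrow> \<exists>c. x \<in> fst c \<and> slice_chart M S ?L c"
    using slice_model_submfd_model[OF S] by (auto simp: slice_model_def)
  note Lfin = fin_dim_subspace_subset[OF W L]
  fix x assume x: "x \<in> Q \<inter> S"
  then have xQ: "x \<in> Q" and xS: "x \<in> S"
    by auto
  obtain c T \<psi> where c: "c \<in> atlas M" "x \<in> fst c" "fst c \<subseteq> Q" "smooth_on ?W (snd c ` fst c) (\<lambda>y. E (chart_inv c y))"
    and T: "open_in V T" "E x \<in> T" "smooth_on V T \<psi>" "\<psi> ` T \<subseteq> ?W"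
    and \<psi>: "\<And>y. y \<in> Q \<Longrightarrow> E y \<in> T \<Longrightarrow> y \<in> fst c" "\<And>y. y \<in> Q \<Longrightarrow> E y \<in> T \<Longrightarrow> snd c y = \<psi> (E y)"
    using vec_embeddingE[OF E xQ] by metis
  note injc = weakly_chartedD(2)[OF M c(1)]
  obtain b where b: "x \<in> fst b" "slice_chart M S ?L b"
    using slices[OF xS] by blast
  then have bm: "b \<in> max_atlas M"
    by (simp add: slice_chart_def)
  note bD = max_atlasD[OF bm]
  define A where "A = snd b ` (fst b \<inter> fst c)"
  define B where "B = snd c ` (fst c \<inter> fst b)"
  have A: "open_in ?W A" "smooth_on ?W A (\<lambda>z. snd c (chart_inv b z))"
    and B: "open_in ?W B" "smooth_on ?W B (\<lambda>z. snd b (chart_inv c z))"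
    using bm c(1) by (auto simp: max_atlas_def compatible_def smooth_transition_def A_def B_def o_def)
  have inv_b: "chart_inv b (snd b y) = y" if "y \<in> fst b" for y
    by (rule chart_inv_left[OF bD(2) that])
  have inv_c: "chart_inv c (snd c y) = y" if "y \<in> fst c" for y
    by (rule chart_inv_left[OF injc that])
  have Ab: "A \<subseteq> snd b ` fst b"
    by (auto simp: A_def)
  have dom: "chart_inv b ` A = fst b \<inter> fst c"
    unfolding A_def using inv_b by (force simp: image_iff)
  have restr: "(fst b \<inter> fst c, snd b) \<in> max_atlas M"
    using max_atlas_restrict[OF M bm A(1) Ab] unfolding dom .
  have "slice_chart M S ?L (fst b \<inter> fst c, snd b)"
    unfolding slice_chart_def using restr slice_chart_image(2)[OF b(2), of "fst b \<inter> fst c"] by simp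
  then have katlas: "(S \<inter> (fst b \<inter> fst c), snd b) \<in> atlas (submfd M S)"
    unfolding submfd_atlas by (metis fst_conv snd_conv)
  let ?k = "(S \<inter> (fst b \<inter> fst c), snd b)"
  have inv_k: "chart_inv ?k (snd b y) = y" if "y \<in> fst ?k" for y
    using chart_inv_left[of ?k y] that bD(2) by (auto simp: inj_on_def)
  have kA: "snd ?k ` fst ?k \<subseteq> A"
    by (auto simp: A_def)
  have smA: "smooth_on ?W A (\<lambda>y. E (chart_inv c (snd c (chart_inv b y))))"
    by (rule smooth_on_comp[OF W' A(1) W openin_imp_subset[OF B(1)] _ A(2) smooth_on_subset[OF c(4) _ subset_refl]])
       (auto simp: A_def B_def inv_b)
  have smk: "smooth_on ?L (snd ?k ` fst ?k) (\<lambda>y. E (chart_inv ?k y))"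
  proof (rule smooth_on_cong)
    show "smooth_on ?L (snd ?k ` fst ?k) (\<lambda>y. E (chart_inv c (snd c (chart_inv b y))))"
      by (rule smooth_on_subset[OF smA kA L(2)])
    fix y assume "y \<in> snd ?k ` fst ?k"
    then obtain p where p: "p \<in> fst ?k" "y = snd b p"
      by auto
    then have "p \<in> fst b" "p \<in> fst c"
      by auto
    then show "E (chart_inv c (snd c (chart_inv b y))) = E (chart_inv ?k y)"
      unfolding p(2) inv_k[OF p(1)] by (simp add: inv_b inv_c)
  qed
  define T' where "T' = {z \<in> T. \<psi> z \<in> B}"
  have T': "open_in V T'"
    unfolding T'_def by (rule open_in_preimage[OF smooth_on_imp_continuous_on[OF T(3)] T(1) _ B(1)]) (use T(4) in auto)
  \<comment> \<open>The projection forces values in the slice space also where the argument does not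
    come from a point of \<open>S\<close>; on points of \<open>S\<close> it changes nothing.\<close>
  define \<psi>' where "\<psi>' z = proj ?L (snd b (chart_inv c (\<psi> z)))" for z
  have "smooth_on V T' (\<lambda>z. snd b (chart_inv c (\<psi> z)))"
    by (rule smooth_on_comp[OF fin_dim_subspaceD(1)[OF V] T' W openin_imp_subset[OF B(1)] _ smooth_on_subset[OF T(3) _ subset_refl] B(2)])
       (auto simp: T'_def)
  then have sm\<psi>': "smooth_on V T' \<psi>'"
    unfolding \<psi>'_def by (rule smooth_on_bounded_linear[OF bounded_linear_proj[OF Lfin]])
  have \<psi>'L: "\<psi>' ` T' \<subseteq> ?L"
    unfolding \<psi>'_def using proj_in[OF Lfin] by auto
  have ExT': "E x \<in> T'"
  proof -
    have "\<psi> (E x) = snd c x"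
      using \<psi>(2)[OF xQ T(2)] by simp
    then show ?thesis
      using T(2) c(2) b(1) by (auto simp: T'_def B_def)
  qed
  have recover: "y \<in> fst ?k \<and> snd ?k y = \<psi>' (E y)" if y: "y \<in> Q \<inter> S" "E y \<in> T'" for y
  proof -
    have yT: "E y \<in> T" "\<psi> (E y) \<in> B"
      using y by (auto simp: T'_def)
    have yc: "y \<in> fst c" "snd c y = \<psi> (E y)"
      using \<psi> y yT by auto
    then have yb: "y \<in> fst b"
      using yT(2) injc by (auto simp: B_def dest: inj_onD)
    have "snd b y \<in> snd b ` (S \<inter> fst b)"
      using y yb by auto
    then have "snd b y \<in> ?L"
      unfolding slice_chart_image(1)[OF b(2)] by auto
    then show ?thesis
      using y yc yb inv_c[OF yc(1)] proj_id[OF Lfin] by (simp add: \<psi>'_def yc(2)[symmetric])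
  qed
  show "\<exists>c\<in>atlas (submfd M S). x \<in> fst c \<and> fst c \<subseteq> Q \<inter> S \<and> smooth_on ?L (snd c ` fst c) (\<lambda>y. E (chart_inv c y)) \<and>
       (\<exists>T \<psi>. open_in V T \<and> E x \<in> T \<and> smooth_on V T \<psi> \<and> \<psi> ` T \<subseteq> ?L \<and>
         (\<forall>y\<in>Q \<inter> S. E y \<in> T \<longrightarrow> y \<in> fst c \<and> snd c y = \<psi> (E y)))"
  proof (rule bexI[OF _ katlas], intro conjI exI[of _ T'] exI[of _ \<psi>'] ballI impI)
    show "x \<in> fst ?k"
      using xS b(1) c(2) by simp
    show "fst ?k \<subseteq> Q \<inter> S"
      using c(3) by auto
  qed (use smk T' ExT' sm\<psi>' \<psi>'L recover in blast)+
qed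

section \<open>The manifold topology\<close>

lemma openin_mtop:
  fixes M :: "('p, 'm::dual_separating) mfd"
  assumes M: "charted M"
  shows "openin (mtop M) W \<longleftrightarrow> W \<subseteq> pts M \<and> (\<forall>c\<in>atlas M. open_in (model M) (snd c ` (W \<inter> fst c)))"
proof -
  have "istopology (\<lambda>W. W \<subseteq> pts M \<and> (\<forall>c\<in>atlas M. open_in (model M) (snd c ` (W \<inter> fst c))))"
    unfolding istopology_def
  proof (intro conjI allI impI ballI)
    fix W W' c
    assume W: "W \<subseteq> pts M \<and> (\<forall>c\<in>atlas M. open_in (model M) (snd c ` (W \<inter> fst c)))"
      and W': "W' \<subseteq> pts M \<and> (\<forall>c\<in>atlas M. open_in (model M) (snd c ` (W' \<inter> fst c)))"
    show "W \<inter> W' \<subseteq> pts M"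
      using W by auto
    assume c: "c \<in> atlas M"
    have "snd c ` (W \<inter> W' \<inter> fst c) = snd c ` (W \<inter> fst c) \<inter> snd c ` (W' \<inter> fst c)"
      using charted_atlasD(1)[OF M c] by (auto simp: inj_on_def)
    then show "open_in (model M) (snd c ` (W \<inter> W' \<inter> fst c))"
      using W W' c by auto
  next
    fix \<K> c
    assume \<K>: "\<forall>W\<in>\<K>. W \<subseteq> pts M \<and> (\<forall>c\<in>atlas M. open_in (model M) (snd c ` (W \<inter> fst c)))"
    then show "\<Union>\<K> \<subseteq> pts M"
      by blast
    assume c: "c \<in> atlas M"
    have "snd c ` (\<Union>\<K> \<inter> fst c) = (\<Union>W\<in>\<K>. snd c ` (W \<inter> fst c))"
      by blast
    then show "open_in (model M) (snd c ` (\<Union>\<K> \<inter> fst c))"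
      using \<K> c by auto
  qed
  then show ?thesis
    by (simp add: mtop_def topology_inverse')
qed

lemma topspace_mtop:
  fixes M :: "('p, 'm::dual_separating) mfd"
  assumes M: "charted M"
  shows "topspace (mtop M) = pts M"
proof -
  have "openin (mtop M) (pts M)"
    unfolding openin_mtop[OF M]
  proof (intro conjI ballI subset_refl)
    fix c assume c: "c \<in> atlas M"
    have "pts M \<inter> fst c = fst c"
      using charted_atlasD(2)[OF M c] by auto
    then show "open_in (model M) (snd c ` (pts M \<inter> fst c))"
      using charted_atlasD(3)[OF M c] by simp
  qed
  moreover have "topspace (mtop M) \<subseteq> pts M"
    using openin_topspace[of "mtop M"] unfolding openin_mtop[OF M] by blast
  ultimately show ?thesis
    using openin_subset by blast
qed

context
  fixes M :: "('p, 'm::dual_separating) mfd" and V :: "'v::dual_separating set" and E :: "'p \<Rightarrow> 'v"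
  assumes M: "charted M" and E: "vec_embedding M (pts M) V E"
begin

lemma vec_embedding_fin_dim: "fin_dim_subspace V" and vec_embedding_in: "x \<in> pts M \<Longrightarrow> E x \<in> V"
  using E by (auto simp: vec_embedding_def)

lemma vec_embedding_smooth: "smooth_map M (vec_mfd V) E"
proof (rule smooth_map_onI[OF M charted_vec_mfd[OF vec_embedding_fin_dim]])
  show "E ` pts M \<subseteq> pts (vec_mfd V)"
    using vec_embedding_in by auto
  fix x assume "x \<in> pts M"
  then obtain c where c: "c \<in> atlas M" "x \<in> fst c" "smooth_on (model M) (snd c ` fst c) (\<lambda>y. E (chart_inv c y))"
    using vec_embeddingE[OF E] by metis
  note cD = charted_atlasD[OF M c(1)]
  have "local_rep (model M) (pts M) c (V, \<lambda>x. x) E x (snd c ` fst c)"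
    unfolding local_rep_def using c cD vec_embedding_in chart_inv_in[of _ c] by auto
  then show "\<exists>c\<in>max_atlas M. \<exists>d\<in>max_atlas (vec_mfd V). \<exists>U. local_rep (model M) (pts M) c d E x U"
    using charted_atlas_subset[OF M] c(1) vec_chart[OF vec_embedding_fin_dim] by blast
qed simp

text \<open>In a chart at \<open>f x\<close> the map is \<open>\<psi>\<close> after \<open>E\<close>
  after \<open>f\<close>, on the set where \<open>E\<close> after \<open>f\<close> takes values in
  \<open>T\<close>. This set is open because \<open>E\<close> after \<open>f\<close> is continuous,
  so continuity of \<open>f\<close> comes out along with smoothness.\<close>

lemma vec_embedding_smooth_mapI:
  fixes P :: "('q, 'n::dual_separating) mfd"
  assumes P: "charted P" and f: "smooth_map_on P (vec_mfd V) W (\<lambda>x. E (f x))" and im: "f ` W \<subseteq> pts M"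
  shows "smooth_map_on P M W f"
proof (rule smooth_map_onI[OF P M smooth_map_on_subset[OF f] im])
  note V = vec_embedding_fin_dim
  fix x assume x: "x \<in> W"
  then have fx: "f x \<in> pts M" and xP: "x \<in> pts P"
    using im smooth_map_on_subset[OF f] by auto
  obtain c T \<psi> where c: "c \<in> atlas M" "f x \<in> fst c"
    and T: "open_in V T" "E (f x) \<in> T" "smooth_on V T \<psi>"
    and \<psi>: "\<And>y. y \<in> pts M \<Longrightarrow> E y \<in> T \<Longrightarrow> y \<in> fst c" "\<And>y. y \<in> pts M \<Longrightarrow> E y \<in> T \<Longrightarrow> snd c y = \<psi> (E y)"
    using vec_embeddingE[OF E fx] by metis
  note b = chart_at_max_atlas[OF P xP]
  let ?b = "chart_at P x"
  note inv_b = chart_inv_left[OF max_atlasD(2)[OF b(1)]]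
  define A where "A = snd ?b ` (fst ?b \<inter> W)"
  have A: "open_in (model P) A" "smooth_on (model P) A (\<lambda>y. E (f (chart_inv ?b y)))"
    unfolding A_def using smooth_map_on_vecD[OF P V f b(1)] by auto
  have A_in: "chart_inv ?b y \<in> fst ?b" "chart_inv ?b y \<in> W" "f (chart_inv ?b y) \<in> pts M" if "y \<in> A" for y
    using that inv_b im by (auto simp: A_def)
  define U where "U = {y \<in> A. E (f (chart_inv ?b y)) \<in> T}"
  have U: "open_in (model P) U"
    unfolding U_def
    by (rule open_in_preimage[OF smooth_on_imp_continuous_on[OF A(2)] A(1) _ T(1)]) (use vec_embedding_in A_in(3) in auto)
  have "smooth_on (model P) U (\<lambda>y. \<psi> (E (f (chart_inv ?b y))))"
    by (rule smooth_on_comp[OF fin_dim_subspaceD(1)[OF charted_fin_dim[OF P]] U V openin_imp_subset[OF T(1)] _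
          smooth_on_subset[OF A(2) _ subset_refl] T(3)]) (auto simp: U_def)
  then have sm: "smooth_on (model P) U (\<lambda>y. snd c (f (chart_inv ?b y)))"
    by (rule smooth_on_cong) (use \<psi>(2) A_in(3) in \<open>auto simp: U_def\<close>)
  have "snd ?b x \<in> U"
    using x b(2) T(2) inv_b[OF b(2)] by (auto simp: U_def A_def)
  moreover have "U \<subseteq> snd ?b ` fst ?b"
    by (auto simp: U_def A_def)
  moreover have "chart_inv ?b y \<in> W \<and> f (chart_inv ?b y) \<in> fst c" if "y \<in> U" for y
    using that A_in \<psi>(1) by (auto simp: U_def)
  ultimately have "local_rep (model P) W ?b c f x U"
    unfolding local_rep_def using b(2) U sm by blast
  then show "\<exists>c\<in>max_atlas P. \<exists>d\<in>max_atlas M. \<exists>U. local_rep (model P) W c d f x U"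
    using b(1) charted_atlas_subset[OF M] c(1) by blast
qed

lemma vec_embedding_preimage_open:
  assumes "open_in V T"
  shows "openin (mtop M) {x \<in> pts M. E x \<in> T}"
  unfolding openin_mtop[OF M]
proof (intro conjI ballI)
  fix c assume c: "c \<in> atlas M"
  have cm: "c \<in> max_atlas M"
    using charted_atlas_subset[OF M] c by auto
  have dom: "fst c \<inter> pts M = fst c"
    using charted_atlasD(2)[OF M c] by auto
  note Ec = smooth_map_on_vecD[OF M vec_embedding_fin_dim vec_embedding_smooth cm, unfolded dom]
  have "open_in (model M) {y \<in> snd c ` fst c. E (chart_inv c y) \<in> T}"
  proof (rule open_in_preimage[OF smooth_on_imp_continuous_on[OF Ec(2)] Ec(1) _ assms])
    fix y assume "y \<in> snd c ` fst c"
    from chart_inv_in[OF this] show "E (chart_inv c y) \<in> V"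
      using vec_embedding_in charted_atlasD(2)[OF M c] by blast
  qed
  moreover have "{y \<in> snd c ` fst c. E (chart_inv c y) \<in> T} = snd c ` ({x \<in> pts M. E x \<in> T} \<inter> fst c)"
    using chart_inv_left[OF charted_atlasD(1)[OF M c]] charted_atlasD(2)[OF M c] by auto
  ultimately show "open_in (model M) (snd c ` ({x \<in> pts M. E x \<in> T} \<inter> fst c))"
    by simp
qed auto

text \<open>Together with \<open>vec_embedding_preimage_open\<close> this says that
  \<open>mtop M\<close> is the topology induced by \<open>E\<close> from \<open>V\<close>. Near
  \<open>x\<close> the set is described by chart coordinates, which \<open>\<psi>\<close> reads off
  from \<open>E\<close>.\<close>

lemma vec_embedding_open:
  assumes W: "openin (mtop M) W" and x: "x \<in> W"
  obtains T where "open_in V T" "E x \<in> T" "\<And>y. y \<in> pts M \<Longrightarrow> E y \<in> T \<Longrightarrow> y \<in> W"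
proof -
  have xM: "x \<in> pts M"
    using W x unfolding openin_mtop[OF M] by blast
  then obtain c T \<psi> where c: "c \<in> atlas M" "x \<in> fst c"
    and T: "open_in V T" "E x \<in> T" "smooth_on V T \<psi>" "\<psi> ` T \<subseteq> model M"
    and \<psi>: "\<And>y. y \<in> pts M \<Longrightarrow> E y \<in> T \<Longrightarrow> y \<in> fst c" "\<And>y. y \<in> pts M \<Longrightarrow> E y \<in> T \<Longrightarrow> snd c y = \<psi> (E y)"
    using vec_embeddingE[OF E] by metis
  have Wc: "open_in (model M) (snd c ` (W \<inter> fst c))"
    using W c(1) unfolding openin_mtop[OF M] by blast
  show thesis
  proof
    show "open_in V {z \<in> T. \<psi> z \<in> snd c ` (W \<inter> fst c)}"
      by (rule open_in_preimage[OF smooth_on_imp_continuous_on[OF T(3)] T(1) _ Wc]) (use T(4) in auto)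
    show "E x \<in> {z \<in> T. \<psi> z \<in> snd c ` (W \<inter> fst c)}"
      using T(2) \<psi>(2)[OF xM T(2)] x c(2) by (metis (mono_tags, lifting) IntI imageI mem_Collect_eq)
    fix y assume y: "y \<in> pts M" "E y \<in> {z \<in> T. \<psi> z \<in> snd c ` (W \<inter> fst c)}"
    then have "snd c y \<in> snd c ` (W \<inter> fst c)" "y \<in> fst c"
      using \<psi> by auto
    then show "y \<in> W"
      using charted_atlasD(1)[OF M c(1)] by (auto dest: inj_onD)
  qed
qed

lemma vec_embedding_inj:
  assumes "x \<in> pts M" "y \<in> pts M" "E x = E y"
  shows "x = y"
proof -
  obtain c T \<psi> where c: "c \<in> atlas M" "x \<in> fst c"
    and T: "E x \<in> T"
    and \<psi>: "\<And>y. y \<in> pts M \<Longrightarrow> E y \<in> T \<Longrightarrow> y \<in> fst c" "\<And>y. y \<in> pts M \<Longrightarrow> E y \<in> T \<Longrightarrow> snd c y = \<psi> (E y)"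
    using vec_embeddingE[OF E assms(1)] by metis
  have "snd c x = snd c y" "y \<in> fst c"
    using \<psi>[OF assms(1)] \<psi>[OF assms(2)] T assms(3) by auto
  then show ?thesis
    using charted_atlasD(1)[OF M c(1)] c(2) by (auto dest: inj_onD)
qed

end

text \<open>The base consists of balls around rational combinations of the basis, with radii the
  inverses of positive integers. The ambient type itself need not be separable.\<close>

lemma second_countable_fin_dim_subspace:
  fixes V :: "'v::dual_separating set"
  assumes V: "fin_dim_subspace V"
  shows "second_countable (top_of_set V)"
proof -
  note V' = fin_dim_subspaceD[OF V]
  define lc where "lc r = (\<Sum>b\<in>model_basis V. r b *\<^sub>R b)" for r :: "'v \<Rightarrow> real"
  define D where "D = lc ` (PiE (model_basis V) (\<lambda>_. \<rat>))"
  have "countable (PiE (model_basis V) (\<lambda>_. \<rat> :: real set))"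
    by (intro countable_PiE V'(2) countable_rat)
  then have D: "countable D"
    unfolding D_def by (rule countable_image)
  have dense: "\<exists>q\<in>D. dist q x < e" if x: "x \<in> V" and e: "e > 0" for x e
  proof -
    \<comment> \<open>The summand 1 makes \<open>K\<close> positive and the final estimate
      strict.\<close>
    define K where "K = (\<Sum>b\<in>model_basis V. norm b) + 1"
    have K: "K > 0"
      unfolding K_def by (intro add_nonneg_pos sum_nonneg) auto
    have "\<exists>r\<in>\<rat>. \<bar>r - coord V b x\<bar> < e / K" for b
    proof -
      obtain r where "r \<in> \<rat>" "coord V b x < r" "r < coord V b x + e / K"
        using Rats_dense_in_real[of "coord V b x" "coord V b x + e / K"] e K by auto
      then show ?thesis
        by (intro bexI[of _ r]) auto
    qed
    then obtain r where r: "\<And>b. r b \<in> \<rat>" "\<And>b. \<bar>r b - coord V b x\<bar> < e / K"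
      by metis
    define r' where "r' = restrict r (model_basis V)"
    have "lc r' \<in> D"
      unfolding D_def r'_def using r(1) by auto
    moreover have "dist (lc r') x < e"
    proof -
      have "lc r' - x = (\<Sum>b\<in>model_basis V. (r b - coord V b x) *\<^sub>R b)"
        using proj_id[OF V x] by (simp add: lc_def r'_def proj_def scaleR_left_diff_distrib sum_subtractf)
      also have "norm \<dots> \<le> (\<Sum>b\<in>model_basis V. e / K * norm b)"
      proof (rule sum_norm_le)
        fix b
        show "norm ((r b - coord V b x) *\<^sub>R b) \<le> e / K * norm b"
          using mult_right_mono[OF less_imp_le[OF r(2)[of b]], of "norm b"] by simp
      qed
      also have "\<dots> = e / K * (K - 1)"
        by (simp add: K_def sum_distrib_left)
      also have "\<dots> < e"
        using e K by (simp add: field_simps)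
      finally show ?thesis
        by (simp add: dist_norm)
    qed
    ultimately show ?thesis
      by blast
  qed
  define \<B> where "\<B> = (\<lambda>(q, n::nat). ball q (inverse (Suc n)) \<inter> V) ` (D \<times> UNIV)"
  show ?thesis
    unfolding second_countable_def
  proof (intro exI[of _ \<B>] conjI ballI allI impI)
    show "countable \<B>"
      unfolding \<B>_def using D by auto
    show "open_in V B" if "B \<in> \<B>" for B
      using that unfolding \<B>_def by (auto simp: openin_open)
    fix U x assume U: "open_in V U \<and> x \<in> U"
    then have xV: "x \<in> V"
      using openin_imp_subset by blast
    obtain e where e: "e > 0" "cball x e \<inter> V \<subseteq> U"
      using open_in_ball U by blast
    obtain n where n: "inverse (real (Suc n)) < e / 2"
      using reals_Archimedean[of "e / 2"] e by auto
    obtain q where q: "q \<in> D" "dist q x < inverse (real (Suc n))"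
      using dense[OF xV, of "inverse (real (Suc n))"] by auto
    have "ball q (inverse (real (Suc n))) \<inter> V \<subseteq> U"
    proof
      fix y assume y: "y \<in> ball q (inverse (real (Suc n))) \<inter> V"
      then have "dist x y \<le> e"
        using dist_triangle[of x y q] q(2) n by (auto simp: dist_commute)
      then show "y \<in> U"
        using e y by auto
    qed
    moreover have "ball q (inverse (real (Suc n))) \<inter> V \<in> \<B>"
      unfolding \<B>_def using q(1) by (intro image_eqI[of _ _ "(q, n)"]) auto
    moreover have "x \<in> ball q (inverse (real (Suc n))) \<inter> V"
      using q(2) xV by simp
    ultimately show "\<exists>B\<in>\<B>. x \<in> B \<and> B \<subseteq> U"
      by blast
  qed
qed

text \<open>Separation and a countable base are pulled back from the vector space along the
  injective map \<open>E\<close>.\<close>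

lemma vec_embedding_smooth_manifold:
  fixes M :: "('p, 'm::dual_separating) mfd" and V :: "'v::dual_separating set"
  assumes M: "charted M" and E: "vec_embedding M (pts M) V E"
  shows "smooth_manifold M"
proof -
  have "Hausdorff_space (mtop M)"
    unfolding Hausdorff_space_def
  proof (intro allI impI)
    fix x y assume "x \<in> topspace (mtop M) \<and> y \<in> topspace (mtop M) \<and> x \<noteq> y"
    then have xy: "x \<in> pts M" "y \<in> pts M" "E x \<noteq> E y"
      using topspace_mtop[OF M] vec_embedding_inj[OF M E] by auto
    then obtain T T' where T: "open T" "open T'" "E x \<in> T" "E y \<in> T'" "T \<inter> T' = {}"
      using hausdorff by metis
    let ?U = "\<lambda>T. {x \<in> pts M. E x \<in> V \<inter> T}"
    have "openin (mtop M) (?U T)" "openin (mtop M) (?U T')"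
      by (rule vec_embedding_preimage_open[OF M E openin_open_Int[OF T(1)]]
          vec_embedding_preimage_open[OF M E openin_open_Int[OF T(2)]])+
    moreover have "x \<in> ?U T" "y \<in> ?U T'" "disjnt (?U T) (?U T')"
      using xy T vec_embedding_in[OF M E] by (auto simp: disjnt_def)
    ultimately show "\<exists>U W. openin (mtop M) U \<and> openin (mtop M) W \<and> x \<in> U \<and> y \<in> W \<and> disjnt U W"
      by blast
  qed
  moreover have "second_countable (mtop M)"
  proof -
    obtain \<B> where \<B>: "countable \<B>" "\<And>B. B \<in> \<B> \<Longrightarrow> open_in V B"
      "\<And>U x. open_in V U \<Longrightarrow> x \<in> U \<Longrightarrow> \<exists>B\<in>\<B>. x \<in> B \<and> B \<subseteq> U"
      using second_countable_fin_dim_subspace[OF vec_embedding_fin_dim[OF M E]] unfolding second_countable_def by metis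
    let ?pre = "\<lambda>T. {x \<in> pts M. E x \<in> T}"
    show ?thesis
      unfolding second_countable_def
    proof (intro exI[of _ "?pre ` \<B>"] conjI ballI allI impI)
      show "countable (?pre ` \<B>)"
        using \<B>(1) by (rule countable_image)
      show "openin (mtop M) U" if "U \<in> ?pre ` \<B>" for U
        using that \<B>(2) vec_embedding_preimage_open[OF M E] by auto
      fix W x assume W: "openin (mtop M) W \<and> x \<in> W"
      then obtain T where T: "open_in V T" "E x \<in> T" "\<And>y. y \<in> pts M \<Longrightarrow> E y \<in> T \<Longrightarrow> y \<in> W"
        using vec_embedding_open[OF M E] by metis
      then obtain B where B: "B \<in> \<B>" "E x \<in> B" "B \<subseteq> T"
        using \<B>(3) by blast
      have "x \<in> pts M"
        using W openin_mtop[OF M] by blast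
      then show "\<exists>U\<in>?pre ` \<B>. x \<in> U \<and> U \<subseteq> W"
        using B T(3) by (intro bexI[of _ "?pre B"]) auto
    qed
  qed
  ultimately show ?thesis
    using M by (simp add: smooth_manifold_def charted_def)
qed

section \<open>Lie groups and their representations\<close>

lemma linear_betw_diff_fun:
  assumes "linear_betw V W f" "linear_betw V W g" "subspace W"
  shows "linear_betw V W (\<lambda>x. f x - g x)"
  using assms unfolding linear_betw_def
  by (auto simp: image_subset_iff subspace_diff scaleR_right_diff_distrib)

lemma dir_deriv_add:
  fixes V :: "'a::dual_separating set"
  assumes "fin_dim_subspace V" "open_in V U" "x \<in> U" "v \<in> V" "smooth_on V U f" "smooth_on V U g"
  shows "dir_deriv (\<lambda>y. f y + g y) x v = dir_deriv f x v + dir_deriv g x v"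
  using dir_deriv_eq[OF fin_dim_subspaceD(1)[OF assms(1)] assms(2-4)
      has_derivative_add[OF smooth_on_has_derivative[OF assms(5,1,2,3)] smooth_on_has_derivative[OF assms(6,1,2,3)]]]
  by (simp add: proj_id[OF assms(1,4)])

lemma dir_deriv_scaleR:
  fixes V :: "'a::dual_separating set"
  assumes "fin_dim_subspace V" "open_in V U" "x \<in> U" "v \<in> V" "smooth_on V U f"
  shows "dir_deriv (\<lambda>y. a *\<^sub>R f y) x v = a *\<^sub>R dir_deriv f x v"
  using dir_deriv_eq[OF fin_dim_subspaceD(1)[OF assms(1)] assms(2-4)
      has_derivative_scaleR_right[OF smooth_on_has_derivative[OF assms(5,1,2,3)], of a]]
  by (simp add: proj_id[OF assms(1,4)])

text \<open>The partial derivative at \<open>y0\<close> is the derivative of the two-variable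
  representation at a moving point in a direction \<open>(0, \<alpha>)\<close>, hence smooth jointly
  in the first variable and in the direction. The adjoint representation and the left-invariant
  fields are partial derivatives of this kind.\<close>

lemma smooth_partial_derivative:
  fixes M :: "('p, 'm::dual_separating) mfd" and N :: "('q, 'n::dual_separating) mfd" and P :: "('r, 'l::dual_separating) mfd"
  assumes M: "charted M" and N: "charted N" and P: "charted P"
    and F: "smooth_map (prod_mfd M N) P (\<lambda>(x, y). F x y)"
    and c: "c \<in> atlas M" and e: "e \<in> atlas N" "y0 \<in> fst e" and d: "d \<in> atlas P" "\<And>x. x \<in> fst c \<Longrightarrow> F x y0 \<in> fst d"
  shows "smooth_on (model M \<times> model N) (snd c ` fst c \<times> model N)
    (\<lambda>p. dir_deriv (\<lambda>z. snd d (F (chart_inv c (fst p)) (chart_inv e z))) (snd e y0) (snd p))"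
proof -
  let ?p = "prod_chart c e" and ?V = "model M" and ?W = "model N"
  note cD = charted_atlasD[OF M c] and eD = charted_atlasD[OF N e(1)]
  note V = charted_fin_dim[OF M] and W = charted_fin_dim[OF N]
  note VW = fin_dim_subspace_Times[OF V W]
  have pm: "?p \<in> max_atlas (prod_mfd M N)" and dm: "d \<in> max_atlas P"
    using prod_chart_max_atlas[OF M N c e(1)] charted_atlas_subset[OF P] d(1) by auto
  define Q where "Q = snd ?p ` {x \<in> fst ?p \<inter> pts (prod_mfd M N). (\<lambda>(x, y). F x y) x \<in> fst d}"
  define \<Psi> where "\<Psi> p = snd d (F (chart_inv c (fst p)) (chart_inv e (snd p)))" for p
  have Q: "open_in (?V \<times> ?W) Q" "smooth_on (?V \<times> ?W) Q (\<lambda>z. snd d ((\<lambda>(x, y). F x y) (chart_inv ?p z)))"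
    using smooth_map_onD[OF charted_prod[OF M N] P F pm dm] by (simp_all add: Q_def)
  have "smooth_on (?V \<times> ?W) Q \<Psi>"
    using Q(2)
  proof (rule smooth_on_cong)
    fix z assume "z \<in> Q"
    then have "fst z \<in> snd c ` fst c" "snd z \<in> snd e ` fst e"
      by (auto simp: Q_def)
    then show "snd d ((\<lambda>(x, y). F x y) (chart_inv ?p z)) = \<Psi> z"
      using chart_inv_prod[OF cD(1) eD(1), of "fst z" "snd z"] by (simp add: \<Psi>_def)
  qed
  moreover have "(y, snd e y0) \<in> Q" if "y \<in> snd c ` fst c" for y
  proof -
    have "chart_inv c y \<in> fst c" "snd c (chart_inv c y) = y"
      using that by (auto intro: chart_inv_in chart_inv_right)
    then show ?thesis
      unfolding Q_def using e(2) d(2) cD(2) eD(2) by (intro image_eqI[of _ _ "(chart_inv c y, y0)"]) auto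
  qed
  moreover have "open_in (?V \<times> ?W) (snd c ` fst c \<times> ?W)"
    by (rule open_in_Times[OF cD(3)]) simp
  ultimately have "smooth_on (?V \<times> ?W) (snd c ` fst c \<times> ?W) (\<lambda>p. dir_deriv \<Psi> (fst p, snd e y0) (0, snd p))"
    by (intro smooth_on_dir_deriv_comp[OF VW _ VW Q(1)] smooth_on_Pair smooth_on_const smooth_on_fst smooth_on_snd)
       (auto simp: subspace_0[OF fin_dim_subspaceD(1)[OF V]])
  moreover have "dir_deriv \<Psi> (y, w) (0, \<alpha>) = dir_deriv (\<lambda>z. snd d (F (chart_inv c y) (chart_inv e z))) w \<alpha>" for y w \<alpha>
    by (simp add: dir_deriv_def \<Psi>_def)
  ultimately show ?thesis
    by simp
qed

locale lie =
  fixes G :: "('g, 'e) monoid_scheme" (structure) and M :: "('g, 'm::dual_separating) mfd"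
  assumes lie_group: "lie_group G M"
begin

sublocale group G
  using lie_group by (simp add: lie_group_def)

lemma M: "charted M" and pts_M [simp]: "pts M = carrier G"
  using lie_group by (auto simp: lie_group_def smooth_manifold_charted)

lemma fin_dim: "fin_dim_subspace (model M)"
  by (rule charted_fin_dim[OF M])

lemma smooth_mult:
  assumes "charted P" "smooth_map_on P M W f" "smooth_map_on P M W g"
  shows "smooth_map_on (P :: ('p, 'n::dual_separating) mfd) M W (\<lambda>x. f x \<otimes> g x)"
proof -
  have "smooth_map (prod_mfd M M) M (\<lambda>(g, h). g \<otimes> h)"
    using lie_group by (simp add: lie_group_def)
  from smooth_map_comp[OF assms(1) charted_prod[OF M M] M smooth_map_on_Pair[OF assms(1) M M assms(2,3)] this]
  show ?thesis
    by simp
qed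

lemma smooth_inv:
  assumes "charted P" "smooth_map_on P M W f"
  shows "smooth_map_on (P :: ('p, 'n::dual_separating) mfd) M W (\<lambda>x. inv f x)"
proof -
  have "smooth_map M M (\<lambda>g. inv g)"
    using lie_group by (simp add: lie_group_def)
  from smooth_map_comp[OF assms(1) M M assms(2) this] show ?thesis .
qed

lemma smooth_left_mult: "g \<in> carrier G \<Longrightarrow> smooth_map M M (\<lambda>h. g \<otimes> h)"
  by (intro smooth_mult M smooth_map_ident smooth_map_const) simp

lemma smooth_conj: "g \<in> carrier G \<Longrightarrow> smooth_map M M (\<lambda>h. g \<otimes> h \<otimes> inv g)"
  by (intro smooth_mult M smooth_map_ident smooth_map_const) simp_all

text \<open>All conjugations fix the identity, so their differentials there compose by the chain
  rule on a single tangent space. Smoothness comes from conjugation as a map of two variables,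
  differentiated in the conjugated one.\<close>

lemma Ad_lie_rep: "lie_rep G M (model M) (Ad G M)"
  unfolding lie_rep_def
proof (intro conjI ballI fin_dim)
  show "linear_betw (model M) (model M) (Ad G M g)" if "g \<in> carrier G" for g
  proof -
    have "linear_betw (model M) (model M) (\<lambda>v. Ad G M g v)"
      unfolding Ad_def using mdiff_linear[OF M M smooth_conj[OF that], of \<one>] by simp
    then show ?thesis
      by simp
  qed
  show "Ad G M \<one> v = v" if v: "v \<in> model M" for v
  proof -
    have "mdiff M M (\<lambda>h. \<one> \<otimes> h \<otimes> inv \<one>) \<one> v = mdiff M M (\<lambda>h. h) \<one> v"
      by (rule mdiff_cong[OF M M smooth_conj _ v]) auto
    then show ?thesis
      using mdiff_ident[OF M _ v, of \<one>] by (simp add: Ad_def)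
  qed
  show "Ad G M (g \<otimes> h) v = Ad G M g (Ad G M h v)" if g: "g \<in> carrier G" and h: "h \<in> carrier G" and v: "v \<in> model M" for g h v
  proof -
    have one: "h \<otimes> \<one> \<otimes> inv h = \<one>"
      using h by simp
    have "mdiff M M (\<lambda>x. g \<otimes> h \<otimes> x \<otimes> inv (g \<otimes> h)) \<one> v = mdiff M M (\<lambda>x. g \<otimes> (h \<otimes> x \<otimes> inv h) \<otimes> inv g) \<one> v"
      using g h by (intro mdiff_cong[OF M M smooth_conj _ v]) (auto simp: inv_mult_group m_assoc)
    also have "\<dots> = mdiff M M (\<lambda>x. g \<otimes> x \<otimes> inv g) (h \<otimes> \<one> \<otimes> inv h) (mdiff M M (\<lambda>x. h \<otimes> x \<otimes> inv h) \<one> v)"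
      using h by (intro mdiff_comp[OF M M M smooth_conj[OF h] smooth_conj[OF g] _ _ v]) auto
    finally show ?thesis
      by (simp only: Ad_def one)
  qed
  show "smooth_map (prod_mfd M (vec_mfd (model M))) (vec_mfd (model M)) (\<lambda>(g, v). Ad G M g v)"
  proof (rule smooth_map_prod_vecI[OF M fin_dim fin_dim])
    show "(\<lambda>(g, v). Ad G M g v) (x, v) \<in> model M" if "x \<in> pts M" "v \<in> model M" for x v
      using linear_betw_in[OF mdiff_linear[OF M M smooth_conj, of x \<one>] that(2)] that(1) by (simp add: Ad_def)
    fix c assume c: "c \<in> atlas M"
    let ?e = "chart_at M \<one>"
    have e: "?e \<in> atlas M" "\<one> \<in> fst ?e"
      using chart_at_atlas[OF M, of \<one>] by auto
    note MM = charted_prod[OF M M]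
    have carr: "x \<in> carrier G" if "x \<in> fst c" for x
      using charted_atlasD(2)[OF M c] that by auto
    have "smooth_map (prod_mfd M M) M (\<lambda>p. fst p \<otimes> snd p \<otimes> inv (fst p))"
      by (intro smooth_mult smooth_inv MM smooth_map_fst_snd M)
    then have "smooth_map (prod_mfd M M) M (\<lambda>(g, h). g \<otimes> h \<otimes> inv g)"
      by (simp add: case_prod_beta')
    from smooth_partial_derivative[OF M M M this c e e(1)]
    have "smooth_on (model M \<times> model M) (snd c ` fst c \<times> model M)
      (\<lambda>p. dir_deriv (\<lambda>z. snd ?e (chart_inv c (fst p) \<otimes> chart_inv ?e z \<otimes> inv (chart_inv c (fst p)))) (snd ?e \<one>) (snd p))"
      using carr e by simp
    then show "smooth_on (model M \<times> model M) (snd c ` fst c \<times> model M) (\<lambda>p. (\<lambda>(g, v). Ad G M g v) (chart_inv c (fst p), snd p))"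
    proof (rule smooth_on_cong)
      fix p assume "p \<in> snd c ` fst c \<times> model M"
      then have "chart_inv c (fst p) \<in> carrier G"
        by (intro carr chart_inv_in) auto
      then show "dir_deriv (\<lambda>z. snd ?e (chart_inv c (fst p) \<otimes> chart_inv ?e z \<otimes> inv (chart_inv c (fst p)))) (snd ?e \<one>) (snd p) =
          (\<lambda>(g, v). Ad G M g v) (chart_inv c (fst p), snd p)"
        by (simp add: Ad_def mdiff_eq)
    qed
  qed
qed

text \<open>The left-invariant field of \<open>\<alpha>\<close> in one fixed chart around the
  identity. The values of \<open>left_invariant_vf\<close> refer to charts chosen point by point, so
  they need not vary smoothly.\<close>

definition inv_field :: "'m \<Rightarrow> 'm \<Rightarrow> 'm" where
  "inv_field \<alpha> y = dir_deriv (\<lambda>z. snd (chart_at M \<one>) (chart_inv (chart_at M \<one>) y \<otimes> chart_inv (chart_at M \<one>) z))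
     (snd (chart_at M \<one>) \<one>) \<alpha>"

abbreviation e1 where "e1 \<equiv> chart_at M \<one>"

abbreviation U1 where "U1 \<equiv> snd e1 ` fst e1"

lemma e1: "e1 \<in> atlas M" "e1 \<in> max_atlas M" "\<one> \<in> fst e1" "open_in (model M) U1" "snd e1 \<one> \<in> U1"
  and e1_carrier: "y \<in> U1 \<Longrightarrow> chart_inv e1 y \<in> carrier G" "y \<in> U1 \<Longrightarrow> chart_inv e1 y \<in> fst e1"
proof -
  show e: "e1 \<in> atlas M" "e1 \<in> max_atlas M" "\<one> \<in> fst e1"
    using chart_at_atlas[OF M, of \<one>] chart_at_max_atlas[OF M, of \<one>] by auto
  then show "open_in (model M) U1" "snd e1 \<one> \<in> U1"
    using charted_atlasD[OF M e(1)] by auto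
  show "chart_inv e1 y \<in> fst e1" if "y \<in> U1" for y
    using that by (rule chart_inv_in)
  then show "chart_inv e1 y \<in> carrier G" if "y \<in> U1" for y
    using that charted_atlasD(2)[OF M e(1)] by auto
qed

lemma inv_field_linear:
  assumes y: "y \<in> U1"
  shows "linear_betw (model M) (model M) (\<lambda>\<alpha>. inv_field \<alpha> y)"
proof -
  have "linear_betw (model M) (model M)
      (dir_deriv (\<lambda>z. snd e1 (chart_inv e1 y \<otimes> chart_inv e1 z)) (snd e1 \<one>))"
    by (rule linear_betw_chart[OF M M smooth_left_mult _ e1(2,3) e1(2)]) (use e1_carrier[OF y] in auto)
  then show ?thesis
    by (simp add: inv_field_def[abs_def])
qed

lemma inv_field_smooth:
  assumes \<alpha>: "\<alpha> \<in> model M"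
  shows "smooth_on (model M) U1 (inv_field \<alpha>)"
proof -
  note V = fin_dim_subspaceD(1)[OF fin_dim]
  have "smooth_map (prod_mfd M M) M (\<lambda>(g, h). g \<otimes> h)"
    using lie_group by (simp add: lie_group_def)
  from smooth_partial_derivative[OF M M M this e1(1) e1(1,3) e1(1)]
  have X: "smooth_on (model M \<times> model M) (U1 \<times> model M) (\<lambda>p. inv_field (snd p) (fst p))"
    unfolding inv_field_def using charted_atlasD(2)[OF M e1(1)] by (auto simp: subset_iff)
  have "U1 \<times> model M \<subseteq> model M \<times> model M"
    using openin_imp_subset[OF e1(4)] by auto
  from smooth_on_comp[OF V e1(4) fin_dim_subspace_Times[OF fin_dim fin_dim] this _
      smooth_on_Pair[OF smooth_on_ident smooth_on_const[where c = \<alpha>]] X]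
  show ?thesis
    using \<alpha> by simp
qed

text \<open>\<open>vf_in_chart\<close> undoes the pointwise choice of charts, by the chain rule for
  a left multiplication followed by the identity map.\<close>

lemma inv_field_left_invariant_vf:
  assumes y: "y \<in> U1" and \<alpha>: "\<alpha> \<in> model M"
  shows "vf_in_chart M e1 (left_invariant_vf G M \<alpha>) y = inv_field \<alpha> y"
proof -
  let ?x = "chart_inv e1 y"
  have x: "?x \<in> carrier G" "?x \<otimes> \<one> = ?x" "?x \<in> fst e1"
    using e1_carrier[OF y] by auto
  note d = chart_at_max_atlas[OF M, of ?x]
  have "inv_field \<alpha> y = dir_deriv (\<lambda>z. snd e1 (chart_inv (chart_at M ?x) z)) (snd (chart_at M ?x) (?x \<otimes> \<one>))
      (dir_deriv (\<lambda>z. snd (chart_at M ?x) (?x \<otimes> chart_inv e1 z)) (snd e1 \<one>) \<alpha>)"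
    unfolding inv_field_def
    by (rule dir_deriv_chart_comp[OF M M M smooth_left_mult[OF x(1)] smooth_map_ident[OF M] _ _ e1(2,3) d(1) _ e1(2) _ \<alpha>])
       (use x d in auto)
  then show ?thesis
    by (simp add: vf_in_chart_def Let_def left_invariant_vf_def mdiff_eq x o_def)
qed

lemma lie_bracket_eq:
  assumes "\<alpha> \<in> model M" "\<beta> \<in> model M"
  shows "lie_bracket G M \<alpha> \<beta> = dir_deriv (inv_field \<beta>) (snd e1 \<one>) (inv_field \<alpha> (snd e1 \<one>)) -
    dir_deriv (inv_field \<alpha>) (snd e1 \<one>) (inv_field \<beta> (snd e1 \<one>))"
proof -
  have "dir_deriv (vf_in_chart M e1 (left_invariant_vf G M \<alpha>)) (snd e1 \<one>) (inv_field \<beta> (snd e1 \<one>)) =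
      dir_deriv (inv_field \<alpha>) (snd e1 \<one>) (inv_field \<beta> (snd e1 \<one>))" if "\<alpha> \<in> model M" "\<beta> \<in> model M" for \<alpha> \<beta>
    by (rule dir_deriv_cong[OF fin_dim_subspaceD(1)[OF fin_dim] e1(4,5) linear_betw_in[OF inv_field_linear[OF e1(5)] that(2)]])
       (rule inv_field_left_invariant_vf[OF _ that(1)])
  then show ?thesis
    using assms by (simp add: lie_bracket_def vf_bracket_def Let_def inv_field_left_invariant_vf[OF e1(5)])
qed

lemma lie_bracket_skew: "lie_bracket G M \<alpha> \<beta> = - lie_bracket G M \<beta> \<alpha>"
  by (simp add: lie_bracket_def vf_bracket_def Let_def)

text \<open>At every point near the identity \<open>inv_field \<beta>\<close> is linear in
  \<open>\<beta>\<close>; hence so are its value and its derivative at the identity, and these make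
  up the bracket.\<close>

lemma lie_bracket_linear:
  assumes \<alpha>: "\<alpha> \<in> model M"
  shows "linear_betw (model M) (model M) (lie_bracket G M \<alpha>)"
proof -
  let ?V = "model M" and ?y = "snd e1 \<one>"
  note V = fin_dim_subspaceD(1)[OF fin_dim]
  note X = inv_field_linear and y = e1(5)
  have im: "inv_field \<beta> ` U1 \<subseteq> ?V" if "\<beta> \<in> ?V" for \<beta>
    using linear_betw_in[OF X that] by auto
  have D: "linear_betw ?V ?V (dir_deriv (inv_field \<beta>) ?y)" if "\<beta> \<in> ?V" for \<beta>
    by (rule linear_betw_dir_deriv[OF inv_field_smooth[OF that] fin_dim e1(4,5) fin_dim im[OF that]])
  have v: "inv_field \<alpha> ?y \<in> ?V"
    by (rule linear_betw_in[OF X[OF y] \<alpha>])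
  have "linear_betw ?V ?V (\<lambda>\<beta>. dir_deriv (inv_field \<beta>) ?y (inv_field \<alpha> ?y))"
    unfolding linear_betw_def
  proof (intro conjI ballI allI)
    show "(\<lambda>\<beta>. dir_deriv (inv_field \<beta>) ?y (inv_field \<alpha> ?y)) ` ?V \<subseteq> ?V"
      using linear_betw_in[OF D v] by auto
    show "dir_deriv (inv_field (\<beta> + \<gamma>)) ?y (inv_field \<alpha> ?y) =
        dir_deriv (inv_field \<beta>) ?y (inv_field \<alpha> ?y) + dir_deriv (inv_field \<gamma>) ?y (inv_field \<alpha> ?y)"
      if "\<beta> \<in> ?V" "\<gamma> \<in> ?V" for \<beta> \<gamma>
    proof -
      have "dir_deriv (inv_field (\<beta> + \<gamma>)) ?y (inv_field \<alpha> ?y) = dir_deriv (\<lambda>y. inv_field \<beta> y + inv_field \<gamma> y) ?y (inv_field \<alpha> ?y)"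
        by (rule dir_deriv_cong[OF V e1(4) y v linear_betw_add[OF X that]])
      then show ?thesis
        using dir_deriv_add[OF fin_dim e1(4) y v inv_field_smooth[OF that(1)] inv_field_smooth[OF that(2)]] by simp
    qed
    show "dir_deriv (inv_field (a *\<^sub>R \<beta>)) ?y (inv_field \<alpha> ?y) = a *\<^sub>R dir_deriv (inv_field \<beta>) ?y (inv_field \<alpha> ?y)"
      if "\<beta> \<in> ?V" for a \<beta>
    proof -
      have "dir_deriv (inv_field (a *\<^sub>R \<beta>)) ?y (inv_field \<alpha> ?y) = dir_deriv (\<lambda>y. a *\<^sub>R inv_field \<beta> y) ?y (inv_field \<alpha> ?y)"
        by (rule dir_deriv_cong[OF V e1(4) y v linear_betw_scale[OF X that]])
      then show ?thesis
        using dir_deriv_scaleR[OF fin_dim e1(4) y v inv_field_smooth[OF that]] by simp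
    qed
  qed
  from linear_betw_diff_fun[OF this linear_betw_comp[OF X[OF y] D[OF \<alpha>]] V]
  show ?thesis
    by (rule linear_betw_cong[OF V, THEN iffD1, rotated]) (rule lie_bracket_eq[OF \<alpha>, symmetric])
qed

lemma smooth_rep_orbit:
  assumes \<rho>: "lie_rep G M (V :: 'v::dual_separating set) \<rho>" and v: "v \<in> V"
  shows "smooth_map M (vec_mfd V) (\<lambda>g. \<rho> g v)"
proof -
  have V: "fin_dim_subspace V" and sm: "smooth_map (prod_mfd M (vec_mfd V)) (vec_mfd V) (\<lambda>(g, v). \<rho> g v)"
    using \<rho> by (auto simp: lie_rep_def)
  note VM = charted_vec_mfd[OF V]
  have "smooth_map M (prod_mfd M (vec_mfd V)) (\<lambda>g. (g, v))"
    using v by (intro smooth_map_on_Pair M VM smooth_map_ident smooth_map_const) simp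
  from smooth_map_comp[OF M charted_prod[OF M VM] VM this sm] show ?thesis
    by simp
qed

text \<open>In \<open>\<alpha>\<close> linearity is that of a differential. In \<open>v\<close> it
  holds because the maps \<open>\<rho> g\<close> near the identity are linear and differentiation
  commutes with sums and multiples.\<close>

lemma diff_rep_linear:
  assumes \<rho>: "lie_rep G M (V :: 'v::dual_separating set) \<rho>"
  shows "v \<in> V \<Longrightarrow> linear_betw (model M) V (\<lambda>\<alpha>. diff_rep G M V \<rho> \<alpha> v)"
    and "\<alpha> \<in> model M \<Longrightarrow> linear_betw V V (diff_rep G M V \<rho> \<alpha>)"
proof -
  have V: "fin_dim_subspace V" and lin: "\<And>g. g \<in> carrier G \<Longrightarrow> linear_betw V V (\<rho> g)"
    using \<rho> by (auto simp: lie_rep_def)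
  note V' = fin_dim_subspaceD(1)[OF V]
  show lin1: "linear_betw (model M) V (\<lambda>\<alpha>. diff_rep G M V \<rho> \<alpha> v)" if "v \<in> V" for v
    unfolding diff_rep_def using mdiff_linear[OF M charted_vec_mfd[OF V] smooth_rep_orbit[OF \<rho> that], of \<one>] by simp
  assume \<alpha>: "\<alpha> \<in> model M"
  have eq: "diff_rep G M V \<rho> \<alpha> v = dir_deriv (\<lambda>y. \<rho> (chart_inv e1 y) v) (snd e1 \<one>) \<alpha>" if "v \<in> V" for v
    using chart_at_vec[OF linear_betw_in[OF lin[OF one_closed] that]] by (simp add: diff_rep_def mdiff_eq)
  have sm: "smooth_on (model M) U1 (\<lambda>y. \<rho> (chart_inv e1 y) v)" if "v \<in> V" for v
  proof -
    have "fst e1 \<inter> pts M = fst e1"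
      using charted_atlasD(2)[OF M e1(1)] by auto
    then show ?thesis
      using smooth_map_on_vecD(2)[OF M V smooth_rep_orbit[OF \<rho> that] e1(2)] by simp
  qed
  note W = fin_dim_subspaceD(1)[OF fin_dim]
  show "linear_betw V V (diff_rep G M V \<rho> \<alpha>)"
    unfolding linear_betw_def
  proof (intro conjI ballI allI)
    show "diff_rep G M V \<rho> \<alpha> ` V \<subseteq> V"
      using linear_betw_in[OF lin1 \<alpha>] by auto
    show "diff_rep G M V \<rho> \<alpha> (v + w) = diff_rep G M V \<rho> \<alpha> v + diff_rep G M V \<rho> \<alpha> w" if v: "v \<in> V" and w: "w \<in> V" for v w
    proof -
      have "dir_deriv (\<lambda>y. \<rho> (chart_inv e1 y) (v + w)) (snd e1 \<one>) \<alpha> =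
          dir_deriv (\<lambda>y. \<rho> (chart_inv e1 y) v + \<rho> (chart_inv e1 y) w) (snd e1 \<one>) \<alpha>"
        by (rule dir_deriv_cong[OF W e1(4,5) \<alpha>]) (rule linear_betw_add[OF lin[OF e1_carrier(1)] v w])
      then show ?thesis
        using dir_deriv_add[OF fin_dim e1(4,5) \<alpha> sm[OF v] sm[OF w]] eq v w subspace_add[OF V' v w] by simp
    qed
    show "diff_rep G M V \<rho> \<alpha> (a *\<^sub>R v) = a *\<^sub>R diff_rep G M V \<rho> \<alpha> v" if v: "v \<in> V" for a v
    proof -
      have "dir_deriv (\<lambda>y. \<rho> (chart_inv e1 y) (a *\<^sub>R v)) (snd e1 \<one>) \<alpha> =
          dir_deriv (\<lambda>y. a *\<^sub>R \<rho> (chart_inv e1 y) v) (snd e1 \<one>) \<alpha>"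
        by (rule dir_deriv_cong[OF W e1(4,5) \<alpha>]) (rule linear_betw_scale[OF lin[OF e1_carrier(1)] v])
      then show ?thesis
        using dir_deriv_scaleR[OF fin_dim e1(4,5) \<alpha> sm[OF v]] eq v subspace_scale[OF V' v] by simp
    qed
  qed
qed

lemma prod_lie_rep:
  assumes \<rho>: "lie_rep G M (V :: 'v::dual_separating set) \<rho>" and \<sigma>: "lie_rep G M (W :: 'w::dual_separating set) \<sigma>"
  shows "lie_rep G M (V \<times> W) (\<lambda>g. map_prod (\<rho> g) (\<sigma> g))"
proof -
  have V: "fin_dim_subspace V" and W: "fin_dim_subspace W"
    and smV: "smooth_map (prod_mfd M (vec_mfd V)) (vec_mfd V) (\<lambda>(g, v). \<rho> g v)"
    and smW: "smooth_map (prod_mfd M (vec_mfd W)) (vec_mfd W) (\<lambda>(g, v). \<sigma> g v)"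
    and lV: "\<And>g. g \<in> carrier G \<Longrightarrow> linear_betw V V (\<rho> g)" and lW: "\<And>g. g \<in> carrier G \<Longrightarrow> linear_betw W W (\<sigma> g)"
    using \<rho> \<sigma> by (auto simp: lie_rep_def)
  note VW = fin_dim_subspace_Times[OF V W]
  have lin: "linear_betw (V \<times> W) (V \<times> W) (map_prod (\<rho> g) (\<sigma> g))" if "g \<in> carrier G" for g
    using lV[OF that] lW[OF that] by (auto simp: linear_betw_def)
  have "smooth_map (prod_mfd M (vec_mfd (V \<times> W))) (vec_mfd (V \<times> W)) (\<lambda>(g, v). map_prod (\<rho> g) (\<sigma> g) v)"
  proof (rule smooth_map_prod_vecI[OF M VW VW])
    show "(\<lambda>(g, v). map_prod (\<rho> g) (\<sigma> g) v) (x, v) \<in> V \<times> W" if "x \<in> pts M" "v \<in> V \<times> W" for x v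
      using linear_betw_in[OF lin] that by simp
    fix c assume c: "c \<in> atlas M"
    let ?U = "snd c ` fst c"
    have U: "open_in (model M) ?U"
      by (rule charted_atlasD(3)[OF M c])
    note dom = open_in_Times[OF U openin_subtopology_self, of "V \<times> W"]
    note sub = fin_dim_subspaceD(1)[OF fin_dim_subspace_Times[OF fin_dim VW]]
    have bl: "bounded_linear (\<lambda>p. (fst p, fst (snd p)))" "bounded_linear (\<lambda>p. (fst p, snd (snd p)))"
      by (intro bounded_linear_Pair bounded_linear_fst bounded_linear_compose[OF bounded_linear_fst bounded_linear_snd]
          bounded_linear_compose[OF bounded_linear_snd bounded_linear_snd])+
    have "smooth_on (model M \<times> (V \<times> W)) (?U \<times> (V \<times> W)) (\<lambda>p. (\<lambda>(g, v). \<rho> g v) (chart_inv c (fst (fst p, fst (snd p))), snd (fst p, fst (snd p))))"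
      by (rule smooth_on_comp[OF sub dom fin_dim_subspace_Times[OF fin_dim V] _ _ smooth_on_linear[OF bl(1)]
            smooth_map_prod_vecD[OF M V V smV c]]) (use openin_imp_subset[OF U] in auto)
    moreover have "smooth_on (model M \<times> (V \<times> W)) (?U \<times> (V \<times> W)) (\<lambda>p. (\<lambda>(g, v). \<sigma> g v) (chart_inv c (fst (fst p, snd (snd p))), snd (fst p, snd (snd p))))"
      by (rule smooth_on_comp[OF sub dom fin_dim_subspace_Times[OF fin_dim W] _ _ smooth_on_linear[OF bl(2)]
            smooth_map_prod_vecD[OF M W W smW c]]) (use openin_imp_subset[OF U] in auto)
    ultimately have "smooth_on (model M \<times> (V \<times> W)) (?U \<times> (V \<times> W))
        (\<lambda>p. (\<rho> (chart_inv c (fst p)) (fst (snd p)), \<sigma> (chart_inv c (fst p)) (snd (snd p))))"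
      using smooth_on_Pair by fastforce
    then show "smooth_on (model M \<times> (V \<times> W)) (?U \<times> (V \<times> W)) (\<lambda>p. (\<lambda>(g, v). map_prod (\<rho> g) (\<sigma> g) v) (chart_inv c (fst p), snd p))"
      by (simp add: map_prod_def case_prod_beta')
  qed
  then show ?thesis
    using \<rho> \<sigma> lin VW unfolding lie_rep_def by auto
qed

end

section \<open>The semidirect product as a reductive extension\<close>

text \<open>The kernel of the zero map is the whole Lie algebra. The first component of
  \<open>br\<close> depends on first components only, so \<open>fst\<close> preserves brackets. In
  the bracket of \<open>(\<alpha>, 0)\<close> with \<open>(0, v)\<close>, every term of the second
  component except the action of \<open>\<alpha>\<close> on \<open>v\<close> has a zero
  argument.\<close>

lemma reductive_semidirect:
  fixes M :: "('g, 'm::dual_separating) mfd" and KM :: "('k, 'v::dual_separating) mfd"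
  assumes G: "lie_group G M" and K: "lie_group K KM" and \<rho>: "lie_rep G M (model KM) \<rho>"
  defines "br \<equiv> semidirect_bracket (lie_bracket G M) (lie_bracket K KM) (diff_rep G M (model KM) \<rho>)"
    and "\<sigma> \<equiv> \<lambda>g. map_prod (Ad G M g) (\<rho> g)"
  shows "pfaffian_group G M (model M) (model KM) \<rho> (\<lambda>_. 0)"
    "cartan_type_extension G M (model M) (model KM) \<rho> (model M \<times> model KM) \<sigma> br (\<lambda>\<alpha>. (\<alpha>, 0)) snd"
    "reductive_extension G M (model M) (model KM) \<rho> (model M \<times> model KM) \<sigma> br (\<lambda>\<alpha>. (\<alpha>, 0)) snd"
proof -
  interpret G: lie G M
    by unfold_locales (fact G)
  interpret K: lie K KM
    by unfold_locales (fact K)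
  let ?g = "model M" and ?k = "model KM"
  note g = fin_dim_subspaceD(1)[OF G.fin_dim] and k = fin_dim_subspaceD(1)[OF K.fin_dim]
  have 0: "0 \<in> ?g" "0 \<in> ?k"
    using g k by (auto intro: subspace_0)
  have \<rho>_lin: "\<And>g. g \<in> carrier G \<Longrightarrow> linear_betw ?k ?k (\<rho> g)"
    using \<rho> by (simp add: lie_rep_def)
  have \<rho>0: "\<rho> g 0 = 0" if "g \<in> carrier G" for g
    by (rule linear_betw_0[OF \<rho>_lin[OF that] k])
  note D = G.diff_rep_linear[OF \<rho>]
  note bg = G.lie_bracket_linear and bk = K.lie_bracket_linear
  have bk0: "lie_bracket K KM 0 v = 0" "lie_bracket K KM v 0 = 0" if "v \<in> ?k" for v
    using linear_betw_0[OF bk[OF that] k] K.lie_bracket_skew[of 0 v] by auto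
  have D0: "diff_rep G M ?k \<rho> 0 v = 0" if "v \<in> ?k" for v
    by (rule linear_betw_0[OF D(1)[OF that] g])
  have D0': "diff_rep G M ?k \<rho> \<alpha> 0 = 0" if "\<alpha> \<in> ?g" for \<alpha>
    by (rule linear_betw_0[OF D(2)[OF that] k])
  have br: "br (\<alpha>, v) (\<beta>, w) = (lie_bracket G M \<alpha> \<beta>, lie_bracket K KM v w + diff_rep G M ?k \<rho> \<alpha> w - diff_rep G M ?k \<rho> \<beta> v)"
    for \<alpha> v \<beta> w
    by (simp add: br_def semidirect_bracket_def)
  have skew: "br x y = - br y x" for x y
    using G.lie_bracket_skew[of "fst x" "fst y"] K.lie_bracket_skew[of "snd x" "snd y"]
    by (cases x; cases y) (simp add: br)
  have lin: "linear_betw (?g \<times> ?k) (?g \<times> ?k) (br x)" if x: "x \<in> ?g \<times> ?k" for x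
  proof -
    obtain \<alpha> v where xv: "x = (\<alpha>, v)" "\<alpha> \<in> ?g" "v \<in> ?k"
      using x by auto
    note l = bg[OF xv(2)] bk[OF xv(3)] D(2)[OF xv(2)] D(1)[OF xv(3)]
    show ?thesis
      unfolding linear_betw_def xv(1)
    proof (intro conjI ballI allI)
      show "br (\<alpha>, v) ` (?g \<times> ?k) \<subseteq> ?g \<times> ?k"
        using linear_betw_in[OF l(1)] linear_betw_in[OF l(2)] linear_betw_in[OF l(3)] linear_betw_in[OF l(4)] k
        by (auto simp: br intro!: subspace_diff subspace_add)
      show "br (\<alpha>, v) (y + z) = br (\<alpha>, v) y + br (\<alpha>, v) z" if "y \<in> ?g \<times> ?k" "z \<in> ?g \<times> ?k" for y z
        using that linear_betw_add[OF l(1)] linear_betw_add[OF l(2)] linear_betw_add[OF l(3)] linear_betw_add[OF l(4)]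
        by (auto simp: br)
      show "br (\<alpha>, v) (a *\<^sub>R y) = a *\<^sub>R br (\<alpha>, v) y" if "y \<in> ?g \<times> ?k" for a y
        using that linear_betw_scale[OF l(1)] linear_betw_scale[OF l(2)] linear_betw_scale[OF l(3)] linear_betw_scale[OF l(4)]
        by (auto simp: br scaleR_right_distrib scaleR_right_diff_distrib)
    qed
  qed
  have lin': "linear_betw (?g \<times> ?k) (?g \<times> ?k) (\<lambda>x. br x y)" if y: "y \<in> ?g \<times> ?k" for y
  proof -
    have "(\<lambda>x. br x y) = (\<lambda>x. - br y x)"
      using skew by blast
    moreover have "subspace (?g \<times> ?k)"
      using fin_dim_subspaceD(1)[OF fin_dim_subspace_Times[OF G.fin_dim K.fin_dim]] .
    ultimately show ?thesis
      using lin[OF y] by (auto simp: linear_betw_def image_subset_iff subspace_neg)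
  qed
  show "pfaffian_group G M ?g ?k \<rho> (\<lambda>_. 0)"
    unfolding pfaffian_group_def equivariant_def using G \<rho> 0 \<rho>0 by (auto simp: linear_betw_def)
  show "cartan_type_extension G M ?g ?k \<rho> (?g \<times> ?k) \<sigma> br (\<lambda>\<alpha>. (\<alpha>, 0)) snd"
    unfolding cartan_type_extension_def
  proof (intro conjI)
    show "lie_rep G M (?g \<times> ?k) \<sigma>"
      unfolding \<sigma>_def by (rule G.prod_lie_rep[OF G.Ad_lie_rep \<rho>])
    show "almost_lie_bracket (?g \<times> ?k) br"
      unfolding almost_lie_bracket_def using lin lin' skew by blast
    show "\<forall>\<alpha>\<in>?g. \<forall>\<beta>\<in>?g. (lie_bracket G M \<alpha> \<beta>, 0) = br (\<alpha>, 0) (\<beta>, 0)"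
      using bk0 D0' 0 by (simp add: br)
  qed (use G.Ad_lie_rep \<rho> 0 \<rho>0 in \<open>auto simp: linear_betw_def equivariant_def \<sigma>_def inj_on_def image_iff\<close>)
  show "reductive_extension G M ?g ?k \<rho> (?g \<times> ?k) \<sigma> br (\<lambda>\<alpha>. (\<alpha>, 0)) snd"
    unfolding reductive_extension_def
  proof (intro exI[of _ fst] exI[of _ "\<lambda>v. (0, v)"] conjI)
    show "\<forall>\<alpha>\<in>?g. \<forall>v\<in>?k. diff_rep G M ?k \<rho> \<alpha> v = snd (br (\<alpha>, 0) (0, v))"
      using bk0 D0 0 by (simp add: br)
  qed (use 0 in \<open>auto simp: linear_betw_def equivariant_def \<sigma>_def br\<close>)
qed

section \<open>The differential of the orbit map\<close>

lemma subspace_card_eq: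
  assumes W1: "fin_dim_subspace W1" and W: "fin_dim_subspace W" and sub: "W1 \<subseteq> W"
    and card: "card (model_basis W) \<le> card (model_basis W1)"
  shows "W1 = W"
proof (rule ccontr)
  assume "W1 \<noteq> W"
  then obtain w where w: "w \<in> W" "w \<notin> W1"
    using sub by blast
  note D1 = fin_dim_subspaceD[OF W1] and D = fin_dim_subspaceD[OF W]
  have "independent (insert w (model_basis W1))"
    using w D1(3,5) by (intro independent_insertI) auto
  moreover have "insert w (model_basis W1) \<subseteq> span (model_basis W)"
    using w D1(4) D(5) sub by auto
  ultimately have "card (insert w (model_basis W1)) \<le> card (model_basis W)"
    using independent_span_bound[OF D(2)] by blast
  moreover have "w \<notin> model_basis W1"
    using w D1(4) by auto
  ultimately show False
    using card D1(2) by simp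
qed

text \<open>The measure argument for the orbit map allows only countably many charts, which second
  countability provides through the Lindelof property.\<close>

lemma countable_chart_cover:
  fixes M :: "('p, 'm::dual_separating) mfd"
  assumes M: "smooth_manifold M"
  obtains C where "countable C" "C \<subseteq> atlas M" "(\<Union>c\<in>C. fst c) = pts M"
proof -
  note ch = smooth_manifold_charted[OF M]
  have "Lindelof_space (mtop M)"
    using M by (intro second_countable_imp_Lindelof_space) (simp add: smooth_manifold_def)
  moreover have "openin (mtop M) U" if "U \<in> fst ` atlas M" for U
  proof -
    from that obtain c where c: "c \<in> atlas M" "U = fst c"
      by blast
    show ?thesis
      unfolding openin_mtop[OF ch] c(2)
    proof (intro conjI ballI)
      show "fst c \<subseteq> pts M"
        by (rule charted_atlasD(2)[OF ch c(1)])
      fix d assume "d \<in> atlas M"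
      then have "smooth_transition (model M) d c"
        using ch c(1) by (auto simp: charted_def compatible_def)
      then show "open_in (model M) (snd d ` (fst c \<inter> fst d))"
        by (simp add: smooth_transition_def Int_commute)
    qed
  qed
  moreover have "\<Union> (fst ` atlas M) = topspace (mtop M)"
    using ch by (simp add: topspace_mtop[OF ch] charted_def)
  ultimately obtain \<V> where \<V>: "countable \<V>" "\<V> \<subseteq> fst ` atlas M" "\<Union>\<V> = topspace (mtop M)"
    unfolding Lindelof_space_def by metis
  obtain C where C: "countable C" "C \<subseteq> atlas M" "fst ` C = \<V>"
    using countable_subset_image[of \<V> fst "atlas M"] \<V>(1,2) by metis
  then have "(\<Union>c\<in>C. fst c) = pts M"
    using \<V>(3) topspace_mtop[OF ch] by blast
  then show thesis
    using that C by blast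
qed

locale simply_transitive_action = lie K KM
  for K :: "'k monoid" (structure) and KM :: "('k, 'b::euclidean_space) mfd" +
  fixes X :: "('x, 'a::euclidean_space) mfd" and A :: "'k \<Rightarrow> 'x \<Rightarrow> 'x" and x\<^sub>0 :: 'x
  assumes X: "smooth_manifold X" and x0: "x\<^sub>0 \<in> pts X"
    and act: "lie_group_action K KM X A" and free: "free_action K (pts X) A"
    and trans: "transitive_action K (pts X) A"
begin

lemma chX: "charted X"
  by (rule smooth_manifold_charted[OF X])

lemma V: "fin_dim_subspace (model X)"
  by (rule charted_fin_dim[OF chX])

sublocale act: group_action K "pts X" A
  using act by (simp add: lie_group_action_def)

lemma smooth_act: "k \<in> carrier K \<Longrightarrow> smooth_map X X (A k)"
proof -
  assume k: "k \<in> carrier K"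
  have "smooth_map (prod_mfd KM X) X (\<lambda>(k, x). A k x)"
    using act by (simp add: lie_group_action_def)
  moreover have "smooth_map X (prod_mfd KM X) (\<lambda>x. (k, x))"
    using k by (intro smooth_map_on_Pair chX M smooth_map_ident smooth_map_const) simp
  ultimately have "smooth_map X X (\<lambda>x. (\<lambda>(k, x). A k x) (k, x))"
    by (intro smooth_map_comp[OF chX charted_prod[OF M chX] chX])
  then show ?thesis
    by simp
qed

definition orb :: "'k \<Rightarrow> 'x" where
  "orb k = A k x\<^sub>0"

lemma smooth_orb: "smooth_map KM X orb"
proof -
  have "smooth_map (prod_mfd KM X) X (\<lambda>(k, x). A k x)"
    using act by (simp add: lie_group_action_def)
  moreover have "smooth_map KM (prod_mfd KM X) (\<lambda>k. (k, x\<^sub>0))"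
    using x0 by (intro smooth_map_on_Pair chX M smooth_map_ident smooth_map_const) simp
  ultimately have "smooth_map KM X (\<lambda>k. (\<lambda>(k, x). A k x) (k, x\<^sub>0))"
    by (intro smooth_map_comp[OF M charted_prod[OF M chX] chX])
  then show ?thesis
    by (simp add: orb_def[abs_def])
qed

lemma orb_one: "orb \<one> = x\<^sub>0"
  unfolding orb_def act.id_eq_one[symmetric] using x0 by simp

lemma orb_mult: "k \<in> carrier K \<Longrightarrow> h \<in> carrier K \<Longrightarrow> A k (orb h) = orb (k \<otimes> h)"
  using act.composition_rule[OF x0] by (simp add: orb_def)

lemma orb_inj: "inj_on orb (carrier K)"
proof (rule inj_onI)
  fix k h assume k: "k \<in> carrier K" and h: "h \<in> carrier K" and "orb k = orb h"
  then have "A (inv h) (orb k) = A (inv h) (orb h)"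
    by simp
  then have "orb (inv h \<otimes> k) = x\<^sub>0"
    using k h by (simp add: orb_mult orb_one)
  then have "inv h \<otimes> k \<in> stabilizer K A x\<^sub>0"
    using k h by (simp add: stabilizer_def orb_def)
  then have "inv h \<otimes> k = \<one>"
    using free x0 by (auto simp: free_action_def)
  then have "h \<otimes> (inv h \<otimes> k) = h"
    using h by simp
  then show "k = h"
    using k h by (simp add: m_assoc[symmetric])
qed

lemma orb_surj: "x \<in> pts X \<Longrightarrow> \<exists>k\<in>carrier K. orb k = x"
  using transitive_action.unique_orbit[OF trans x0] by (simp add: orb_def)

definition T :: "'b \<Rightarrow> 'a" where
  "T = orbit_map_diff K KM X A x\<^sub>0"

lemma T_eq: "T v = dir_deriv (\<lambda>y. snd (chart_at X x\<^sub>0) (orb (chart_inv e1 y))) (snd e1 \<one>) v"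
  by (simp add: T_def orbit_map_diff_def mdiff_eq orb_def[symmetric] orb_one)

lemma T_linear: "linear_betw (model KM) (model X) T"
proof -
  have "linear_betw (model KM) (model X) (mdiff KM X orb \<one>)"
    by (rule mdiff_linear[OF M chX smooth_orb]) simp
  then show ?thesis
    by (simp add: T_def orbit_map_diff_def orb_def[abs_def])
qed

text \<open>The identity \<open>orb h = A k (orb (inv k \<otimes> h))\<close> factors the
  differential of \<open>orb\<close> at \<open>k\<close> through the one at the unit, which is the
  hypothesis of constant rank; injectivity of \<open>orb\<close> comes from freeness.\<close>

lemma T_injective:
  assumes v: "v \<in> model KM" "T v = 0"
  shows "v = 0"
proof -
  let ?e = "chart_at X x\<^sub>0"
  have e: "?e \<in> max_atlas X" "x\<^sub>0 \<in> fst ?e"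
    using chart_at_max_atlas[OF chX x0] by auto
  define U where "U = snd e1 ` {x \<in> fst e1 \<inter> pts KM. orb x \<in> fst ?e}"
  define f where "f y = snd ?e (orb (chart_inv e1 y))" for y
  have U: "open_in (model KM) U" "smooth_on (model KM) U f"
    using smooth_map_onD[OF M chX smooth_orb e1(2) e(1)] by (simp_all add: U_def f_def[abs_def])
  have inv: "chart_inv e1 (snd e1 k) = k" if "k \<in> fst e1" for k
    by (rule chart_inv_left[OF max_atlasD(2)[OF e1(2)] that])
  have U_in: "\<exists>k. k \<in> fst e1 \<and> k \<in> carrier K \<and> orb k \<in> fst ?e \<and> y = snd e1 k \<and> f y = snd ?e (orb k)" if "y \<in> U" for y
    using that inv by (auto simp: U_def f_def)
  show ?thesis
  proof (rule constant_rank_injective[OF fin_dim V U(1) _ U(2)])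
    show "snd e1 \<one> \<in> U"
      using e1(3) e(2) orb_one by (auto simp: U_def)
    show "f ` U \<subseteq> model X"
      using U_in openin_imp_subset[OF max_atlasD(4)[OF e(1)]] by fastforce
    show "inj_on f U"
    proof (rule inj_onI)
      fix y z assume y: "y \<in> U" and z: "z \<in> U" and eq: "f y = f z"
      obtain k where k: "k \<in> carrier K" "orb k \<in> fst ?e" "y = snd e1 k" "f y = snd ?e (orb k)"
        using U_in[OF y] by blast
      obtain h where h: "h \<in> carrier K" "orb h \<in> fst ?e" "z = snd e1 h" "f z = snd ?e (orb h)"
        using U_in[OF z] by blast
      have "orb k = orb h"
        using max_atlasD(2)[OF e(1)] k h eq by (auto dest: inj_onD)
      then show "y = z"
        using orb_inj k h by (auto dest: inj_onD)
    qed
    show "v \<in> model KM" "dir_deriv f (snd e1 \<one>) v = 0"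
      using v by (simp_all add: T_eq f_def[abs_def])
    fix y assume "y \<in> U"
    then obtain k where k: "k \<in> fst e1" "k \<in> carrier K" "orb k \<in> fst ?e" "y = snd e1 k"
      using U_in by blast
    note L = smooth_left_mult[OF inv_closed[OF k(2)]]
    note Ak = smooth_act[OF k(2)]
    have kk: "inv k \<otimes> k = \<one>"
      using k(2) by simp
    have Ak0: "A k (orb \<one>) = orb k"
      using orb_mult[OF k(2) one_closed] k(2) by simp
    \<comment> \<open>\<open>\<alpha>\<close> is the differential at \<open>k\<close> of left
      multiplication by \<open>inv k\<close>, and \<open>\<beta>\<close> that of the action of
      \<open>k\<close> at \<open>x\<^sub>0\<close>, both in the charts fixed above.\<close>
    define \<alpha> where "\<alpha> = dir_deriv (\<lambda>y. snd e1 (inv k \<otimes> chart_inv e1 y)) (snd e1 k)"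
    define \<beta> where "\<beta> = dir_deriv (\<lambda>z. snd ?e (A k (chart_inv ?e z))) (snd ?e (orb \<one>))"
    have AO: "smooth_map KM X (\<lambda>h. A k (orb h))"
      by (rule smooth_map_comp[OF M chX chX smooth_orb Ak])
    have "dir_deriv f y w = \<beta> (dir_deriv f (snd e1 \<one>) (\<alpha> w))" if w: "w \<in> model KM" for w
    proof -
      have "dir_deriv f (snd e1 k) w = dir_deriv (\<lambda>y. snd ?e (A k (orb (inv k \<otimes> chart_inv e1 y)))) (snd e1 k) w"
      proof (rule dir_deriv_cong[OF fin_dim_subspaceD(1)[OF fin_dim] max_atlasD(4)[OF e1(2)] _ w])
        show "snd e1 k \<in> U1"
          using k(1) by blast
        fix z assume "z \<in> U1"
        then have "chart_inv e1 z \<in> carrier K"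
          by (rule e1_carrier(1))
        then show "f z = snd ?e (A k (orb (inv k \<otimes> chart_inv e1 z)))"
          using k(2) by (simp add: f_def orb_mult m_assoc[symmetric])
      qed
      also have "\<dots> = dir_deriv (\<lambda>z. snd ?e (A k (orb (chart_inv e1 z)))) (snd e1 (inv k \<otimes> k)) (\<alpha> w)"
        unfolding \<alpha>_def
        by (rule dir_deriv_chart_comp[OF M M chX L AO _ _ e1(2) k(1) e1(2) _ e(1) _ w])
           (use k kk e1(3) Ak0 in auto)
      also have "\<dots> = \<beta> (dir_deriv f (snd e1 \<one>) (\<alpha> w))"
        unfolding \<beta>_def kk f_def[abs_def]
      proof (rule dir_deriv_chart_comp[OF M chX chX smooth_orb Ak _ _ e1(2,3) e(1) _ e(1)])
        show "\<alpha> w \<in> model KM"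
          unfolding \<alpha>_def
          by (rule linear_betw_in[OF linear_betw_chart[OF M M L _ e1(2) k(1) e1(2)] w]) (use k kk e1(3) in auto)
      qed (use Ak0 k orb_one e(2) x0 in auto)
      finally show ?thesis
        by (simp add: k(4))
    qed
    moreover have "linear_betw (model KM) (model KM) \<alpha>"
      unfolding \<alpha>_def by (rule linear_betw_chart[OF M M L _ e1(2) k(1) e1(2)]) (use k kk e1(3) in auto)
    moreover have "linear_betw (model X) (model X) \<beta>"
      unfolding \<beta>_def by (rule linear_betw_chart[OF chX chX Ak _ e(1) _ e(1)]) (use Ak0 k orb_one e(2) x0 in auto)
    ultimately show "\<exists>\<alpha> \<beta>. linear_betw (model KM) (model KM) \<alpha> \<and> linear_betw (model X) (model X) \<beta> \<and>
        (\<forall>v\<in>model KM. dir_deriv f y v = \<beta> (dir_deriv f (snd e1 \<one>) (\<alpha> v)))"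
      by blast
  qed
qed

text \<open>Over a countable cover by charts of \<open>KM\<close>, transitivity makes the coordinate
  expressions of \<open>orb\<close> cover the whole image of a chart of \<open>X\<close>. With too
  small a dimension of \<open>KM\<close> this image would be empty, but the chart contains
  \<open>x\<^sub>0\<close>.\<close>

lemma dim_le: "card (model_basis (model X)) \<le> card (model_basis (model KM))"
proof (rule ccontr)
  assume "\<not> ?thesis"
  then have less: "card (model_basis (model KM)) < card (model_basis (model X))"
    by simp
  have KM: "smooth_manifold KM"
    using lie_group by (simp add: lie_group_def)
  obtain C where C: "countable C" "C \<subseteq> atlas KM" "(\<Union>c\<in>C. fst c) = pts KM"
    using countable_chart_cover[OF KM] by blast
  let ?e = "chart_at X x\<^sub>0"
  have e: "?e \<in> max_atlas X" "x\<^sub>0 \<in> fst ?e"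
    using chart_at_max_atlas[OF chX x0] by auto
  define U where "U c = snd c ` {x \<in> fst c \<inter> pts KM. orb x \<in> fst ?e}" for c :: "('k, 'b) chart"
  define f where "f c y = snd ?e (orb (chart_inv c y))" for c :: "('k, 'b) chart" and y
  have U: "open_in (model KM) (U c)" "smooth_on (model KM) (U c) (f c)" if "c \<in> C" for c
    using smooth_map_onD[OF M chX smooth_orb _ e(1), of c] charted_atlas_subset[OF M] C(2) that
    by (auto simp: U_def f_def[abs_def])
  have "snd ?e ` fst ?e = {}"
  proof (rule lowdim_images_empty_interior[OF fin_dim V less C(1) _ _ max_atlasD(4)[OF e(1)]])
    show "f c differentiable_on U c" if "c \<in> C" for c
      using smooth_on_has_derivative[OF U(2)[OF that] fin_dim U(1)[OF that]]
      unfolding differentiable_on_def differentiable_def by blast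
    show "U c \<subseteq> model KM" if "c \<in> C" for c
      using openin_imp_subset[OF U(1)[OF that]] .
    show "snd ?e ` fst ?e \<subseteq> (\<Union>c\<in>C. f c ` U c)"
    proof
      fix z assume "z \<in> snd ?e ` fst ?e"
      then obtain x where x: "x \<in> fst ?e" "z = snd ?e x"
        by blast
      then have "x \<in> pts X"
        using max_atlasD(3)[OF e(1)] by blast
      then obtain k where k: "k \<in> carrier K" "orb k = x"
        using orb_surj by blast
      then have "k \<in> (\<Union>c\<in>C. fst c)"
        using C(3) by simp
      then obtain c where c: "c \<in> C" "k \<in> fst c"
        by blast
      have "chart_inv c (snd c k) = k"
        using charted_atlasD(1)[OF M] C(2) c by (intro chart_inv_left) auto
      then have "f c (snd c k) = z"
        using k x by (simp add: f_def)
      moreover have "snd c k \<in> U c"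
        using c k x by (auto simp: U_def)
      ultimately show "z \<in> (\<Union>c\<in>C. f c ` U c)"
        using c by blast
    qed
  qed
  then show False
    using e(2) by blast
qed

text \<open>Injectivity gives the range the dimension of the model space of \<open>KM\<close>, and
  \<open>dim_le\<close> makes it fill the model space of \<open>X\<close>.\<close>

lemma T_surj: "T ` model KM = model X"
proof -
  have TW: "T ` model KM \<subseteq> model X"
    using linear_betw_in[OF T_linear] by auto
  have sub: "fin_dim_subspace (T ` model KM)"
    by (rule fin_dim_subspace_subset[OF V linear_betw_image_subspace[OF T_linear fin_dim_subspaceD(1)[OF fin_dim]] TW])
  have "{v \<in> model KM. T v = 0} = {0}"
    using T_injective linear_betw_0[OF T_linear fin_dim_subspaceD(1)[OF fin_dim]]
      subspace_0[OF fin_dim_subspaceD(1)[OF fin_dim]] by auto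
  \<comment> \<open>A set that contains the zero vector is dependent, so the zero space has the
    empty basis.\<close>
  moreover have "card (model_basis {0::'b}) = 0"
  proof -
    have "fin_dim_subspace {0::'b}"
      by (rule fin_dim_subspace_euclidean) simp
    from fin_dim_subspaceD[OF this] have "model_basis {0::'b} \<subseteq> {0}" "0 \<notin> model_basis {0::'b}"
      using dependent_zero by auto
    then have "model_basis {0::'b} = {}"
      by auto
    then show ?thesis
      by simp
  qed
  moreover have "linear_betw (model KM) (T ` model KM) T"
    by (rule linear_betw_subset[OF T_linear]) auto
  ultimately have "card (model_basis (model KM)) = card (model_basis (T ` model KM))"
    using rank_nullity[of "model KM" "T ` model KM" T] fin_dim sub by simp
  then show ?thesis
    using dim_le by (intro subspace_card_eq sub V TW) simp
qed

lemma T_inj_on: "inj_on T (model KM)"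
  by (rule linear_betw_inj_on[OF T_linear fin_dim_subspaceD(1)[OF fin_dim] T_injective])

end

section \<open>Jets of order at most one\<close>

text \<open>The chart independence of 1-jets rests on this formula: the first derivative in one pair
  of charts determines the one in any other pair.\<close>

lemma dir_deriv_chart_change:
  fixes M :: "('p, 'm::dual_separating) mfd" and N :: "('q, 'n::dual_separating) mfd"
  assumes M: "charted M" and N: "charted N" and f: "smooth_map_on M N W f" and x: "x \<in> W"
    and c: "c \<in> max_atlas M" "x \<in> fst c" "c' \<in> max_atlas M" "x \<in> fst c'"
    and d: "d \<in> max_atlas N" "f x \<in> fst d" "d' \<in> max_atlas N" "f x \<in> fst d'" and v: "v \<in> model M"
  shows "dir_deriv (\<lambda>y. snd d (f (chart_inv c y))) (snd c x) v =
    dir_deriv (\<lambda>z. snd d (chart_inv d' z)) (snd d' (f x))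
      (dir_deriv (\<lambda>y. snd d' (f (chart_inv c' y))) (snd c' x) (dir_deriv (\<lambda>y. snd c' (chart_inv c y)) (snd c x) v))"
proof -
  have xp: "x \<in> pts M" "f x \<in> pts N"
    using smooth_map_on_subset[OF f] smooth_map_on_image[OF f] x by auto
  let ?w = "dir_deriv (\<lambda>y. snd c' (chart_inv c y)) (snd c x) v"
  have w: "?w \<in> model M"
    by (rule linear_betw_in[OF linear_betw_chart[OF M M smooth_map_ident[OF M] xp(1) c(1-4)] v])
  have "dir_deriv (\<lambda>y. snd d (f (chart_inv c y))) (snd c x) v = dir_deriv (\<lambda>z. snd d (f (chart_inv c' z))) (snd c' x) ?w"
    by (rule dir_deriv_chart_comp[OF M M N smooth_map_ident[OF M] f xp(1) x c(1-4) d(1,2) v])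
  also have "\<dots> = dir_deriv (\<lambda>z. snd d (chart_inv d' z)) (snd d' (f x)) (dir_deriv (\<lambda>y. snd d' (f (chart_inv c' y))) (snd c' x) ?w)"
    by (rule dir_deriv_chart_comp[OF M N N f smooth_map_ident[OF N] x xp(2) c(3,4) d(3,4) d(1,2) w])
  finally show ?thesis .
qed

lemma finite_jet_index: "fin_dim_subspace V \<Longrightarrow> finite (jet_index k V)"
  unfolding jet_index_def using finite_lists_length_le[OF fin_dim_subspaceD(2)] by blast

text \<open>\<open>Abs_poly_mapping\<close> is meaningful only for finite support; here the support
  lies in the finite set of lists of bounded length over a finite basis.\<close>

lemma lookup_jet_coords:
  fixes X :: "('x, 'a::dual_separating) mfd"
  assumes "fin_dim_subspace (model X)"
  shows "Poly_Mapping.lookup (snd (jet_coords X k c d x \<phi>)) vs =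
    (if vs \<in> jet_index k (model X) then iter_deriv vs (\<lambda>y. snd d (the (\<phi> (chart_inv c y)))) (snd c x) else 0)"
proof -
  have "finite {vs. (if vs \<in> jet_index k (model X) then iter_deriv vs (snd d \<circ> the \<circ> \<phi> \<circ> chart_inv c) (snd c x) else 0) \<noteq> 0}"
    by (rule finite_subset[OF _ finite_jet_index[OF assms, of k]]) auto
  then show ?thesis
    unfolding jet_coords_def snd_conv by (simp add: o_def)
qed

lemma jet_coords_eqI:
  fixes X :: "('x, 'a::dual_separating) mfd"
  assumes "fin_dim_subspace (model X)"
    "\<And>vs. vs \<in> jet_index k (model X) \<Longrightarrow> iter_deriv vs (\<lambda>y. snd d (the (\<phi> (chart_inv c y)))) (snd c x) =
      iter_deriv vs (\<lambda>y. snd d (the (\<psi> (chart_inv c y)))) (snd c x)"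
  shows "jet_coords X k c d x \<phi> = jet_coords X k c d x \<psi>"
proof (rule prod_eqI)
  show "fst (jet_coords X k c d x \<phi>) = fst (jet_coords X k c d x \<psi>)"
    by (simp add: jet_coords_def)
  show "snd (jet_coords X k c d x \<phi>) = snd (jet_coords X k c d x \<psi>)"
    by (rule poly_mapping_eqI) (simp add: lookup_jet_coords[OF assms(1)] assms(2))
qed

lemma jet_eqI:
  assumes "\<phi> x = \<psi> x"
    "\<And>c d. c \<in> atlas X \<Longrightarrow> d \<in> atlas X \<Longrightarrow> x \<in> fst c \<Longrightarrow> the (\<phi> x) \<in> fst d \<Longrightarrow> jet_coords X k c d x \<phi> = jet_coords X k c d x \<psi>"
  shows "jet X k x \<phi> = jet X k x \<psi>"
  unfolding jet_def using assms by (intro arg_cong[of _ _ "Pair x"] Collect_cong) (metis (no_types, lifting))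

lemma jet_memI: "local_smooth_map X \<phi> \<Longrightarrow> x \<in> dom \<phi> \<Longrightarrow> \<phi> \<in> snd (jet X k x \<phi>)"
  by (simp add: jet_def)

text \<open>\<open>jet_rep\<close> chooses an arbitrary member of the class, which is non-empty
  because it contains \<open>\<phi>\<close>. What is known of the choice is that it is a local
  smooth map with the same jet.\<close>

lemma
  assumes "local_smooth_map X \<phi>" "x \<in> dom \<phi>"
  shows jet_rep_smooth: "local_smooth_map X (jet_rep (jet X k x \<phi>))"
    and jet_rep_dom: "x \<in> dom (jet_rep (jet X k x \<phi>))"
    and jet_rep_at: "jet_rep (jet X k x \<phi>) x = \<phi> x"
    and jet_jet_rep: "jet X k x (jet_rep (jet X k x \<phi>)) = jet X k x \<phi>"
proof -
  have "jet_rep (jet X k x \<phi>) \<in> snd (jet X k x \<phi>)"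
    unfolding jet_rep_def by (rule someI[of "\<lambda>\<psi>. \<psi> \<in> snd (jet X k x \<phi>)"]) (rule jet_memI[OF assms])
  then have *: "local_smooth_map X (jet_rep (jet X k x \<phi>))" "x \<in> dom (jet_rep (jet X k x \<phi>))"
    "jet_rep (jet X k x \<phi>) x = \<phi> x"
    "\<And>c d. c \<in> atlas X \<Longrightarrow> d \<in> atlas X \<Longrightarrow> x \<in> fst c \<Longrightarrow> the (\<phi> x) \<in> fst d \<Longrightarrow>
      jet_coords X k c d x (jet_rep (jet X k x \<phi>)) = jet_coords X k c d x \<phi>"
    by (auto simp: jet_def)
  then show "local_smooth_map X (jet_rep (jet X k x \<phi>))" "x \<in> dom (jet_rep (jet X k x \<phi>))"
    "jet_rep (jet X k x \<phi>) x = \<phi> x" "jet X k x (jet_rep (jet X k x \<phi>)) = jet X k x \<phi>"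
    by (auto intro!: jet_eqI)
qed

lemma fst_jet [simp]: "fst (jet X k x \<phi>) = x"
  by (simp add: jet_def)

lemma jet_index_0: "jet_index 0 V = {[]}"
  by (auto simp: jet_index_def)

lemma jet_index_1: "jet_index (Suc 0) V = insert [] ((\<lambda>b. [b]) ` model_basis V)"
  unfolding jet_index_def by (auto simp: le_Suc_eq length_Suc_conv)

lemma jet_0_eqI:
  fixes X :: "('x, 'a::dual_separating) mfd"
  assumes X: "charted X" and "\<phi> x = \<psi> x" "x \<in> dom \<phi>"
  shows "jet X 0 x \<phi> = jet X 0 x \<psi>"
proof (rule jet_eqI[of \<phi> x \<psi>, OF assms(2)])
  fix c d assume "c \<in> atlas X" "x \<in> fst c"
  then have "chart_inv c (snd c x) = x"
    by (intro chart_inv_left charted_atlasD(1)[OF X])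
  then show "jet_coords X 0 c d x \<phi> = jet_coords X 0 c d x \<psi>"
    using assms(2) by (intro jet_coords_eqI charted_fin_dim X) (simp add: jet_index_0)
qed

lemma local_smooth_mapD:
  assumes "local_smooth_map X \<phi>" "x \<in> dom \<phi>"
  shows "smooth_map_on X X (dom \<phi>) (\<lambda>x. the (\<phi> x))" "x \<in> pts X" "the (\<phi> x) \<in> pts X"
proof -
  show *: "smooth_map_on X X (dom \<phi>) (\<lambda>x. the (\<phi> x))"
    using assms by (simp add: local_smooth_map_def o_def)
  show "x \<in> pts X" "the (\<phi> x) \<in> pts X"
    using smooth_map_on_subset[OF *] smooth_map_on_image[OF *] assms(2) by auto
qed

text \<open>\<open>jet\<close> compares coordinates in all pairs of atlas charts; by the first order
  chain rule one pair of charts and the basis directions are enough.\<close>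

lemma jet_1_eqI:
  fixes X :: "('x, 'a::dual_separating) mfd"
  assumes X: "charted X" and \<phi>: "local_smooth_map X \<phi>" "x \<in> dom \<phi>" and \<psi>: "local_smooth_map X \<psi>" "x \<in> dom \<psi>"
    and eq: "\<phi> x = \<psi> x"
    and c': "c' \<in> max_atlas X" "x \<in> fst c'" and d': "d' \<in> max_atlas X" "the (\<phi> x) \<in> fst d'"
    and D: "\<And>b. b \<in> model_basis (model X) \<Longrightarrow> dir_deriv (\<lambda>y. snd d' (the (\<phi> (chart_inv c' y)))) (snd c' x) b =
      dir_deriv (\<lambda>y. snd d' (the (\<psi> (chart_inv c' y)))) (snd c' x) b"
  shows "jet X (Suc 0) x \<phi> = jet X (Suc 0) x \<psi>"
proof (rule jet_eqI[of \<phi> x \<psi>, OF eq])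
  fix c d assume cd: "c \<in> atlas X" "d \<in> atlas X" "x \<in> fst c" "the (\<phi> x) \<in> fst d"
  then have m: "c \<in> max_atlas X" "d \<in> max_atlas X"
    using charted_atlas_subset[OF X] by auto
  note V = charted_fin_dim[OF X]
  note s\<phi> = local_smooth_mapD[OF \<phi>] and s\<psi> = local_smooth_mapD[OF \<psi>]
  have d'\<psi>: "the (\<psi> x) \<in> fst d'" "the (\<psi> x) \<in> fst d"
    using eq d' cd by auto
  have Dv: "dir_deriv (\<lambda>y. snd d' (the (\<phi> (chart_inv c' y)))) (snd c' x) v =
      dir_deriv (\<lambda>y. snd d' (the (\<psi> (chart_inv c' y)))) (snd c' x) v" if v: "v \<in> model X" for v
    using D linear_betw_coord_sum[OF linear_betw_chart[OF X X s\<phi>(1) \<phi>(2) c' d'] V v]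
      linear_betw_coord_sum[OF linear_betw_chart[OF X X s\<psi>(1) \<psi>(2) c' d'(1) d'\<psi>(1)] V v] by simp
  show "jet_coords X (Suc 0) c d x \<phi> = jet_coords X (Suc 0) c d x \<psi>"
  proof (rule jet_coords_eqI[OF V])
    fix vs assume "vs \<in> jet_index (Suc 0) (model X)"
    then consider "vs = []" | b where "vs = [b]" "b \<in> model_basis (model X)"
      by (auto simp: jet_index_1)
    then show "iter_deriv vs (\<lambda>y. snd d (the (\<phi> (chart_inv c y)))) (snd c x) =
        iter_deriv vs (\<lambda>y. snd d (the (\<psi> (chart_inv c y)))) (snd c x)"
    proof cases
      case 1
      then show ?thesis
        using chart_inv_left[OF charted_atlasD(1)[OF X cd(1)] cd(3)] eq by simp
    next
      case 2
      then have b: "b \<in> model X"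
        using fin_dim_subspaceD(4)[OF V] by auto
      have w: "dir_deriv (\<lambda>y. snd c' (chart_inv c y)) (snd c x) b \<in> model X"
        by (rule linear_betw_in[OF linear_betw_chart[OF X X smooth_map_ident[OF X] s\<phi>(2) m(1) cd(3) c'] b])
      show ?thesis
        using dir_deriv_chart_change[OF X X s\<phi>(1) \<phi>(2) m(1) cd(3) c' m(2) cd(4) d' b]
          dir_deriv_chart_change[OF X X s\<psi>(1) \<psi>(2) m(1) cd(3) c' m(2) d'\<psi>(2) d'(1) d'\<psi>(1) b] Dv[OF w] eq 2(1)
        by simp
    qed
  qed
qed

text \<open>With the converse \<open>jet_1_eq_mdiffI\<close>, a 1-jet amounts to its source, its
  target and the differential at the source. Computations with 1-jets can thus be carried out with
  linear maps.\<close>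

lemma jet_1_mdiff:
  fixes X :: "('x, 'a::dual_separating) mfd"
  assumes X: "charted X" and \<phi>: "local_smooth_map X \<phi>" "x \<in> dom \<phi>" and \<psi>: "local_smooth_map X \<psi>" "x \<in> dom \<psi>"
    and eq: "jet X (Suc 0) x \<phi> = jet X (Suc 0) x \<psi>" and v: "v \<in> model X"
  shows "mdiff X X (\<lambda>x. the (\<phi> x)) x v = mdiff X X (\<lambda>x. the (\<psi> x)) x v"
proof -
  note V = charted_fin_dim[OF X]
  note s\<phi> = local_smooth_mapD[OF \<phi>] and s\<psi> = local_smooth_mapD[OF \<psi>]
  have "\<phi> \<in> snd (jet X (Suc 0) x \<psi>)"
    using jet_memI[OF \<phi>, of "Suc 0"] by (simp add: eq)
  then have at: "\<phi> x = \<psi> x" and co: "\<And>c d. c \<in> atlas X \<Longrightarrow> d \<in> atlas X \<Longrightarrow> x \<in> fst c \<Longrightarrow> the (\<psi> x) \<in> fst d \<Longrightarrow>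
      jet_coords X (Suc 0) c d x \<phi> = jet_coords X (Suc 0) c d x \<psi>"
    by (auto simp: jet_def)
  let ?c = "chart_at X x" and ?d = "chart_at X (the (\<phi> x))"
  note c = chart_at_atlas[OF X s\<phi>(2)] and d = chart_at_atlas[OF X s\<phi>(3)]
  have "mdiff X X (\<lambda>x. the (\<phi> x)) x b = mdiff X X (\<lambda>x. the (\<psi> x)) x b" if b: "b \<in> model_basis (model X)" for b
  proof -
    have "[b] \<in> jet_index (Suc 0) (model X)"
      using b by (auto simp: jet_index_1)
    then have look: "Poly_Mapping.lookup (snd (jet_coords X (Suc 0) ?c ?d x \<eta>)) [b] =
        dir_deriv (\<lambda>y. snd ?d (the (\<eta> (chart_inv ?c y)))) (snd ?c x) b" for \<eta>
      by (simp add: lookup_jet_coords[OF V])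
    have "the (\<psi> x) \<in> fst ?d"
      using d(2) at by simp
    then have "dir_deriv (\<lambda>y. snd ?d (the (\<phi> (chart_inv ?c y)))) (snd ?c x) b =
        dir_deriv (\<lambda>y. snd ?d (the (\<psi> (chart_inv ?c y)))) (snd ?c x) b"
      using co[OF c(1) d(1) c(2)] unfolding look[symmetric] by simp
    then show ?thesis
      unfolding mdiff_eq at by simp
  qed
  then show ?thesis
    using linear_betw_coord_sum[OF mdiff_linear[OF X X s\<phi>(1) \<phi>(2)] V v]
      linear_betw_coord_sum[OF mdiff_linear[OF X X s\<psi>(1) \<psi>(2)] V v] by simp
qed

lemma jet_1_eq_mdiffI:
  fixes X :: "('x, 'a::dual_separating) mfd"
  assumes X: "charted X" and \<phi>: "local_smooth_map X \<phi>" "x \<in> dom \<phi>" and \<psi>: "local_smooth_map X \<psi>" "x \<in> dom \<psi>"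
    and eq: "\<phi> x = \<psi> x"
    and D: "\<And>v. v \<in> model X \<Longrightarrow> mdiff X X (\<lambda>x. the (\<phi> x)) x v = mdiff X X (\<lambda>x. the (\<psi> x)) x v"
  shows "jet X (Suc 0) x \<phi> = jet X (Suc 0) x \<psi>"
proof (rule jet_1_eqI[OF X \<phi> \<psi> eq])
  note s\<phi> = local_smooth_mapD[OF \<phi>]
  show "chart_at X x \<in> max_atlas X" "x \<in> fst (chart_at X x)"
    "chart_at X (the (\<phi> x)) \<in> max_atlas X" "the (\<phi> x) \<in> fst (chart_at X (the (\<phi> x)))"
    by (rule chart_at_max_atlas[OF X s\<phi>(2)] chart_at_max_atlas[OF X s\<phi>(3)])+
  show "dir_deriv (\<lambda>y. snd (chart_at X (the (\<phi> x))) (the (\<phi> (chart_inv (chart_at X x) y)))) (snd (chart_at X x) x) b =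
      dir_deriv (\<lambda>y. snd (chart_at X (the (\<phi> x))) (the (\<psi> (chart_inv (chart_at X x) y)))) (snd (chart_at X x) x) b"
    if "b \<in> model_basis (model X)" for b
    using D[of b] fin_dim_subspaceD(4)[OF charted_fin_dim[OF X]] that eq by (auto simp: mdiff_eq)
qed

lemma jets_ofE:
  assumes "j \<in> jets_of X k {\<phi>. local_smooth_map X \<phi>}"
  shows "j = jet X k (jet_source j) (jet_rep j)" "local_smooth_map X (jet_rep j)" "jet_source j \<in> dom (jet_rep j)"
proof -
  from assms obtain x \<phi> where j: "j = jet X k x \<phi>" "local_smooth_map X \<phi>" "x \<in> dom \<phi>"
    by (auto simp: jets_of_def)
  then have "jet_source j = x"
    by (simp add: jet_source_def)
  then show "j = jet X k (jet_source j) (jet_rep j)" "local_smooth_map X (jet_rep j)" "jet_source j \<in> dom (jet_rep j)"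
    using jet_jet_rep[OF j(2,3), of k] jet_rep_smooth[OF j(2,3), of k] jet_rep_dom[OF j(2,3), of k] j(1) by simp_all
qed

section \<open>The jet manifold in coordinates\<close>

lemma mem_jet_model:
  "(y, p) \<in> model (jet_mfd X k) \<longleftrightarrow> y \<in> model X \<and> (\<forall>vs. Poly_Mapping.lookup p vs \<in> model X) \<and>
      (\<forall>vs. vs \<notin> jet_index k (model X) \<longrightarrow> Poly_Mapping.lookup p vs = 0) \<and>
      (\<forall>vs ws. mset vs = mset ws \<longrightarrow> Poly_Mapping.lookup p vs = Poly_Mapping.lookup p ws)"
  by (auto simp: jet_mfd_def Let_def in_keys_iff subset_iff)

text \<open>Finitely many indices and a finite basis confine the second component to the span of the
  functions \<open>Poly_Mapping.single vs b\<close>; the remaining conditions, among them symmetry,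
  cut out a subspace.\<close>

lemma fin_dim_jet_model:
  fixes X :: "('x, 'a::dual_separating) mfd"
  assumes V: "fin_dim_subspace (model X)"
  shows "fin_dim_subspace (model (jet_mfd X k))"
proof -
  let ?V = "model X" and ?I = "jet_index k (model X)"
  note V' = fin_dim_subspaceD[OF V]
  let ?B = "\<Union>vs\<in>?I. Poly_Mapping.single vs ` model_basis ?V"
  have "finite ?B"
    using finite_jet_index[OF V] V'(2) by auto
  then have P: "fin_dim_subspace (span ?B)"
    unfolding fin_dim_subspace_def by blast
  have "subspace (model (jet_mfd X k))"
    unfolding subspace_def
  proof (intro conjI ballI allI)
    show "0 \<in> model (jet_mfd X k)"
      using subspace_0[OF V'(1)] by (simp add: mem_jet_model zero_prod_def)
    show "x + y \<in> model (jet_mfd X k)" if x: "x \<in> model (jet_mfd X k)" and y: "y \<in> model (jet_mfd X k)" for x y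
    proof -
      obtain a p b q where xy: "x = (a, p)" "y = (b, q)"
        by (cases x; cases y) blast
      have p: "a \<in> ?V" "\<And>vs. Poly_Mapping.lookup p vs \<in> ?V" "\<And>vs. vs \<notin> ?I \<Longrightarrow> Poly_Mapping.lookup p vs = 0"
        "\<And>vs ws. mset vs = mset ws \<Longrightarrow> Poly_Mapping.lookup p vs = Poly_Mapping.lookup p ws"
        using x[unfolded xy mem_jet_model] by blast+
      have q: "b \<in> ?V" "\<And>vs. Poly_Mapping.lookup q vs \<in> ?V" "\<And>vs. vs \<notin> ?I \<Longrightarrow> Poly_Mapping.lookup q vs = 0"
        "\<And>vs ws. mset vs = mset ws \<Longrightarrow> Poly_Mapping.lookup q vs = Poly_Mapping.lookup q ws"
        using y[unfolded xy mem_jet_model] by blast+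
      show ?thesis
        unfolding xy add_Pair mem_jet_model lookup_add
      proof (intro conjI allI impI)
        fix vs ws :: "'a list" assume "mset vs = mset ws"
        then have "Poly_Mapping.lookup p vs = Poly_Mapping.lookup p ws" "Poly_Mapping.lookup q vs = Poly_Mapping.lookup q ws"
          by (rule p(4) q(4))+
        then show "Poly_Mapping.lookup p vs + Poly_Mapping.lookup q vs = Poly_Mapping.lookup p ws + Poly_Mapping.lookup q ws"
          by (rule arg_cong2)
      qed (simp_all add: p(1-3) q(1-3) subspace_add[OF V'(1)])
    qed
    show "c *\<^sub>R x \<in> model (jet_mfd X k)" if x: "x \<in> model (jet_mfd X k)" for c x
    proof -
      obtain a p where xy: "x = (a, p)"
        by (cases x)
      have p: "a \<in> ?V" "\<And>vs. Poly_Mapping.lookup p vs \<in> ?V" "\<And>vs. vs \<notin> ?I \<Longrightarrow> Poly_Mapping.lookup p vs = 0"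
        "\<And>vs ws. mset vs = mset ws \<Longrightarrow> Poly_Mapping.lookup p vs = Poly_Mapping.lookup p ws"
        using x[unfolded xy mem_jet_model] by blast+
      show ?thesis
        unfolding xy scaleR_Pair mem_jet_model lookup_scaleR
      proof (intro conjI allI impI)
        fix vs ws :: "'a list" assume "mset vs = mset ws"
        then have "Poly_Mapping.lookup p vs = Poly_Mapping.lookup p ws"
          by (rule p(4))
        then show "c *\<^sub>R Poly_Mapping.lookup p vs = c *\<^sub>R Poly_Mapping.lookup p ws"
          by (rule arg_cong)
      qed (simp_all add: p(1-3) subspace_scale[OF V'(1)])
    qed
  qed
  moreover have "model (jet_mfd X k) \<subseteq> ?V \<times> span ?B"
  proof
    fix x assume x: "x \<in> model (jet_mfd X k)"
    obtain a p where ap: "x = (a, p)"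
      by (cases x)
    have p: "a \<in> ?V" "\<And>vs. Poly_Mapping.lookup p vs \<in> ?V" "\<And>vs. vs \<notin> ?I \<Longrightarrow> Poly_Mapping.lookup p vs = 0"
      "\<And>vs ws. mset vs = mset ws \<Longrightarrow> Poly_Mapping.lookup p vs = Poly_Mapping.lookup p ws"
      using x[unfolded ap mem_jet_model] by blast+
    have "p = (\<Sum>vs\<in>?I. Poly_Mapping.single vs (Poly_Mapping.lookup p vs))"
    proof (rule poly_mapping_eqI)
      fix ws
      have "Poly_Mapping.lookup (\<Sum>vs\<in>?I. Poly_Mapping.single vs (Poly_Mapping.lookup p vs)) ws =
          (\<Sum>vs\<in>?I. if vs = ws then Poly_Mapping.lookup p vs else 0)"
        by (simp add: lookup_sum lookup_single when_def)
      then show "Poly_Mapping.lookup p ws = Poly_Mapping.lookup (\<Sum>vs\<in>?I. Poly_Mapping.single vs (Poly_Mapping.lookup p vs)) ws"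
        using p(3) finite_jet_index[OF V, of k] by simp
    qed
    also have "\<dots> \<in> span ?B"
    proof (rule span_sum)
      fix vs assume vs: "vs \<in> ?I"
      have "Poly_Mapping.lookup p vs \<in> span (model_basis ?V)"
        using p(2) V'(5) by simp
      then have "Poly_Mapping.single vs (Poly_Mapping.lookup p vs) \<in> span (Poly_Mapping.single vs ` model_basis ?V)"
        unfolding linear_span_image[OF bounded_linear.linear[OF bounded_linear_single]] by blast
      then show "Poly_Mapping.single vs (Poly_Mapping.lookup p vs) \<in> span ?B"
        using span_mono[of "Poly_Mapping.single vs ` model_basis ?V" ?B] vs by blast
    qed
    finally show "x \<in> ?V \<times> span ?B"
      using p(1) ap by simp
  qed
  ultimately show ?thesis
    by (rule fin_dim_subspace_subset[OF fin_dim_subspace_Times[OF V P]])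
qed

definition jet_chart :: "('x, 'a::real_normed_vector) mfd \<Rightarrow> nat \<Rightarrow> ('x, 'a) chart \<Rightarrow> ('x, 'a) chart \<Rightarrow> ('x jet, 'a jet_coord) chart" where
  "jet_chart X k c d = ({j \<in> jets_of X k {\<phi>. local_smooth_map X \<phi>}. jet_source j \<in> fst c \<and> jet_target j \<in> fst d},
     \<lambda>j. jet_coords X k c d (jet_source j) (jet_rep j))"

lemma jet_mfd_simps:
  "pts (jet_mfd X k) = jets_of X k {\<phi>. local_smooth_map X \<phi>}"
  "e \<in> atlas (jet_mfd X k) \<longleftrightarrow> (\<exists>c\<in>atlas X. \<exists>d\<in>atlas X. e = jet_chart X k c d)"
  by (simp add: jet_mfd_def Let_def) (simp add: jet_mfd_def Let_def jet_chart_def del: split_paired_Ex, blast)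

text \<open>The chart records source, target and derivatives in one pair of charts. Up to order one
  these determine the jet by \<open>jet_0_eqI\<close> and \<open>jet_1_eqI\<close>; for higher
  orders the same argument would call for higher chain rules.\<close>

lemma inj_on_jet_chart:
  fixes X :: "('x, 'a::dual_separating) mfd"
  assumes X: "charted X" and k: "k \<le> Suc 0" and c: "c \<in> atlas X" and d: "d \<in> atlas X"
  shows "inj_on (snd (jet_chart X k c d)) (fst (jet_chart X k c d))"
proof (rule inj_onI)
  note V = charted_fin_dim[OF X]
  fix j j' assume j: "j \<in> fst (jet_chart X k c d)" and j': "j' \<in> fst (jet_chart X k c d)"
    and eq: "snd (jet_chart X k c d) j = snd (jet_chart X k c d) j'"
  define x x' \<phi> \<psi> where "x = jet_source j" and "x' = jet_source j'" and "\<phi> = jet_rep j" and "\<psi> = jet_rep j'"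
  have jJ: "j \<in> jets_of X k {\<phi>. local_smooth_map X \<phi>}" "j' \<in> jets_of X k {\<phi>. local_smooth_map X \<phi>}"
    and xc: "x \<in> fst c" "x' \<in> fst c" "the (\<phi> x) \<in> fst d" "the (\<psi> x') \<in> fst d"
    using j j' by (auto simp: jet_chart_def jet_target_def x_def x'_def \<phi>_def \<psi>_def)
  note J = jets_ofE[OF jJ(1), folded x_def \<phi>_def] and J' = jets_ofE[OF jJ(2), folded x'_def \<psi>_def]
  have co: "jet_coords X k c d x \<phi> = jet_coords X k c d x' \<psi>"
    using eq by (simp add: jet_chart_def x_def x'_def \<phi>_def \<psi>_def)
  then have "snd c x = snd c x'"
    by (simp add: jet_coords_def)
  then have xx: "x' = x"
    using charted_atlasD(1)[OF X c] xc by (auto dest: inj_onD)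
  note co = co[unfolded xx] and J' = J'[unfolded xx] and xc = xc[unfolded xx]
  have look: "iter_deriv vs (\<lambda>y. snd d (the (\<phi> (chart_inv c y)))) (snd c x) =
      iter_deriv vs (\<lambda>y. snd d (the (\<psi> (chart_inv c y)))) (snd c x)" if "vs \<in> jet_index k (model X)" for vs
    using lookup_jet_coords[OF V, of k c d x \<phi> vs] lookup_jet_coords[OF V, of k c d x \<psi> vs] that by (simp add: co)
  have ic: "chart_inv c (snd c x) = x"
    by (rule chart_inv_left[OF charted_atlasD(1)[OF X c] xc(1)])
  have "[] \<in> jet_index k (model X)"
    by (simp add: jet_index_def)
  from look[OF this] have "snd d (the (\<phi> x)) = snd d (the (\<psi> x))"
    by (simp add: ic)
  then have "the (\<phi> x) = the (\<psi> x)"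
    using charted_atlasD(1)[OF X d] xc by (auto dest: inj_onD)
  then have at: "\<phi> x = \<psi> x"
    using J(3) J'(3) by auto
  have m: "c \<in> max_atlas X" "d \<in> max_atlas X"
    using charted_atlas_subset[OF X] c d by auto
  have "jet X k x \<phi> = jet X k x \<psi>"
  proof (cases "k = 0")
    case True
    then show ?thesis
      using jet_0_eqI[of X \<phi> x \<psi>, OF X at J(3)] by simp
  next
    case False
    then have k1: "k = Suc 0"
      using k by simp
    show ?thesis
      unfolding k1
    proof (rule jet_1_eqI[OF X J(2,3) J'(2,3) at m(1) xc(1) m(2) xc(3)])
      fix b assume "b \<in> model_basis (model X)"
      then have "[b] \<in> jet_index k (model X)"
        by (simp add: k1 jet_index_1)
      from look[OF this] show "dir_deriv (\<lambda>y. snd d (the (\<phi> (chart_inv c y)))) (snd c x) b =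
          dir_deriv (\<lambda>y. snd d (the (\<psi> (chart_inv c y)))) (snd c x) b"
        by simp
    qed
  qed
  then show "j = j'"
    using J(1) J'(1) by simp
qed

lemma weakly_charted_jet_mfd:
  fixes X :: "('x, 'a::dual_separating) mfd"
  assumes X: "charted X" and k: "k \<le> Suc 0"
  shows "weakly_charted (jet_mfd X k)"
  unfolding weakly_charted_def
proof (intro conjI ballI)
  show "fin_dim_subspace (model (jet_mfd X k))"
    by (rule fin_dim_jet_model[OF charted_fin_dim[OF X]])
  show "inj_on (snd e) (fst e)" if e: "e \<in> atlas (jet_mfd X k)" for e
  proof -
    from e obtain c d where "c \<in> atlas X" "d \<in> atlas X" "e = jet_chart X k c d"
      unfolding jet_mfd_simps by blast
    then show ?thesis
      using inj_on_jet_chart[OF X k] by simp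
  qed
  show "(\<Union>e\<in>atlas (jet_mfd X k). fst e) = pts (jet_mfd X k)"
  proof (intro equalityI subsetI)
    fix j assume "j \<in> (\<Union>e\<in>atlas (jet_mfd X k). fst e)"
    then obtain e where e: "e \<in> atlas (jet_mfd X k)" "j \<in> fst e"
      by blast
    from e(1) obtain c d where "e = jet_chart X k c d"
      unfolding jet_mfd_simps by blast
    then show "j \<in> pts (jet_mfd X k)"
      using e(2) by (simp add: jet_chart_def jet_mfd_simps)
  next
    fix j assume "j \<in> pts (jet_mfd X k)"
    then have j: "j \<in> jets_of X k {\<phi>. local_smooth_map X \<phi>}"
      by (simp add: jet_mfd_simps)
    note J = jets_ofE[OF j]
    note p = local_smooth_mapD[OF J(2,3)]
    note c = chart_at_atlas[OF X p(2)] and d = chart_at_atlas[OF X p(3)]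
    have "jet_chart X k (chart_at X (jet_source j)) (chart_at X (the (jet_rep j (jet_source j)))) \<in> atlas (jet_mfd X k)"
      unfolding jet_mfd_simps using c(1) d(1) by blast
    moreover have "j \<in> fst (jet_chart X k (chart_at X (jet_source j)) (chart_at X (the (jet_rep j (jet_source j)))))"
      using j c(2) d(2) by (simp add: jet_chart_def jet_target_def)
    ultimately show "j \<in> (\<Union>e\<in>atlas (jet_mfd X k). fst e)"
      by blast
  qed
qed

lemma jet_chart_in_model:
  fixes X :: "('x, 'a::dual_separating) mfd"
  assumes X: "charted X" and c: "c \<in> atlas X" and d: "d \<in> atlas X" and j: "j \<in> fst (jet_chart X (Suc 0) c d)"
  shows "snd (jet_chart X (Suc 0) c d) j \<in> model (jet_mfd X (Suc 0))"
proof -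
  note V = charted_fin_dim[OF X]
  define x \<phi> where "x = jet_source j" and "\<phi> = jet_rep j"
  have jJ: "j \<in> jets_of X (Suc 0) {\<phi>. local_smooth_map X \<phi>}" and xc: "x \<in> fst c" "the (\<phi> x) \<in> fst d"
    using j by (auto simp: jet_chart_def jet_target_def x_def \<phi>_def)
  note J = jets_ofE[OF jJ, folded x_def \<phi>_def]
  have m: "c \<in> max_atlas X" "d \<in> max_atlas X"
    using charted_atlas_subset[OF X] c d by auto
  have ic: "chart_inv c (snd c x) = x"
    by (rule chart_inv_left[OF charted_atlasD(1)[OF X c] xc(1)])
  let ?p = "snd (jet_coords X (Suc 0) c d x \<phi>)"
  note look = lookup_jet_coords[OF V, of "Suc 0" c d x \<phi>]
  have p_in: "Poly_Mapping.lookup ?p vs \<in> model X" for vs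
  proof (cases "vs \<in> jet_index (Suc 0) (model X)")
    case False
    then show ?thesis
      using subspace_0[OF fin_dim_subspaceD(1)[OF V]] by (simp add: look)
  next
    case True
    then consider "vs = []" | b where "vs = [b]" "b \<in> model_basis (model X)"
      by (auto simp: jet_index_1)
    then show ?thesis
    proof cases
      case 1
      then show ?thesis
        using True xc(2) openin_imp_subset[OF charted_atlasD(3)[OF X d]] by (auto simp: look ic)
    next
      case 2
      then have "b \<in> model X"
        using fin_dim_subspaceD(4)[OF V] by auto
      from linear_betw_in[OF linear_betw_chart[OF X X local_smooth_mapD(1)[OF J(2,3)] J(3) m(1) xc(1) m(2) xc(2)] this]
      show ?thesis
        using True 2 by (simp add: look)
    qed
  qed
  have p_zero: "Poly_Mapping.lookup ?p vs = 0" if "vs \<notin> jet_index (Suc 0) (model X)" for vs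
    using that by (simp add: look)
  \<comment> \<open>Lists with the same multiset are equal as soon as one of them has length at most
    one; outside the index set both sides are zero.\<close>
  have p_sym: "Poly_Mapping.lookup ?p vs = Poly_Mapping.lookup ?p ws" if eq: "mset vs = mset ws" for vs ws
  proof (cases "vs \<in> jet_index (Suc 0) (model X) \<or> ws \<in> jet_index (Suc 0) (model X)")
    case True
    then have "vs = ws"
      using eq by (auto simp: jet_index_1)
    then show ?thesis
      by simp
  qed (simp add: look)
  have "fst (jet_coords X (Suc 0) c d x \<phi>) \<in> model X"
    using xc(1) openin_imp_subset[OF charted_atlasD(3)[OF X c]] by (auto simp: jet_coords_def)
  then have "(fst (jet_coords X (Suc 0) c d x \<phi>), ?p) \<in> model (jet_mfd X (Suc 0))"
    unfolding mem_jet_model using p_in p_zero p_sym by blast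
  then show ?thesis
    by (simp add: jet_chart_def x_def \<phi>_def)
qed

text \<open>The start of the descent to submanifolds: the embedding is the jet chart itself,
  recovered from its own coordinates by the identity on the whole model space. The image of the
  chart is not claimed to be open.\<close>

lemma vec_embedding_jet_chart:
  fixes X :: "('x, 'a::dual_separating) mfd"
  assumes X: "charted X" and c: "c \<in> atlas X" and d: "d \<in> atlas X"
  shows "vec_embedding (jet_mfd X (Suc 0)) (fst (jet_chart X (Suc 0) c d)) (model (jet_mfd X (Suc 0))) (snd (jet_chart X (Suc 0) c d))"
proof -
  let ?e = "jet_chart X (Suc 0) c d" and ?V = "model (jet_mfd X (Suc 0))"
  have e: "?e \<in> atlas (jet_mfd X (Suc 0))"
    unfolding jet_mfd_simps using c d by blast
  have V: "fin_dim_subspace ?V"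
    by (rule fin_dim_jet_model[OF charted_fin_dim[OF X]])
  have sm: "smooth_on ?V (snd ?e ` fst ?e) (\<lambda>y. snd ?e (chart_inv ?e y))"
    by (rule smooth_on_cong[OF smooth_on_ident]) (rule chart_inv_right[symmetric])
  have im: "snd ?e j \<in> ?V" if "j \<in> fst ?e" for j
    by (rule jet_chart_in_model[OF X c d that])
  show ?thesis
    unfolding vec_embedding_def
  proof (intro conjI V ballI)
    show "snd ?e ` fst ?e \<subseteq> ?V"
      using im by blast
    fix j assume j: "j \<in> fst ?e"
    have "\<exists>T \<psi>. open_in ?V T \<and> snd ?e j \<in> T \<and> smooth_on ?V T \<psi> \<and> \<psi> ` T \<subseteq> ?V \<and>
        (\<forall>y\<in>fst ?e. snd ?e y \<in> T \<longrightarrow> y \<in> fst ?e \<and> snd ?e y = \<psi> (snd ?e y))"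
      using im[OF j] by (intro exI[of _ ?V] exI[of _ "\<lambda>x. x"]) (simp add: smooth_on_ident)
    then show "\<exists>c\<in>atlas (jet_mfd X (Suc 0)). j \<in> fst c \<and> fst c \<subseteq> fst ?e \<and>
        smooth_on ?V (snd c ` fst c) (\<lambda>y. snd ?e (chart_inv c y)) \<and>
        (\<exists>T \<psi>. open_in ?V T \<and> snd ?e j \<in> T \<and> smooth_on ?V T \<psi> \<and> \<psi> ` T \<subseteq> ?V \<and>
          (\<forall>y\<in>fst ?e. snd ?e y \<in> T \<longrightarrow> y \<in> fst c \<and> snd c y = \<psi> (snd ?e y)))"
      using e j sm by blast
  qed
qed

section \<open>The isotropy group\<close>

lemma local_smooth_map_comp:
  fixes X :: "('x, 'a::dual_separating) mfd"
  assumes X: "charted X" and \<phi>: "local_smooth_map X \<phi>" and \<psi>: "local_smooth_map X \<psi>"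
  shows "local_smooth_map X (\<psi> \<circ>\<^sub>m \<phi>)"
proof -
  have s\<phi>: "smooth_map_on X X (dom \<phi>) (\<lambda>x. the (\<phi> x))" and s\<psi>: "smooth_map_on X X (dom \<psi>) (\<lambda>x. the (\<psi> x))"
    using \<phi> \<psi> by (simp_all add: local_smooth_map_def o_def)
  have dom: "dom (\<psi> \<circ>\<^sub>m \<phi>) = {x \<in> dom \<phi>. the (\<phi> x) \<in> dom \<psi>}"
    by (auto simp: map_comp_def split: option.splits)
  have "smooth_map_on X X (dom (\<psi> \<circ>\<^sub>m \<phi>)) (\<lambda>x. the ((\<psi> \<circ>\<^sub>m \<phi>) x))"
    unfolding dom by (rule smooth_map_on_cong[OF smooth_map_on_comp[OF X X X s\<phi> s\<psi>] _ X]) auto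
  then show ?thesis
    by (simp add: local_smooth_map_def o_def)
qed

lemma mdiff_map_comp:
  fixes X :: "('x, 'a::dual_separating) mfd"
  assumes X: "charted X" and \<phi>: "local_smooth_map X \<phi>" "\<phi> x = Some y" and \<psi>: "local_smooth_map X \<psi>" "y \<in> dom \<psi>"
    and v: "v \<in> model X"
  shows "mdiff X X (\<lambda>x. the ((\<psi> \<circ>\<^sub>m \<phi>) x)) x v = mdiff X X (\<lambda>x. the (\<psi> x)) y (mdiff X X (\<lambda>x. the (\<phi> x)) x v)"
proof -
  have x: "x \<in> dom \<phi>" "x \<in> dom (\<psi> \<circ>\<^sub>m \<phi>)"
    using \<phi>(2) \<psi>(2) by auto
  note s\<phi> = local_smooth_mapD(1)[OF \<phi>(1) x(1)] and s\<psi> = local_smooth_mapD(1)[OF \<psi>]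
  note sc = local_smooth_mapD(1)[OF local_smooth_map_comp[OF X \<phi>(1) \<psi>(1)] x(2)]
  have "mdiff X X (\<lambda>x. the ((\<psi> \<circ>\<^sub>m \<phi>) x)) x v = mdiff X X (\<lambda>x. the (\<psi> (the (\<phi> x)))) x v"
    by (rule mdiff_cong[OF X X sc x(2) v]) (auto simp: map_comp_def split: option.splits)
  also have "\<dots> = mdiff X X (\<lambda>x. the (\<psi> x)) (the (\<phi> x)) (mdiff X X (\<lambda>x. the (\<phi> x)) x v)"
    by (rule mdiff_comp[OF X X X s\<phi> s\<psi> x(1) _ v]) (use \<phi> \<psi> in simp)
  finally show ?thesis
    using \<phi>(2) by simp
qed

locale pseudogroup_isotropy =
  fixes X :: "('x, 'a::dual_separating) mfd" and \<Gamma> :: "('x \<rightharpoonup> 'x) set" and x\<^sub>0 :: 'x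
  assumes X: "smooth_manifold X" and \<Gamma>: "lie_pseudogroup X \<Gamma>" and x0: "x\<^sub>0 \<in> pts X"
begin

abbreviation G where "G \<equiv> isotropy_group X \<Gamma> x\<^sub>0"

abbreviation GM where "GM \<equiv> isotropy_mfd X \<Gamma> x\<^sub>0"

abbreviation V where "V \<equiv> model X"

lemma chX: "charted X"
  by (rule smooth_manifold_charted[OF X])

lemma V: "fin_dim_subspace V"
  by (rule charted_fin_dim[OF chX])

lemma pseudogroup:
  "\<phi> \<in> \<Gamma> \<Longrightarrow> smooth_embedding X \<phi>" "id_pmap X \<in> \<Gamma>" "\<phi> \<in> \<Gamma> \<Longrightarrow> \<psi> \<in> \<Gamma> \<Longrightarrow> \<psi> \<circ>\<^sub>m \<phi> \<in> \<Gamma>" "\<phi> \<in> \<Gamma> \<Longrightarrow> inverse_pmap \<phi> \<in> \<Gamma>"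
proof -
  have P: "\<forall>\<phi>\<in>\<Gamma>. smooth_embedding X \<phi>" "id_pmap X \<in> \<Gamma>" "\<forall>\<phi>\<in>\<Gamma>. \<forall>\<psi>\<in>\<Gamma>. \<psi> \<circ>\<^sub>m \<phi> \<in> \<Gamma>" "\<forall>\<phi>\<in>\<Gamma>. inverse_pmap \<phi> \<in> \<Gamma>"
  proof -
    have "pseudogroup X \<Gamma>"
      using \<Gamma> by (simp only: lie_pseudogroup_def)
    note P = this[unfolded pseudogroup_def]
    show "\<forall>\<phi>\<in>\<Gamma>. smooth_embedding X \<phi>"
      by (rule P[THEN conjunct1])
    show "id_pmap X \<in> \<Gamma>"
      by (rule P[THEN conjunct2, THEN conjunct1])
    show "\<forall>\<phi>\<in>\<Gamma>. \<forall>\<psi>\<in>\<Gamma>. \<psi> \<circ>\<^sub>m \<phi> \<in> \<Gamma>"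
      by (rule P[THEN conjunct2, THEN conjunct2, THEN conjunct1])
    show "\<forall>\<phi>\<in>\<Gamma>. inverse_pmap \<phi> \<in> \<Gamma>"
      by (rule P[THEN conjunct2, THEN conjunct2, THEN conjunct2, THEN conjunct1])
  qed
  show "\<phi> \<in> \<Gamma> \<Longrightarrow> smooth_embedding X \<phi>" "id_pmap X \<in> \<Gamma>" "\<phi> \<in> \<Gamma> \<Longrightarrow> \<psi> \<in> \<Gamma> \<Longrightarrow> \<psi> \<circ>\<^sub>m \<phi> \<in> \<Gamma>" "\<phi> \<in> \<Gamma> \<Longrightarrow> inverse_pmap \<phi> \<in> \<Gamma>"
    using P(1) P(2) P(3) P(4) by simp_all
qed

lemma smooth: "\<phi> \<in> \<Gamma> \<Longrightarrow> local_smooth_map X \<phi>"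
  using pseudogroup(1) by (simp add: smooth_embedding_def)

lemma carrierE:
  assumes "j \<in> carrier G"
  obtains \<phi> where "\<phi> \<in> \<Gamma>" "\<phi> x\<^sub>0 = Some x\<^sub>0" "j = jet X (Suc 0) x\<^sub>0 \<phi>" "local_smooth_map X \<phi>" "x\<^sub>0 \<in> dom \<phi>"
  using assms smooth by (auto simp: isotropy_group_def)

lemma carrierI: "\<phi> \<in> \<Gamma> \<Longrightarrow> \<phi> x\<^sub>0 = Some x\<^sub>0 \<Longrightarrow> jet X (Suc 0) x\<^sub>0 \<phi> \<in> carrier G"
  by (auto simp: isotropy_group_def)

lemma rep:
  assumes "j \<in> carrier G"
  shows "local_smooth_map X (jet_rep j)" "jet_rep j x\<^sub>0 = Some x\<^sub>0" "x\<^sub>0 \<in> dom (jet_rep j)"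
    "j = jet X (Suc 0) x\<^sub>0 (jet_rep j)" "jet_source j = x\<^sub>0" "j \<in> jets_of X (Suc 0) {\<phi>. local_smooth_map X \<phi>}"
proof -
  obtain \<phi> where \<phi>: "\<phi> x\<^sub>0 = Some x\<^sub>0" "j = jet X (Suc 0) x\<^sub>0 \<phi>" "local_smooth_map X \<phi>" "x\<^sub>0 \<in> dom \<phi>"
    using carrierE[OF assms] by metis
  note r = jet_rep_smooth[OF \<phi>(3,4)] jet_rep_dom[OF \<phi>(3,4)] jet_rep_at[OF \<phi>(3,4)] jet_jet_rep[OF \<phi>(3,4)]
  show "local_smooth_map X (jet_rep j)" "jet_rep j x\<^sub>0 = Some x\<^sub>0" "x\<^sub>0 \<in> dom (jet_rep j)" "j = jet X (Suc 0) x\<^sub>0 (jet_rep j)"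
    unfolding \<phi>(2) using r \<phi>(1) by simp_all
  show "jet_source j = x\<^sub>0"
    by (simp add: \<phi>(2) jet_source_def)
  show "j \<in> jets_of X (Suc 0) {\<phi>. local_smooth_map X \<phi>}"
    using \<phi> by (auto simp: jets_of_def)
qed

text \<open>The isotropy representation on the tangent space at \<open>x\<^sub>0\<close>. By
  \<open>lin_jet\<close> it can be computed from any local smooth map with the jet
  \<open>j\<close>.\<close>

definition lin :: "'x jet \<Rightarrow> 'a \<Rightarrow> 'a" where
  "lin j = mdiff X X (\<lambda>x. the (jet_rep j x)) x\<^sub>0"

lemma lin_linear:
  assumes "j \<in> carrier G"
  shows "linear_betw V V (lin j)"
  unfolding lin_def by (rule mdiff_linear[OF chX chX local_smooth_mapD(1)[OF rep(1,3)[OF assms]] rep(3)[OF assms]])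

lemma lin_jet:
  assumes "local_smooth_map X \<phi>" "\<phi> x\<^sub>0 = Some x\<^sub>0" "v \<in> V"
  shows "lin (jet X (Suc 0) x\<^sub>0 \<phi>) v = mdiff X X (\<lambda>x. the (\<phi> x)) x\<^sub>0 v"
proof -
  have "x\<^sub>0 \<in> dom \<phi>"
    using assms(2) by auto
  then show ?thesis
    unfolding lin_def using assms
    by (intro jet_1_mdiff[OF chX jet_rep_smooth jet_rep_dom _ _ jet_jet_rep]) auto
qed

text \<open>Source and target are fixed on \<open>G\<close>, so the differential alone determines
  the jet: the isotropy representation is faithful. Group laws in \<open>G\<close> can therefore be
  verified as identities between linear maps.\<close>

lemma lin_ext:
  assumes j: "j \<in> carrier G" and j': "j' \<in> carrier G" and eq: "\<And>v. v \<in> V \<Longrightarrow> lin j v = lin j' v"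
  shows "j = j'"
proof -
  have "jet X (Suc 0) x\<^sub>0 (jet_rep j) = jet X (Suc 0) x\<^sub>0 (jet_rep j')"
    using rep(2)[OF j] rep(2)[OF j'] eq
    by (intro jet_1_eq_mdiffI[OF chX rep(1,3)[OF j] rep(1,3)[OF j']]) (auto simp: lin_def)
  then show ?thesis
    using rep(4)[OF j] rep(4)[OF j'] by simp
qed

text \<open>Multiplication is defined by chosen representatives, which need not belong to \<Gamma>.
  By the chain rule the jet of the composite depends only on the two jets, so representatives in
  \<Gamma> may be used; closure of \<open>G\<close> follows from this.\<close>

lemma jet_comp:
  assumes \<phi>: "\<phi> \<in> \<Gamma>" "\<phi> x\<^sub>0 = Some x\<^sub>0" and \<psi>: "\<psi> \<in> \<Gamma>" "\<psi> x\<^sub>0 = Some x\<^sub>0"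
  shows "jet X (Suc 0) x\<^sub>0 \<psi> \<otimes>\<^bsub>G\<^esub> jet X (Suc 0) x\<^sub>0 \<phi> = jet X (Suc 0) x\<^sub>0 (\<psi> \<circ>\<^sub>m \<phi>)"
proof -
  let ?j = "jet X (Suc 0) x\<^sub>0 \<psi>" and ?k = "jet X (Suc 0) x\<^sub>0 \<phi>"
  have j: "?j \<in> carrier G" and k: "?k \<in> carrier G"
    using \<phi> \<psi> by (auto intro: carrierI)
  note s\<phi> = smooth[OF \<phi>(1)] and s\<psi> = smooth[OF \<psi>(1)]
  have x0: "x\<^sub>0 \<in> dom \<phi>" "x\<^sub>0 \<in> dom \<psi>"
    using \<phi> \<psi> by auto
  have "jet X (Suc 0) x\<^sub>0 (jet_rep ?j \<circ>\<^sub>m jet_rep ?k) = jet X (Suc 0) x\<^sub>0 (\<psi> \<circ>\<^sub>m \<phi>)"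
  proof (rule jet_1_eq_mdiffI[OF chX local_smooth_map_comp[OF chX rep(1)[OF k] rep(1)[OF j]] _ local_smooth_map_comp[OF chX s\<phi> s\<psi>]])
    show "x\<^sub>0 \<in> dom (jet_rep ?j \<circ>\<^sub>m jet_rep ?k)" "x\<^sub>0 \<in> dom (\<psi> \<circ>\<^sub>m \<phi>)"
      "(jet_rep ?j \<circ>\<^sub>m jet_rep ?k) x\<^sub>0 = (\<psi> \<circ>\<^sub>m \<phi>) x\<^sub>0"
      using rep(2)[OF j] rep(2)[OF k] \<phi> \<psi> by auto
    fix v assume v: "v \<in> V"
    have "mdiff X X (\<lambda>x. the ((jet_rep ?j \<circ>\<^sub>m jet_rep ?k) x)) x\<^sub>0 v = lin ?j (lin ?k v)"
      unfolding lin_def by (rule mdiff_map_comp[OF chX rep(1,2)[OF k] rep(1,3)[OF j] v])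
    also have "\<dots> = mdiff X X (\<lambda>x. the (\<psi> x)) x\<^sub>0 (mdiff X X (\<lambda>x. the (\<phi> x)) x\<^sub>0 v)"
      using lin_jet[OF s\<phi> \<phi>(2) v] lin_jet[OF s\<psi> \<psi>(2) linear_betw_in[OF lin_linear[OF k] v]] by simp
    also have "\<dots> = mdiff X X (\<lambda>x. the ((\<psi> \<circ>\<^sub>m \<phi>) x)) x\<^sub>0 v"
      by (rule mdiff_map_comp[OF chX s\<phi> \<phi>(2) s\<psi> x0(2) v, symmetric])
    finally show "mdiff X X (\<lambda>x. the ((jet_rep ?j \<circ>\<^sub>m jet_rep ?k) x)) x\<^sub>0 v = mdiff X X (\<lambda>x. the ((\<psi> \<circ>\<^sub>m \<phi>) x)) x\<^sub>0 v" .
  qed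
  then show ?thesis
    by (simp add: isotropy_group_def)
qed

lemma mult_closed: "j \<in> carrier G \<Longrightarrow> k \<in> carrier G \<Longrightarrow> j \<otimes>\<^bsub>G\<^esub> k \<in> carrier G"
proof -
  assume j: "j \<in> carrier G" and k: "k \<in> carrier G"
  obtain \<psi> where \<psi>: "\<psi> \<in> \<Gamma>" "\<psi> x\<^sub>0 = Some x\<^sub>0" "j = jet X (Suc 0) x\<^sub>0 \<psi>"
    using carrierE[OF j] by metis
  obtain \<phi> where \<phi>: "\<phi> \<in> \<Gamma>" "\<phi> x\<^sub>0 = Some x\<^sub>0" "k = jet X (Suc 0) x\<^sub>0 \<phi>"
    using carrierE[OF k] by metis
  show ?thesis
    unfolding \<psi>(3) \<phi>(3) jet_comp[OF \<phi>(1,2) \<psi>(1,2)]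
    using \<phi> \<psi> by (intro carrierI pseudogroup) auto
qed

lemma lin_mult:
  assumes j: "j \<in> carrier G" and k: "k \<in> carrier G" and v: "v \<in> V"
  shows "lin (j \<otimes>\<^bsub>G\<^esub> k) v = lin j (lin k v)"
proof -
  obtain \<psi> where \<psi>: "\<psi> \<in> \<Gamma>" "\<psi> x\<^sub>0 = Some x\<^sub>0" "j = jet X (Suc 0) x\<^sub>0 \<psi>"
    using carrierE[OF j] by metis
  obtain \<phi> where \<phi>: "\<phi> \<in> \<Gamma>" "\<phi> x\<^sub>0 = Some x\<^sub>0" "k = jet X (Suc 0) x\<^sub>0 \<phi>"
    using carrierE[OF k] by metis
  have "lin (j \<otimes>\<^bsub>G\<^esub> k) v = mdiff X X (\<lambda>x. the ((\<psi> \<circ>\<^sub>m \<phi>) x)) x\<^sub>0 v"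
    unfolding \<psi>(3) \<phi>(3) jet_comp[OF \<phi>(1,2) \<psi>(1,2)]
    using \<phi> \<psi> by (intro lin_jet smooth pseudogroup v) auto
  also have "\<dots> = mdiff X X (\<lambda>x. the (\<psi> x)) x\<^sub>0 (mdiff X X (\<lambda>x. the (\<phi> x)) x\<^sub>0 v)"
    using \<psi> by (intro mdiff_map_comp[OF chX smooth[OF \<phi>(1)] \<phi>(2) smooth[OF \<psi>(1)] _ v]) auto
  also have "\<dots> = lin j (lin k v)"
    using lin_jet[OF smooth[OF \<phi>(1)] \<phi>(2) v] lin_jet[OF smooth[OF \<psi>(1)] \<psi>(2) linear_betw_in[OF lin_linear[OF k] v]]
    unfolding \<psi>(3) \<phi>(3) by simp
  finally show ?thesis .
qed

lemma mdiff_near_id: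
  assumes "local_smooth_map X \<phi>" "x\<^sub>0 \<in> dom \<phi>" "\<And>x. x \<in> dom \<phi> \<Longrightarrow> \<phi> x = Some x" "v \<in> V"
  shows "mdiff X X (\<lambda>x. the (\<phi> x)) x\<^sub>0 v = v"
proof -
  have "mdiff X X (\<lambda>x. the (\<phi> x)) x\<^sub>0 v = mdiff X X (\<lambda>x. x) x\<^sub>0 v"
    by (rule mdiff_cong[OF chX chX local_smooth_mapD(1)[OF assms(1,2)] assms(2,4)]) (simp add: assms(3))
  then show ?thesis
    by (simp add: mdiff_ident[OF chX x0 assms(4)])
qed

lemma id_pmap_at: "x \<in> pts X \<Longrightarrow> id_pmap X x = Some x" "dom (id_pmap X) = pts X"
  by (auto simp: id_pmap_def restrict_map_def dom_def)

lemma one_closed: "\<one>\<^bsub>G\<^esub> \<in> carrier G"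
  using carrierI[OF pseudogroup(2) id_pmap_at(1)[OF x0]] by (simp add: isotropy_group_def)

lemma lin_one: "v \<in> V \<Longrightarrow> lin \<one>\<^bsub>G\<^esub> v = v"
proof -
  assume v: "v \<in> V"
  have "lin \<one>\<^bsub>G\<^esub> v = mdiff X X (\<lambda>x. the (id_pmap X x)) x\<^sub>0 v"
    using lin_jet[OF smooth[OF pseudogroup(2)] id_pmap_at(1)[OF x0] v] by (simp add: isotropy_group_def)
  also have "\<dots> = v"
    using x0 id_pmap_at by (intro mdiff_near_id smooth pseudogroup v) auto
  finally show ?thesis .
qed

text \<open>The jet of \<open>inverse_pmap \<phi>\<close> is the inverse. Its composite with
  \<open>\<phi>\<close> is the identity on a domain that may be smaller than \<open>pts X\<close>,
  which is enough for the differential at \<open>x\<^sub>0\<close> to be the identity.\<close>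

lemma inverse_ex:
  assumes j: "j \<in> carrier G"
  shows "\<exists>k\<in>carrier G. k \<otimes>\<^bsub>G\<^esub> j = \<one>\<^bsub>G\<^esub>"
proof -
  obtain \<phi> where \<phi>: "\<phi> \<in> \<Gamma>" "\<phi> x\<^sub>0 = Some x\<^sub>0" "j = jet X (Suc 0) x\<^sub>0 \<phi>"
    using carrierE[OF j] by metis
  have sub: "dom \<phi> \<subseteq> pts X"
    using smooth_map_on_subset[of X X "dom \<phi>" "the \<circ> \<phi>"] smooth[OF \<phi>(1)] by (simp add: local_smooth_map_def)
  \<comment> \<open>An embedding is injective, being a homeomorphism onto its range; this makes the
    definite description in \<open>inverse_pmap\<close> meaningful.\<close>
  have "inj_on (the \<circ> \<phi>) (topspace (subtopology (mtop X) (dom \<phi>)))"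
    using pseudogroup(1)[OF \<phi>(1)] by (simp add: smooth_embedding_def homeomorphic_map_def homeomorphic_eq_everything_map)
  moreover have "topspace (subtopology (mtop X) (dom \<phi>)) = dom \<phi>"
    using sub by (auto simp: topspace_mtop[OF chX])
  ultimately have inj: "inj_on (the \<circ> \<phi>) (dom \<phi>)"
    by simp
  have inv: "inverse_pmap \<phi> y = Some x" if "\<phi> x = Some y" for x y
  proof -
    have "(THE x. \<phi> x = Some y) = x"
    proof (rule the_equality)
      show "\<phi> x = Some y"
        by (rule that)
      fix x' assume "\<phi> x' = Some y"
      then show "x' = x"
        using inj that by (auto simp: inj_on_def dom_def)
    qed
    then show ?thesis
      using that by (auto simp: inverse_pmap_def ran_def)
  qed
  let ?\<psi> = "inverse_pmap \<phi>"
  have \<psi>: "?\<psi> \<in> \<Gamma>" "?\<psi> x\<^sub>0 = Some x\<^sub>0"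
    using pseudogroup(4)[OF \<phi>(1)] inv[OF \<phi>(2)] by auto
  let ?k = "jet X (Suc 0) x\<^sub>0 ?\<psi>"
  have k: "?k \<in> carrier G"
    by (rule carrierI[OF \<psi>])
  have "?k \<otimes>\<^bsub>G\<^esub> j = \<one>\<^bsub>G\<^esub>"
  proof (rule lin_ext[OF mult_closed[OF k j] one_closed])
    fix v assume v: "v \<in> V"
    have "lin (?k \<otimes>\<^bsub>G\<^esub> j) v = mdiff X X (\<lambda>x. the ((?\<psi> \<circ>\<^sub>m \<phi>) x)) x\<^sub>0 v"
      unfolding \<phi>(3) jet_comp[OF \<phi>(1,2) \<psi>]
      using \<phi> \<psi> by (intro lin_jet smooth pseudogroup v) auto
    also have "\<dots> = v"
    proof (rule mdiff_near_id[OF smooth[OF pseudogroup(3)[OF \<phi>(1) \<psi>(1)]] _ _ v])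
      show "x\<^sub>0 \<in> dom (?\<psi> \<circ>\<^sub>m \<phi>)"
        using \<phi>(2) \<psi>(2) by auto
      show "(?\<psi> \<circ>\<^sub>m \<phi>) x = Some x" if "x \<in> dom (?\<psi> \<circ>\<^sub>m \<phi>)" for x
      proof -
        from that obtain y where "\<phi> x = Some y"
          by (auto simp: map_comp_def split: option.splits)
        then show ?thesis
          using inv by simp
      qed
    qed
    finally show "lin (?k \<otimes>\<^bsub>G\<^esub> j) v = lin \<one>\<^bsub>G\<^esub> v"
      by (simp add: lin_one[OF v])
  qed
  then show ?thesis
    using k by blast
qed

sublocale group G
proof (rule groupI)
  show "j \<otimes>\<^bsub>G\<^esub> k \<otimes>\<^bsub>G\<^esub> l = j \<otimes>\<^bsub>G\<^esub> (k \<otimes>\<^bsub>G\<^esub> l)" if j: "j \<in> carrier G" and k: "k \<in> carrier G" and l: "l \<in> carrier G" for j k l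
    using j k l by (intro lin_ext mult_closed) (simp_all add: lin_mult mult_closed linear_betw_in[OF lin_linear])
  show "\<one>\<^bsub>G\<^esub> \<otimes>\<^bsub>G\<^esub> j = j" if j: "j \<in> carrier G" for j
    using j by (intro lin_ext mult_closed one_closed)
      (simp_all add: lin_mult one_closed lin_one linear_betw_in[OF lin_linear])
qed (use mult_closed one_closed inverse_ex in auto)

lemma lin_inv:
  assumes j: "j \<in> carrier G" and v: "v \<in> V"
  shows "lin (inv\<^bsub>G\<^esub> j) (lin j v) = v" "lin j (lin (inv\<^bsub>G\<^esub> j) v) = v"
  using lin_mult[OF inv_closed[OF j] j v] lin_mult[OF j inv_closed[OF j] v] j by (simp_all add: lin_one[OF v])

lemma slice_model_jets: "\<exists>L. slice_model (jet_mfd X k) (jets_of X k \<Gamma>) L"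
  using \<Gamma> by (simp add: lie_pseudogroup_def embedded_submanifold_def)

lemma charted_jets: "k \<le> Suc 0 \<Longrightarrow> charted (jet_pseudogroup_mfd X \<Gamma> k)"
  unfolding jet_pseudogroup_mfd_def by (intro charted_submfd weakly_charted_jet_mfd chX slice_model_jets)

text \<open>A 0-jet carries only source and target, so lying over the 0-jet of the identity means
  fixing \<open>x\<^sub>0\<close>. Membership in \<open>jets_of\<close> supplies a representative in
  \<Gamma>, which \<open>jet_rep j\<close> alone would not.\<close>

lemma carrier_fibre:
  "carrier G = {j \<in> pts (jet_pseudogroup_mfd X \<Gamma> (Suc 0)). jet_proj X 0 j = jet X 0 x\<^sub>0 (id_pmap X)}"
proof (intro equalityI subsetI)
  fix j assume j: "j \<in> carrier G"
  obtain \<phi> where \<phi>: "\<phi> \<in> \<Gamma>" "j = jet X (Suc 0) x\<^sub>0 \<phi>" "x\<^sub>0 \<in> dom \<phi>"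
    using carrierE[OF j] by metis
  have "jet X 0 x\<^sub>0 (jet_rep j) = jet X 0 x\<^sub>0 (id_pmap X)"
    using rep(2,3)[OF j] id_pmap_at(1)[OF x0] by (intro jet_0_eqI[OF chX]) auto
  moreover have "j \<in> jets_of X (Suc 0) \<Gamma>"
    using \<phi> by (auto simp: jets_of_def)
  ultimately show "j \<in> {j \<in> pts (jet_pseudogroup_mfd X \<Gamma> (Suc 0)). jet_proj X 0 j = jet X 0 x\<^sub>0 (id_pmap X)}"
    by (simp add: jet_pseudogroup_mfd_def jet_proj_def rep(5)[OF j])
next
  fix j assume "j \<in> {j \<in> pts (jet_pseudogroup_mfd X \<Gamma> (Suc 0)). jet_proj X 0 j = jet X 0 x\<^sub>0 (id_pmap X)}"
  then have j: "j \<in> jets_of X (Suc 0) \<Gamma>" "jet X 0 (jet_source j) (jet_rep j) = jet X 0 x\<^sub>0 (id_pmap X)"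
    by (simp_all add: jet_pseudogroup_mfd_def jet_proj_def)
  then obtain x \<phi> where \<phi>: "j = jet X (Suc 0) x \<phi>" "\<phi> \<in> \<Gamma>" "x \<in> dom \<phi>"
    by (auto simp: jets_of_def)
  have "x = x\<^sub>0"
    using arg_cong[OF j(2), of fst] by (simp add: \<phi>(1) jet_source_def)
  note r = jet_rep_smooth[OF smooth[OF \<phi>(2)] \<phi>(3), of "Suc 0", folded \<phi>(1)] jet_rep_dom[OF smooth[OF \<phi>(2)] \<phi>(3), of "Suc 0", folded \<phi>(1)]
    jet_rep_at[OF smooth[OF \<phi>(2)] \<phi>(3), of "Suc 0", folded \<phi>(1)]
  have "jet_rep j \<in> snd (jet X 0 x (jet_rep j))"
    by (rule jet_memI[OF r(1,2)])
  then have "jet_rep j \<in> snd (jet X 0 x\<^sub>0 (id_pmap X))"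
    using j(2) by (simp add: \<phi>(1) jet_source_def)
  then have "jet_rep j x\<^sub>0 = Some x\<^sub>0"
    using id_pmap_at(1)[OF x0] by (simp add: jet_def)
  then show "j \<in> carrier G"
    using r(3) \<phi> carrierI \<open>x = x\<^sub>0\<close> by simp
qed

lemma slice_model_isotropy: "\<exists>L. slice_model (jet_pseudogroup_mfd X \<Gamma> (Suc 0)) (carrier G) L"
proof -
  have sub: "surjective_submersion (jet_pseudogroup_mfd X \<Gamma> (Suc 0)) (jet_pseudogroup_mfd X \<Gamma> 0) (jet_proj X 0)"
    using \<Gamma> by (simp add: lie_pseudogroup_def)
  have one: "\<one>\<^bsub>G\<^esub> \<in> pts (jet_pseudogroup_mfd X \<Gamma> (Suc 0))" "jet_proj X 0 \<one>\<^bsub>G\<^esub> = jet X 0 x\<^sub>0 (id_pmap X)"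
    using one_closed carrier_fibre by auto
  show ?thesis
    unfolding carrier_fibre
    using sub charted_jets one
    by (intro fibre_slice_model[of "jet_pseudogroup_mfd X \<Gamma> (Suc 0)" "jet_pseudogroup_mfd X \<Gamma> 0" "jet_proj X 0" "\<one>\<^bsub>G\<^esub>"])
       (simp_all add: surjective_submersion_def)
qed

lemma GM_eq: "GM = submfd (jet_pseudogroup_mfd X \<Gamma> (Suc 0)) (carrier G)"
  by (simp add: isotropy_mfd_def)

lemma charted_GM: "charted GM"
  unfolding GM_eq by (intro charted_submfd charted_weakly_charted charted_jets slice_model_isotropy order_refl)

lemma pts_GM [simp]: "pts GM = carrier G"
  by (simp add: GM_eq)

abbreviation c0 where "c0 \<equiv> chart_at X x\<^sub>0"

lemma c0: "c0 \<in> atlas X" "c0 \<in> max_atlas X" "x\<^sub>0 \<in> fst c0" "chart_inv c0 (snd c0 x\<^sub>0) = x\<^sub>0"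
  using chart_at_atlas[OF chX x0] chart_at_max_atlas[OF chX x0] charted_atlasD(1)[OF chX, THEN chart_inv_left] by auto

text \<open>Coordinates in the jet chart given by \<open>c0\<close> at both source and target. Its
  domain contains all of \<open>G\<close>, so that \<open>E\<close> is global on
  \<open>G\<close>.\<close>

definition E :: "'x jet \<Rightarrow> 'a jet_coord" where
  "E = snd (jet_chart X (Suc 0) c0 c0)"

text \<open>On \<open>G\<close> the coordinates are affine in the values \<open>lin j b\<close>, and
  \<open>lin_E\<close> reads these values off again: smoothness in terms of \<open>E\<close> and
  smoothness of the matrix of \<open>lin j\<close> are the same thing.\<close>

lemma E_eq:
  assumes j: "j \<in> carrier G"
  shows "E j = (snd c0 x\<^sub>0, Poly_Mapping.single [] (snd c0 x\<^sub>0) + (\<Sum>b\<in>model_basis V. Poly_Mapping.single [b] (lin j b)))"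
proof -
  have "E j = jet_coords X (Suc 0) c0 c0 x\<^sub>0 (jet_rep j)"
    by (simp add: E_def jet_chart_def rep(5)[OF j])
  moreover have "fst (jet_coords X (Suc 0) c0 c0 x\<^sub>0 (jet_rep j)) = snd c0 x\<^sub>0"
    by (simp add: jet_coords_def)
  moreover have "snd (jet_coords X (Suc 0) c0 c0 x\<^sub>0 (jet_rep j)) =
      Poly_Mapping.single [] (snd c0 x\<^sub>0) + (\<Sum>b\<in>model_basis V. Poly_Mapping.single [b] (lin j b))"
  proof (rule poly_mapping_eqI)
    fix vs
    have rhs: "Poly_Mapping.lookup (Poly_Mapping.single [] (snd c0 x\<^sub>0) + (\<Sum>b\<in>model_basis V. Poly_Mapping.single [b] (lin j b))) vs =
        (if vs = [] then snd c0 x\<^sub>0 else 0) + (\<Sum>b\<in>model_basis V. if [b] = vs then lin j b else 0)"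
      by (simp add: lookup_add lookup_sum lookup_single when_def eq_commute)
    have lhs: "Poly_Mapping.lookup (snd (jet_coords X (Suc 0) c0 c0 x\<^sub>0 (jet_rep j))) vs =
        (if vs \<in> jet_index (Suc 0) V then iter_deriv vs (\<lambda>y. snd c0 (the (jet_rep j (chart_inv c0 y)))) (snd c0 x\<^sub>0) else 0)"
      by (rule lookup_jet_coords[OF V])
    have linb: "lin j b = dir_deriv (\<lambda>y. snd c0 (the (jet_rep j (chart_inv c0 y)))) (snd c0 x\<^sub>0) b" for b
      using rep(2)[OF j] by (simp add: lin_def mdiff_eq)
    consider "vs = []" | b where "vs = [b]" "b \<in> model_basis V" | "vs \<notin> jet_index (Suc 0) V"
      by (auto simp: jet_index_1)
    then show "Poly_Mapping.lookup (snd (jet_coords X (Suc 0) c0 c0 x\<^sub>0 (jet_rep j))) vs =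
        Poly_Mapping.lookup (Poly_Mapping.single [] (snd c0 x\<^sub>0) + (\<Sum>b\<in>model_basis V. Poly_Mapping.single [b] (lin j b))) vs"
      unfolding lhs rhs
    proof cases
      case 1
      then show "(if vs \<in> jet_index (Suc 0) V then iter_deriv vs (\<lambda>y. snd c0 (the (jet_rep j (chart_inv c0 y)))) (snd c0 x\<^sub>0) else 0) =
        (if vs = [] then snd c0 x\<^sub>0 else 0) + (\<Sum>b\<in>model_basis V. if [b] = vs then lin j b else 0)"
        using rep(2)[OF j] c0(4) by (simp add: jet_index_1)
    next
      case 2
      have "(\<Sum>b'\<in>model_basis V. if [b'] = vs then lin j b' else 0) = (\<Sum>b'\<in>model_basis V. if b' = b then lin j b' else 0)"
        by (intro sum.cong) (auto simp: 2)
      also have "\<dots> = lin j b"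
        using 2 fin_dim_subspaceD(2)[OF V] by simp
      finally show "(if vs \<in> jet_index (Suc 0) V then iter_deriv vs (\<lambda>y. snd c0 (the (jet_rep j (chart_inv c0 y)))) (snd c0 x\<^sub>0) else 0) =
        (if vs = [] then snd c0 x\<^sub>0 else 0) + (\<Sum>b\<in>model_basis V. if [b] = vs then lin j b else 0)"
        using 2 by (simp add: jet_index_1 linb)
    next
      case 3
      then have "vs \<noteq> []" "\<And>b. b \<in> model_basis V \<Longrightarrow> [b] \<noteq> vs"
        by (auto simp: jet_index_1)
      then have "(\<Sum>b\<in>model_basis V. if [b] = vs then lin j b else 0) = 0"
        by (intro sum.neutral) auto
      then show "(if vs \<in> jet_index (Suc 0) V then iter_deriv vs (\<lambda>y. snd c0 (the (jet_rep j (chart_inv c0 y)))) (snd c0 x\<^sub>0) else 0) =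
        (if vs = [] then snd c0 x\<^sub>0 else 0) + (\<Sum>b\<in>model_basis V. if [b] = vs then lin j b else 0)"
        using 3 \<open>vs \<noteq> []\<close> by simp
    qed
  qed
  ultimately show ?thesis
    by (simp add: prod_eq_iff)
qed

lemma lin_E:
  assumes j: "j \<in> carrier G" and b: "b \<in> model_basis V"
  shows "lin j b = Poly_Mapping.lookup (snd (E j)) [b]"
proof -
  have "(\<Sum>b'\<in>model_basis V. if b' = b then lin j b' else 0) = lin j b"
    using b fin_dim_subspaceD(2)[OF V] by simp
  then show ?thesis
    by (simp add: E_eq[OF j] lookup_add lookup_sum lookup_single when_def)
qed

text \<open>The embedding descends twice, from the jet manifold to the jets of \<Gamma> and from
  there to \<open>G\<close>. As \<open>G\<close> lies in the domain of a single jet chart, no point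
  of \<open>G\<close> is lost.\<close>

lemma vec_embedding_GM: "vec_embedding GM (pts GM) (model (jet_mfd X (Suc 0))) E"
proof -
  let ?e = "jet_chart X (Suc 0) c0 c0"
  have "vec_embedding (jet_pseudogroup_mfd X \<Gamma> (Suc 0)) (fst ?e \<inter> jets_of X (Suc 0) \<Gamma>) (model (jet_mfd X (Suc 0))) E"
    unfolding jet_pseudogroup_mfd_def E_def
    by (rule vec_embedding_submfd[OF weakly_charted_jet_mfd[OF chX order_refl] slice_model_jets vec_embedding_jet_chart[OF chX c0(1) c0(1)]])
  from vec_embedding_submfd[OF charted_weakly_charted[OF charted_jets[OF order_refl]] slice_model_isotropy this]
  have "vec_embedding GM (fst ?e \<inter> jets_of X (Suc 0) \<Gamma> \<inter> carrier G) (model (jet_mfd X (Suc 0))) E"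
    by (simp add: GM_eq)
  moreover have "fst ?e \<inter> jets_of X (Suc 0) \<Gamma> \<inter> carrier G = pts GM"
  proof -
    have "j \<in> fst ?e" if "j \<in> carrier G" for j
      using rep[OF that] c0(3) by (simp add: jet_chart_def jet_target_def)
    moreover have "j \<in> jets_of X (Suc 0) \<Gamma>" if "j \<in> carrier G" for j
      using that unfolding carrier_fibre by (simp add: jet_pseudogroup_mfd_def)
    ultimately show ?thesis
      by auto
  qed
  ultimately show ?thesis
    by simp
qed

lemma smooth_on_lin:
  assumes "c \<in> atlas GM" "v \<in> V"
  shows "smooth_on (model GM) (snd c ` fst c) (\<lambda>y. lin (chart_inv c y) v)"
proof -
  have cm: "c \<in> max_atlas GM" and cG: "fst c \<subseteq> carrier G"
    using charted_atlas_subset[OF charted_GM] charted_atlasD(2)[OF charted_GM assms(1)] assms(1) by auto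
  have "fst c \<inter> pts GM = fst c"
    using cG by auto
  then have E: "smooth_on (model GM) (snd c ` fst c) (\<lambda>y. E (chart_inv c y))"
    using smooth_map_on_vecD(2)[OF charted_GM fin_dim_jet_model[OF V] vec_embedding_smooth[OF charted_GM vec_embedding_GM] cm] by simp
  have "smooth_on (model GM) (snd c ` fst c)
      (\<lambda>y. \<Sum>b\<in>model_basis V. coord V b v *\<^sub>R Poly_Mapping.lookup (snd (E (chart_inv c y))) [b])"
    by (intro smooth_on_sum smooth_on_scaleR smooth_on_const fin_dim_subspaceD V
        smooth_on_bounded_linear[OF bounded_linear_compose[OF bounded_linear_lookup bounded_linear_snd] E])
  then show ?thesis
  proof (rule smooth_on_cong)
    fix y assume "y \<in> snd c ` fst c"
    then have j: "chart_inv c y \<in> carrier G"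
      using chart_inv_in[of y c] cG by auto
    show "(\<Sum>b\<in>model_basis V. coord V b v *\<^sub>R Poly_Mapping.lookup (snd (E (chart_inv c y))) [b]) = lin (chart_inv c y) v"
      unfolding linear_betw_coord_sum[OF lin_linear[OF j] V assms(2)] by (simp add: lin_E[OF j])
  qed
qed

lemma smooth_map_lin:
  assumes "v \<in> V"
  shows "smooth_map GM (vec_mfd V) (\<lambda>j. lin j v)"
  by (rule smooth_map_vecI[OF charted_GM V]) (use linear_betw_in[OF lin_linear assms] smooth_on_lin assms in auto)

text \<open>No chart of \<open>G\<close> is touched: \<open>E\<close> is affine in the values
  \<open>lin (f p) b\<close>, and \<open>vec_embedding_smooth_mapI\<close> passes from
  \<open>E\<close> to \<open>G\<close>.\<close>

lemma smooth_map_GM_I: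
  fixes P :: "('p, 'n::dual_separating) mfd"
  assumes P: "charted P" and f: "\<And>p. p \<in> pts P \<Longrightarrow> f p \<in> carrier G"
    and sm: "\<And>c b. c \<in> atlas P \<Longrightarrow> b \<in> model_basis V \<Longrightarrow> smooth_on (model P) (snd c ` fst c) (\<lambda>y. lin (f (chart_inv c y)) b)"
  shows "smooth_map P GM f"
proof (rule vec_embedding_smooth_mapI[OF charted_GM vec_embedding_GM P])
  show "f ` pts P \<subseteq> pts GM"
    using f by auto
  show "smooth_map P (vec_mfd (model (jet_mfd X (Suc 0)))) (\<lambda>p. E (f p))"
  proof (rule smooth_map_vecI[OF P fin_dim_jet_model[OF V]])
    show "E (f p) \<in> model (jet_mfd X (Suc 0))" if "p \<in> pts P" for p
      using vec_embedding_in[OF charted_GM vec_embedding_GM] f[OF that] by simp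
    fix c assume c: "c \<in> atlas P"
    have "smooth_on (model P) (snd c ` fst c) (\<lambda>y. (snd c0 x\<^sub>0,
        Poly_Mapping.single [] (snd c0 x\<^sub>0) + (\<Sum>b\<in>model_basis V. Poly_Mapping.single [b] (lin (f (chart_inv c y)) b))))"
      by (intro smooth_on_Pair smooth_on_add smooth_on_const smooth_on_sum fin_dim_subspaceD V
          smooth_on_bounded_linear[OF bounded_linear_single sm[OF c]])
    then show "smooth_on (model P) (snd c ` fst c) (\<lambda>y. E (f (chart_inv c y)))"
    proof (rule smooth_on_cong)
      fix y assume "y \<in> snd c ` fst c"
      then have "f (chart_inv c y) \<in> carrier G"
        using chart_inv_in[of y c] charted_atlasD(2)[OF P c] by (intro f) auto
      from E_eq[OF this] show "(snd c0 x\<^sub>0,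
        Poly_Mapping.single [] (snd c0 x\<^sub>0) + (\<Sum>b\<in>model_basis V. Poly_Mapping.single [b] (lin (f (chart_inv c y)) b))) = E (f (chart_inv c y))"
        by simp
    qed
  qed
qed

lemma smooth_isotropy_mult: "smooth_map (prod_mfd GM GM) GM (\<lambda>(j, k). j \<otimes>\<^bsub>G\<^esub> k)"
proof (rule smooth_map_GM_I)
  note P = charted_prod[OF charted_GM charted_GM]
  show "charted (prod_mfd GM GM)"
    by (rule P)
  show "(\<lambda>(j, k). j \<otimes>\<^bsub>G\<^esub> k) p \<in> carrier G" if "p \<in> pts (prod_mfd GM GM)" for p
    using that by auto
  fix c b assume c: "c \<in> atlas (prod_mfd GM GM)" and b: "b \<in> model_basis V"
  let ?U = "snd c ` fst c" and ?W = "model (prod_mfd GM GM)"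
  have bV: "b' \<in> V" if "b' \<in> model_basis V" for b'
    using that fin_dim_subspaceD(4)[OF V] by auto
  have cm: "c \<in> max_atlas (prod_mfd GM GM)" and dom: "fst c \<inter> pts (prod_mfd GM GM) = fst c"
    using charted_atlas_subset[OF P] charted_atlasD(2)[OF P c] c by auto
  have sm: "smooth_on ?W ?U (\<lambda>y. lin (fst (chart_inv c y)) v)" "smooth_on ?W ?U (\<lambda>y. lin (snd (chart_inv c y)) v)" if "v \<in> V" for v
    using smooth_map_on_vecD(2)[OF P V smooth_map_comp[OF P charted_GM charted_vec_mfd[OF V] smooth_map_fst_snd(1)[OF charted_GM charted_GM] smooth_map_lin[OF that]] cm]
      smooth_map_on_vecD(2)[OF P V smooth_map_comp[OF P charted_GM charted_vec_mfd[OF V] smooth_map_fst_snd(2)[OF charted_GM charted_GM] smooth_map_lin[OF that]] cm]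
    unfolding dom by auto
  \<comment> \<open>The matrix product: the coordinates of the second factor at \<open>b\<close> are
    the coefficients for the values of the first factor on the basis.\<close>
  have "smooth_on ?W ?U (\<lambda>y. \<Sum>b'\<in>model_basis V. coord V b' (lin (snd (chart_inv c y)) b) *\<^sub>R lin (fst (chart_inv c y)) b')"
    by (intro smooth_on_sum smooth_on_scaleR fin_dim_subspaceD V sm(1) bV
        smooth_on_bounded_linear[OF bounded_linear_coord[OF V] sm(2)[OF bV[OF b]]])
  then show "smooth_on ?W ?U (\<lambda>y. lin ((\<lambda>(j, k). j \<otimes>\<^bsub>G\<^esub> k) (chart_inv c y)) b)"
  proof (rule smooth_on_cong)
    fix y assume "y \<in> ?U"
    then have "chart_inv c y \<in> pts (prod_mfd GM GM)"
      using chart_inv_in[of y c] charted_atlasD(2)[OF P c] by auto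
    then obtain j k where jk: "chart_inv c y = (j, k)" "j \<in> carrier G" "k \<in> carrier G"
      by auto
    show "(\<Sum>b'\<in>model_basis V. coord V b' (lin (snd (chart_inv c y)) b) *\<^sub>R lin (fst (chart_inv c y)) b') =
        lin ((\<lambda>(j, k). j \<otimes>\<^bsub>G\<^esub> k) (chart_inv c y)) b"
      using linear_betw_coord_sum[OF lin_linear[OF jk(2)] V linear_betw_in[OF lin_linear[OF jk(3)] bV[OF b]]]
        lin_mult[OF jk(2,3) bV[OF b]] by (simp add: jk(1))
  qed
qed

lemma smooth_isotropy_inv: "smooth_map GM GM (\<lambda>j. inv\<^bsub>G\<^esub> j)"
proof (rule smooth_map_GM_I[OF charted_GM])
  show "inv\<^bsub>G\<^esub> j \<in> carrier G" if "j \<in> pts GM" for j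
    using that by simp
  fix c b assume c: "c \<in> atlas GM" and b: "b \<in> model_basis V"
  have bV: "b \<in> V"
    using b fin_dim_subspaceD(4)[OF V] by auto
  have carr: "chart_inv c y \<in> carrier G" if "y \<in> snd c ` fst c" for y
    using chart_inv_in[OF that] charted_atlasD(2)[OF charted_GM c] by auto
  \<comment> \<open>Inverses in \<open>G\<close> are sent by \<open>lin\<close> to inverses of
    linear maps, so this is an instance of a smooth inverse family.\<close>
  show "smooth_on (model GM) (snd c ` fst c) (\<lambda>y. lin (inv\<^bsub>G\<^esub> chart_inv c y) b)"
  proof (rule smooth_on_inverse_family[OF charted_fin_dim[OF charted_GM] charted_atlasD(3)[OF charted_GM c] V _ _ _ _ _ bV])
    show "linear_betw V V (lin (chart_inv c y))" "linear_betw V V (lin (inv\<^bsub>G\<^esub> chart_inv c y))" if "y \<in> snd c ` fst c" for y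
      using carr[OF that] by (auto intro: lin_linear)
    show "lin (inv\<^bsub>G\<^esub> chart_inv c y) (lin (chart_inv c y) w) = w" "lin (chart_inv c y) (lin (inv\<^bsub>G\<^esub> chart_inv c y) w) = w"
      if "y \<in> snd c ` fst c" "w \<in> V" for y w
      using lin_inv[OF carr[OF that(1)] that(2)] by auto
    show "smooth_on (model GM) (snd c ` fst c) (\<lambda>y. lin (chart_inv c y) w)" if "w \<in> V" for w
      by (rule smooth_on_lin[OF c that])
  qed
qed

lemma lie_group_isotropy: "lie_group G GM"
  unfolding lie_group_def
  using smooth_isotropy_mult smooth_isotropy_inv vec_embedding_smooth_manifold[OF charted_GM vec_embedding_GM]
  by (simp add: is_group)

text \<open>Transport of the isotropy representation along an isomorphism \<open>T\<close>. With the
  differential of the orbit map for \<open>T\<close>, it becomes the action of \<open>G\<close> on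
  the Lie algebra of \<open>K\<close>.\<close>

lemma conjugate_lie_rep:
  fixes W :: "'w::dual_separating set" and T :: "'w \<Rightarrow> 'a"
  assumes W: "fin_dim_subspace W" and T: "linear_betw W V T" "inj_on T W" "T ` W = V"
  shows "lie_rep G GM W (\<lambda>j \<xi>. inv_into W T (lin j (T \<xi>)))"
proof -
  note W' = fin_dim_subspaceD(1)[OF W]
  note S = linear_betw_inv_into[OF T(1) W' T(2,3)]
  have TS: "T (inv_into W T v) = v" if "v \<in> V" for v
    using that T(3) by (intro f_inv_into_f) simp
  have ST: "inv_into W T (T \<xi>) = \<xi>" if "\<xi> \<in> W" for \<xi>
    by (rule inv_into_f_f[OF T(2) that])
  have lin: "linear_betw W W (\<lambda>\<xi>. inv_into W T (lin j (T \<xi>)))" if "j \<in> carrier G" for j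
    using linear_betw_comp[OF linear_betw_comp[OF T(1) lin_linear[OF that]] S] .
  have "smooth_map (prod_mfd GM (vec_mfd W)) (vec_mfd W) (\<lambda>(j, \<xi>). inv_into W T (lin j (T \<xi>)))"
  proof (rule smooth_map_prod_vecI[OF charted_GM W W])
    show "(\<lambda>(j, \<xi>). inv_into W T (lin j (T \<xi>))) (j, \<xi>) \<in> W" if "j \<in> pts GM" "\<xi> \<in> W" for j \<xi>
      using linear_betw_in[OF lin] that by simp
    fix c assume c: "c \<in> atlas GM"
    let ?U = "snd c ` fst c" and ?M = "model GM"
    note M = charted_fin_dim[OF charted_GM]
    note U = charted_atlasD(3)[OF charted_GM c]
    have sm: "smooth_on (?M \<times> W) (?U \<times> W) (\<lambda>p. lin (chart_inv c (fst p)) b)" if "b \<in> model_basis V" for b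
    proof -
      have "b \<in> V"
        using that fin_dim_subspaceD(4)[OF V] by auto
      from smooth_on_comp[OF fin_dim_subspaceD(1)[OF fin_dim_subspace_Times[OF M W]] open_in_Times[OF U openin_subtopology_self]
          M openin_imp_subset[OF U] _ smooth_on_fst smooth_on_lin[OF c this]]
      show ?thesis
        by auto
    qed
    have bl: "bounded_linear (\<lambda>p::'a jet_coord \<times> 'w. coord V b (T (proj W (snd p))))" for b
      by (intro bounded_linear_compose[OF bounded_linear_coord[OF V]] bounded_linear_compose[OF bounded_linear_proj_comp[OF T(1) W]]
          bounded_linear_snd)
    \<comment> \<open>\<open>T\<close> and its inverse are linear only on \<open>W\<close> and
      \<open>V\<close>. With \<open>proj W\<close> and \<open>proj V\<close> inserted they become
      bounded on the whole types, and the projections meet only vectors that they fix.\<close>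
    have "smooth_on (?M \<times> W) (?U \<times> W)
        (\<lambda>p. inv_into W T (proj V (\<Sum>b\<in>model_basis V. coord V b (T (proj W (snd p))) *\<^sub>R lin (chart_inv c (fst p)) b)))"
      by (intro smooth_on_bounded_linear[OF bounded_linear_proj_comp[OF S V]] smooth_on_sum fin_dim_subspaceD V
          smooth_on_scaleR smooth_on_linear[OF bl] sm)
    then show "smooth_on (?M \<times> W) (?U \<times> W) (\<lambda>p. (\<lambda>(j, \<xi>). inv_into W T (lin j (T \<xi>))) (chart_inv c (fst p), snd p))"
    proof (rule smooth_on_cong)
      fix p assume p: "p \<in> ?U \<times> W"
      then have j: "chart_inv c (fst p) \<in> carrier G"
        using chart_inv_in[of "fst p" c] charted_atlasD(2)[OF charted_GM c] by auto
      have Tp: "T (snd p) \<in> V" "snd p \<in> W"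
        using p linear_betw_in[OF T(1)] by auto
      have "(\<Sum>b\<in>model_basis V. coord V b (T (proj W (snd p))) *\<^sub>R lin (chart_inv c (fst p)) b) = lin (chart_inv c (fst p)) (T (snd p))"
        using linear_betw_coord_sum[OF lin_linear[OF j] V Tp(1)] by (simp add: proj_id[OF W Tp(2)])
      then show "inv_into W T (proj V (\<Sum>b\<in>model_basis V. coord V b (T (proj W (snd p))) *\<^sub>R lin (chart_inv c (fst p)) b)) =
          (\<lambda>(j, \<xi>). inv_into W T (lin j (T \<xi>))) (chart_inv c (fst p), snd p)"
        using proj_id[OF V linear_betw_in[OF lin_linear[OF j] Tp(1)]] by simp
    qed
  qed
  then show ?thesis
    unfolding lie_rep_def
    using W lin ST TS lin_one lin_mult linear_betw_in[OF T(1)] linear_betw_in[OF lin_linear] by auto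
qed

end

theorem proposition4p2:
  fixes X :: "('x, 'a::euclidean_space) mfd"
    and \<Gamma> :: "('x \<rightharpoonup> 'x) set"
    and x\<^sub>0 :: 'x
    and K :: "'k monoid"
    and KM :: "('k, 'b::euclidean_space) mfd"
    and A :: "'k \<Rightarrow> 'x \<Rightarrow> 'x"
  assumes "smooth_manifold X"
    and "lie_pseudogroup X \<Gamma>"
    and "transitive_pseudogroup X \<Gamma>"
    and "x\<^sub>0 \<in> pts X"
    and "lie_group K KM"
    and "lie_group_action K KM X A"
    and "free_action K (pts X) A"
    and "transitive_action K (pts X) A"
  defines "G \<equiv> isotropy_group X \<Gamma> x\<^sub>0"
    and "GM \<equiv> isotropy_mfd X \<Gamma> x\<^sub>0"
    and "\<rho> \<equiv> isotropy_rep K KM X A x\<^sub>0"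
  defines "\<gg> \<equiv> model GM"
    and "\<kk> \<equiv> model KM"
  defines "\<zz> \<equiv> \<gg> \<times> \<kk>"
    and "\<sigma> \<equiv> \<lambda>j. map_prod (Ad G GM j) (\<rho> j)"
    and "br \<equiv> semidirect_bracket (lie_bracket G GM) (lie_bracket K KM) (diff_rep G GM \<kk> \<rho>)"
  shows "pfaffian_group G GM \<gg> \<kk> \<rho> (\<lambda>_. 0) \<and>
         cartan_type_extension G GM \<gg> \<kk> \<rho> \<zz> \<sigma> br (\<lambda>\<alpha>. (\<alpha>, 0)) snd \<and>
         reductive_extension G GM \<gg> \<kk> \<rho> \<zz> \<sigma> br (\<lambda>\<alpha>. (\<alpha>, 0)) snd"
proof -
  interpret iso: pseudogroup_isotropy X \<Gamma> x\<^sub>0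
    by (rule pseudogroup_isotropy.intro[OF assms(1,2,4)])
  interpret act: simply_transitive_action K KM X A x\<^sub>0
    by (rule simply_transitive_action.intro[OF lie.intro simply_transitive_action_axioms.intro]) (fact assms)+
  \<comment> \<open>In this form the action is the isotropy representation conjugated by
    \<open>act.T\<close>, so that bijectivity of the orbit differential can be applied.\<close>
  have "\<rho> = (\<lambda>j \<xi>. inv_into \<kk> act.T (iso.lin j (act.T \<xi>)))"
    by (simp add: \<rho>_def \<kk>_def isotropy_rep_def[abs_def] act.T_def iso.lin_def o_def)
  then have "lie_rep G GM \<kk> \<rho>"
    using iso.conjugate_lie_rep[OF act.fin_dim act.T_linear act.T_inj_on act.T_surj]
    by (simp add: G_def GM_def \<kk>_def)
  then show ?thesis
    using reductive_semidirect[OF iso.lie_group_isotropy assms(5)]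
    unfolding G_def GM_def \<gg>_def \<kk>_def \<zz>_def \<sigma>_def br_def by blast
qed

end
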